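(* Let $K$ be a field of characteristic $\neq 2$, $A$ an associative, unital, commutative $K$-algebra, and $\mathfrak{l}=\bigoplus_{\gamma\in\mathcal{B}}\mathfrak{l}_\gamma$ a Lie algebra over $K$ graded in an abelian group $\mathcal{B}$. Fix $\beta\in\mathcal{B}$ and assume that $S^2(H_1(\mathfrak{l}))_\beta=\{0\}$. Then the space $H_2(A\otimes\mathfrak{l})_\beta$ is an iterated extension of the following spaces: $\mathrm{HC}_1(A)\otimes\mathrm{Kill}(\mathfrak{l})_\beta$; $(A/A_0)\otimes\big(\mathrm{Kill}(\mathfrak{l})/\mathrm{Im}(\bar\eta_{\mathfrak{l}})\big)_\beta$; and $A\otimes H_2(\mathfrak{l})_\beta$. The natural projection $H_2(A\otimes\mathfrak{l})_\beta\to A\otimes H_2(\mathfrak{l})_\beta$ is surjective, and its kernel $\mathcal{K}(A,\mathfrak{l})_\beta$ lies in each of the following two exact sequences: $$0\to (A/A_0)\otimes\mathrm{coker}(\bar\eta_{\mathfrak{l}})_\beta\to\mathcal{K}(A,\mathfrak{l})_\beta\to\mathrm{HC}_1(A)\otimes\mathrm{Kill}(\mathfrak{l})_\beta\to 0,$$ $$0\to \mathrm{HC}_1(A)\otimes\mathrm{Im}(\bar\eta_{\mathfrak{l}})_\beta\to\mathcal{K}(A,\mathfrak{l})_\beta\to\mathrm{HH}_1(A)\otimes\mathrm{coker}(\bar\eta_{\mathfrak{l}})_\beta\to 0.$$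
   Context: All tensor products, exterior/symmetric powers and homology are over $K$; $A\otimes\mathfrak{l}$ (current Lie algebra) is viewed as a Lie algebra over $K$ with bracket $[a\otimes x,b\otimes y]=ab\otimes[x,y]$, graded by $(A\otimes\mathfrak{l})_\gamma=A\otimes\mathfrak{l}_\gamma$. Gradings are induced on exterior and symmetric powers (degrees add), homology and Killing modules; subscript $\beta$ denotes the degree-$\beta$ component. $H_*$ is Chevalley–Eilenberg homology with trivial coefficients. The natural projection $H_2(A\otimes\mathfrak{l})\to A\otimes H_2(\mathfrak{l})$ is induced by $(a\otimes x)\wedge(b\otimes y)\mapsto ab\otimes(x\wedge y)$. An iterated extension of a finite list of spaces is a space with a finite filtration whose successive quotients are, in some order, those spaces. Define $T,T_0:A^{\otimes 3}\to\Lambda^2A$ by $T(a\otimes b\otimes c)=ab\wedge c+bc\wedge a+ca\wedge b$ and $T_0(a\otimes b\otimes c)=T(a\otimes b\otimes c)-abc\wedge 1$. Then $\mathrm{HC}_1(A)=\mathrm{coker}(T)$ (first cyclic homology), $\mathrm{HH}_1(A)=\mathrm{coker}(T_0)$ (first Hochschild homology), and $A_0$ is the kernel of the map $A\to\mathrm{HH}_1(A)$, $a\mapsto[a\wedge 1]$. $\mathrm{Kill}(\mathfrak{l})$ is the cokernel of $\mathfrak{l}^{\otimes 3}\to S^2\mathfrak{l}$, $x\otimes y\otimes z\mapsto[x,y]\odot z-x\odot[y,z]$ ($\odot$ the symmetric product). The Koszul map $\eta:\Lambda^3\mathfrak{l}\to\mathrm{Kill}(\mathfrak{l})$ sends $x\wedge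 y\wedge z$ to the class of $x\odot[y,z]$; it vanishes on 3-boundaries, and the reduced Koszul map $\bar\eta_{\mathfrak{l}}:H_3(\mathfrak{l})\to\mathrm{Kill}(\mathfrak{l})$ is induced by its restriction to 3-cycles. *)

theory Defs
  imports "HOL-Library.Poly_Mapping" "HOL-Library.Multiset" "HOL.Vector_Spaces"
begin

text \<open>
  A record \<open>V\<close> stands for the vector space \<open>carr V / rel V\<close>: its elements are the cosets
  \<open>x + rel V\<close> with \<open>x \<in> carr V\<close>. Both are subspaces of one ambient vector space with scalar
  multiplication \<open>scl V\<close>.
\<close>

record ('k, 'v) subquot =
  scl :: "'k \<Rightarrow> 'v \<Rightarrow> 'v"
  carr :: "'v set"
  rel :: "'v set"

definition whole :: "('k \<Rightarrow> 'v \<Rightarrow> 'v) \<Rightarrow> ('k, 'v::zero) subquot" where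
  "whole s = \<lparr>scl = s, carr = UNIV, rel = {0}\<rparr>"

definition cls :: "('k, 'v::ab_group_add) subquot \<Rightarrow> 'v \<Rightarrow> 'v set" where
  "cls V x = {y. y - x \<in> rel V}"

definition elts :: "('k, 'v::ab_group_add) subquot \<Rightarrow> 'v set set" where
  "elts V = cls V ` carr V"

text \<open>The vector space operations on cosets; the zero vector is \<open>rel V\<close> itself.\<close>

definition qadd :: "'v::ab_group_add set \<Rightarrow> 'v set \<Rightarrow> 'v set" where
  "qadd X Y = {x + y |x y. x \<in> X \<and> y \<in> Y}"

definition qscl :: "('k, 'v::ab_group_add) subquot \<Rightarrow> 'k \<Rightarrow> 'v set \<Rightarrow> 'v set" where
  "qscl V c X = {scl V c x + r |x r. x \<in> X \<and> r \<in> rel V}"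

definition is_zero_space :: "('k, 'v::ab_group_add) subquot \<Rightarrow> bool" where
  "is_zero_space V \<longleftrightarrow> elts V = {rel V}"

definition lin ::
  "('k, 'v::ab_group_add) subquot \<Rightarrow> ('k, 'w::ab_group_add) subquot \<Rightarrow> ('v set \<Rightarrow> 'w set) \<Rightarrow> bool" where
  "lin V W F \<longleftrightarrow>
     (\<forall>X\<in>elts V. F X \<in> elts W) \<and>
     (\<forall>X\<in>elts V. \<forall>Y\<in>elts V. F (qadd X Y) = qadd (F X) (F Y)) \<and>
     (\<forall>c. \<forall>X\<in>elts V. F (qscl V c X) = qscl W c (F X))"

definition isomorphic ::
  "('k, 'v::ab_group_add) subquot \<Rightarrow> ('k, 'w::ab_group_add) subquot \<Rightarrow> bool" where
  "isomorphic V W \<longleftrightarrow> (\<exists>F. lin V W F \<and> bij_betw F (elts V) (elts W))"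

definition short_exact ::
  "('k, 'u::ab_group_add) subquot \<Rightarrow> ('k, 'v::ab_group_add) subquot \<Rightarrow> ('k, 'w::ab_group_add) subquot \<Rightarrow> bool" where
  "short_exact U V W \<longleftrightarrow> (\<exists>F H. lin U V F \<and> lin V W H \<and>
     inj_on F (elts U) \<and> F ` elts U = {X \<in> elts V. H X = rel W} \<and> H ` elts V = elts W)"

definition ker_space ::
  "('k, 'v::ab_group_add) subquot \<Rightarrow> ('k, 'w::ab_group_add) subquot \<Rightarrow> ('v set \<Rightarrow> 'w set) \<Rightarrow> ('k, 'v) subquot" where
  "ker_space V W F = V\<lparr>carr := {x \<in> carr V. F (cls V x) = rel W}\<rparr>"

text \<open>
  The listed spaces may live over different types, so a list of spaces \<open>S\<^sub>i\<close> is passed as the list of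
  predicates ``isomorphic to \<open>S\<^sub>i\<close>''.
\<close>

definition iterated_extension ::
  "('k::field, 'v::ab_group_add) subquot \<Rightarrow> (('k, 'v) subquot \<Rightarrow> bool) list \<Rightarrow> bool" where
  "iterated_extension V Ps \<longleftrightarrow> (\<exists>Fil \<pi>.
     (\<forall>i\<le>length Ps. module.subspace (scl V) (Fil i)) \<and>
     Fil 0 = rel V \<and> Fil (length Ps) = carr V \<and>
     (\<forall>i<length Ps. Fil i \<subseteq> Fil (Suc i)) \<and>
     bij_betw \<pi> {..<length Ps} {..<length Ps} \<and>
     (\<forall>i<length Ps. (Ps ! \<pi> i) (V\<lparr>carr := Fil (Suc i), rel := Fil i\<rparr>)))"

text \<open>
  Image and cokernel of the map \<open>V \<rightarrow> W\<close> induced by a map \<open>f\<close> on representatives.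
\<close>

definition imag ::
  "('v \<Rightarrow> 'w) \<Rightarrow> ('k, 'v) subquot \<Rightarrow> ('k, 'w::ab_group_add) subquot \<Rightarrow> ('k, 'w) subquot" where
  "imag f V W = W\<lparr>carr := {f v + r |v r. v \<in> carr V \<and> r \<in> rel W}\<rparr>"

definition coker ::
  "('v \<Rightarrow> 'w) \<Rightarrow> ('k, 'v) subquot \<Rightarrow> ('k, 'w::ab_group_add) subquot \<Rightarrow> ('k, 'w) subquot" where
  "coker f V W = W\<lparr>rel := {f v + r |v r. v \<in> carr V \<and> r \<in> rel W}\<rparr>"

text \<open>
  If \<open>W\<close> inherits a grading from its ambient space and \<open>D\<close> is the degree \<open>\<beta>\<close> component of the
  latter, then this is the degree \<open>\<beta>\<close> component of \<open>W\<close>, as a subspace of \<open>W\<close>.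
\<close>

definition hcomp :: "('k, 'w::ab_group_add) subquot \<Rightarrow> 'w set \<Rightarrow> ('k, 'w) subquot" where
  "hcomp W D = W\<lparr>carr := {d + r |d r. d \<in> D \<inter> carr W \<and> r \<in> rel W}\<rparr>"

text \<open>\<open>'x \<Rightarrow>\<^sub>0 'k\<close> is the free vector space on \<open>'x\<close>.\<close>

abbreviation pure :: "'x \<Rightarrow> ('x \<Rightarrow>\<^sub>0 'k::field)" where
  "pure x \<equiv> Poly_Mapping.single x 1"

definition pscale :: "'k::field \<Rightarrow> ('x \<Rightarrow>\<^sub>0 'k) \<Rightarrow> ('x \<Rightarrow>\<^sub>0 'k)" where
  "pscale c = Poly_Mapping.map ((*) c)"

definition lift :: "('k::field \<Rightarrow> 'v \<Rightarrow> 'v::ab_group_add) \<Rightarrow> ('x \<Rightarrow> 'v) \<Rightarrow> ('x \<Rightarrow>\<^sub>0 'k) \<Rightarrow> 'v" where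
  "lift s f p = (\<Sum>x\<in>Poly_Mapping.keys p. s (Poly_Mapping.lookup p x) (f x))"

abbreviation pspan :: "('x \<Rightarrow>\<^sub>0 'k::field) set \<Rightarrow> ('x \<Rightarrow>\<^sub>0 'k) set" where
  "pspan \<equiv> module.span pscale"

definition tensor ::
  "('k::field, 'v::ab_group_add) subquot \<Rightarrow> ('k, 'w::ab_group_add) subquot \<Rightarrow> ('k, 'v \<times> 'w \<Rightarrow>\<^sub>0 'k) subquot" where
  "tensor V W = \<lparr>
     scl = pscale,
     carr = pspan {pure (x, y) |x y. x \<in> carr V \<and> y \<in> carr W},
     rel = pspan (
       {pure (x + x', y) - pure (x, y) - pure (x', y) |x x' y. x \<in> carr V \<and> x' \<in> carr V \<and> y \<in> carr W} \<union>
       {pure (x, y + y') - pure (x, y) - pure (x, y') |x y y'. x \<in> carr V \<and> y \<in> carr W \<and> y' \<in> carr W} \<union>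
       {pure (scl V c x, y) - pscale c (pure (x, y)) |c x y. x \<in> carr V \<and> y \<in> carr W} \<union>
       {pure (x, scl W c y) - pscale c (pure (x, y)) |c x y. x \<in> carr V \<and> y \<in> carr W} \<union>
       {pure (x, y) |x y. x \<in> rel V \<and> y \<in> carr W} \<union>
       {pure (x, y) |x y. x \<in> carr V \<and> y \<in> rel W})\<rparr>"

text \<open>Pure tensors of the \<open>n\<close>-th tensor power are given by lists of length \<open>n\<close>.\<close>

definition tpow :: "nat \<Rightarrow> ('k::field, 'v::ab_group_add) subquot \<Rightarrow> ('k, 'v list \<Rightarrow>\<^sub>0 'k) subquot" where
  "tpow n V = \<lparr>
     scl = pscale,
     carr = pspan {pure xs |xs. length xs = n \<and> set xs \<subseteq> carr V},
     rel = pspan (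
       {pure (us @ (x + y) # vs) - pure (us @ x # vs) - pure (us @ y # vs) |us vs x y.
          length us + length vs + 1 = n \<and> set us \<union> set vs \<union> {x, y} \<subseteq> carr V} \<union>
       {pure (us @ scl V c x # vs) - pscale c (pure (us @ x # vs)) |us vs c x.
          length us + length vs + 1 = n \<and> set us \<union> set vs \<union> {x} \<subseteq> carr V} \<union>
       {pure (us @ r # vs) |us vs r.
          length us + length vs + 1 = n \<and> set us \<union> set vs \<subseteq> carr V \<and> r \<in> rel V})\<rparr>"

definition extpow :: "nat \<Rightarrow> ('k::field, 'v::ab_group_add) subquot \<Rightarrow> ('k, 'v list \<Rightarrow>\<^sub>0 'k) subquot" where
  "extpow n V = (tpow n V)\<lparr>rel := pspan (rel (tpow n V) \<union>
     {pure xs |xs. length xs = n \<and> set xs \<subseteq> carr V \<and> \<not> distinct xs})\<rparr>"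

definition sympow :: "nat \<Rightarrow> ('k::field, 'v::ab_group_add) subquot \<Rightarrow> ('k, 'v list \<Rightarrow>\<^sub>0 'k) subquot" where
  "sympow n V = (tpow n V)\<lparr>rel := pspan (rel (tpow n V) \<union>
     {pure xs - pure ys |xs ys. length xs = n \<and> set xs \<subseteq> carr V \<and> mset xs = mset ys})\<rparr>"

text \<open>
  The span of the pure tensors of homogeneous elements of total degree \<open>\<beta>\<close>, for a grading with
  components \<open>G \<gamma>\<close> (sets of representatives). It induces the degree \<open>\<beta>\<close> components of tensor,
  exterior and symmetric powers and of their subquotients.
\<close>

definition hpow :: "('b::ab_group_add \<Rightarrow> 'v set) \<Rightarrow> nat \<Rightarrow> 'b \<Rightarrow> ('v list \<Rightarrow>\<^sub>0 'k::field) set" where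
  "hpow G n \<beta> = pspan {pure xs |xs \<gamma>s.
     length xs = n \<and> list_all2 (\<lambda>x \<gamma>. x \<in> G \<gamma>) xs \<gamma>s \<and> sum_list \<gamma>s = \<beta>}"

text \<open>Unlike \<open>comm_ring_1\<close>, the sort used here does not exclude the zero algebra.\<close>

locale comm_unital_algebra = vector_space s
  for s :: "'k::field \<Rightarrow> 'a::{comm_ring, comm_monoid_mult} \<Rightarrow> 'a" +
  assumes scale_mult: "s c (a * b) = s c a * b"

locale lie_algebra = vector_space s
  for s :: "'k::field \<Rightarrow> 'l::ab_group_add \<Rightarrow> 'l" +
  fixes br :: "'l \<Rightarrow> 'l \<Rightarrow> 'l"
  assumes br_linear_right: "Vector_Spaces.linear s s (br x)"
    and br_linear_left: "Vector_Spaces.linear s s (\<lambda>x. br x y)"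
    and br_self: "br x x = 0"
    and jacobi: "br x (br y z) + br y (br z x) + br z (br x y) = 0"

locale graded_lie_algebra = lie_algebra s br
  for s :: "'k::field \<Rightarrow> 'l::ab_group_add \<Rightarrow> 'l" and br :: "'l \<Rightarrow> 'l \<Rightarrow> 'l" +
  fixes G :: "'b::ab_group_add \<Rightarrow> 'l set"
  assumes G_subspace: "subspace (G \<gamma>)"
    and G_span: "span (\<Union>\<gamma>. G \<gamma>) = UNIV"
    and G_independent:
      "\<lbrakk>finite S; \<And>\<gamma>. \<gamma> \<in> S \<Longrightarrow> f \<gamma> \<in> G \<gamma>; (\<Sum>\<gamma>\<in>S. f \<gamma>) = 0; \<delta> \<in> S\<rbrakk> \<Longrightarrow> f \<delta> = 0"
    and G_bracket: "\<lbrakk>x \<in> G \<gamma>; y \<in> G \<delta>\<rbrakk> \<Longrightarrow> br x y \<in> G (\<gamma> + \<delta>)"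

text \<open>
  \<open>d (x\<^sub>1 \<and> \<dots> \<and> x\<^sub>n) = \<Sum>\<^bsub>i<j\<^esub> (-1)\<^sup>i\<^sup>+\<^sup>j [x\<^sub>i, x\<^sub>j] \<and> x\<^sub>1 \<and> \<dots> \<and> x\<^sub>n\<close> with \<open>x\<^sub>i\<close>, \<open>x\<^sub>j\<close> omitted. In all of the following,
  \<open>br\<close> is a bracket on representatives of \<open>V\<close>.
\<close>

definition ce_diff :: "('v \<Rightarrow> 'v \<Rightarrow> 'v) \<Rightarrow> ('v list \<Rightarrow>\<^sub>0 'k::field) \<Rightarrow> ('v list \<Rightarrow>\<^sub>0 'k)" where
  "ce_diff br = lift pscale (\<lambda>xs. \<Sum>(i, j)\<in>{(i, j). i < j \<and> j < length xs}.
     pscale ((- 1) ^ (i + j)) (pure (br (xs ! i) (xs ! j) # nths xs (- {i, j}))))"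

definition homology ::
  "nat \<Rightarrow> ('k::field, 'v::ab_group_add) subquot \<Rightarrow> ('v \<Rightarrow> 'v \<Rightarrow> 'v) \<Rightarrow> ('k, 'v list \<Rightarrow>\<^sub>0 'k) subquot" where
  "homology n V br = \<lparr>
     scl = pscale,
     carr = {z \<in> carr (extpow n V). ce_diff br z \<in> rel (extpow (n - 1) V)},
     rel = {ce_diff br w + r |w r. w \<in> carr (extpow (Suc n) V) \<and> r \<in> rel (extpow n V)}\<rparr>"

definition kill :: "('k::field \<Rightarrow> 'l \<Rightarrow> 'l::ab_group_add) \<Rightarrow> ('l \<Rightarrow> 'l \<Rightarrow> 'l) \<Rightarrow> ('k, 'l list \<Rightarrow>\<^sub>0 'k) subquot" where
  "kill s br = coker
     (lift pscale (\<lambda>xs. pure [br (xs ! 0) (xs ! 1), xs ! 2] - pure [xs ! 0, br (xs ! 1) (xs ! 2)]))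
     (tpow 3 (whole s)) (sympow 2 (whole s))"

definition koszul :: "('l \<Rightarrow> 'l \<Rightarrow> 'l) \<Rightarrow> ('l list \<Rightarrow>\<^sub>0 'k::field) \<Rightarrow> ('l list \<Rightarrow>\<^sub>0 'k)" where
  "koszul br = lift pscale (\<lambda>xs. pure [xs ! 0, br (xs ! 1) (xs ! 2)])"

definition im_koszul :: "('k::field \<Rightarrow> 'l \<Rightarrow> 'l::ab_group_add) \<Rightarrow> ('l \<Rightarrow> 'l \<Rightarrow> 'l) \<Rightarrow> ('k, 'l list \<Rightarrow>\<^sub>0 'k) subquot" where
  "im_koszul s br = imag (koszul br) (homology 3 (whole s) br) (kill s br)"

definition coker_koszul :: "('k::field \<Rightarrow> 'l \<Rightarrow> 'l::ab_group_add) \<Rightarrow> ('l \<Rightarrow> 'l \<Rightarrow> 'l) \<Rightarrow> ('k, 'l list \<Rightarrow>\<^sub>0 'k) subquot" where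
  "coker_koszul s br = coker (koszul br) (homology 3 (whole s) br) (kill s br)"

definition HC1 ::
  "('k::field \<Rightarrow> 'a \<Rightarrow> 'a::{comm_ring, comm_monoid_mult}) \<Rightarrow> ('k, 'a list \<Rightarrow>\<^sub>0 'k) subquot" where
  "HC1 s = coker
     (lift pscale (\<lambda>as. let a = as ! 0; b = as ! 1; c = as ! 2 in
        pure [a * b, c] + pure [b * c, a] + pure [c * a, b]))
     (tpow 3 (whole s)) (extpow 2 (whole s))"

definition HH1 ::
  "('k::field \<Rightarrow> 'a \<Rightarrow> 'a::{comm_ring, comm_monoid_mult}) \<Rightarrow> ('k, 'a list \<Rightarrow>\<^sub>0 'k) subquot" where
  "HH1 s = coker
     (lift pscale (\<lambda>as. let a = as ! 0; b = as ! 1; c = as ! 2 in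
        pure [a * b, c] + pure [b * c, a] + pure [c * a, b] - pure [a * b * c, 1]))
     (tpow 3 (whole s)) (extpow 2 (whole s))"

definition A_mod_A0 ::
  "('k::field \<Rightarrow> 'a \<Rightarrow> 'a::{comm_ring, comm_monoid_mult}) \<Rightarrow> ('k, 'a) subquot" where
  "A_mod_A0 s = (whole s)\<lparr>rel := {a. cls (HH1 s) (pure [a, 1]) = rel (HH1 s)}\<rparr>"

definition cur :: "('k::field \<Rightarrow> 'a \<Rightarrow> 'a::ab_group_add) \<Rightarrow> ('k \<Rightarrow> 'l \<Rightarrow> 'l::ab_group_add)
    \<Rightarrow> ('k, 'a \<times> 'l \<Rightarrow>\<^sub>0 'k) subquot" where
  "cur sA sL = tensor (whole sA) (whole sL)"

definition cur_br :: "('l \<Rightarrow> 'l \<Rightarrow> 'l) \<Rightarrow> ('a::times \<times> 'l \<Rightarrow>\<^sub>0 'k::field) \<Rightarrow> ('a \<times> 'l \<Rightarrow>\<^sub>0 'k)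
    \<Rightarrow> ('a \<times> 'l \<Rightarrow>\<^sub>0 'k)" where
  "cur_br br p q =
     lift pscale (\<lambda>(a, x). lift pscale (\<lambda>(b, y). pure (a * b, br x y)) q) p"

definition cur_grading :: "('k::field \<Rightarrow> 'a \<Rightarrow> 'a::ab_group_add) \<Rightarrow> ('k \<Rightarrow> 'l \<Rightarrow> 'l::ab_group_add)
    \<Rightarrow> ('b \<Rightarrow> 'l set) \<Rightarrow> 'b \<Rightarrow> ('a \<times> 'l \<Rightarrow>\<^sub>0 'k) set" where
  "cur_grading sA sL G \<gamma> = carr (tensor (whole sA) (hcomp (whole sL) (G \<gamma>)))"

definition H2_cur where
  "H2_cur sA sL br G \<beta> =
     hcomp (homology 2 (cur sA sL) (cur_br br)) (hpow (cur_grading sA sL G) 2 \<beta>)"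

definition A_tensor_H2 where
  "A_tensor_H2 sA sL br G \<beta> =
     tensor (whole sA) (hcomp (homology 2 (whole sL) br) (hpow G 2 \<beta>))"

text \<open>\<open>proj_rep\<close> is \<open>(a \<otimes> x) \<and> (b \<otimes> y) \<mapsto> a b \<otimes> (x \<and> y)\<close> on representatives.\<close>

definition proj_rep ::
  "(('a::times \<times> 'l \<Rightarrow>\<^sub>0 'k::field) list \<Rightarrow>\<^sub>0 'k) \<Rightarrow> ('a \<times> ('l list \<Rightarrow>\<^sub>0 'k) \<Rightarrow>\<^sub>0 'k)" where
  "proj_rep = lift pscale (\<lambda>ps.
     lift pscale (\<lambda>(a, x). lift pscale (\<lambda>(b, y). pure (a * b, pure [x, y])) (ps ! 1)) (ps ! 0))"

text \<open>
  For a 2-cycle \<open>z\<close> of the current algebra, \<open>proj_rep z\<close> represents an element of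
  \<open>A \<otimes> \<Lambda>\<^sup>2\<close> lying in the image of \<open>A \<otimes> Z\<^sub>2\<close>, but is not itself written with cycles in the second factor.
  So the class of \<open>z\<close> is sent to the class of those \<open>t\<close> representing elements of \<open>A \<otimes> H\<^sub>2\<close> that
  agree with \<open>proj_rep z\<close> in \<open>A \<otimes> (\<Lambda>\<^sup>2/B\<^sub>2)\<close>, of which \<open>A \<otimes> H\<^sub>2\<close> is a subspace.
\<close>

definition nat_proj where
  "nat_proj sA sL br G \<beta> X =
     {t \<in> carr (A_tensor_H2 sA sL br G \<beta>). \<exists>z\<in>X. proj_rep z - t \<in>
        rel (tensor (whole sA) (coker (ce_diff br) (extpow 3 (whole sL)) (extpow 2 (whole sL))))}"

definition K_space where
  "K_space sA sL br G \<beta> =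
     ker_space (H2_cur sA sL br G \<beta>) (A_tensor_H2 sA sL br G \<beta>) (nat_proj sA sL br G \<beta>)"

definition S2_H1 where
  "S2_H1 s br G \<beta> =
     hcomp (sympow 2 (homology 1 (whole s) br))
       (hpow (\<lambda>\<gamma>. carr (hcomp (homology 1 (whole s) br) (hpow G 1 \<gamma>))) 2 \<beta>)"

end

theory Submission
  imports Defs
begin

text \<open>
  Write \<open>\<iota> a = a \<and> 1 \<in> HH\<^sub>1(A)\<close>. Comparing the boundaries of \<open>(a \<otimes> x) \<and> (b \<otimes> y) \<and> (c \<otimes> z)\<close> for the scalars \<open>(a, b, c)\<close>,
  \<open>(b, a, c)\<close> and \<open>(a b, 1, 1)\<close> and separating the parts symmetric and skew in the elements of \<open>l\<close> shows: since every
  element of degree \<open>\<beta>\<close> of \<open>l \<otimes> l\<close> lies in \<open>l \<otimes> [l, l] + [l, l] \<otimes> l\<close>, the quotient of \<open>\<Lambda>\<^sup>2(A \<otimes> l)\<^sub>\<beta>\<close> by the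
  boundaries is the quotient of \<open>HH\<^sub>1(A) \<otimes> Kill(l)\<^sub>\<beta> \<oplus> A \<otimes> \<Lambda>\<^sup>2(l)\<^sub>\<beta>\<close> by the elements \<open>(\<iota> a \<otimes> \<eta>(w), - a \<otimes> d w)\<close> with
  \<open>w \<in> \<Lambda>\<^sup>3(l)\<^sub>\<beta>\<close>. Hence the kernel of the natural projection is \<open>(HH\<^sub>1(A) \<otimes> Kill(l)\<^sub>\<beta>) / (\<iota>(A) \<otimes> Im(\<eta>)\<^sub>\<beta>)\<close>. The two
  sequences arise by dividing out \<open>\<iota>(A) \<otimes> Kill(l)\<^sub>\<beta>\<close> and \<open>HH\<^sub>1(A) \<otimes> Im(\<eta>)\<^sub>\<beta>\<close>, since \<open>HC\<^sub>1(A) = HH\<^sub>1(A) / \<iota>(A)\<close>.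

  To verify an identity modulo a subspace \<open>R\<close>, a linear map \<open>\<pi>\<close> with kernel \<open>R\<close> is applied, which turns it into an equation.
\<close>

subsection \<open>Linear maps given on representatives\<close>

text \<open>Passing from the presentation of the quotient to the kernel rests on exactness of
  tensoring over a field. An element of \<open>HH\<^sub>1(A) \<otimes> Kill\<close> dies iff it is a
  sum of terms \<open>\<iota> a \<otimes> \<eta>(w)\<close> whose companions
  \<open>a \<otimes> d w\<close> sum to zero in \<open>A \<otimes> \<Lambda>\<^sup>2\<close>. By
  flatness the \<open>w\<close> can then be taken to be cycles, which is why the image of the
  reduced Koszul map appears and not that of \<open>\<eta>\<close>. Conversely, an element whose
  second component lies in \<open>A \<otimes> d(\<Lambda>\<^sup>3)\<close> can be pushed entirely
  into the first component. Two obstacles shape the rest. A 3-chain that bounds an element of degree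
  \<beta> need not be homogeneous, so equations are cut down by the degree projection
  \<open>proj2\<close>, which respects \<open>d\<close> and \<open>\<eta>\<close> only modulo
  relations and respects \<open>x \<and> x = 0\<close> by division by 2. And the natural projection
  has no formula in terms of cycles of \<open>l\<close>; its values are chosen, and compared inside
  \<open>A \<otimes> (\<Lambda>\<^sup>2/B\<^sub>2)\<close>.\<close>

definition wf_subquot :: "('k::field, 'v::ab_group_add) subquot \<Rightarrow> bool" where
  "wf_subquot V \<longleftrightarrow> vector_space (scl V) \<and> module.subspace (scl V) (carr V) \<and>
     module.subspace (scl V) (rel V) \<and> rel V \<subseteq> carr V"

lemma vector_space_subspaceI:
  assumes "vector_space s" "0 \<in> S" "\<And>x y. x \<in> S \<Longrightarrow> y \<in> S \<Longrightarrow> x + y \<in> S" "\<And>c x. x \<in> S \<Longrightarrow> s c x \<in> S"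
  shows "module.subspace s S"
proof -
  interpret vector_space s by fact
  show ?thesis using assms by (auto intro: subspaceI)
qed

lemma subspace_facts:
  assumes "vector_space s" "module.subspace s S"
  shows "0 \<in> S" "x \<in> S \<Longrightarrow> y \<in> S \<Longrightarrow> x + y \<in> S" "x \<in> S \<Longrightarrow> s c x \<in> S"
    "x \<in> S \<Longrightarrow> y \<in> S \<Longrightarrow> x - y \<in> S" "x \<in> S \<Longrightarrow> - x \<in> S"
proof -
  interpret vector_space s by fact
  show "0 \<in> S" "x \<in> S \<Longrightarrow> y \<in> S \<Longrightarrow> x + y \<in> S" "x \<in> S \<Longrightarrow> s c x \<in> S"
    "x \<in> S \<Longrightarrow> y \<in> S \<Longrightarrow> x - y \<in> S" "x \<in> S \<Longrightarrow> - x \<in> S"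
    using assms(2) by (auto intro: subspace_0 subspace_add subspace_scale subspace_diff subspace_neg)
qed

context
  fixes V :: "('k::field, 'v::ab_group_add) subquot"
  assumes V: "wf_subquot V"
begin

lemma wf_vs: "vector_space (scl V)" and wf_carr: "module.subspace (scl V) (carr V)"
  and wf_rel: "module.subspace (scl V) (rel V)" and wf_sub: "x \<in> rel V \<Longrightarrow> x \<in> carr V"
  using V by (auto simp: wf_subquot_def)

lemmas carr_facts = subspace_facts[OF wf_vs wf_carr]
lemmas rel_facts = subspace_facts[OF wf_vs wf_rel]

lemma rel_sym: "x - y \<in> rel V \<Longrightarrow> y - x \<in> rel V"
  using rel_facts(5)[of "x - y"] by simp

lemma rel_trans: "x - y \<in> rel V \<Longrightarrow> y - z \<in> rel V \<Longrightarrow> x - z \<in> rel V"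
  using rel_facts(2)[of "x - y" "y - z"] by simp

lemma rel_mem: "x - y \<in> rel V \<Longrightarrow> y \<in> rel V \<Longrightarrow> x \<in> rel V"
  using rel_facts(2)[of "x - y" y] by simp

lemma rel_mem': "x - y \<in> rel V \<Longrightarrow> x \<in> rel V \<Longrightarrow> y \<in> rel V"
  using rel_facts(4)[of x "x - y"] by simp

lemma cls_eq_iff: "cls V x = cls V y \<longleftrightarrow> x - y \<in> rel V"
proof
  assume "cls V x = cls V y"
  moreover have "x \<in> cls V x" by (simp add: cls_def rel_facts)
  ultimately show "x - y \<in> rel V" by (simp add: cls_def)
next
  assume a: "x - y \<in> rel V"
  have "z - x \<in> rel V \<longleftrightarrow> z - y \<in> rel V" for z
    using rel_facts(2)[OF _ a, of "z - x"] rel_facts(4)[OF _ a, of "z - y"] by auto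
  then show "cls V x = cls V y" by (auto simp: cls_def)
qed

lemma cls_zero: "cls V 0 = rel V"
  by (simp add: cls_def)

lemma cls_rel_iff: "cls V x = rel V \<longleftrightarrow> x \<in> rel V"
  using cls_eq_iff[of x 0] by (simp add: cls_zero)

lemma qadd_cls: "qadd (cls V x) (cls V y) = cls V (x + y)"
proof (intro equalityI subsetI)
  fix z assume "z \<in> qadd (cls V x) (cls V y)"
  then obtain a b where ab: "z = a + b" "a - x \<in> rel V" "b - y \<in> rel V" by (auto simp: qadd_def cls_def)
  have "a + b - (x + y) = (a - x) + (b - y)" by simp
  then show "z \<in> cls V (x + y)" using ab rel_facts(2) by (simp only: cls_def mem_Collect_eq)
next
  fix z assume "z \<in> cls V (x + y)"
  then have "z - (x + y) \<in> rel V" by (simp add: cls_def)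
  then have "z = x + (z - x) \<and> x \<in> cls V x \<and> z - x \<in> cls V y" by (simp add: cls_def rel_facts algebra_simps)
  then show "z \<in> qadd (cls V x) (cls V y)" unfolding qadd_def by blast
qed

lemma qscl_cls: "qscl V c (cls V x) = cls V (scl V c x)"
proof (intro equalityI subsetI)
  interpret vector_space "scl V" by (rule wf_vs)
  fix z assume "z \<in> qscl V c (cls V x)"
  then obtain a r where ab: "z = scl V c a + r" "a - x \<in> rel V" "r \<in> rel V" by (auto simp: qscl_def cls_def)
  have "scl V c a + r - scl V c x = scl V c (a - x) + r" by (simp add: scale_right_diff_distrib)
  then show "z \<in> cls V (scl V c x)" using ab rel_facts(2,3) by (simp only: cls_def mem_Collect_eq)
next
  fix z assume "z \<in> cls V (scl V c x)"
  then have "z = scl V c x + (z - scl V c x) \<and> x \<in> cls V x \<and> z - scl V c x \<in> rel V"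
    by (simp add: cls_def rel_facts)
  then show "z \<in> qscl V c (cls V x)" unfolding qscl_def by blast
qed

end

text \<open>Additivity and homogeneity hold only modulo \<open>rel W\<close>: maps such as
  \<open>\<lambda>a. pure [a, 1]\<close>, or a choice of representatives such as
  \<open>np_rep\<close>, are linear on cosets but not on the ambient spaces.\<close>

definition rep_map ::
  "('k::field, 'v::ab_group_add) subquot \<Rightarrow> ('k, 'w::ab_group_add) subquot \<Rightarrow> ('v \<Rightarrow> 'w) \<Rightarrow> bool" where
  "rep_map V W f \<longleftrightarrow> (\<forall>x\<in>carr V. f x \<in> carr W) \<and> (\<forall>x\<in>rel V. f x \<in> rel W) \<and>
     (\<forall>x\<in>carr V. \<forall>y\<in>carr V. f (x + y) - (f x + f y) \<in> rel W) \<and>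
     (\<forall>c. \<forall>x\<in>carr V. f (scl V c x) - scl W c (f x) \<in> rel W)"

definition rep_inj ::
  "('k::field, 'v::ab_group_add) subquot \<Rightarrow> ('k, 'w::ab_group_add) subquot \<Rightarrow> ('v \<Rightarrow> 'w) \<Rightarrow> bool" where
  "rep_inj V W f \<longleftrightarrow> (\<forall>x\<in>carr V. f x \<in> rel W \<longrightarrow> x \<in> rel V)"

definition rep_surj ::
  "('k::field, 'v::ab_group_add) subquot \<Rightarrow> ('k, 'w::ab_group_add) subquot \<Rightarrow> ('v \<Rightarrow> 'w) \<Rightarrow> bool" where
  "rep_surj V W f \<longleftrightarrow> (\<forall>y\<in>carr W. \<exists>x\<in>carr V. y - f x \<in> rel W)"

text \<open>Collecting everything congruent to some value of \<open>f\<close> on \<open>X\<close>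
  gives a map of cosets without a choice of representative.\<close>

definition induced :: "('k, 'w::ab_group_add) subquot \<Rightarrow> ('v \<Rightarrow> 'w) \<Rightarrow> 'v set \<Rightarrow> 'w set" where
  "induced W f X = {y. \<exists>x\<in>X. y - f x \<in> rel W}"

lemma linear_rep_map:
  assumes "Vector_Spaces.linear (scl V) (scl W) f" "wf_subquot W"
    "\<And>x. x \<in> carr V \<Longrightarrow> f x \<in> carr W" "\<And>x. x \<in> rel V \<Longrightarrow> f x \<in> rel W"
  shows "rep_map V W f"
  using assms(2-) assms(1)[unfolded Vector_Spaces.linear_iff]
  by (auto simp: rep_map_def rel_facts)

lemma rep_map_diff:
  assumes "wf_subquot V" "wf_subquot W" "rep_map V W f" "x \<in> carr V" "y \<in> carr V"
  shows "f (x - y) - (f x - f y) \<in> rel W"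
proof -
  have "f ((x - y) + y) - (f (x - y) + f y) \<in> rel W"
    using assms carr_facts(4)[OF assms(1)] by (simp only: rep_map_def)
  then have "f x - (f (x - y) + f y) \<in> rel W" by simp
  then have "(f (x - y) + f y) - f x \<in> rel W" by (rule rel_sym[OF assms(2)])
  moreover have "(f (x - y) + f y) - f x = f (x - y) - (f x - f y)" by simp
  ultimately show ?thesis by (simp only:)
qed

lemma rep_map_cong_rel:
  assumes "wf_subquot V" "wf_subquot W" "rep_map V W f" "x \<in> carr V" "y \<in> carr V" "x - y \<in> rel V"
  shows "f x - f y \<in> rel W"
proof -
  have "f (x - y) \<in> rel W" using assms by (auto simp: rep_map_def)
  with rep_map_diff[OF assms(1-5)] show ?thesis by (rule rel_mem'[OF assms(2)])
qed

lemma induced_cls: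
  assumes "wf_subquot V" "wf_subquot W" "rep_map V W f" "x \<in> carr V"
  shows "induced W f (cls V x) = cls W (f x)"
proof (intro equalityI subsetI)
  fix y assume "y \<in> induced W f (cls V x)"
  then obtain x' where x': "x' - x \<in> rel V" "y - f x' \<in> rel W" by (auto simp: induced_def cls_def)
  have "(x' - x) + x \<in> carr V" by (rule carr_facts(2)[OF assms(1) wf_sub[OF assms(1) x'(1)] assms(4)])
  then have "f x' - f x \<in> rel W" by (intro rep_map_cong_rel[OF assms(1-3) _ assms(4) x'(1)]) simp
  then have "(y - f x') + (f x' - f x) \<in> rel W" using x' by (intro rel_facts(2)[OF assms(2)])
  then show "y \<in> cls W (f x)" by (simp add: cls_def)
next
  fix y assume "y \<in> cls W (f x)"
  moreover have "x \<in> cls V x" using rel_facts(1)[OF assms(1)] by (simp add: cls_def)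
  ultimately show "y \<in> induced W f (cls V x)" unfolding induced_def cls_def mem_Collect_eq by blast
qed

lemma lin_induced:
  assumes "wf_subquot V" "wf_subquot W" "rep_map V W f"
  shows "lin V W (induced W f)"
proof -
  note i = induced_cls[OF assms]
  note r = assms(3)[unfolded rep_map_def]
  note c = carr_facts[OF assms(1)]
  show ?thesis
    unfolding lin_def elts_def
  proof (intro conjI ballI allI; elim imageE; hypsubst)
    fix x assume x: "x \<in> carr V"
    show "induced W f (cls V x) \<in> cls W ` carr W" using r x by (simp add: i)
    fix k
    show "induced W f (qscl V k (cls V x)) = qscl W k (induced W f (cls V x))"
      using r x c(3)[OF x, of k]
      by (simp add: i qscl_cls[OF assms(1)] qscl_cls[OF assms(2)] cls_eq_iff[OF assms(2)])
  next
    fix x y assume x: "x \<in> carr V" "y \<in> carr V"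
    show "induced W f (qadd (cls V x) (cls V y)) = qadd (induced W f (cls V x)) (induced W f (cls V y))"
      using r x c(2)[OF x]
      by (simp add: i qadd_cls[OF assms(1)] qadd_cls[OF assms(2)] cls_eq_iff[OF assms(2)])
  qed
qed

lemma inj_on_induced:
  assumes "wf_subquot V" "wf_subquot W" "rep_map V W f" "rep_inj V W f"
  shows "inj_on (induced W f) (elts V)"
proof (rule inj_onI)
  fix X Y assume "X \<in> elts V" "Y \<in> elts V" and e: "induced W f X = induced W f Y"
  then obtain x y where xy: "x \<in> carr V" "y \<in> carr V" "X = cls V x" "Y = cls V y" by (auto simp: elts_def)
  have "f x - f y \<in> rel W" using e xy by (simp add: induced_cls[OF assms(1-3)] cls_eq_iff[OF assms(2)])
  then have "(f (x - y) - (f x - f y)) + (f x - f y) \<in> rel W"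
    by (intro rel_facts(2)[OF assms(2)] rep_map_diff[OF assms(1-3)] xy)
  then have "x - y \<in> rel V" using assms(4) carr_facts(4)[OF assms(1) xy(1,2)] by (simp add: rep_inj_def)
  then show "X = Y" using xy by (simp add: cls_eq_iff[OF assms(1)])
qed

lemma image_induced:
  assumes "wf_subquot V" "wf_subquot W" "rep_map V W f"
  shows "induced W f ` elts V = {cls W y |y. y \<in> carr W \<and> (\<exists>x\<in>carr V. y - f x \<in> rel W)}"
proof (intro equalityI subsetI)
  fix Y assume "Y \<in> induced W f ` elts V"
  then obtain x where x: "x \<in> carr V" "Y = cls W (f x)" by (auto simp: elts_def induced_cls[OF assms])
  moreover have "f x \<in> carr W" using x assms by (auto simp: rep_map_def)
  moreover have "f x - f x \<in> rel W" using rel_facts(1)[OF assms(2)] by simp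
  ultimately show "Y \<in> {cls W y |y. y \<in> carr W \<and> (\<exists>x\<in>carr V. y - f x \<in> rel W)}" by blast
next
  fix Y assume "Y \<in> {cls W y |y. y \<in> carr W \<and> (\<exists>x\<in>carr V. y - f x \<in> rel W)}"
  then obtain y x where "Y = cls W y" "x \<in> carr V" "y - f x \<in> rel W" by blast
  then have "Y = induced W f (cls V x)" "cls V x \<in> elts V"
    by (simp_all add: induced_cls[OF assms] cls_eq_iff[OF assms(2)] elts_def)
  then show "Y \<in> induced W f ` elts V" by blast
qed

lemma image_induced_surj:
  assumes "wf_subquot V" "wf_subquot W" "rep_map V W f" "rep_surj V W f"
  shows "induced W f ` elts V = elts W"
  unfolding image_induced[OF assms(1-3)] using assms(4) by (auto simp: elts_def rep_surj_def)

lemma isomorphicI: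
  assumes "wf_subquot V" "wf_subquot W" "rep_map V W f" "rep_inj V W f" "rep_surj V W f"
  shows "isomorphic V W"
  unfolding isomorphic_def bij_betw_def
  using lin_induced[OF assms(1-3)] inj_on_induced[OF assms(1-4)] image_induced_surj[OF assms(1-3,5)] by blast

text \<open>\<open>g\<close> picks an arbitrary preimage modulo relations. Each law for
  \<open>g\<close> is obtained by applying \<open>f\<close> to both sides and cancelling
  \<open>f\<close>, which is injective modulo \<open>rel V\<close>.\<close>

lemma rep_map_inverse:
  assumes "wf_subquot V" "wf_subquot W" "rep_map V W f" "rep_inj V W f" "rep_surj V W f"
  obtains g where "rep_map W V g" "\<And>y. y \<in> carr W \<Longrightarrow> g y \<in> carr V" "\<And>y. y \<in> carr W \<Longrightarrow> y - f (g y) \<in> rel W"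
    "\<And>x. x \<in> carr V \<Longrightarrow> x - g (f x) \<in> rel V" "rep_inj W V g" "rep_surj W V g"
proof -
  note rf = assms(3)[unfolded rep_map_def]
  obtain g where g: "g y \<in> carr V \<and> y - f (g y) \<in> rel W" if "y \<in> carr W" for y
    using assms(5) unfolding rep_surj_def by metis
  have inj: "x - x' \<in> rel V" if "x \<in> carr V" "x' \<in> carr V" "f x - f x' \<in> rel W" for x x'
  proof -
    have "(f (x - x') - (f x - f x')) + (f x - f x') \<in> rel W"
      by (intro rel_facts(2)[OF assms(2)] rep_map_diff[OF assms(1-3)] that)
    then show ?thesis using assms(4) carr_facts(4)[OF assms(1) that(1,2)] by (simp add: rep_inj_def)
  qed
  have gf: "x - g (f x) \<in> rel V" if "x \<in> carr V" for x
    using inj that g rf by auto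
  have "rep_map W V g"
    unfolding rep_map_def
  proof (intro conjI ballI allI)
    fix y assume y: "y \<in> carr W"
    then show "g y \<in> carr V" using g by blast
    fix c
    have "f (scl V c (g y)) - scl W c (f (g y)) \<in> rel W" using rf g[OF y] by blast
    moreover have "scl W c (y - f (g y)) \<in> rel W" using g[OF y] rel_facts(3)[OF assms(2)] by blast
    moreover have "scl W c y - f (g (scl W c y)) \<in> rel W" using g carr_facts(3)[OF assms(2) y] by blast
    ultimately have "scl W c (y - f (g y)) - (scl W c y - f (g (scl W c y)))
       - (f (scl V c (g y)) - scl W c (f (g y))) \<in> rel W"
      using rel_facts(4)[OF assms(2)] by blast
    moreover have "scl W c (y - f (g y)) = scl W c y - scl W c (f (g y))"
      using wf_vs[OF assms(2)] by (simp add: module.scale_right_diff_distrib module_iff_vector_space)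
    ultimately have "f (g (scl W c y)) - f (scl V c (g y)) \<in> rel W" by (simp add: algebra_simps)
    then show "g (scl W c y) - scl V c (g y) \<in> rel V"
      using inj g y carr_facts(3)[OF assms(2)] carr_facts(3)[OF assms(1)] by blast
  next
    fix y assume y: "y \<in> rel W"
    then have yc: "y \<in> carr W" by (rule wf_sub[OF assms(2)])
    have "f (g y) \<in> rel W" using y g[OF yc] rel_mem'[OF assms(2)] by blast
    then show "g y \<in> rel V" using assms(4) g[OF yc] by (simp add: rep_inj_def)
  next
    fix x y assume y: "x \<in> carr W" "y \<in> carr W"
    have "f (g x + g y) - (f (g x) + f (g y)) \<in> rel W" using rf g y by blast
    moreover have "(x - f (g x)) + (y - f (g y)) \<in> rel W" using g y rel_facts(2)[OF assms(2)] by blast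
    moreover have "(x + y) - f (g (x + y)) \<in> rel W" using g carr_facts(2)[OF assms(2)] y by blast
    ultimately have "((x - f (g x)) + (y - f (g y))) - ((x + y) - f (g (x + y)))
       - (f (g x + g y) - (f (g x) + f (g y))) \<in> rel W"
      using rel_facts(4)[OF assms(2)] by blast
    then have "f (g (x + y)) - f (g x + g y) \<in> rel W" by (simp add: algebra_simps)
    then show "g (x + y) - (g x + g y) \<in> rel V"
      by (intro inj carr_facts(2)[OF assms(1)] conjunct1[OF g] carr_facts(2)[OF assms(2)] y)
  qed
  moreover have "rep_inj W V g"
    unfolding rep_inj_def
  proof (intro ballI impI)
    fix y assume y: "y \<in> carr W" "g y \<in> rel V"
    then have "f (g y) \<in> rel W" using rf by blast
    then have "(y - f (g y)) + f (g y) \<in> rel W" using g[OF y(1)] rel_facts(2)[OF assms(2)] by blast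
    then show "y \<in> rel W" by simp
  qed
  moreover have "rep_surj W V g" unfolding rep_surj_def using gf rf by blast
  ultimately show ?thesis using that g gf by blast
qed

lemma rep_map_comp:
  assumes "wf_subquot U" "wf_subquot V" "wf_subquot W" "rep_map U V f" "rep_map V W g"
  shows "rep_map U W (\<lambda>x. g (f x))"
proof -
  have 1: "f x \<in> carr V" if "x \<in> carr U" for x using assms that by (auto simp: rep_map_def)
  have "g (f (x + y)) - (g (f x) + g (f y)) \<in> rel W" if "x \<in> carr U" "y \<in> carr U" for x y
  proof -
    have "f (x + y) - (f x + f y) \<in> rel V" using assms that by (auto simp: rep_map_def)
    then have "g (f (x + y)) - g (f x + f y) \<in> rel W"
      using that by (intro rep_map_cong_rel[OF assms(2,3,5)] 1 carr_facts(2)[OF assms(1)] carr_facts(2)[OF assms(2)])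
    moreover have "g (f x + f y) - (g (f x) + g (f y)) \<in> rel W"
      using assms that 1 by (auto simp: rep_map_def)
    ultimately show ?thesis by (rule rel_trans[OF assms(3)])
  qed
  moreover have "g (f (scl U c x)) - scl W c (g (f x)) \<in> rel W" if "x \<in> carr U" for c x
  proof -
    have "f (scl U c x) - scl V c (f x) \<in> rel V" using assms that by (auto simp: rep_map_def)
    then have "g (f (scl U c x)) - g (scl V c (f x)) \<in> rel W"
      using that by (intro rep_map_cong_rel[OF assms(2,3,5)] 1 carr_facts(3)[OF assms(1)] carr_facts(3)[OF assms(2)])
    moreover have "g (scl V c (f x)) - scl W c (g (f x)) \<in> rel W"
      using assms that 1 by (auto simp: rep_map_def)
    ultimately show ?thesis by (rule rel_trans[OF assms(3)])
  qed
  ultimately show ?thesis using assms by (auto simp: rep_map_def)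
qed

section \<open>Exact sequences and filtrations on the level of representatives\<close>

definition rep_exact ::
  "('k::field, 'u::ab_group_add) subquot \<Rightarrow> ('k, 'v::ab_group_add) subquot \<Rightarrow> ('k, 'w::ab_group_add) subquot \<Rightarrow>
    ('u \<Rightarrow> 'v) \<Rightarrow> ('v \<Rightarrow> 'w) \<Rightarrow> bool" where
  "rep_exact U V W f g \<longleftrightarrow> rep_map U V f \<and> rep_map V W g \<and> rep_inj U V f \<and> rep_surj V W g \<and>
     (\<forall>x\<in>carr V. g x \<in> rel W \<longleftrightarrow> (\<exists>u\<in>carr U. x - f u \<in> rel V))"

lemma rep_exact_short_exact:
  assumes "wf_subquot U" "wf_subquot V" "wf_subquot W" "rep_exact U V W f g"
  shows "short_exact U V W"
proof -
  note r = assms(4)[unfolded rep_exact_def]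
  have "induced V f ` elts U = {X \<in> elts V. induced W g X = rel W}"
  proof -
    have "induced V f ` elts U = {cls V y |y. y \<in> carr V \<and> g y \<in> rel W}"
      using r by (subst image_induced[OF assms(1,2)]) auto
    also have "\<dots> = {X \<in> elts V. induced W g X = rel W}"
    proof -
      have "induced W g (cls V y) = rel W \<longleftrightarrow> g y \<in> rel W" if "y \<in> carr V" for y
        using r that by (simp add: induced_cls[OF assms(2,3)] cls_rel_iff[OF assms(3)])
      then show ?thesis by (auto simp: elts_def)
    qed
    finally show ?thesis .
  qed
  then show ?thesis
    unfolding short_exact_def using r
    by (intro exI[of _ "induced V f"] exI[of _ "induced W g"])
      (simp add: lin_induced[OF assms(1,2)] lin_induced[OF assms(2,3)]
      inj_on_induced[OF assms(1,2)] image_induced_surj[OF assms(2,3)])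
qed

text \<open>With \<open>k\<close> inverse to \<open>h\<close> modulo relations, the new maps are
  \<open>h\<close> after \<open>f\<close> and \<open>g\<close> after \<open>k\<close>. It serves to
  prove exactness for an explicit model \<open>Q\<close> and to carry it over to the kernel of the
  natural projection.\<close>

lemma rep_exact_transport:
  assumes "wf_subquot U" "wf_subquot Q" "wf_subquot V" "wf_subquot W" "rep_exact U Q W f g" "rep_map Q V h" "rep_inj Q V h" "rep_surj Q V h"
  obtains f' g' where "rep_exact U V W f' g'"
proof -
  note r = assms(5)[unfolded rep_exact_def]
  obtain k where k: "rep_map V Q k" "\<And>y. y \<in> carr V \<Longrightarrow> k y \<in> carr Q" "\<And>y. y \<in> carr V \<Longrightarrow> y - h (k y) \<in> rel V"
    "\<And>x. x \<in> carr Q \<Longrightarrow> x - k (h x) \<in> rel Q" "rep_inj V Q k" "rep_surj V Q k"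
    using rep_map_inverse[OF assms(2,3,6-8)] by metis
  have f: "f x \<in> carr Q" if "x \<in> carr U" for x using r that by (auto simp: rep_map_def)
  have h: "h x \<in> carr V" if "x \<in> carr Q" for x using assms(6) that by (auto simp: rep_map_def)
  have "rep_surj V W (\<lambda>x. g (k x))"
    unfolding rep_surj_def
  proof
    fix y assume "y \<in> carr W"
    then obtain x where x: "x \<in> carr Q" "y - g x \<in> rel W" using r by (auto simp: rep_surj_def)
    have "g x - g (k (h x)) \<in> rel W"
      using r x h k by (intro rep_map_cong_rel[OF assms(2,4)]) auto
    then have "y - g (k (h x)) \<in> rel W" using x rel_trans[OF assms(4)] by blast
    then show "\<exists>x\<in>carr V. y - g (k x) \<in> rel W" using h x by blast
  qed
  moreover have "g (k x) \<in> rel W \<longleftrightarrow> (\<exists>u\<in>carr U. x - h (f u) \<in> rel V)" if x: "x \<in> carr V" for x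
  proof -
    have "k x - f u \<in> rel Q \<longleftrightarrow> x - h (f u) \<in> rel V" if u: "u \<in> carr U" for u
    proof
      assume "k x - f u \<in> rel Q"
      then have "h (k x) - h (f u) \<in> rel V"
        using k x f u by (intro rep_map_cong_rel[OF assms(2,3,6)]) auto
      then show "x - h (f u) \<in> rel V" using k(3)[OF x] rel_trans[OF assms(3)] by blast
    next
      assume "x - h (f u) \<in> rel V"
      then have "k x - k (h (f u)) \<in> rel Q"
        using k x f u h by (intro rep_map_cong_rel[OF assms(3,2) k(1)]) auto
      then show "k x - f u \<in> rel Q"
        using k(4)[OF f[OF u]] rel_sym[OF assms(2)] rel_trans[OF assms(2)] by blast
    qed
    then show ?thesis using r k(2)[OF x] by auto
  qed
  moreover have "rep_inj U V (\<lambda>x. h (f x))"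
    using r f assms(7) by (auto simp: rep_inj_def)
  ultimately have "rep_exact U V W (\<lambda>x. h (f x)) (\<lambda>x. g (k x))"
    unfolding rep_exact_def using rep_map_comp[OF assms(1-3)] rep_map_comp[OF assms(3,2,4)] r k(1) assms(6) by blast
  then show ?thesis by (rule that)
qed

lemma kernel_good:
  assumes "wf_subquot V" "wf_subquot W" "rep_map V W f"
  shows "module.subspace (scl V) {x \<in> carr V. f x \<in> rel W}"
proof (rule vector_space_subspaceI[OF wf_vs[OF assms(1)]])
  note r = assms(3)[unfolded rep_map_def]
  show "0 \<in> {x \<in> carr V. f x \<in> rel W}" using r rel_facts(1)[OF assms(1)] carr_facts(1)[OF assms(1)] by auto
  fix x assume x: "x \<in> {x \<in> carr V. f x \<in> rel W}"
  { fix y assume y: "y \<in> {x \<in> carr V. f x \<in> rel W}"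
    have "f x + f y \<in> rel W" using x y rel_facts(2)[OF assms(2)] by simp
    then have "f (x + y) \<in> rel W" using r x y rel_mem[OF assms(2)] by blast
    then show "x + y \<in> {x \<in> carr V. f x \<in> rel W}" using x y carr_facts[OF assms(1)] by simp }
  { fix c
    have "scl W c (f x) \<in> rel W" using x rel_facts(3)[OF assms(2)] by simp
    then have "f (scl V c x) \<in> rel W" using r x rel_mem[OF assms(2)] by blast
    then show "scl V c x \<in> {x \<in> carr V. f x \<in> rel W}" using x carr_facts[OF assms(1)] by simp }
qed

lemma wf_carr_kernel:
  assumes "wf_subquot V" "wf_subquot W" "rep_map V W f"
  shows "wf_subquot (V\<lparr>carr := {x \<in> carr V. f x \<in> rel W}\<rparr>)"
  using kernel_good[OF assms] assms by (auto simp: wf_subquot_def rep_map_def)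

lemma wf_rel_kernel:
  assumes "wf_subquot V" "wf_subquot W" "rep_map V W f"
  shows "wf_subquot (V\<lparr>rel := {x \<in> carr V. f x \<in> rel W}\<rparr>)"
  using kernel_good[OF assms] assms by (auto simp: wf_subquot_def)

text \<open>The first isomorphism theorem, read from \<open>W\<close> to the quotient because the
  entries \<open>isomorphic W\<close> of an iterated extension are applied in that direction; hence
  the passage to the inverse.\<close>

lemma isomorphic_quot_kernel:
  assumes "wf_subquot V" "wf_subquot W" "rep_map V W f" "rep_surj V W f"
  shows "isomorphic W (V\<lparr>rel := {x \<in> carr V. f x \<in> rel W}\<rparr>)"
proof -
  let ?V = "V\<lparr>rel := {x \<in> carr V. f x \<in> rel W}\<rparr>"
  have g: "wf_subquot ?V" by (rule wf_rel_kernel[OF assms(1-3)])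
  have m: "rep_map ?V W f" using assms(3) by (auto simp: rep_map_def)
  have i: "rep_inj ?V W f" by (auto simp: rep_inj_def)
  have s: "rep_surj ?V W f" using assms(4) by (auto simp: rep_surj_def)
  obtain k where "rep_map W ?V k" "rep_inj W ?V k" "rep_surj W ?V k"
    by (rule rep_map_inverse[OF g assms(2) m i s]) (rule that)
  then show ?thesis by (rule isomorphicI[OF assms(2) g])
qed

text \<open>The three step filtration \<open>f(U) \<subseteq> ker h \<subseteq> V\<close>.\<close>

lemma iterated_extension3:
  assumes "wf_subquot U" "wf_subquot V" "wf_subquot W" "wf_subquot Y" "rep_map V Y h" "rep_surj V Y h"
    and ex: "rep_exact U (V\<lparr>carr := {x \<in> carr V. h x \<in> rel Y}\<rparr>) W f g"
  shows "iterated_extension V [isomorphic W, isomorphic U, isomorphic Y]"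
proof -
  let ?K = "V\<lparr>carr := {x \<in> carr V. h x \<in> rel Y}\<rparr>"
  let ?F = "{x \<in> carr ?K. g x \<in> rel W}"
  note r = ex[unfolded rep_exact_def]
  have gK: "wf_subquot ?K" by (rule wf_carr_kernel[OF assms(2,4,5)])
  have mg: "rep_map ?K W g" and sg: "rep_surj ?K W g" using r by auto
  have "isomorphic W (?K\<lparr>rel := ?F\<rparr>)" by (rule isomorphic_quot_kernel[OF gK assms(3) mg sg])
  then have W: "isomorphic W (V\<lparr>carr := {x \<in> carr V. h x \<in> rel Y}, rel := ?F\<rparr>)" by simp
  have "isomorphic Y (V\<lparr>rel := {x \<in> carr V. h x \<in> rel Y}\<rparr>)"
    by (rule isomorphic_quot_kernel[OF assms(2,4-6)])
  then have Y: "isomorphic Y (V\<lparr>carr := carr V, rel := {x \<in> carr V. h x \<in> rel Y}\<rparr>)" by simp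
  have gF: "wf_subquot (?K\<lparr>carr := ?F\<rparr>)" by (rule wf_carr_kernel[OF gK assms(3) mg])
  have "isomorphic U (?K\<lparr>carr := ?F\<rparr>)"
  proof (rule isomorphicI[OF assms(1) gF])
    have "g (f u) \<in> rel W" if u: "u \<in> carr U" for u
    proof -
      have "f u \<in> carr ?K" using r u by (auto simp: rep_map_def)
      moreover have "f u - f u \<in> rel ?K" using rel_facts(1)[OF gK] by simp
      ultimately show ?thesis using r u by blast
    qed
    then show "rep_map U (?K\<lparr>carr := ?F\<rparr>) f" using r by (auto simp: rep_map_def)
    show "rep_inj U (?K\<lparr>carr := ?F\<rparr>) f" using r by (auto simp: rep_inj_def)
    show "rep_surj U (?K\<lparr>carr := ?F\<rparr>) f" using r by (auto simp: rep_surj_def)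
  qed
  then have U: "isomorphic U (V\<lparr>carr := ?F, rel := rel V\<rparr>)" by simp
  define Fil where "Fil i = (if i = 0 then rel V else if i = 1 then ?F
    else if i = 2 then {x \<in> carr V. h x \<in> rel Y} else carr V)" for i :: nat
  \<comment> \<open>The filtration starts with the copy of \<open>U\<close>, while the list names
    \<open>W\<close> first; the permutation swaps these two.\<close>
  define \<pi> where "\<pi> i = (if i = 0 then 1 else if i = 1 then 0 else i)" for i :: nat
  have sF: "module.subspace (scl V) ?F" using kernel_good[OF gK assms(3) mg] by simp
  have sK: "module.subspace (scl V) {x \<in> carr V. h x \<in> rel Y}" by (rule kernel_good[OF assms(2,4,5)])
  have 1: "{..<length [isomorphic W, isomorphic U, isomorphic Y]} = {0,1,2}" by auto
  have 2: "rel V \<subseteq> ?F" using wf_sub[OF gF] by auto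
  show ?thesis
    unfolding iterated_extension_def
  proof (intro exI[of _ Fil] exI[of _ \<pi>] conjI)
    show "bij_betw \<pi> {..<length [isomorphic W, isomorphic U, isomorphic Y]}
       {..<length [isomorphic W, isomorphic U, isomorphic Y]}"
      unfolding 1 by (auto simp: bij_betw_def inj_on_def \<pi>_def)
    show "\<forall>i\<le>length [isomorphic W, isomorphic U, isomorphic Y]. module.subspace (scl V) (Fil i)"
      using sF sK wf_rel[OF assms(2)] wf_carr[OF assms(2)] by (auto simp: Fil_def)
    show "\<forall>i<length [isomorphic W, isomorphic U, isomorphic Y]. Fil i \<subseteq> Fil (Suc i)"
      using 2 by (auto simp: Fil_def less_Suc_eq)
    show "\<forall>i<length [isomorphic W, isomorphic U, isomorphic Y].
       ([isomorphic W, isomorphic U, isomorphic Y] ! \<pi> i) (V\<lparr>carr := Fil (Suc i), rel := Fil i\<rparr>)"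
      using U W Y by (auto simp: Fil_def \<pi>_def less_Suc_eq)
  qed (auto simp: Fil_def)
qed

subsection \<open>Linear algebra\<close>

text \<open>The basic induction principle: carriers and relations of all constructions are spans, so
  membership claims about linear images reduce to generators. With \<open>R = {0}\<close> it proves
  equations.\<close>

lemma linear_span_in:
  assumes "Vector_Spaces.linear s1 s2 F" "module.subspace s2 R" "\<And>x. x \<in> S \<Longrightarrow> F x \<in> R"
    "y \<in> module.span s1 S"
  shows "F y \<in> R"
proof -
  interpret Vector_Spaces.linear s1 s2 F by fact
  have "vs1.subspace {x. F x \<in> R}" by (rule subspace_linear_preimage[OF assms(2)])
  then have "vs1.span S \<subseteq> {x. F x \<in> R}" using assms(3) by (intro vs1.span_minimal) auto
  then show ?thesis using assms(4) by auto
qed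

lemma ex_projection:
  assumes "vector_space s" "module.subspace s S"
  obtains p where "Vector_Spaces.linear s s p" "\<And>x. p x \<in> S" "\<And>x. x \<in> S \<Longrightarrow> p x = x"
proof -
  interpret vector_space s by fact
  interpret vector_space_pair s s ..
  have "\<exists>g. g ` UNIV \<subseteq> S \<and> Vector_Spaces.linear s s g \<and> (\<forall>v\<in>S. g (id v) = v)"
    using assms(2) by (intro linear_exists_left_inverse_on linear_id) auto
  then show ?thesis using that by auto
qed

text \<open>Subtracting a projection onto \<open>R\<close> from the identity realises the quotient
  inside the same space, so no new type is needed.\<close>

lemma ex_quotient_map:
  assumes "vector_space s" "module.subspace s R"
  obtains \<pi> where "Vector_Spaces.linear s s \<pi>" "\<And>x. \<pi> x = 0 \<longleftrightarrow> x \<in> R"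
proof -
  interpret vector_space s by fact
  obtain p where p: "Vector_Spaces.linear s s p" "\<And>x. p x \<in> R" "\<And>x. x \<in> R \<Longrightarrow> p x = x"
    using ex_projection[OF assms] by metis
  have "Vector_Spaces.linear s s (\<lambda>x. x - p x)"
    using p(1) by (simp add: Vector_Spaces.linear_iff scale_right_diff_distrib)
  moreover have "x - p x = 0 \<longleftrightarrow> x \<in> R" for x
    using p(2)[of x] p(3)[of x] by auto
  ultimately show ?thesis by (rule that)
qed

lemma ex_separating_functional:
  fixes s :: "'k::field \<Rightarrow> 'v::ab_group_add \<Rightarrow> 'v"
  assumes "vector_space s" "module.subspace s R" "x \<notin> R"
  obtains f where "Vector_Spaces.linear s ((*) :: 'k \<Rightarrow> 'k \<Rightarrow> 'k) f" "\<And>r. r \<in> R \<Longrightarrow> f r = 0" "f x \<noteq> 0"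
proof -
  interpret vector_space s by fact
  interpret k: vector_space "(*) :: 'k \<Rightarrow> 'k \<Rightarrow> 'k" by unfold_locales (simp_all add: algebra_simps)
  interpret vector_space_pair s "(*) :: 'k \<Rightarrow> 'k \<Rightarrow> 'k" ..
  obtain B where B: "B \<subseteq> R" "independent B" "R \<subseteq> span B"
    using maximal_independent_subset[of R] by metis
  have sB: "span B = R" using B assms(2) by (intro span_subspace) auto
  have "independent (insert x B)" using B sB assms(3) by (intro independent_insertI) auto
  then obtain f where f: "Vector_Spaces.linear s (*) f" "\<forall>b\<in>insert x B. f b = (if b = x then 1 else 0)"
    using linear_independent_extend[of "insert x B" "\<lambda>b. if b = x then 1 else (0::'k)"] by auto
  have "f r = 0" if "r \<in> R" for r
  proof -
    have "f r \<in> {0}"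
    proof (rule linear_span_in[OF f(1), of "{0}" B])
      show "k.subspace {0}" by simp
      show "f b \<in> {0}" if "b \<in> B" for b using f(2) that B(1) assms(3) by auto
      show "r \<in> span B" using that sB by simp
    qed
    then show ?thesis by simp
  qed
  then show ?thesis using f by (intro that[of f]) auto
qed

subsection \<open>Free vector spaces\<close>

lemma lookup_pscale [simp]: "Poly_Mapping.lookup (pscale c p) x = c * Poly_Mapping.lookup p x"
  by (simp add: pscale_def Poly_Mapping.map.rep_eq when_def)

interpretation pv: vector_space "pscale :: 'k::field \<Rightarrow> ('x \<Rightarrow>\<^sub>0 'k) \<Rightarrow> _"
  by unfold_locales (auto intro!: poly_mapping_eqI simp: lookup_add algebra_simps)

text \<open>A common finite index set makes sums over the different supports of \<open>p\<close>,
  \<open>q\<close> and \<open>p + q\<close> comparable.\<close>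

lemma lift_superset:
  assumes "vector_space s" "finite A" "Poly_Mapping.keys p \<subseteq> A"
  shows "lift s f p = (\<Sum>x\<in>A. s (Poly_Mapping.lookup p x) (f x))"
proof -
  interpret vector_space s by fact
  show ?thesis unfolding lift_def
    using assms(2,3) by (intro sum.mono_neutral_left) (auto simp: in_keys_iff)
qed

lemma linear_lift:
  assumes "vector_space s"
  shows "Vector_Spaces.linear pscale s (lift s f)"
proof -
  interpret vector_space s by fact
  have 1: "lift s f (p + q) = lift s f p + lift s f q" for p q
  proof -
    let ?A = "Poly_Mapping.keys p \<union> Poly_Mapping.keys q"
    have "Poly_Mapping.keys (p + q) \<subseteq> ?A" by (rule Poly_Mapping.keys_add)
    then show ?thesis
      by (simp add: lift_superset[OF assms, where A = ?A] lookup_add scale_left_distrib sum.distrib)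
  qed
  have 2: "lift s f (pscale c p) = s c (lift s f p)" for c p
  proof -
    have "Poly_Mapping.keys (pscale c p) \<subseteq> Poly_Mapping.keys p" by (auto simp: in_keys_iff)
    then show ?thesis
      by (simp add: lift_superset[OF assms, where A = "Poly_Mapping.keys p"] scale_sum_right)
  qed
  show ?thesis
    unfolding Vector_Spaces.linear_iff using 1 2 assms by (auto simp: pv.vector_space_axioms)
qed

lemma lift_pure:
  assumes "vector_space s"
  shows "lift s f (pure x) = f x"
proof -
  interpret vector_space s by fact
  show ?thesis by (simp add: lift_superset[OF assms, of "{x}"])
qed

lemma expand_pure: "p = (\<Sum>x\<in>Poly_Mapping.keys p. pscale (Poly_Mapping.lookup p x) (pure x))"
  by (rule poly_mapping_eqI)
    (auto simp: lookup_sum lookup_single when_def in_keys_iff if_distrib cong: if_cong)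

lemma linear_eq_pure:
  assumes "Vector_Spaces.linear pscale s F" "Vector_Spaces.linear pscale s H" "\<And>x. F (pure x) = H (pure x)"
  shows "F p = H p"
proof -
  interpret F: Vector_Spaces.linear pscale s F by fact
  interpret H: Vector_Spaces.linear pscale s H by fact
  show ?thesis
    by (subst (1 2) expand_pure[of p]) (simp add: F.sum H.sum F.scale H.scale assms(3))
qed

lemma span_pure_UNIV: "pspan (range pure) = UNIV"
proof -
  have "p \<in> pspan (range pure)" for p :: "'x \<Rightarrow>\<^sub>0 'k::field"
    by (subst expand_pure[of p]) (intro pv.span_sum pv.span_scale pv.span_base rangeI)
  then show ?thesis by auto
qed

lemmas linear_plift = linear_lift[OF pv.vector_space_axioms]
lemmas plift_pure [simp] = lift_pure[OF pv.vector_space_axioms]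

lemma plift_simps [simp]:
  "lift pscale f (p + q) = lift pscale f p + lift pscale f q"
  "lift pscale f (p - q) = lift pscale f p - lift pscale f q"
  "lift pscale f (- p) = - lift pscale f p"
  "lift pscale f (pscale c p) = pscale c (lift pscale f p)"
  "lift pscale f 0 = 0"
proof -
  interpret Vector_Spaces.linear pscale pscale "lift pscale f" by (rule linear_plift)
  show "lift pscale f (p + q) = lift pscale f p + lift pscale f q"
    "lift pscale f (p - q) = lift pscale f p - lift pscale f q"
    "lift pscale f (- p) = - lift pscale f p"
    "lift pscale f (pscale c p) = pscale c (lift pscale f p)"
    "lift pscale f 0 = 0"
    by (simp_all add: add diff neg scale)
qed

lemma plift_fun_add: "lift pscale (\<lambda>x. f x + g x) p = lift pscale f p + lift pscale g p"
  by (simp add: lift_def pv.scale_right_distrib sum.distrib)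

lemma plift_fun_diff: "lift pscale (\<lambda>x. f x - g x) p = lift pscale f p - lift pscale g p"
  by (simp add: lift_def pv.scale_right_diff_distrib sum_subtractf)

lemma plift_fun_scale: "lift pscale (\<lambda>x. pscale c (f x)) p = pscale c (lift pscale f p)"
  by (simp add: lift_def pv.scale_sum_right mult.commute)

lemma plift_fun_neg: "lift pscale (\<lambda>x. - f x) p = - lift pscale f p"
  using plift_fun_diff[of "\<lambda>x. 0" f p] by (simp add: lift_def)

lemma plin_iff: "Vector_Spaces.linear pscale pscale F \<longleftrightarrow>
    (\<forall>x y. F (x + y) = F x + F y) \<and> (\<forall>c x. F (pscale c x) = pscale c (F x))"
  by (simp add: Vector_Spaces.linear_iff pv.vector_space_axioms)

lemma linear_simps:
  assumes "Vector_Spaces.linear s1 s2 F"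
  shows "F (x + y) = F x + F y" "F (x - y) = F x - F y" "F (- x) = - F x" "F (s1 c x) = s2 c (F x)" "F 0 = 0"
    "F (sum g A) = (\<Sum>a\<in>A. F (g a))"
proof -
  interpret F: Vector_Spaces.linear s1 s2 F by fact
  show "F (x + y) = F x + F y" "F (x - y) = F x - F y" "F (- x) = - F x" "F (s1 c x) = s2 c (F x)" "F 0 = 0"
    "F (sum g A) = (\<Sum>a\<in>A. F (g a))"
    by (simp_all add: F.add F.diff F.neg F.scale F.sum)
qed

lemma linear_compose: "Vector_Spaces.linear s1 s2 f \<Longrightarrow> Vector_Spaces.linear s2 s3 g \<Longrightarrow>
    Vector_Spaces.linear s1 s3 (\<lambda>x. g (f x))"
  by (simp add: Vector_Spaces.linear_iff)

subsection \<open>Tensor products\<close>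

definition tmap :: "('v \<Rightarrow> 'v1) \<Rightarrow> ('w \<Rightarrow> 'w1) \<Rightarrow> ('v \<times> 'w \<Rightarrow>\<^sub>0 'k::field) \<Rightarrow> ('v1 \<times> 'w1 \<Rightarrow>\<^sub>0 'k)" where
  "tmap f g = lift pscale (\<lambda>(x, y). pure (f x, g y))"

lemma linear_tmap: "Vector_Spaces.linear pscale pscale (tmap f g)"
  by (simp add: tmap_def linear_plift)

lemmas tmap_simps [simp] = linear_simps[OF linear_tmap]

lemma tmap_pure [simp]: "tmap f g (pure (x, y)) = pure (f x, g y)"
  by (simp add: tmap_def)

lemma tmap_comp: "tmap f g (tmap f' g' t) = tmap (\<lambda>x. f (f' x)) (\<lambda>x. g (g' x)) t"
  by (rule linear_eq_pure[of pscale]) (auto simp: plin_iff)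

lemma tensor_scl [simp]: "scl (tensor V W) = pscale"
  by (simp add: tensor_def)

lemma tensor_carr_pure: "x \<in> carr V \<Longrightarrow> y \<in> carr W \<Longrightarrow> pure (x, y) \<in> carr (tensor V W)"
  by (auto simp: tensor_def intro!: pv.span_base)

lemma tensor_relI:
  "x \<in> carr V \<Longrightarrow> x' \<in> carr V \<Longrightarrow> y \<in> carr W \<Longrightarrow> pure (x + x', y) - pure (x, y) - pure (x', y) \<in> rel (tensor V W)"
  "x \<in> carr V \<Longrightarrow> y \<in> carr W \<Longrightarrow> y' \<in> carr W \<Longrightarrow> pure (x, y + y') - pure (x, y) - pure (x, y') \<in> rel (tensor V W)"
  "x \<in> carr V \<Longrightarrow> y \<in> carr W \<Longrightarrow> pure (scl V c x, y) - pscale c (pure (x, y)) \<in> rel (tensor V W)"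
  "x \<in> carr V \<Longrightarrow> y \<in> carr W \<Longrightarrow> pure (x, scl W c y) - pscale c (pure (x, y)) \<in> rel (tensor V W)"
  "x \<in> rel V \<Longrightarrow> y \<in> carr W \<Longrightarrow> pure (x, y) \<in> rel (tensor V W)"
  "x \<in> carr V \<Longrightarrow> y \<in> rel W \<Longrightarrow> pure (x, y) \<in> rel (tensor V W)"
  unfolding tensor_def subquot.simps by (rule pv.span_base; blast)+

lemma tensor_carr_induct:
  assumes "Vector_Spaces.linear pscale s F" "module.subspace s R" "t \<in> carr (tensor V W)"
    "\<And>x y. x \<in> carr V \<Longrightarrow> y \<in> carr W \<Longrightarrow> F (pure (x, y)) \<in> R"
  shows "F t \<in> R"
  using assms(3) unfolding tensor_def subquot.simps
  by (rule linear_span_in[OF assms(1,2), rotated]) (use assms(4) in auto)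

lemma tensor_rel_induct:
  assumes F: "Vector_Spaces.linear pscale s F" "module.subspace s R" "t \<in> rel (tensor V W)"
    "\<And>x x' y. x \<in> carr V \<Longrightarrow> x' \<in> carr V \<Longrightarrow> y \<in> carr W \<Longrightarrow> F (pure (x + x', y)) - F (pure (x, y)) - F (pure (x', y)) \<in> R"
    "\<And>x y y'. x \<in> carr V \<Longrightarrow> y \<in> carr W \<Longrightarrow> y' \<in> carr W \<Longrightarrow> F (pure (x, y + y')) - F (pure (x, y)) - F (pure (x, y')) \<in> R"
    "\<And>c x y. x \<in> carr V \<Longrightarrow> y \<in> carr W \<Longrightarrow> F (pure (scl V c x, y)) - s c (F (pure (x, y))) \<in> R"
    "\<And>c x y. x \<in> carr V \<Longrightarrow> y \<in> carr W \<Longrightarrow> F (pure (x, scl W c y)) - s c (F (pure (x, y))) \<in> R"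
    "\<And>x y. x \<in> rel V \<Longrightarrow> y \<in> carr W \<Longrightarrow> F (pure (x, y)) \<in> R"
    "\<And>x y. x \<in> carr V \<Longrightarrow> y \<in> rel W \<Longrightarrow> F (pure (x, y)) \<in> R"
  shows "F t \<in> R"
  using assms(3) unfolding tensor_def subquot.simps
  apply (rule linear_span_in[OF assms(1,2), rotated])
  using assms(4-) by (auto simp: linear_simps[OF F(1)])

lemma wf_tensor:
  assumes "wf_subquot V" "wf_subquot W"
  shows "wf_subquot (tensor V W)"
proof -
  have "t \<in> carr (tensor V W)" if "t \<in> rel (tensor V W)" for t
    by (rule tensor_rel_induct[OF pv.linear_ident _ that, of "carr (tensor V W)"])
      (auto intro!: pv.subspace_diff pv.subspace_scale tensor_carr_pure simp: wf_sub[OF assms(1)] wf_sub[OF assms(2)]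
        carr_facts[OF assms(1)] carr_facts[OF assms(2)], auto simp: tensor_def)
  then show ?thesis unfolding wf_subquot_def tensor_scl by (auto simp: tensor_def pv.vector_space_axioms)
qed

text \<open>As \<open>f\<close> and \<open>g\<close> are linear only modulo relations, every tensor
  relation needs two moves: replace one factor by a congruent one (\<open>l\<close> or
  \<open>r\<close>), then use a defining relation of the target.\<close>

lemma rep_map_tmap:
  assumes V: "wf_subquot V'" and W: "wf_subquot W'" and f: "rep_map V V' f" and g: "rep_map W W' g"
    and gd: "wf_subquot (tensor V W)"
  shows "rep_map (tensor V W) (tensor V' W') (tmap f g)"
proof (rule linear_rep_map)
  let ?T = "tensor V' W'"
  note f = f[unfolded rep_map_def] and g = g[unfolded rep_map_def]
  show "wf_subquot ?T" by (rule wf_tensor[OF V W])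
  then have gT: "pv.subspace (rel ?T)" "pv.subspace (carr ?T)" by (auto simp: wf_subquot_def)
  show "Vector_Spaces.linear (scl (tensor V W)) (scl ?T) (tmap f g)" by (simp add: linear_tmap)
  show "tmap f g t \<in> carr ?T" if "t \<in> carr (tensor V W)" for t
    by (rule tensor_carr_induct[OF linear_tmap gT(2) that]) (use f g in \<open>auto intro: tensor_carr_pure\<close>)
  have l: "pure (x', y) - pure (x, y) \<in> rel ?T" if "x' - x \<in> rel V'" "x \<in> carr V'" "y \<in> carr W'" for x' x y
  proof -
    have "pure (x + (x' - x), y) - pure (x, y) - pure (x' - x, y) \<in> rel ?T"
      by (rule tensor_relI(1)[OF that(2) wf_sub[OF V that(1)] that(3)])
    from pv.subspace_add[OF gT(1) this tensor_relI(5)[OF that(1,3)]] show ?thesis by simp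
  qed
  have r: "pure (x, y') - pure (x, y) \<in> rel ?T" if "y' - y \<in> rel W'" "x \<in> carr V'" "y \<in> carr W'" for x y y'
  proof -
    have "pure (x, y + (y' - y)) - pure (x, y) - pure (x, y' - y) \<in> rel ?T"
      by (rule tensor_relI(2)[OF that(2,3) wf_sub[OF W that(1)]])
    from pv.subspace_add[OF gT(1) this tensor_relI(6)[OF that(2,1)]] show ?thesis by simp
  qed
  have tr: "a - c - d \<in> rel ?T" if "a - b \<in> rel ?T" "b - c - d \<in> rel ?T" for a b c d
    using pv.subspace_add[OF gT(1) that] by (simp add: algebra_simps)
  have tr': "a - c \<in> rel ?T" if "a - b \<in> rel ?T" "b - c \<in> rel ?T" for a b c
    using pv.subspace_add[OF gT(1) that] by (simp add: algebra_simps)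
  show "tmap f g t \<in> rel ?T" if "t \<in> rel (tensor V W)" for t
  proof (rule tensor_rel_induct[OF linear_tmap gT(1) that], unfold tmap_pure)
    show "pure (f (x + x'), g y) - pure (f x, g y) - pure (f x', g y) \<in> rel ?T"
      if "x \<in> carr V" "x' \<in> carr V" "y \<in> carr W" for x x' y
    proof -
      have "pure (f (x + x'), g y) - pure (f x + f x', g y) \<in> rel ?T"
        using f g that by (intro l carr_facts(2)[OF V]) auto
      moreover have "pure (f x + f x', g y) - pure (f x, g y) - pure (f x', g y) \<in> rel ?T"
        using f g that by (intro tensor_relI) auto
      ultimately show ?thesis by (rule tr)
    qed
    show "pure (f x, g (y + y')) - pure (f x, g y) - pure (f x, g y') \<in> rel ?T"
      if "x \<in> carr V" "y \<in> carr W" "y' \<in> carr W" for x y y'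
    proof -
      have "pure (f x, g (y + y')) - pure (f x, g y + g y') \<in> rel ?T"
        using f g that by (intro r carr_facts(2)[OF W]) auto
      moreover have "pure (f x, g y + g y') - pure (f x, g y) - pure (f x, g y') \<in> rel ?T"
        using f g that by (intro tensor_relI) auto
      ultimately show ?thesis by (rule tr)
    qed
    show "pure (f (scl V c x), g y) - pscale c (pure (f x, g y)) \<in> rel ?T" if "x \<in> carr V" "y \<in> carr W" for c x y
    proof -
      have "pure (f (scl V c x), g y) - pure (scl V' c (f x), g y) \<in> rel ?T"
        using f g that by (intro l carr_facts(3)[OF V]) auto
      moreover have "pure (scl V' c (f x), g y) - pscale c (pure (f x, g y)) \<in> rel ?T"
        using f g that by (intro tensor_relI) auto
      ultimately show ?thesis by (rule tr')
    qed
    show "pure (f x, g (scl W c y)) - pscale c (pure (f x, g y)) \<in> rel ?T" if "x \<in> carr V" "y \<in> carr W" for c x y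
    proof -
      have "pure (f x, g (scl W c y)) - pure (f x, scl W' c (g y)) \<in> rel ?T"
        using f g that by (intro r carr_facts(3)[OF W]) auto
      moreover have "pure (f x, scl W' c (g y)) - pscale c (pure (f x, g y)) \<in> rel ?T"
        using f g that by (intro tensor_relI) auto
      ultimately show ?thesis by (rule tr')
    qed
  qed (use f g in \<open>auto intro: tensor_relI\<close>)
qed

text \<open>Projections onto the subspaces give a left inverse of the inclusion.\<close>

lemma tensor_subspace_rel:
  assumes V: "wf_subquot V" "wf_subquot V'" "scl V' = scl V" "rel V' = rel V" "carr V' \<subseteq> carr V"
    and W: "wf_subquot W" "wf_subquot W'" "scl W' = scl W" "rel W' = rel W" "carr W' \<subseteq> carr W"
    and t: "t \<in> carr (tensor V' W')" "t \<in> rel (tensor V W)"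
  shows "t \<in> rel (tensor V' W')"
proof -
  obtain p where p: "Vector_Spaces.linear (scl V) (scl V) p" "\<And>x. p x \<in> carr V'" "\<And>x. x \<in> carr V' \<Longrightarrow> p x = x"
    using ex_projection[OF wf_vs[OF V(2)] wf_carr[OF V(2)]] V(3) by metis
  obtain q where q: "Vector_Spaces.linear (scl W) (scl W) q" "\<And>x. q x \<in> carr W'" "\<And>x. x \<in> carr W' \<Longrightarrow> q x = x"
    using ex_projection[OF wf_vs[OF W(2)] wf_carr[OF W(2)]] W(3) by metis
  have "rep_map V V' p"
    using V p wf_sub[OF V(2)] by (intro linear_rep_map) auto
  moreover have "rep_map W W' q"
    using W q wf_sub[OF W(2)] by (intro linear_rep_map) auto
  ultimately have "rep_map (tensor V W) (tensor V' W') (tmap p q)"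
    by (intro rep_map_tmap V W wf_tensor)
  then have "tmap p q t \<in> rel (tensor V' W')" using t(2) by (auto simp: rep_map_def)
  moreover have "tmap p q t - t \<in> {0}"
    by (rule tensor_carr_induct[OF _ _ t(1), of pscale]) (auto simp: plin_iff pv.scale_right_diff_distrib p q)
  ultimately show ?thesis by simp
qed

text \<open>Flatness over a field: the kernel of \<open>1 \<otimes> d\<close> comes from
  \<open>A \<otimes> ker d\<close>. A splitting \<open>e\<close> of \<open>d\<close> modulo
  relations gives \<open>k = 1 - e d\<close> with values in the kernel, and \<open>v\<close> is
  congruent to \<open>(1 \<otimes> k) v + (1 \<otimes> e)(1 \<otimes> d) v\<close>, whose last term
  is a relation.\<close>

lemma tensor_kernel:
  assumes A: "wf_subquot A" and V: "wf_subquot V" and W: "wf_subquot W" and d: "Vector_Spaces.linear (scl V) (scl W) d" "rep_map V W d"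
    and v: "v \<in> carr (tensor A V)" "tmap (\<lambda>a. a) d v \<in> rel (tensor A W)"
  obtains v' where "v' \<in> carr (tensor A (V\<lparr>carr := {x \<in> carr V. d x \<in> rel W}\<rparr>))" "v - v' \<in> rel (tensor A V)"
proof -
  let ?N = "V\<lparr>carr := {x \<in> carr V. d x \<in> rel W}\<rparr>"
  note dl = linear_simps[OF d(1)]
  interpret V: vector_space "scl V" by (rule wf_vs[OF V])
  interpret W: vector_space "scl W" by (rule wf_vs[OF W])
  interpret VW: vector_space_pair "scl V" "scl W" ..
  obtain \<pi> where \<pi>: "Vector_Spaces.linear (scl W) (scl W) \<pi>" "\<And>x. \<pi> x = 0 \<longleftrightarrow> x \<in> rel W"
    using ex_quotient_map[OF wf_vs[OF W] wf_rel[OF W]] by metis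
  note \<pi>l = linear_simps[OF \<pi>(1)]
  have "Vector_Spaces.linear (scl V) (scl W) (\<lambda>x. \<pi> (d x))" by (rule linear_compose[OF d(1) \<pi>(1)])
  \<comment> \<open>\<open>h\<close> inverts \<open>\<pi> d\<close> on its image only; precomposing
    it with \<open>\<pi>\<close> makes \<open>e\<close> vanish on \<open>rel W\<close>, so that
    \<open>e\<close> descends to cosets.\<close>
  then obtain h where h: "h ` UNIV \<subseteq> carr V" "Vector_Spaces.linear (scl W) (scl V) h"
    "\<forall>y\<in>(\<lambda>x. \<pi> (d x)) ` carr V. \<pi> (d (h y)) = y"
    using VW.linear_exists_right_inverse_on wf_carr[OF V] by metis
  note hl = linear_simps[OF h(2)]
  define e where "e x = h (\<pi> x)" for x
  define k where "k x = x - e (d x)" for x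
  have el: "Vector_Spaces.linear (scl W) (scl V) e"
    unfolding e_def by (rule linear_compose[OF \<pi>(1) h(2)])
  have e0: "e x = 0" if "x \<in> rel W" for x using that \<pi>(2)[of x] hl(5) by (simp add: e_def)
  have e: "rep_map W V e"
    using h(1) e0 rel_facts(1)[OF V] by (intro linear_rep_map[OF el V]) (auto simp: e_def)
  have rk: "wf_subquot ?N" by (rule wf_carr_kernel[OF V W d(2)])
  have k: "rep_map V ?N k"
  proof (rule linear_rep_map[OF _ rk])
    show "Vector_Spaces.linear (scl V) (scl ?N) k"
      using linear_simps[OF el] by (simp add: Vector_Spaces.linear_iff V.vector_space_axioms k_def dl V.scale_right_diff_distrib)
    show "k x \<in> carr ?N" if x: "x \<in> carr V" for x
    proof -
      have "\<pi> (d (k x)) = 0" using h(3) x by (auto simp: k_def dl \<pi>l e_def)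
      moreover have "k x \<in> carr V" unfolding k_def e_def using h(1) x by (intro carr_facts(4)[OF V]) auto
      ultimately show ?thesis using \<pi> by simp
    qed
    show "k x \<in> rel ?N" if "x \<in> rel V" for x
      using that d(2) by (auto simp: k_def rep_map_def e0)
  qed
  have "rep_map (tensor A V) (tensor A ?N) (tmap (\<lambda>a. a) k)"
    using A by (intro rep_map_tmap A V rk k wf_tensor) (auto simp: rep_map_def rel_facts)
  then have 1: "tmap (\<lambda>a. a) k v \<in> carr (tensor A ?N)" using v(1) by (auto simp: rep_map_def)
  have "rep_map (tensor A W) (tensor A V) (tmap (\<lambda>a. a) e)"
    using A by (intro rep_map_tmap A V W e wf_tensor) (auto simp: rep_map_def rel_facts)
  then have "tmap (\<lambda>a. a) e (tmap (\<lambda>a. a) d v) \<in> rel (tensor A V)" using v(2) by (auto simp: rep_map_def)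
  then have 2: "tmap (\<lambda>a. a) (\<lambda>x. e (d x)) v \<in> rel (tensor A V)" by (simp add: tmap_comp)
  have "v - tmap (\<lambda>a. a) k v - tmap (\<lambda>a. a) (\<lambda>x. e (d x)) v \<in> rel (tensor A V)"
  proof (rule tensor_carr_induct[OF _ _ v(1)])
    show "pv.subspace (rel (tensor A V))" using wf_tensor[OF A V] by (simp add: wf_subquot_def)
    show "Vector_Spaces.linear pscale pscale (\<lambda>v. v - tmap (\<lambda>a. a) k v - tmap (\<lambda>a. a) (\<lambda>x. e (d x)) v)"
      by (auto simp: plin_iff pv.scale_right_diff_distrib)
    fix a x assume a: "a \<in> carr A" "x \<in> carr V"
    have "pure (a, k x + e (d x)) - pure (a, k x) - pure (a, e (d x)) \<in> rel (tensor A V)"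
      using a k e d(2) by (intro tensor_relI) (auto simp: rep_map_def)
    then show "pure (a, x) - tmap (\<lambda>a. a) k (pure (a, x)) - tmap (\<lambda>a. a) (\<lambda>x. e (d x)) (pure (a, x)) \<in> rel (tensor A V)"
      by (simp add: k_def)
  qed
  then have "v - tmap (\<lambda>a. a) k v \<in> rel (tensor A V)"
    using 2 rel_mem[OF wf_tensor[OF A V]] by blast
  with 1 show ?thesis by (rule that)
qed

subsection \<open>Powers\<close>

lemma pow_scl [simp]: "scl (tpow n V) = pscale" "scl (extpow n V) = pscale" "scl (sympow n V) = pscale"
  by (simp_all add: tpow_def extpow_def sympow_def)

lemma pow_carr [simp]: "carr (extpow n V) = carr (tpow n V)" "carr (sympow n V) = carr (tpow n V)"
  by (simp_all add: extpow_def sympow_def)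

lemma extpow_rel: "rel (extpow n V) = pspan (rel (tpow n V) \<union>
     {pure xs |xs. length xs = n \<and> set xs \<subseteq> carr V \<and> \<not> distinct xs})"
  by (simp add: extpow_def)

lemma sympow_rel: "rel (sympow n V) = pspan (rel (tpow n V) \<union>
     {pure xs - pure ys |xs ys. length xs = n \<and> set xs \<subseteq> carr V \<and> mset xs = mset ys})"
  by (simp add: sympow_def)

lemma tpow_carr_pure: "length xs = n \<Longrightarrow> set xs \<subseteq> carr V \<Longrightarrow> pure xs \<in> carr (tpow n V)"
  by (auto simp: tpow_def intro!: pv.span_base)

lemma tpow_carr_induct:
  assumes "Vector_Spaces.linear pscale s F" "module.subspace s R" "t \<in> carr (tpow n V)"
    "\<And>xs. length xs = n \<Longrightarrow> set xs \<subseteq> carr V \<Longrightarrow> F (pure xs) \<in> R"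
  shows "F t \<in> R"
  using assms(3) unfolding tpow_def subquot.simps
  by (rule linear_span_in[OF assms(1,2), rotated]) (use assms(4) in auto)

lemma tpow_relI:
  assumes "length us + length vs + 1 = n" "set us \<subseteq> carr V" "set vs \<subseteq> carr V"
  shows "x \<in> carr V \<Longrightarrow> y \<in> carr V \<Longrightarrow> pure (us @ (x + y) # vs) - pure (us @ x # vs) - pure (us @ y # vs) \<in> rel (tpow n V)"
    "x \<in> carr V \<Longrightarrow> pure (us @ scl V c x # vs) - pscale c (pure (us @ x # vs)) \<in> rel (tpow n V)"
    "x \<in> rel V \<Longrightarrow> pure (us @ x # vs) \<in> rel (tpow n V)"
  unfolding tpow_def subquot.simps using assms by - (rule pv.span_base; (simp; blast)?; fail)+

lemma tpow_rel_induct: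
  assumes F: "Vector_Spaces.linear pscale s F" "module.subspace s R" "t \<in> rel (tpow n V)"
    "\<And>us vs x y. length us + length vs + 1 = n \<Longrightarrow> set us \<subseteq> carr V \<Longrightarrow> set vs \<subseteq> carr V \<Longrightarrow> x \<in> carr V \<Longrightarrow> y \<in> carr V \<Longrightarrow>
       F (pure (us @ (x + y) # vs)) - F (pure (us @ x # vs)) - F (pure (us @ y # vs)) \<in> R"
    "\<And>us vs c x. length us + length vs + 1 = n \<Longrightarrow> set us \<subseteq> carr V \<Longrightarrow> set vs \<subseteq> carr V \<Longrightarrow> x \<in> carr V \<Longrightarrow>
       F (pure (us @ scl V c x # vs)) - s c (F (pure (us @ x # vs))) \<in> R"
    "\<And>us vs x. length us + length vs + 1 = n \<Longrightarrow> set us \<subseteq> carr V \<Longrightarrow> set vs \<subseteq> carr V \<Longrightarrow> x \<in> rel V \<Longrightarrow>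
       F (pure (us @ x # vs)) \<in> R"
  shows "F t \<in> R"
  using assms(3) unfolding tpow_def subquot.simps
  apply (rule linear_span_in[OF assms(1,2), rotated])
  using assms(4-) by (auto simp: linear_simps[OF F(1)])

lemma extpow_rel_induct:
  assumes F: "Vector_Spaces.linear pscale s F" "module.subspace s R" "t \<in> rel (extpow n V)"
    "\<And>t. t \<in> rel (tpow n V) \<Longrightarrow> F t \<in> R"
    "\<And>xs. length xs = n \<Longrightarrow> set xs \<subseteq> carr V \<Longrightarrow> \<not> distinct xs \<Longrightarrow> F (pure xs) \<in> R"
  shows "F t \<in> R"
  using assms(3) unfolding extpow_rel
  apply (rule linear_span_in[OF assms(1,2), rotated])
  using assms(4-) by auto

lemma sympow_rel_induct:
  assumes F: "Vector_Spaces.linear pscale s F" "module.subspace s R" "t \<in> rel (sympow n V)"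
    "\<And>t. t \<in> rel (tpow n V) \<Longrightarrow> F t \<in> R"
    "\<And>xs ys. length xs = n \<Longrightarrow> set xs \<subseteq> carr V \<Longrightarrow> mset xs = mset ys \<Longrightarrow> F (pure xs) - F (pure ys) \<in> R"
  shows "F t \<in> R"
  using assms(3) unfolding sympow_rel
  apply (rule linear_span_in[OF assms(1,2), rotated])
  using assms(4-) by (auto simp: linear_simps[OF F(1)])

lemma extpow_relI:
  "t \<in> rel (tpow n V) \<Longrightarrow> t \<in> rel (extpow n V)"
  "length xs = n \<Longrightarrow> set xs \<subseteq> carr V \<Longrightarrow> \<not> distinct xs \<Longrightarrow> pure xs \<in> rel (extpow n V)"
  unfolding extpow_rel by (rule pv.span_base; blast)+

lemma sympow_relI:
  "t \<in> rel (tpow n V) \<Longrightarrow> t \<in> rel (sympow n V)"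
  "length xs = n \<Longrightarrow> set xs \<subseteq> carr V \<Longrightarrow> mset xs = mset ys \<Longrightarrow> pure xs - pure ys \<in> rel (sympow n V)"
  unfolding sympow_rel by (rule pv.span_base; blast)+

lemma wf_tpow:
  assumes "wf_subquot V"
  shows "wf_subquot (tpow n V)"
proof -
  have "t \<in> carr (tpow n V)" if "t \<in> rel (tpow n V)" for t
    by (rule tpow_rel_induct[OF pv.linear_ident _ that, of "carr (tpow n V)"])
      (auto intro!: pv.subspace_diff pv.subspace_scale tpow_carr_pure simp: wf_sub[OF assms] carr_facts[OF assms],
        auto simp: tpow_def)
  then show ?thesis unfolding wf_subquot_def by (auto simp: tpow_def pv.vector_space_axioms)
qed

lemma wf_extpow:
  assumes "wf_subquot V"
  shows "wf_subquot (extpow n V)"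
proof -
  have c: "pv.subspace (carr (tpow n V))" using wf_tpow[OF assms, of n] by (simp add: wf_subquot_def)
  have "t \<in> carr (tpow n V)" if "t \<in> rel (extpow n V)" for t
    by (rule extpow_rel_induct[OF pv.linear_ident c that]) (auto intro: wf_sub[OF wf_tpow[OF assms]] tpow_carr_pure)
  then show ?thesis using c unfolding wf_subquot_def by (auto simp: extpow_def pv.vector_space_axioms)
qed

lemma wf_sympow:
  assumes "wf_subquot V"
  shows "wf_subquot (sympow n V)"
proof -
  have c: "pv.subspace (carr (tpow n V))" using wf_tpow[OF assms, of n] by (simp add: wf_subquot_def)
  have "t \<in> carr (tpow n V)" if "t \<in> rel (sympow n V)" for t
  proof (rule sympow_rel_induct[OF pv.linear_ident c that])
    fix xs ys :: "'b list" assume *: "length xs = n" "set xs \<subseteq> carr V" "mset xs = mset ys"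
    show "pure xs - pure ys \<in> carr (tpow n V)"
      using * mset_eq_length[OF *(3)] mset_eq_setD[OF *(3)] by (intro pv.subspace_diff[OF c] tpow_carr_pure) auto
  qed (auto intro: wf_sub[OF wf_tpow[OF assms]])
  then show ?thesis using c unfolding wf_subquot_def by (auto simp: sympow_def pv.vector_space_axioms)
qed

lemma length1: "length xs = Suc 0 \<longleftrightarrow> (\<exists>x. xs = [x])"
  by (simp add: length_Suc_conv)

lemma length2: "length xs = 2 \<longleftrightarrow> (\<exists>x y. xs = [x, y])"
  by (auto simp: numeral_2_eq_2 length_Suc_conv)

lemma length3: "length xs = 3 \<longleftrightarrow> (\<exists>x y z. xs = [x, y, z])"
  by (auto simp: numeral_3_eq_3 length_Suc_conv)

lemma split1: "length us + length vs + 1 = 1 \<longleftrightarrow> us = [] \<and> vs = []"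
  by auto

lemma split2: "length us + length vs + 1 = 2 \<longleftrightarrow> us = [] \<and> (\<exists>z. vs = [z]) \<or> (\<exists>z. us = [z]) \<and> vs = []"
  by (cases us; cases "tl us") (auto simp: numeral_2_eq_2 length_Suc_conv)

lemma split3: "length us + length vs + 1 = 3 \<longleftrightarrow> us = [] \<and> (\<exists>z w. vs = [z, w]) \<or> (\<exists>z w. us = [z] \<and> vs = [w])
    \<or> (\<exists>z w. us = [z, w]) \<and> vs = []"
  by (cases us; cases "tl us"; cases "tl (tl us)") (auto simp: numeral_3_eq_3 length_Suc_conv)

lemma whole_simps [simp]: "scl (whole s) = s" "carr (whole s) = UNIV" "rel (whole s) = {0}"
  by (simp_all add: whole_def)

lemma wf_whole:
  assumes "vector_space s"
  shows "wf_subquot (whole s)"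
proof -
  interpret vector_space s by fact
  show ?thesis by (simp add: wf_subquot_def assms)
qed

lemma extpow2_rel_induct:
  assumes F: "Vector_Spaces.linear pscale s F" "module.subspace s R" "t \<in> rel (extpow 2 V)"
    "\<And>x y z. x \<in> carr V \<Longrightarrow> y \<in> carr V \<Longrightarrow> z \<in> carr V \<Longrightarrow> F (pure [x + y, z]) - F (pure [x, z]) - F (pure [y, z]) \<in> R"
    "\<And>x y z. x \<in> carr V \<Longrightarrow> y \<in> carr V \<Longrightarrow> z \<in> carr V \<Longrightarrow> F (pure [z, x + y]) - F (pure [z, x]) - F (pure [z, y]) \<in> R"
    "\<And>c x z. x \<in> carr V \<Longrightarrow> z \<in> carr V \<Longrightarrow> F (pure [scl V c x, z]) - s c (F (pure [x, z])) \<in> R"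
    "\<And>c x z. x \<in> carr V \<Longrightarrow> z \<in> carr V \<Longrightarrow> F (pure [z, scl V c x]) - s c (F (pure [z, x])) \<in> R"
    "\<And>x z. x \<in> rel V \<Longrightarrow> z \<in> carr V \<Longrightarrow> F (pure [x, z]) \<in> R"
    "\<And>x z. x \<in> rel V \<Longrightarrow> z \<in> carr V \<Longrightarrow> F (pure [z, x]) \<in> R"
    "\<And>x. x \<in> carr V \<Longrightarrow> F (pure [x, x]) \<in> R"
  shows "F t \<in> R"
proof (rule extpow_rel_induct[OF F(1-3)])
  show "F t \<in> R" if "t \<in> rel (tpow 2 V)" for t
    by (rule tpow_rel_induct[OF F(1,2) that]; unfold split2; use assms(4-9) in auto)
qed (use assms(10) in \<open>auto simp: length2\<close>)

lemma sympow2_rel_induct: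
  assumes F: "Vector_Spaces.linear pscale s F" "module.subspace s R" "t \<in> rel (sympow 2 V)"
    "\<And>x y z. x \<in> carr V \<Longrightarrow> y \<in> carr V \<Longrightarrow> z \<in> carr V \<Longrightarrow> F (pure [x + y, z]) - F (pure [x, z]) - F (pure [y, z]) \<in> R"
    "\<And>x y z. x \<in> carr V \<Longrightarrow> y \<in> carr V \<Longrightarrow> z \<in> carr V \<Longrightarrow> F (pure [z, x + y]) - F (pure [z, x]) - F (pure [z, y]) \<in> R"
    "\<And>c x z. x \<in> carr V \<Longrightarrow> z \<in> carr V \<Longrightarrow> F (pure [scl V c x, z]) - s c (F (pure [x, z])) \<in> R"
    "\<And>c x z. x \<in> carr V \<Longrightarrow> z \<in> carr V \<Longrightarrow> F (pure [z, scl V c x]) - s c (F (pure [z, x])) \<in> R"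
    "\<And>x z. x \<in> rel V \<Longrightarrow> z \<in> carr V \<Longrightarrow> F (pure [x, z]) \<in> R"
    "\<And>x z. x \<in> rel V \<Longrightarrow> z \<in> carr V \<Longrightarrow> F (pure [z, x]) \<in> R"
    "\<And>x y. x \<in> carr V \<Longrightarrow> y \<in> carr V \<Longrightarrow> F (pure [x, y]) - F (pure [y, x]) \<in> R"
  shows "F t \<in> R"
proof (rule sympow_rel_induct[OF F(1-3)])
  show "F t \<in> R" if "t \<in> rel (tpow 2 V)" for t
    by (rule tpow_rel_induct[OF F(1,2) that]; unfold split2; use assms(4-9) in auto)
  fix xs ys :: "'b list" assume "length xs = 2" "set xs \<subseteq> carr V" and m: "mset xs = mset ys"
  then obtain x y where xs: "xs = [x, y]" "x \<in> carr V" "y \<in> carr V" by (auto simp: length2)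
  have "length ys = 2" using m xs(1) mset_eq_length[OF m] by simp
  then obtain x' y' where ys: "ys = [x', y']" by (auto simp: length2)
  have "x' = x \<and> y' = y \<or> x' = y \<and> y' = x" using m xs ys by (auto simp: add_eq_conv_ex)
  moreover have "0 \<in> R" using F by (metis Vector_Spaces.linear_iff subspace_facts(1))
  ultimately show "F (pure xs) - F (pure ys) \<in> R" using assms(10) xs ys by auto
qed

lemma tpow2I:
  assumes "z \<in> carr V"
  shows "x \<in> carr V \<Longrightarrow> y \<in> carr V \<Longrightarrow> pure [x + y, z] - pure [x, z] - pure [y, z] \<in> rel (tpow 2 V)"
    "x \<in> carr V \<Longrightarrow> y \<in> carr V \<Longrightarrow> pure [z, x + y] - pure [z, x] - pure [z, y] \<in> rel (tpow 2 V)"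
    "x \<in> carr V \<Longrightarrow> pure [scl V c x, z] - pscale c (pure [x, z]) \<in> rel (tpow 2 V)"
    "x \<in> carr V \<Longrightarrow> pure [z, scl V c x] - pscale c (pure [z, x]) \<in> rel (tpow 2 V)"
    "x \<in> rel V \<Longrightarrow> pure [x, z] \<in> rel (tpow 2 V)"
    "x \<in> rel V \<Longrightarrow> pure [z, x] \<in> rel (tpow 2 V)"
  using tpow_relI[where us = "[]" and vs = "[z]" and n = 2 and V = V]
    tpow_relI[where us = "[z]" and vs = "[]" and n = 2 and V = V] assms by auto

subsection \<open>The Chevalley--Eilenberg differential in low degrees\<close>

lemma linear_ce_diff: "Vector_Spaces.linear pscale pscale (ce_diff br)"
  by (simp add: ce_diff_def linear_plift)

lemmas ce_diff_simps [simp] = linear_simps[OF linear_ce_diff]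

text \<open>Counting positions from 0 instead of 1 changes \<open>i + j\<close> by 2, so the signs
  are the usual ones; the pair (0, 1) has sign -1.\<close>

lemma ce_diff2 [simp]: "ce_diff br (pure [x, y]) = - pure [br x y]"
proof -
  have "{(i::nat, j). i < j \<and> j < 2} = {(0, 1)}" by auto
  moreover have "nths [x, y] (- {0, 1}) = []" by (simp add: nths_Cons)
  ultimately show ?thesis by (simp add: ce_diff_def numeral_2_eq_2)
qed

lemma ce_diff3 [simp]: "ce_diff br (pure [x, y, z]) = - pure [br x y, z] + pure [br x z, y] - pure [br y z, x]"
proof -
  have "{(i::nat, j). i < j \<and> j < 3} = {(0, 1), (0, 2), (1, 2)}" by auto
  moreover have "nths [x, y, z] (- {0, 1}) = [z]" "nths [x, y, z] (- {0, 2}) = [y]" "nths [x, y, z] (- {1, 2}) = [x]"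
    by (simp_all add: nths_Cons numeral_2_eq_2)
  ultimately show ?thesis by (simp add: ce_diff_def numeral_3_eq_3 numeral_2_eq_2)
qed

lemma linear_koszul: "Vector_Spaces.linear pscale pscale (koszul br)"
  by (simp add: koszul_def linear_plift)

lemmas koszul_simps [simp] = linear_simps[OF linear_koszul]

lemma koszul3 [simp]: "koszul br (pure [x, y, z]) = pure [x, br y z]"
  by (simp add: koszul_def)

subsection \<open>Two-cocycles on current algebras\<close>

text \<open>
  \<open>W a x b y\<close> is the value at \<open>(a \<otimes> x) \<and> (b \<otimes> y)\<close>. The parts symmetric and skew in \<open>x, y\<close> are treated
  separately; comparing the cocycle identity for \<open>(a, b, c)\<close>, \<open>(b, a, c)\<close>, \<open>(a b, 1, 1)\<close> isolates them.
\<close>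

locale current_cocycle =
  fixes W :: "'a::{comm_ring, comm_monoid_mult} \<Rightarrow> 'l \<Rightarrow> 'a \<Rightarrow> 'l \<Rightarrow> 'z::ab_group_add"
    and br :: "'l \<Rightarrow> 'l \<Rightarrow> 'l"
  assumes skew: "W b y a x = - W a x b y"
    and cocycle: "W (a * b) (br x y) c z + W (b * c) (br y z) a x + W (c * a) (br z x) b y = 0"
    and no_two_torsion: "\<And>w :: 'z. w + w = 0 \<Longrightarrow> w = 0"
begin

text \<open>Both \<open>Sy\<close> and \<open>Sk\<close> are twice the usual parts, because the
  group \<open>'z\<close> has no division by 2, only absence of 2-torsion.\<close>

definition Sy :: "'a \<Rightarrow> 'a \<Rightarrow> 'l \<Rightarrow> 'l \<Rightarrow> 'z" where "Sy a b x y = W a x b y + W a y b x"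
definition Sk :: "'a \<Rightarrow> 'a \<Rightarrow> 'l \<Rightarrow> 'l \<Rightarrow> 'z" where "Sk a b x y = W a x b y - W a y b x"

lemma Sy_swap: "Sy a b x y = Sy a b y x"
  by (simp add: Sy_def add.commute)

lemma Sy_skew: "Sy b a x y = - Sy a b x y"
  by (simp add: Sy_def skew[of b])

lemma Sk_sym: "Sk b a x y = Sk a b x y"
  by (simp add: Sk_def skew[of b])

lemma double: "W a x b y + W a x b y = Sy a b x y + Sk a b x y"
  by (simp add: Sy_def Sk_def)

text \<open>The term with \<open>a * b\<close> is unchanged when \<open>a\<close> and
  \<open>b\<close> trade places, so it cancels from the two cocycle identities.\<close>

lemma exchange: "W (b * c) (br y z) a x + W (c * a) (br z x) b y
    = W (a * c) (br y z) b x + W (c * b) (br z x) a y"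
proof -
  have "W (a * b) (br x y) c z + (W (b * c) (br y z) a x + W (c * a) (br z x) b y)
      = W (a * b) (br x y) c z + (W (a * c) (br y z) b x + W (c * b) (br z x) a y)"
    using cocycle[of a b x y c z] cocycle[of b a x y c z] by (simp add: add.assoc mult.commute)
  then show ?thesis by simp
qed

text \<open>For \<open>c = 1\<close> the four terms of \<open>exchange\<close> combine by skewness
  into two symmetric parts. Together with \<open>Sy_swap\<close> this is invariance of the symmetric
  form, the defining relation of the Killing module.\<close>

lemma Sy_cyclic: "Sy a b (br z x) y = Sy a b (br y z) x"
proof -
  have "W a (br z x) b y - W b (br z x) a y = W a (br y z) b x - W b (br y z) a x"
    using exchange[of b 1 y z a x] by (simp add: algebra_simps)
  then show ?thesis by (simp add: Sy_def skew[of b])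
qed

text \<open>Here a different scalar of \<open>exchange\<close> is set to 1. After doubling, the
  symmetric parts cancel by \<open>Sy_cyclic\<close> and only skew parts remain.\<close>

lemma Sk_cyclic_diff: "Sk a c (br y z) x - Sk (a * c) 1 (br y z) x = Sk a c (br z x) y - Sk (a * c) 1 (br z x) y"
proof -
  \<comment> \<open>Doubles an equation between four values of \<open>W\<close>, so that
    \<open>double\<close> can split each of them without dividing by 2.\<close>
  have d: "Sy p q u v + Sk p q u v + (Sy p' q' u' v' + Sk p' q' u' v')
      = Sy r s m n + Sk r s m n + (Sy r' s' m' n' + Sk r' s' m' n')"
    if "W p u q v + W p' u' q' v' = W r m s n + W r' m' s' n'" for p q u v p' q' u' v' r s m n r' s' m' n'
  proof -
    have "(W p u q v + W p' u' q' v') + (W p u q v + W p' u' q' v')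
        = (W r m s n + W r' m' s' n') + (W r m s n + W r' m' s' n')"
      using that by simp
    then show ?thesis unfolding double[symmetric] by (simp add: algebra_simps)
  qed
  have "Sy c a (br y z) x + Sk c a (br y z) x + (Sy (c * a) 1 (br z x) y + Sk (c * a) 1 (br z x) y)
      = Sy (a * c) 1 (br y z) x + Sk (a * c) 1 (br y z) x + (Sy c a (br z x) y + Sk c a (br z x) y)"
    using d[OF exchange[of 1 c y z a x]] by simp
  then have "Sk c a (br y z) x + Sk (c * a) 1 (br z x) y = Sk (a * c) 1 (br y z) x + Sk c a (br z x) y"
    using Sy_cyclic[of c a z x y] Sy_cyclic[of "c * a" 1 z x y] by (simp add: algebra_simps)
  then show ?thesis by (simp add: Sk_sym[of c a] algebra_simps)
qed

text \<open>Twice the cocycle identity. Cyclic invariance brings the three symmetric parts to the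
  same argument; the skew parts stay in their three cyclic positions.\<close>

lemma double_cocycle:
  "Sy (a * b) c (br y z) x + Sy (b * c) a (br y z) x + Sy (c * a) b (br y z) x +
   (Sk (a * b) c (br x y) z + Sk (b * c) a (br y z) x + Sk (c * a) b (br z x) y) = 0"
proof -
  have "(W (a * b) (br x y) c z + W (a * b) (br x y) c z) + (W (b * c) (br y z) a x + W (b * c) (br y z) a x)
      + (W (c * a) (br z x) b y + W (c * a) (br z x) b y)
    = (W (a * b) (br x y) c z + W (b * c) (br y z) a x + W (c * a) (br z x) b y)
      + (W (a * b) (br x y) c z + W (b * c) (br y z) a x + W (c * a) (br z x) b y)"
    by (simp only: ac_simps)
  then have "(Sy (a * b) c (br x y) z + Sk (a * b) c (br x y) z) + (Sy (b * c) a (br y z) x + Sk (b * c) a (br y z) x)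
      + (Sy (c * a) b (br z x) y + Sk (c * a) b (br z x) y) = 0"
    unfolding double cocycle by simp
  moreover have "Sy (a * b) c (br x y) z = Sy (a * b) c (br y z) x"
    using Sy_cyclic[of "a * b" c x y z] Sy_cyclic[of "a * b" c z x y] by simp
  moreover have "Sy (c * a) b (br z x) y = Sy (c * a) b (br y z) x"
    by (rule Sy_cyclic)
  ultimately show ?thesis by (simp add: ac_simps)
qed

text \<open>The defect \<open>M\<close> is invariant under cyclic rotation. The identities for
  \<open>(a, b, 1)\<close> and \<open>(a * b, 1, 1)\<close> share their symmetric term and one skew
  term; their difference says that two rotations of \<open>M\<close> add up to 0, so twice
  \<open>M\<close> vanishes.\<close>

lemma Sk_unit: "Sk a b (br y z) x = Sk (a * b) 1 (br y z) x"
proof -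
  define M where "M x y z = Sk a b (br y z) x - Sk (a * b) 1 (br y z) x" for x y z
  have c: "M x y z = M y z x" unfolding M_def by (rule Sk_cyclic_diff)
  have e1: "Sy (a * b) 1 (br y z) x + (Sk (a * b) 1 (br x y) z + Sk a b (br y z) x + Sk a b (br z x) y) = 0"
    using double_cocycle[of a b 1 y z x] by (simp add: Sy_skew[of b a] Sk_sym[of b a])
  have e2: "Sy (a * b) 1 (br y z) x + (Sk (a * b) 1 (br x y) z + Sk (a * b) 1 (br y z) x + Sk (a * b) 1 (br z x) y) = 0"
    using double_cocycle[of "a * b" 1 1 y z x] by (simp add: Sy_skew[of 1 "a * b"] Sk_sym[of 1 "a * b"])
  have cancel: "(r - r') + (t - t') = 0" if "p + (q + r + t) = 0" "p + (q + r' + t') = 0" for p q r t r' t' :: 'z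
  proof -
    have "(p + (q + r + t)) - (p + (q + r' + t')) = 0" using that by simp
    then show ?thesis by (simp add: algebra_simps)
  qed
  have "M x y z + M y z x = 0" unfolding M_def by (rule cancel[OF e1 e2])
  then have "M x y z + M x y z = 0" using c by simp
  then have "M x y z = 0" by (rule no_two_torsion)
  then show ?thesis by (simp add: M_def)
qed

text \<open>The only relation linking the two parts: the symmetric one,
  \<open>\<iota> a \<otimes> \<eta>(x \<and> y \<and> z)\<close>, against the skew one,
  \<open>a \<otimes> d(x \<and> y \<and> z)\<close>.\<close>

lemma Sy_one: "Sy a 1 (br y z) x + (Sk a 1 (br x y) z + Sk a 1 (br y z) x + Sk a 1 (br z x) y) = 0"
  using double_cocycle[of a 1 1 y z x] by (simp add: Sy_skew[of 1 a] Sk_sym[of 1 a])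

text \<open>By \<open>Sk_unit\<close> the skew terms depend on the product \<open>a * b * c\<close>
  alone, and \<open>Sy_one\<close> turns their sum into the symmetric term at 1. The outcome is the
  relation \<open>T\<^sub>0\<close> of Hochschild homology.\<close>

lemma Sy_hochschild:
  "Sy (a * b) c (br y z) x + Sy (b * c) a (br y z) x + Sy (c * a) b (br y z) x = Sy (a * b * c) 1 (br y z) x"
proof -
  have "Sy (a * b) c (br y z) x + Sy (b * c) a (br y z) x + Sy (c * a) b (br y z) x +
   (Sk (a * b * c) 1 (br x y) z + Sk (a * b * c) 1 (br y z) x + Sk (a * b * c) 1 (br z x) y) = 0"
    using double_cocycle[of a b c y z x] Sk_unit[of "a * b" c x y z] Sk_unit[of "b * c" a y z x]
      Sk_unit[of "c * a" b z x y] by (simp add: mult.commute mult.left_commute)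
  then show ?thesis unfolding Sy_one[of "a * b * c" y z x, symmetric] by (rule add_right_imp_eq)
qed

text \<open>Skew parts are under control only if one argument is a bracket. This is the place that
  makes the vanishing of \<open>S\<^sup>2(H\<^sub>1)\<close> in degree \<beta> necessary for the
  later decomposition.\<close>

lemma decompose: "W a x b y + W a x b y = Sy a b x y + Sk (a * b) 1 x y" if "y = br u v \<or> x = br u v"
proof -
  have "Sk a b x y = Sk (a * b) 1 x y"
    using that
  proof
    assume "y = br u v"
    then have "Sk a b y x = Sk (a * b) 1 y x" using Sk_unit by simp
    then have "- Sk a b y x = - Sk (a * b) 1 y x" by simp
    then show ?thesis by (simp add: Sk_def)
  next
    assume "x = br u v"
    then show ?thesis using Sk_unit[of a b u v y] by simp
  qed
  then show ?thesis by (simp add: double)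
qed

end

subsection \<open>Homogeneous components\<close>

context graded_lie_algebra
begin

lemma vs: "vector_space s" ..

lemma homogeneous_induct:
  assumes "\<And>x y. P x \<Longrightarrow> P y \<Longrightarrow> P (x + y)" "\<And>c x. P x \<Longrightarrow> P (s c x)" "\<And>\<gamma> x. x \<in> G \<gamma> \<Longrightarrow> P x"
  shows "P x"
proof -
  have "subspace {x. P x}"
    using assms(3)[OF subspace_0[OF G_subspace]] assms(1,2) by (intro subspaceI) auto
  then have "span (\<Union>\<gamma>. G \<gamma>) \<subseteq> {x. P x}" using assms(3) by (intro span_minimal) auto
  then show ?thesis by (auto simp: G_span)
qed

definition is_dec :: "'l \<Rightarrow> ('b \<Rightarrow> 'l) \<Rightarrow> bool" where
  "is_dec x f \<longleftrightarrow> (\<forall>\<gamma>. f \<gamma> \<in> G \<gamma>) \<and> (\<exists>S. finite S \<and> (\<forall>\<gamma>. \<gamma> \<notin> S \<longrightarrow> f \<gamma> = 0) \<and> x = sum f S)"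

lemma is_dec_add:
  assumes "is_dec x f" "is_dec y g"
  shows "is_dec (x + y) (\<lambda>\<gamma>. f \<gamma> + g \<gamma>)"
proof -
  obtain S where S: "finite S" "\<And>\<gamma>. \<gamma> \<notin> S \<Longrightarrow> f \<gamma> = 0" "x = sum f S" using assms(1) by (auto simp: is_dec_def)
  obtain T where T: "finite T" "\<And>\<gamma>. \<gamma> \<notin> T \<Longrightarrow> g \<gamma> = 0" "y = sum g T" using assms(2) by (auto simp: is_dec_def)
  have "x = sum f (S \<union> T)" "y = sum g (S \<union> T)"
    using S T by (auto intro!: sum.mono_neutral_left)
  then have "x + y = (\<Sum>\<gamma>\<in>S \<union> T. f \<gamma> + g \<gamma>)" by (simp add: sum.distrib)
  then show ?thesis unfolding is_dec_def
    using S T assms by (auto simp: is_dec_def intro!: subspace_add[OF G_subspace] exI[of _ "S \<union> T"])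
qed

lemma is_dec_scale:
  assumes "is_dec x f"
  shows "is_dec (s c x) (\<lambda>\<gamma>. s c (f \<gamma>))"
  using assms by (auto simp: is_dec_def scale_sum_right intro!: subspace_scale[OF G_subspace])

lemma is_dec_homogeneous: "x \<in> G \<gamma> \<Longrightarrow> is_dec x (\<lambda>\<delta>. if \<delta> = \<gamma> then x else 0)"
  by (auto simp: is_dec_def subspace_0[OF G_subspace] intro!: exI[of _ "{\<gamma>}"])

lemma is_dec_unique:
  assumes "is_dec x f" "is_dec x g"
  shows "f = g"
proof
  fix \<gamma>
  have "is_dec (x + s (- 1) x) (\<lambda>\<gamma>. f \<gamma> + s (- 1) (g \<gamma>))" by (intro is_dec_add is_dec_scale assms)
  then have "is_dec 0 (\<lambda>\<gamma>. f \<gamma> - g \<gamma>)" by simp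
  then obtain S where S: "finite S" "\<And>\<gamma>. \<gamma> \<notin> S \<Longrightarrow> f \<gamma> - g \<gamma> = 0" "(\<Sum>\<gamma>\<in>S. f \<gamma> - g \<gamma>) = 0" "\<And>\<gamma>. f \<gamma> - g \<gamma> \<in> G \<gamma>"
    by (auto simp: is_dec_def)
  have "f \<gamma> - g \<gamma> = 0" using S(2) G_independent[OF S(1) S(4) S(3), of \<gamma>] by blast
  then show "f \<gamma> = g \<gamma>" by simp
qed

lemma is_dec_ex: "\<exists>f. is_dec x f"
  by (induction x rule: homogeneous_induct) (use is_dec_add is_dec_scale is_dec_homogeneous in blast)+

definition comp :: "'b \<Rightarrow> 'l \<Rightarrow> 'l" where
  "comp \<gamma> x = (THE f. is_dec x f) \<gamma>"

lemma is_dec_comp: "is_dec x (\<lambda>\<gamma>. comp \<gamma> x)"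
  unfolding comp_def using is_dec_ex is_dec_unique by (metis theI)

lemma comp_eqI: "is_dec x f \<Longrightarrow> comp \<gamma> x = f \<gamma>"
  using is_dec_unique[OF is_dec_comp] by metis

lemma comp_add: "comp \<gamma> (x + y) = comp \<gamma> x + comp \<gamma> y"
  by (rule comp_eqI[OF is_dec_add[OF is_dec_comp is_dec_comp]])

lemma comp_scale: "comp \<gamma> (s c x) = s c (comp \<gamma> x)"
  by (rule comp_eqI[OF is_dec_scale[OF is_dec_comp]])

lemma comp_homogeneous: "x \<in> G \<gamma> \<Longrightarrow> comp \<delta> x = (if \<delta> = \<gamma> then x else 0)"
  by (rule comp_eqI[OF is_dec_homogeneous])

lemma comp_in: "comp \<gamma> x \<in> G \<gamma>"
  using is_dec_comp[of x] by (simp add: is_dec_def)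

definition supp :: "'l \<Rightarrow> 'b set" where "supp x = {\<gamma>. comp \<gamma> x \<noteq> 0}"

lemma finite_supp: "finite (supp x)"
proof -
  obtain S where "finite S" "\<And>\<gamma>. \<gamma> \<notin> S \<Longrightarrow> comp \<gamma> x = 0" using is_dec_comp[of x] by (auto simp: is_dec_def)
  then show ?thesis by (auto simp: supp_def intro: finite_subset)
qed

text \<open>The projection of \<open>l \<otimes> l\<close> to degree \<beta>, sending
  \<open>x \<otimes> y\<close> to the sum of \<open>x\<^sub>\<gamma> \<otimes>
  y\<^sub>\<beta>\<^sub>-\<^sub>\<gamma>\<close>. On lists it is bilinear only modulo tensor
  relations, so its properties are stated after a map \<open>\<pi>\<close> that kills these.\<close>

definition proj2 :: "'b \<Rightarrow> ('l list \<Rightarrow>\<^sub>0 'k) \<Rightarrow> ('l list \<Rightarrow>\<^sub>0 'k)" where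
  "proj2 \<beta> = lift pscale (\<lambda>xs. \<Sum>\<gamma>\<in>supp (xs ! 0). pure [comp \<gamma> (xs ! 0), comp (\<beta> - \<gamma>) (xs ! 1)])"

lemma linear_proj2: "Vector_Spaces.linear pscale pscale (proj2 \<beta>)"
  by (simp add: proj2_def linear_plift)

lemmas proj2_simps [simp] = linear_simps[OF linear_proj2]

lemma wf_L: "wf_subquot (whole s)"
  by (rule wf_whole[OF vs])

lemma hpowI:
  "x \<in> G \<gamma> \<Longrightarrow> y \<in> G \<delta> \<Longrightarrow> \<gamma> + \<delta> = \<beta> \<Longrightarrow> pure [x, y] \<in> hpow G 2 \<beta>"
  "x \<in> G \<gamma> \<Longrightarrow> y \<in> G \<delta> \<Longrightarrow> z \<in> G \<epsilon> \<Longrightarrow> \<gamma> + (\<delta> + \<epsilon>) = \<beta> \<Longrightarrow> pure [x, y, z] \<in> hpow G 3 \<beta>"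
  unfolding hpow_def
  by (rule pv.span_base; force intro!: exI[of _ "[\<gamma>, \<delta>]"])
    (rule pv.span_base; force intro!: exI[of _ "[\<gamma>, \<delta>, \<epsilon>]"])

lemma proj2_in: "t \<in> carr (tpow 2 (whole s)) \<Longrightarrow> proj2 \<beta> t \<in> hpow G 2 \<beta>"
proof (erule tpow_carr_induct[OF linear_proj2, rotated])
  show "pv.subspace (hpow G 2 \<beta>)" by (simp add: hpow_def)
  fix xs :: "'l list" assume "length xs = 2"
  show "proj2 \<beta> (pure xs) \<in> hpow G 2 \<beta>"
    unfolding proj2_def plift_pure
    by (rule pv.subspace_sum) (simp add: hpow_def, rule hpowI[OF comp_in comp_in], simp)
qed

lemma hpow2_induct:
  assumes "Vector_Spaces.linear pscale s' F" "module.subspace s' R" "t \<in> hpow G 2 \<beta>"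
    "\<And>x y \<gamma> \<delta>. x \<in> G \<gamma> \<Longrightarrow> y \<in> G \<delta> \<Longrightarrow> \<gamma> + \<delta> = \<beta> \<Longrightarrow> F (pure [x, y]) \<in> R"
  shows "F t \<in> R"
  using assms(3) unfolding hpow_def
  by (rule linear_span_in[OF assms(1,2), rotated])
    (use assms(4) in \<open>auto simp: length2 list_all2_Cons1\<close>)

lemma hpow3_induct:
  assumes "Vector_Spaces.linear pscale s' F" "module.subspace s' R" "t \<in> hpow G 3 \<beta>"
    "\<And>x y z \<gamma> \<delta> \<epsilon>. x \<in> G \<gamma> \<Longrightarrow> y \<in> G \<delta> \<Longrightarrow> z \<in> G \<epsilon> \<Longrightarrow> \<gamma> + (\<delta> + \<epsilon>) = \<beta> \<Longrightarrow> F (pure [x, y, z]) \<in> R"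
  shows "F t \<in> R"
  using assms(3) unfolding hpow_def
  by (rule linear_span_in[OF assms(1,2), rotated])
    (use assms(4) in \<open>auto simp: length3 list_all2_Cons1\<close>)

context
  fixes \<pi> :: "('l list \<Rightarrow>\<^sub>0 'k) \<Rightarrow> 'z::ab_group_add" and t :: "'k \<Rightarrow> 'z \<Rightarrow> 'z"
  assumes \<pi>: "Vector_Spaces.linear pscale t \<pi>" and ker: "\<And>r. r \<in> rel (tpow 2 (whole s)) \<Longrightarrow> \<pi> r = 0"
begin

lemma bilinear:
  "\<pi> (pure [x + y, z]) = \<pi> (pure [x, z]) + \<pi> (pure [y, z])"
  "\<pi> (pure [z, x + y]) = \<pi> (pure [z, x]) + \<pi> (pure [z, y])"
  "\<pi> (pure [s c x, z]) = t c (\<pi> (pure [x, z]))"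
  "\<pi> (pure [z, s c x]) = t c (\<pi> (pure [z, x]))"
  "\<pi> (pure [0, z]) = 0" "\<pi> (pure [z, 0]) = 0"
proof -
  note tp = tpow2I[where V = "whole s", simplified, THEN ker, unfolded linear_simps[OF \<pi>]]
  show "\<pi> (pure [x + y, z]) = \<pi> (pure [x, z]) + \<pi> (pure [y, z])"
    using tp(1)[of x y z] by (simp add: algebra_simps)
  show "\<pi> (pure [z, x + y]) = \<pi> (pure [z, x]) + \<pi> (pure [z, y])"
    using tp(2)[of z x y] by (simp add: algebra_simps)
  show "\<pi> (pure [s c x, z]) = t c (\<pi> (pure [x, z]))" using tp(3)[of c x z] by simp
  show "\<pi> (pure [z, s c x]) = t c (\<pi> (pure [z, x]))" using tp(4)[of z c x] by simp
  show "\<pi> (pure [0, z]) = 0" "\<pi> (pure [z, 0]) = 0" using tp(5,6) by simp_all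
qed

lemma proj2_superset:
  assumes "finite S" "supp x \<subseteq> S"
  shows "\<pi> (proj2 \<beta> (pure [x, y])) = (\<Sum>\<gamma>\<in>S. \<pi> (pure [comp \<gamma> x, comp (\<beta> - \<gamma>) y]))"
proof -
  have "\<pi> (proj2 \<beta> (pure [x, y])) = (\<Sum>\<gamma>\<in>supp x. \<pi> (pure [comp \<gamma> x, comp (\<beta> - \<gamma>) y]))"
    by (simp add: proj2_def linear_simps[OF \<pi>])
  also have "\<dots> = (\<Sum>\<gamma>\<in>S. \<pi> (pure [comp \<gamma> x, comp (\<beta> - \<gamma>) y]))"
    using assms by (intro sum.mono_neutral_left) (auto simp: supp_def bilinear)
  finally show ?thesis .
qed

text \<open>The definition sums over the support of the first entry. Reindexing by
  \<open>\<beta> - \<gamma>\<close> gives the same sum over the support of the second, the symmetry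
  on which \<open>proj2_swap\<close> relies.\<close>

lemma proj2_superset2:
  assumes "finite S" "supp y \<subseteq> S"
  shows "\<pi> (proj2 \<beta> (pure [x, y])) = (\<Sum>\<gamma>\<in>S. \<pi> (pure [comp (\<beta> - \<gamma>) x, comp \<gamma> y]))"
proof -
  let ?S = "supp x \<union> (\<lambda>\<gamma>. \<beta> - \<gamma>) ` S"
  have "\<pi> (proj2 \<beta> (pure [x, y])) = (\<Sum>\<gamma>\<in>?S. \<pi> (pure [comp \<gamma> x, comp (\<beta> - \<gamma>) y]))"
    using assms finite_supp by (intro proj2_superset) auto
  also have "\<dots> = (\<Sum>\<gamma>\<in>(\<lambda>\<gamma>. \<beta> - \<gamma>) ` S. \<pi> (pure [comp \<gamma> x, comp (\<beta> - \<gamma>) y]))"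
  proof (intro sum.mono_neutral_right ballI)
    fix \<gamma> assume "\<gamma> \<in> ?S - (\<lambda>\<gamma>. \<beta> - \<gamma>) ` S"
    then have "\<beta> - \<gamma> \<notin> S" by (force simp: image_iff)
    then have "comp (\<beta> - \<gamma>) y = 0" using assms(2) by (auto simp: supp_def)
    then show "\<pi> (pure [comp \<gamma> x, comp (\<beta> - \<gamma>) y]) = 0" by (simp add: bilinear)
  qed (use assms finite_supp in auto)
  also have "\<dots> = (\<Sum>\<gamma>\<in>S. \<pi> (pure [comp (\<beta> - \<gamma>) x, comp \<gamma> y]))"
    by (subst sum.reindex) (auto simp: inj_on_def)
  finally show ?thesis .
qed

lemma proj2_bilinear:
  "\<pi> (proj2 \<beta> (pure [x + y, z])) = \<pi> (proj2 \<beta> (pure [x, z])) + \<pi> (proj2 \<beta> (pure [y, z]))"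
  "\<pi> (proj2 \<beta> (pure [z, x + y])) = \<pi> (proj2 \<beta> (pure [z, x])) + \<pi> (proj2 \<beta> (pure [z, y]))"
  "\<pi> (proj2 \<beta> (pure [s c x, z])) = t c (\<pi> (proj2 \<beta> (pure [x, z])))"
  "\<pi> (proj2 \<beta> (pure [z, s c x])) = t c (\<pi> (proj2 \<beta> (pure [z, x])))"
proof -
  interpret T: Vector_Spaces.linear pscale t \<pi> by (rule \<pi>)
  let ?S = "supp x \<union> supp y \<union> supp (x + y) \<union> supp (s c x) \<union> supp z"
  have f: "finite ?S" by (simp add: finite_supp)
  note s = proj2_superset[OF f]
  show "\<pi> (proj2 \<beta> (pure [x + y, z])) = \<pi> (proj2 \<beta> (pure [x, z])) + \<pi> (proj2 \<beta> (pure [y, z]))"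
    by (subst (1 2 3) s) (auto simp: comp_add bilinear sum.distrib)
  show "\<pi> (proj2 \<beta> (pure [z, x + y])) = \<pi> (proj2 \<beta> (pure [z, x])) + \<pi> (proj2 \<beta> (pure [z, y]))"
    by (subst (1 2 3) s) (auto simp: comp_add bilinear sum.distrib)
  show "\<pi> (proj2 \<beta> (pure [s c x, z])) = t c (\<pi> (proj2 \<beta> (pure [x, z])))"
    by (subst (1 2) s) (auto simp: comp_scale bilinear T.vs2.scale_sum_right)
  show "\<pi> (proj2 \<beta> (pure [z, s c x])) = t c (\<pi> (proj2 \<beta> (pure [z, x])))"
    by (subst (1 2) s) (auto simp: comp_scale bilinear T.vs2.scale_sum_right)
qed

lemma proj2_homogeneous:
  assumes "x \<in> G \<gamma>" "y \<in> G \<delta>"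
  shows "\<pi> (proj2 \<beta> (pure [x, y])) = (if \<gamma> + \<delta> = \<beta> then \<pi> (pure [x, y]) else 0)"
proof -
  have "supp x \<subseteq> {\<gamma>}" using assms(1) by (auto simp: supp_def comp_homogeneous)
  moreover have "\<beta> - \<gamma> = \<delta> \<longleftrightarrow> \<gamma> + \<delta> = \<beta>" by (auto simp: algebra_simps)
  ultimately show ?thesis
    using assms by (subst proj2_superset[of "{\<gamma>}"]) (auto simp: comp_homogeneous bilinear)
qed

text \<open>The scalar \<open>c\<close> treats both powers at once: \<open>c = -1\<close> for the
  exterior square, \<open>c = 1\<close> for the symmetric one.\<close>

lemma proj2_swap:
  assumes "\<And>x y. \<pi> (pure [x, y]) = t c (\<pi> (pure [y, x]))"
  shows "\<pi> (proj2 \<beta> (pure [x, y])) = t c (\<pi> (proj2 \<beta> (pure [y, x])))"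
proof -
  interpret T: Vector_Spaces.linear pscale t \<pi> by (rule \<pi>)
  have "\<pi> (proj2 \<beta> (pure [x, y])) = (\<Sum>\<gamma>\<in>supp x. t c (\<pi> (pure [comp (\<beta> - \<gamma>) y, comp \<gamma> x])))"
    by (subst proj2_superset[OF finite_supp order_refl]) (rule sum.cong[OF refl assms])
  also have "\<dots> = t c (\<pi> (proj2 \<beta> (pure [y, x])))"
    by (subst proj2_superset2[OF finite_supp order_refl]) (simp add: T.vs2.scale_sum_right)
  finally show ?thesis .
qed

end

end

subsection \<open>Cokernels, images and homogeneous components\<close>

lemma subspace_image_sum:
  assumes "Vector_Spaces.linear s1 s2 f" "module.subspace s1 A" "module.subspace s2 B"
  shows "module.subspace s2 {f v + r |v r. v \<in> A \<and> r \<in> B}"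
proof -
  interpret Vector_Spaces.linear s1 s2 f by fact
  have "vs2.subspace {x + y |x y. x \<in> f ` A \<and> y \<in> B}"
    using assms by (intro vs2.subspace_sums subspace_image)
  moreover have "{x + y |x y. x \<in> f ` A \<and> y \<in> B} = {f v + r |v r. v \<in> A \<and> r \<in> B}" by auto
  ultimately show ?thesis by simp
qed

lemma coker_simps [simp]: "scl (coker f V W) = scl W" "carr (coker f V W) = carr W"
  "rel (coker f V W) = {f v + r |v r. v \<in> carr V \<and> r \<in> rel W}"
  by (simp_all add: coker_def)

lemma imag_simps [simp]: "scl (imag f V W) = scl W" "rel (imag f V W) = rel W"
  "carr (imag f V W) = {f v + r |v r. v \<in> carr V \<and> r \<in> rel W}"
  by (simp_all add: imag_def)

lemma hcomp_simps [simp]: "scl (hcomp W D) = scl W" "rel (hcomp W D) = rel W"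
  "carr (hcomp W D) = {d + r |d r. d \<in> D \<inter> carr W \<and> r \<in> rel W}"
  by (simp_all add: hcomp_def)

lemma wf_coker:
  assumes "Vector_Spaces.linear (scl V) (scl W) f" "module.subspace (scl V) (carr V)" "wf_subquot W"
    "\<And>x. x \<in> carr V \<Longrightarrow> f x \<in> carr W"
  shows "wf_subquot (coker f V W)"
  using assms subspace_image_sum[OF assms(1,2) wf_rel[OF assms(3)]] carr_facts[OF assms(3)]
  by (auto simp: wf_subquot_def)

lemma wf_imag:
  assumes "Vector_Spaces.linear (scl V) (scl W) f" "module.subspace (scl V) (carr V)" "wf_subquot W"
  shows "wf_subquot (imag f V W)"
proof -
  have "f 0 = 0" by (rule linear_simps(5)[OF assms(1)])
  moreover have "0 \<in> carr V" using assms by (metis Vector_Spaces.linear_iff subspace_facts(1))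
  ultimately have "\<exists>v r'. r = f v + r' \<and> v \<in> carr V \<and> r' \<in> rel W" if "r \<in> rel W" for r
    using that by (intro exI[of _ 0] exI[of _ r]) simp
  then show ?thesis
    using assms subspace_image_sum[OF assms(1,2) wf_rel[OF assms(3)]]
    by (auto simp: wf_subquot_def)
qed

lemma wf_hcomp:
  assumes "vector_space (scl W)" "module.subspace (scl W) (carr W)" "module.subspace (scl W) (rel W)"
    "module.subspace (scl W) D"
  shows "wf_subquot (hcomp W D)"
proof -
  interpret vector_space "scl W" by fact
  have "subspace {x + y |x y. x \<in> D \<inter> carr W \<and> y \<in> rel W}"
    using assms by (intro subspace_sums subspace_inter)
  moreover have "\<exists>d r'. r = d + r' \<and> d \<in> D \<inter> carr W \<and> r' \<in> rel W" if "r \<in> rel W" for r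
    using that assms by (intro exI[of _ 0] exI[of _ r]) (auto simp: subspace_0)
  ultimately show ?thesis using assms by (auto simp: wf_subquot_def)
qed

lemma coker_rel_induct:
  assumes "t \<in> rel (coker f V W)" "Vector_Spaces.linear (scl W) s F" "module.subspace s R"
    "\<And>v. v \<in> carr V \<Longrightarrow> F (f v) \<in> R" "\<And>r. r \<in> rel W \<Longrightarrow> F r \<in> R"
  shows "F t \<in> R"
proof -
  have "vector_space s" using assms(2) by (simp add: Vector_Spaces.linear_iff)
  note sub = subspace_facts(2)[OF this assms(3)]
  obtain v r where "t = f v + r" "v \<in> carr V" "r \<in> rel W" using assms(1) by auto
  then show ?thesis using assms(4,5) sub linear_simps(1)[OF assms(2)] by simp
qed

lemma quotient_map_pscale:
  fixes R :: "('x \<Rightarrow>\<^sub>0 'k::field) set"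
  assumes "pv.subspace R"
  shows "\<exists>\<pi> :: ('x \<Rightarrow>\<^sub>0 'k) \<Rightarrow> ('x \<Rightarrow>\<^sub>0 'k). Vector_Spaces.linear pscale pscale \<pi> \<and> (\<forall>x. \<pi> x = 0 \<longleftrightarrow> x \<in> R)"
  by (rule ex_quotient_map[OF pv.vector_space_axioms assms]) blast

lemma not_distinct3:
  assumes "length xs = 3" "\<not> distinct xs"
  obtains x y where "xs = [x, x, y] \<or> xs = [x, y, x] \<or> xs = [y, x, x]"
proof -
  obtain a b c where xs: "xs = [a, b, c]" using assms(1) by (auto simp: length3)
  then consider "a = b" | "a = c" | "b = c" using assms(2) by auto
  then show ?thesis using xs that by cases blast+
qed

lemma double_eq_0:
  assumes "(2::'k::field) \<noteq> 0"
  shows "x + x = 0 \<Longrightarrow> x = (0 :: 'x \<Rightarrow>\<^sub>0 'k)"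
proof -
  assume "x + x = 0"
  then have "pscale (2::'k) x = 0" using pv.scale_left_distrib[of 1 1 x] by simp
  then show "x = 0" using assms by simp
qed

context graded_lie_algebra
begin

lemmas br_left = linear_simps[OF br_linear_left]
lemmas br_right = linear_simps[OF br_linear_right]

lemma br_skew: "br y x = - br x y"
proof -
  have "br (x + y) (x + y) = br x x + br y x + (br x y + br y y)" by (simp only: br_left br_right)
  then have "br y x + br x y = 0" by (simp add: br_self)
  then show ?thesis by (simp only: eq_neg_iff_add_eq_0)
qed

text \<open>Arbitrary elements are split into homogeneous ones slot by slot; the multilinearity
  relations used on the way lie in \<open>S\<close> by assumption.\<close>

lemma tpow3_induct:
  assumes S: "pv.subspace S" "\<And>r. r \<in> rel (tpow 3 (whole s)) \<Longrightarrow> r \<in> S"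
    "\<And>x y z \<gamma> \<delta> \<epsilon>. x \<in> G \<gamma> \<Longrightarrow> y \<in> G \<delta> \<Longrightarrow> z \<in> G \<epsilon> \<Longrightarrow> pure [x, y, z] \<in> S"
    and w: "w \<in> carr (tpow 3 (whole s))"
  shows "w \<in> S"
proof -
  have a: "p \<in> S" if "p - q - r \<in> S" "q \<in> S" "r \<in> S" for p q r
    using pv.subspace_add[OF S(1) pv.subspace_add[OF S(1) that(1,2)] that(3)] by simp
  have b: "p \<in> S" if "p - pscale c q \<in> S" "q \<in> S" for p c q
    using pv.subspace_add[OF S(1) that(1) pv.subspace_scale[OF S(1) that(2)], of c] by simp
  note tp = tpow_relI[where V = "whole s" and n = 3, simplified, THEN S(2)]
  have 1: "pure [x, y, z] \<in> S" if "y \<in> G \<delta>" "z \<in> G \<epsilon>" for x y z \<delta> \<epsilon>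
  proof (induction x rule: homogeneous_induct)
    case (1 x x') with tp(1)[of "[]" "[y,z]" x x'] a[of "pure [x + x',y,z]" "pure [x,y,z]" "pure [x',y,z]"] show ?case by simp
  next
    case (2 c x) with tp(2)[of "[]" "[y,z]" c x] b[of "pure [s c x,y,z]" c "pure [x,y,z]"] show ?case by simp
  qed (use S(3) that in blast)
  have 2: "pure [x, y, z] \<in> S" if "z \<in> G \<epsilon>" for x y z \<epsilon>
  proof (induction y rule: homogeneous_induct)
    case (1 y y') with tp(1)[of "[x]" "[z]" y y'] a[of "pure [x,y + y',z]" "pure [x,y,z]" "pure [x,y',z]"] show ?case by simp
  next
    case (2 c y) with tp(2)[of "[x]" "[z]" c y] b[of "pure [x,s c y,z]" c "pure [x,y,z]"] show ?case by simp
  qed (use 1 that in blast)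
  have 3: "pure [x, y, z] \<in> S" for x y z
  proof (induction z rule: homogeneous_induct)
    case (1 z z') with tp(1)[of "[x,y]" "[]" z z'] a[of "pure [x,y,z + z']" "pure [x,y,z]" "pure [x,y,z']"] show ?case by simp
  next
    case (2 c z) with tp(2)[of "[x,y]" "[]" c z] b[of "pure [x,y,s c z]" c "pure [x,y,z]"] show ?case by simp
  qed (use 2 in blast)
  show ?thesis
    by (rule tpow_carr_induct[OF pv.linear_ident S(1) w]) (use 3 in \<open>auto simp: length3\<close>)
qed

subsection \<open>The Killing module\<close>

definition kill_map :: "('l list \<Rightarrow>\<^sub>0 'k) \<Rightarrow> ('l list \<Rightarrow>\<^sub>0 'k)" where
  "kill_map = lift pscale (\<lambda>xs. pure [br (xs ! 0) (xs ! 1), xs ! 2] - pure [xs ! 0, br (xs ! 1) (xs ! 2)])"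

lemma kill_eq: "kill s br = coker kill_map (tpow 3 (whole s)) (sympow 2 (whole s))"
  by (simp add: kill_def kill_map_def)

lemma linear_kill_map: "Vector_Spaces.linear pscale pscale kill_map"
  by (simp add: kill_map_def linear_plift)

lemmas kill_map_simps [simp] = linear_simps[OF linear_kill_map]

lemma kill_map3 [simp]: "kill_map (pure [x, y, z]) = pure [br x y, z] - pure [x, br y z]"
  by (simp add: kill_map_def)

lemma whole_pure [simp]: "length xs = n \<Longrightarrow> pure xs \<in> carr (tpow n (whole s))"
  by (rule tpow_carr_pure) auto

lemma subspace_tpow: "pv.subspace (carr (tpow n (whole s)))"
  using wf_tpow[OF wf_L, of n] by (simp add: wf_subquot_def)

lemma wf_kill: "wf_subquot (kill s br)"
  unfolding kill_eq
proof (rule wf_coker)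
  show "kill_map x \<in> carr (sympow 2 (whole s))" if "x \<in> carr (tpow 3 (whole s))" for x
    unfolding pow_carr
    by (rule tpow_carr_induct[OF linear_kill_map subspace_tpow that])
      (auto simp: length3 intro!: pv.subspace_diff[OF subspace_tpow])
qed (auto simp: linear_kill_map wf_sympow[OF wf_L] subspace_tpow)

lemma kill_simps [simp]: "scl (kill s br) = pscale" "carr (kill s br) = carr (tpow 2 (whole s))"
  by (simp_all add: kill_eq)

lemma sympow_kill: "r \<in> rel (sympow 2 (whole s)) \<Longrightarrow> r \<in> rel (kill s br)"
  unfolding kill_eq coker_simps
  using subspace_facts(1)[OF pv.vector_space_axioms subspace_tpow[of 3]]
  by (intro CollectI exI[of _ 0] exI[of _ r]) simp

lemma kill_relI: "pure [br x y, z] - pure [x, br y z] \<in> rel (kill s br)"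
proof -
  have "0 \<in> rel (sympow 2 (whole s))" by (rule rel_facts(1)[OF wf_sympow[OF wf_L]])
  then show ?thesis unfolding kill_eq coker_simps
    by (intro CollectI exI[of _ "pure [x, y, z]"] exI[of _ 0]) simp
qed

lemma kill_swap: "pure [x, y] - pure [y, x] \<in> rel (kill s br)"
  by (intro sympow_kill sympow_relI) auto

context
  fixes \<pi> :: "('l list \<Rightarrow>\<^sub>0 'k) \<Rightarrow> 'z::ab_group_add" and t :: "'k \<Rightarrow> 'z \<Rightarrow> 'z"
  assumes \<pi>: "Vector_Spaces.linear pscale t \<pi>"
begin

lemma kill_form:
  assumes "\<And>r. r \<in> rel (kill s br) \<Longrightarrow> \<pi> r = 0"
  shows "r \<in> rel (tpow 2 (whole s)) \<Longrightarrow> \<pi> r = 0"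
    "\<pi> (pure [x, y]) = \<pi> (pure [y, x])" "\<pi> (pure [br x y, z]) = \<pi> (pure [x, br y z])"
proof -
  note l = linear_simps[OF \<pi>]
  show "\<pi> r = 0" if "r \<in> rel (tpow 2 (whole s))"
    by (rule assms[OF sympow_kill[OF sympow_relI(1)[OF that]]])
  show "\<pi> (pure [x, y]) = \<pi> (pure [y, x])" using assms[OF kill_swap[of x y]] by (simp add: l)
  show "\<pi> (pure [br x y, z]) = \<pi> (pure [x, br y z])" using assms[OF kill_relI[of x y z]] by (simp add: l)
qed

lemma ext_form:
  assumes "\<And>r. r \<in> rel (extpow 2 (whole s)) \<Longrightarrow> \<pi> r = 0"
  shows "r \<in> rel (tpow 2 (whole s)) \<Longrightarrow> \<pi> r = 0"
    "\<pi> (pure [x, x]) = 0" "\<pi> (pure [x, y]) = - \<pi> (pure [y, x])"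
proof -
  show t: "\<pi> r = 0" if "r \<in> rel (tpow 2 (whole s))" for r
    by (rule assms[OF extpow_relI(1)[OF that]])
  have d: "\<pi> (pure [x, x]) = 0" for x by (rule assms[OF extpow_relI(2)]) auto
  then show "\<pi> (pure [x, x]) = 0" .
  show "\<pi> (pure [x, y]) = - \<pi> (pure [y, x])"
    using d[of "x + y"] d[of x] d[of y] by (simp add: bilinear[OF \<pi> t] eq_neg_iff_add_eq_0 add.commute)
qed

end

section \<open>Compatibility of the differential, the Koszul map and the degree projection with the
  relations\<close>

lemma wf_ext: "wf_subquot (extpow n (whole s))"
  by (rule wf_extpow[OF wf_L])

lemma ext_rel_sub: "pv.subspace (rel (extpow n (whole s)))"
  using wf_ext[of n] by (simp add: wf_subquot_def)

lemma kill_rel_sub: "pv.subspace (rel (kill s br))"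
  using wf_kill by (simp add: wf_subquot_def)

lemma ce_diff_ext3: "r \<in> rel (extpow 3 (whole s)) \<Longrightarrow> ce_diff br r \<in> rel (extpow 2 (whole s))"
proof -
  assume r: "r \<in> rel (extpow 3 (whole s))"
  obtain \<pi> :: "('l list \<Rightarrow>\<^sub>0 'k) \<Rightarrow> ('l list \<Rightarrow>\<^sub>0 'k)" where \<pi>: "Vector_Spaces.linear pscale pscale \<pi>" "\<And>x. \<pi> x = 0 \<longleftrightarrow> x \<in> rel (extpow 2 (whole s))"
    using quotient_map_pscale[OF ext_rel_sub[of 2]] by blast
  note e = ext_form[OF \<pi>(1) \<pi>(2)[THEN iffD2]]
  note b = bilinear[OF \<pi>(1) e(1)]
  note pl = linear_simps[OF \<pi>(1)]
  have l: "Vector_Spaces.linear pscale pscale (\<lambda>x. \<pi> (ce_diff br x))"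
    by (rule linear_compose[OF linear_ce_diff \<pi>(1)])
  have "\<pi> (ce_diff br r) \<in> {0}"
  proof (rule extpow_rel_induct[OF l pv.subspace_single_0 r])
    show "\<pi> (ce_diff br t) \<in> {0}" if "t \<in> rel (tpow 3 (whole s))" for t
      by (rule tpow_rel_induct[OF l pv.subspace_single_0 that]; unfold split3)
        (auto simp: pl br_left br_right b pv.scale_right_diff_distrib)
    fix xs :: "'l list" assume "length xs = 3" "\<not> distinct xs"
    from not_distinct3[OF this] obtain x y where "xs = [x, x, y] \<or> xs = [x, y, x] \<or> xs = [y, x, x]" by blast
    moreover have "br y x = - br x y" by (rule br_skew)
    moreover have "\<pi> (pure [- br x y, x]) = - \<pi> (pure [br x y, x])"
      using b(1)[of "- br x y" "br x y" x] by (simp add: b eq_neg_iff_add_eq_0)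
    moreover have "\<pi> (pure [- br x y, y]) = - \<pi> (pure [br x y, y])"
      using b(1)[of "- br x y" "br x y" y] by (simp add: b eq_neg_iff_add_eq_0)
    ultimately show "\<pi> (ce_diff br (pure xs)) \<in> {0}"
      by (auto simp: pl br_self b)
  qed
  then show ?thesis using \<pi>(2) by simp
qed

text \<open>On a list with a repeated entry, invariance moves the bracket onto the equal entries:
  \<open>x\<close> paired with \<open>[x, y]\<close> equals \<open>[x, x]\<close> paired with
  \<open>y\<close>, which is 0.\<close>

lemma koszul_ext3: "r \<in> rel (extpow 3 (whole s)) \<Longrightarrow> koszul br r \<in> rel (kill s br)"
proof -
  assume r: "r \<in> rel (extpow 3 (whole s))"
  obtain \<pi> :: "('l list \<Rightarrow>\<^sub>0 'k) \<Rightarrow> ('l list \<Rightarrow>\<^sub>0 'k)" where \<pi>: "Vector_Spaces.linear pscale pscale \<pi>" "\<And>x. \<pi> x = 0 \<longleftrightarrow> x \<in> rel (kill s br)"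
    using quotient_map_pscale[OF kill_rel_sub] by blast
  note e = kill_form[OF \<pi>(1) \<pi>(2)[THEN iffD2]]
  note b = bilinear[OF \<pi>(1) e(1)]
  note pl = linear_simps[OF \<pi>(1)]
  have l: "Vector_Spaces.linear pscale pscale (\<lambda>x. \<pi> (koszul br x))"
    by (rule linear_compose[OF linear_koszul \<pi>(1)])
  have "\<pi> (koszul br r) \<in> {0}"
  proof (rule extpow_rel_induct[OF l pv.subspace_single_0 r])
    show "\<pi> (koszul br t) \<in> {0}" if "t \<in> rel (tpow 3 (whole s))" for t
      by (rule tpow_rel_induct[OF l pv.subspace_single_0 that]; unfold split3)
        (auto simp: pl br_left br_right b)
    fix xs :: "'l list" assume "length xs = 3" "\<not> distinct xs"
    from not_distinct3[OF this] obtain x y where xs: "xs = [x, x, y] \<or> xs = [x, y, x] \<or> xs = [y, x, x]" by blast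
    have "\<pi> (pure [x, br x y]) = 0" using e(3)[of x x y] by (simp add: br_self b)
    moreover have "\<pi> (pure [x, br y x]) = - \<pi> (pure [x, br x y])"
      using b(2)[of x "- br x y" "br x y"] by (simp add: br_skew[of y x] b eq_neg_iff_add_eq_0)
    ultimately show "\<pi> (koszul br (pure xs)) \<in> {0}" using xs by (auto simp: br_self b)
  qed
  then show ?thesis using \<pi>(2) by simp
qed

lemma ce_diff_ext2: "r \<in> rel (extpow 2 (whole s)) \<Longrightarrow> ce_diff br r \<in> rel (extpow 1 (whole s))"
proof -
  assume r: "r \<in> rel (extpow 2 (whole s))"
  have tp: "pure [x + y] - pure [x] - pure [y] \<in> rel (extpow 1 (whole s))"
    "pure [s c x] - pscale c (pure [x]) \<in> rel (extpow 1 (whole s))" "pure [0] \<in> rel (extpow 1 (whole s))" for c x y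
    using tpow_relI[where V = "whole s" and n = 1 and us = "[]" and vs = "[]", THEN extpow_relI(1)] by simp_all
  note sub = ext_rel_sub[of 1]
  show ?thesis
  proof (rule extpow2_rel_induct[OF linear_ce_diff sub r])
    fix x y z
    show "ce_diff br (pure [x + y, z]) - ce_diff br (pure [x, z]) - ce_diff br (pure [y, z]) \<in> rel (extpow 1 (whole s))"
      using pv.subspace_neg[OF sub tp(1)[of "br x z" "br y z"]] by (simp add: br_left algebra_simps)
    show "ce_diff br (pure [z, x + y]) - ce_diff br (pure [z, x]) - ce_diff br (pure [z, y]) \<in> rel (extpow 1 (whole s))"
      using pv.subspace_neg[OF sub tp(1)[of "br z x" "br z y"]] by (simp add: br_right algebra_simps)
    fix c
    show "ce_diff br (pure [scl (whole s) c x, z]) - pscale c (ce_diff br (pure [x, z])) \<in> rel (extpow 1 (whole s))"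
      using pv.subspace_neg[OF sub tp(2)[of c "br x z"]] by (simp add: br_left algebra_simps)
    show "ce_diff br (pure [z, scl (whole s) c x]) - pscale c (ce_diff br (pure [z, x])) \<in> rel (extpow 1 (whole s))"
      using pv.subspace_neg[OF sub tp(2)[of c "br z x"]] by (simp add: br_right algebra_simps)
  qed (use pv.subspace_neg[OF sub tp(3)] in \<open>auto simp: br_self br_left br_right\<close>)
qed

lemma proj2_homogeneous_rel:
  assumes "x \<in> G \<gamma>" "y \<in> G \<delta>"
  shows "\<gamma> + \<delta> = \<beta> \<Longrightarrow> proj2 \<beta> (pure [x, y]) - pure [x, y] \<in> rel (tpow 2 (whole s))"
    "\<gamma> + \<delta> \<noteq> \<beta> \<Longrightarrow> proj2 \<beta> (pure [x, y]) \<in> rel (tpow 2 (whole s))"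
proof -
  have "pv.subspace (rel (tpow 2 (whole s)))" using wf_tpow[OF wf_L, of 2] by (simp add: wf_subquot_def)
  from quotient_map_pscale[OF this]
  obtain \<pi> :: "('l list \<Rightarrow>\<^sub>0 'k) \<Rightarrow> ('l list \<Rightarrow>\<^sub>0 'k)" where \<pi>: "Vector_Spaces.linear pscale pscale \<pi>" "\<And>x. \<pi> x = 0 \<longleftrightarrow> x \<in> rel (tpow 2 (whole s))"
    by blast
  note h = proj2_homogeneous[OF \<pi>(1) \<pi>(2)[THEN iffD2] assms, of \<beta>]
  show "proj2 \<beta> (pure [x, y]) - pure [x, y] \<in> rel (tpow 2 (whole s))" if "\<gamma> + \<delta> = \<beta>"
    unfolding \<pi>(2)[symmetric] using h that by (simp add: linear_simps[OF \<pi>(1)])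
  show "proj2 \<beta> (pure [x, y]) \<in> rel (tpow 2 (whole s))" if "\<gamma> + \<delta> \<noteq> \<beta>"
    unfolding \<pi>(2)[symmetric] using h that by simp
qed

lemma proj2_id:
  assumes "t \<in> hpow G 2 \<beta>"
  shows "proj2 \<beta> t - t \<in> rel (tpow 2 (whole s))"
proof (rule hpow2_induct[OF _ _ assms])
  show "Vector_Spaces.linear pscale pscale (\<lambda>t. proj2 \<beta> t - t)"
    by (simp add: plin_iff pv.scale_right_diff_distrib)
  show "pv.subspace (rel (tpow 2 (whole s)))" using wf_tpow[OF wf_L, of 2] by (simp add: wf_subquot_def)
qed (rule proj2_homogeneous_rel)

lemma hpow_sub: "pv.subspace (hpow G n \<beta>)"
  by (simp add: hpow_def)

lemma hpow_carr: "t \<in> hpow G n \<beta> \<Longrightarrow> t \<in> carr (tpow n (whole s))"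
  unfolding hpow_def tpow_def subquot.simps by (erule set_mp[OF pv.span_mono, rotated]) auto

context
  assumes two: "(2::'k) \<noteq> 0"
begin

text \<open>The delicate generator is \<open>[x, x]\<close>, whose projection is a sum over pairs of
  distinct slots. By \<open>proj2_swap\<close> its class equals its own negative, and 2 is
  invertible.\<close>

lemma proj2_ext: "r \<in> rel (extpow 2 (whole s)) \<Longrightarrow> proj2 \<beta> r \<in> rel (extpow 2 (whole s))"
proof -
  assume r: "r \<in> rel (extpow 2 (whole s))"
  obtain \<pi> :: "('l list \<Rightarrow>\<^sub>0 'k) \<Rightarrow> ('l list \<Rightarrow>\<^sub>0 'k)" where \<pi>: "Vector_Spaces.linear pscale pscale \<pi>" "\<And>x. \<pi> x = 0 \<longleftrightarrow> x \<in> rel (extpow 2 (whole s))"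
    using quotient_map_pscale[OF ext_rel_sub[of 2]] by blast
  note e = ext_form[OF \<pi>(1) \<pi>(2)[THEN iffD2]]
  note b = proj2_bilinear[OF \<pi>(1) e(1)]
  have l: "Vector_Spaces.linear pscale pscale (\<lambda>x. \<pi> (proj2 \<beta> x))"
    by (rule linear_compose[OF linear_proj2 \<pi>(1)])
  have m: "\<pi> (proj2 \<beta> (pure [0, x])) = 0" "\<pi> (proj2 \<beta> (pure [x, 0])) = 0" for x
    using b(3)[of \<beta> 0 0 x] b(4)[of \<beta> x 0 0] by simp_all
  have "\<pi> (proj2 \<beta> r) \<in> {0}"
  proof (rule extpow2_rel_induct[OF l pv.subspace_single_0 r])
    fix x
    have "\<pi> (pure [x, y]) = pscale (- 1) (\<pi> (pure [y, x]))" for x y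
      using e(3)[of x y] by simp
    from proj2_swap[OF \<pi>(1) e(1) this, of \<beta> x x]
    have "\<pi> (proj2 \<beta> (pure [x, x])) = - \<pi> (proj2 \<beta> (pure [x, x]))" by simp
    then have "\<pi> (proj2 \<beta> (pure [x, x])) + \<pi> (proj2 \<beta> (pure [x, x])) = 0" by (simp only: eq_neg_iff_add_eq_0)
    then show "\<pi> (proj2 \<beta> (pure [x, x])) \<in> {0}" using double_eq_0[OF two] by simp
  qed (auto simp: b m)
  then show ?thesis using \<pi>(2) by simp
qed

text \<open>\<open>kill_map\<close> preserves degree because the bracket does, so on homogeneous
  triples both of its terms survive or both vanish; \<open>tpow3_induct\<close> reduces to such
  triples.\<close>

lemma proj2_kill: "r \<in> rel (kill s br) \<Longrightarrow> proj2 \<beta> r \<in> rel (kill s br)"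
proof -
  assume r: "r \<in> rel (kill s br)"
  obtain \<pi> :: "('l list \<Rightarrow>\<^sub>0 'k) \<Rightarrow> ('l list \<Rightarrow>\<^sub>0 'k)" where \<pi>: "Vector_Spaces.linear pscale pscale \<pi>" "\<And>x. \<pi> x = 0 \<longleftrightarrow> x \<in> rel (kill s br)"
    using quotient_map_pscale[OF kill_rel_sub] by blast
  note e = kill_form[OF \<pi>(1) \<pi>(2)[THEN iffD2]]
  note b = proj2_bilinear[OF \<pi>(1) e(1)]
  note pl = linear_simps[OF \<pi>(1)]
  note bi = bilinear[OF \<pi>(1) e(1)]
  have l: "Vector_Spaces.linear pscale pscale (\<lambda>x. \<pi> (proj2 \<beta> x))"
    by (rule linear_compose[OF linear_proj2 \<pi>(1)])
  have m: "\<pi> (proj2 \<beta> (pure [0, x])) = 0" "\<pi> (proj2 \<beta> (pure [x, 0])) = 0" for x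
    using b(3)[of \<beta> 0 0 x] b(4)[of \<beta> x 0 0] by simp_all
  have l3: "Vector_Spaces.linear pscale pscale (\<lambda>x. \<pi> (proj2 \<beta> (kill_map x)))"
    by (rule linear_compose[OF linear_kill_map l])
  have "\<pi> (proj2 \<beta> r) \<in> {0}"
  proof (rule coker_rel_induct[OF r[unfolded kill_eq] _ pv.subspace_single_0])
    fix v :: "'l list \<Rightarrow>\<^sub>0 'k" assume v: "v \<in> carr (tpow 3 (whole s))"
    have "v \<in> {v. \<pi> (proj2 \<beta> (kill_map v)) = 0}"
    proof (rule tpow3_induct[OF _ _ _ v])
      show "pv.subspace {v. \<pi> (proj2 \<beta> (kill_map v)) = 0}"
        by (rule pv.subspaceI) (auto simp: pl)
      fix t :: "'l list \<Rightarrow>\<^sub>0 'k" assume t: "t \<in> rel (tpow 3 (whole s))"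
      have "\<pi> (proj2 \<beta> (kill_map t)) \<in> {0}"
        by (rule tpow_rel_induct[OF l3 pv.subspace_single_0 t]; unfold split3)
          (auto simp: pl br_left br_right b m pv.scale_right_diff_distrib)
      then show "t \<in> {v. \<pi> (proj2 \<beta> (kill_map v)) = 0}" by simp
    next
      fix x y z \<gamma> \<delta> \<epsilon> assume h: "x \<in> G \<gamma>" "y \<in> G \<delta>" "z \<in> G \<epsilon>"
      show "pure [x, y, z] \<in> {v. \<pi> (proj2 \<beta> (kill_map v)) = 0}"
        using proj2_homogeneous[OF \<pi>(1) e(1) G_bracket[OF h(1,2)] h(3), of \<beta>]
          proj2_homogeneous[OF \<pi>(1) e(1) h(1) G_bracket[OF h(2,3)], of \<beta>] e(3)[of x y z]
        by (auto simp: pl add.assoc)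
    qed
    then show "\<pi> (proj2 \<beta> (kill_map v)) \<in> {0}" by simp
  next
    fix t :: "'l list \<Rightarrow>\<^sub>0 'k" assume t: "t \<in> rel (sympow 2 (whole s))"
    show "\<pi> (proj2 \<beta> t) \<in> {0}"
    proof (rule sympow2_rel_induct[OF l pv.subspace_single_0 t])
      fix x y
      have "\<pi> (pure [x, y]) = pscale 1 (\<pi> (pure [y, x]))" for x y
        using e(2)[of x y] by simp
      from proj2_swap[OF \<pi>(1) e(1) this, of \<beta> x y]
      show "\<pi> (proj2 \<beta> (pure [x, y])) - \<pi> (proj2 \<beta> (pure [y, x])) \<in> {0}" by simp
    qed (auto simp: b m)
  qed (simp add: l)
  then show ?thesis using \<pi>(2) by simp
qed

text \<open>This replaces a degree projection on triple tensors. It matters that one and the same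
  \<open>w'\<close> serves the differential and the Koszul map: if \<open>w\<close> has a boundary
  that is trivial in degree \<beta>, then \<open>w'\<close> is a cycle with the right Koszul
  image.\<close>

lemma homogeneous_part:
  assumes "w \<in> carr (tpow 3 (whole s))"
  obtains w' where "w' \<in> hpow G 3 \<beta>" "ce_diff br w' - proj2 \<beta> (ce_diff br w) \<in> rel (extpow 2 (whole s))"
    "koszul br w' - proj2 \<beta> (koszul br w) \<in> rel (kill s br)"
proof -
  define S where "S = {w. \<exists>w'\<in>hpow G 3 \<beta>. ce_diff br w' - proj2 \<beta> (ce_diff br w) \<in> rel (extpow 2 (whole s)) \<and>
    koszul br w' - proj2 \<beta> (koszul br w) \<in> rel (kill s br)}"
  have SI: "w \<in> S" if "w' \<in> hpow G 3 \<beta>" "ce_diff br w' - proj2 \<beta> (ce_diff br w) \<in> rel (extpow 2 (whole s))"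
    "koszul br w' - proj2 \<beta> (koszul br w) \<in> rel (kill s br)" for w w' using that unfolding S_def by blast
  have 0: "0 \<in> hpow G 3 \<beta>" using hpow_sub pv.subspace_0 by blast
  note er = rel_facts[OF wf_ext[of 2], simplified] and kr = rel_facts[OF wf_kill, simplified]
  have "w \<in> S"
  proof (rule tpow3_induct[OF _ _ _ assms])
    show "pv.subspace S"
    proof (rule pv.subspaceI)
      show "0 \<in> S" using SI[OF 0] er(1) kr(1) by simp
      fix x assume "x \<in> S"
      then obtain x' where x: "x' \<in> hpow G 3 \<beta>" "ce_diff br x' - proj2 \<beta> (ce_diff br x) \<in> rel (extpow 2 (whole s))"
        "koszul br x' - proj2 \<beta> (koszul br x) \<in> rel (kill s br)" unfolding S_def by blast
      show "pscale c x \<in> S" for c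
        using er(3)[OF x(2), of c] kr(3)[OF x(3), of c] pv.subspace_scale[OF hpow_sub x(1), of c]
        by (intro SI[of "pscale c x'"]) (auto simp: pv.scale_right_diff_distrib)
      fix y assume "y \<in> S"
      then obtain y' where y: "y' \<in> hpow G 3 \<beta>" "ce_diff br y' - proj2 \<beta> (ce_diff br y) \<in> rel (extpow 2 (whole s))"
        "koszul br y' - proj2 \<beta> (koszul br y) \<in> rel (kill s br)" unfolding S_def by blast
      show "x + y \<in> S"
        using er(2)[OF x(2) y(2)] kr(2)[OF x(3) y(3)] pv.subspace_add[OF hpow_sub x(1) y(1)]
        by (intro SI[of "x' + y'"]) (auto simp: algebra_simps)
    qed
    show "r \<in> S" if "r \<in> rel (tpow 3 (whole s))" for r
    proof (rule SI[OF 0])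
      have r: "r \<in> rel (extpow 3 (whole s))" by (rule extpow_relI(1)[OF that])
      show "ce_diff br 0 - proj2 \<beta> (ce_diff br r) \<in> rel (extpow 2 (whole s))"
        using er(5)[OF proj2_ext[OF ce_diff_ext3[OF r]]] by simp
      show "koszul br 0 - proj2 \<beta> (koszul br r) \<in> rel (kill s br)"
        using kr(5)[OF proj2_kill[OF koszul_ext3[OF r]]] by simp
    qed
    fix x y z \<gamma> \<delta> \<epsilon> assume h: "x \<in> G \<gamma>" "y \<in> G \<delta>" "z \<in> G \<epsilon>"
    note t = extpow_relI(1)[of _ 2 "whole s"] sympow_kill[OF sympow_relI(1)]
    note h1 = G_bracket[OF h(1,2)] G_bracket[OF h(1,3)] G_bracket[OF h(2,3)]
    have eq: "\<gamma> + \<delta> + \<epsilon> = \<beta> \<longleftrightarrow> \<gamma> + (\<delta> + \<epsilon>) = \<beta>" "\<gamma> + \<epsilon> + \<delta> = \<beta> \<longleftrightarrow> \<gamma> + (\<delta> + \<epsilon>) = \<beta>"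
      "\<delta> + \<epsilon> + \<gamma> = \<beta> \<longleftrightarrow> \<gamma> + (\<delta> + \<epsilon>) = \<beta>" by (simp_all add: ac_simps)
    show "pure [x, y, z] \<in> S"
    proof (cases "\<gamma> + (\<delta> + \<epsilon>) = \<beta>")
      case True
      note p = proj2_homogeneous_rel(1)[of _ _ _ _ \<beta>]
      note e = p[OF h1(1) h(3), unfolded eq, OF True] p[OF h1(2) h(2), unfolded eq, OF True]
        p[OF h1(3) h(1), unfolded eq, OF True]
      have "(proj2 \<beta> (pure [br x y, z]) - pure [br x y, z]) - (proj2 \<beta> (pure [br x z, y]) - pure [br x z, y])
         + (proj2 \<beta> (pure [br y z, x]) - pure [br y z, x]) \<in> rel (extpow 2 (whole s))"
        by (intro er(2,4) e[THEN t(1)])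
      moreover have "- (proj2 \<beta> (pure [x, br y z]) - pure [x, br y z]) \<in> rel (kill s br)"
        using True by (intro kr(5) t(2) p[OF h(1) h1(3)])
      ultimately show ?thesis using hpowI(2)[OF h True]
        by (intro SI[of "pure [x, y, z]"]) (auto simp: algebra_simps)
    next
      case False
      note p = proj2_homogeneous_rel(2)[of _ _ _ _ \<beta>]
      note e = p[OF h1(1) h(3), unfolded eq, OF False] p[OF h1(2) h(2), unfolded eq, OF False]
        p[OF h1(3) h(1), unfolded eq, OF False]
      have "proj2 \<beta> (pure [br x y, z]) - proj2 \<beta> (pure [br x z, y])
         + proj2 \<beta> (pure [br y z, x]) \<in> rel (extpow 2 (whole s))"
        by (intro er(2,4) e[THEN t(1)])
      moreover have "- proj2 \<beta> (pure [x, br y z]) \<in> rel (kill s br)"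
        using False by (intro kr(5) t(2) p[OF h(1) h1(3)])
      ultimately show ?thesis
        by (intro SI[OF 0]) (auto simp: algebra_simps)
    qed
  qed
  then show ?thesis using that unfolding S_def by blast
qed

end

subsection \<open>Vanishing of the symmetric square of the first homology\<close>

text \<open>
  If neither \<open>x\<close> nor \<open>y\<close> were in \<open>[l, l]\<close>, some functional \<open>f\<close> on \<open>l/[l, l]\<close> would satisfy
  \<open>f x \<noteq> 0 \<noteq> f y\<close>, and the symmetric form \<open>f \<otimes> f\<close> would not vanish at \<open>x \<odot> y\<close>.
\<close>

lemma S2_H1_zero:
  assumes Z: "is_zero_space (S2_H1 s br G \<beta>)" and x: "x \<in> G \<gamma>" and y: "y \<in> G \<delta>" and b: "\<gamma> + \<delta> = \<beta>"
  shows "x \<in> span {br u v |u v. True} \<or> y \<in> span {br u v |u v. True}"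
proof (rule ccontr)
  let ?R = "span {br u v |u v. True}"
  let ?H = "homology 1 (whole s) br"
  assume "\<not> ?thesis"
  then have n: "x \<notin> ?R" "y \<notin> ?R" by auto
  obtain f where f: "Vector_Spaces.linear s ((*) :: 'k \<Rightarrow> 'k \<Rightarrow> 'k) f" "\<And>r. r \<in> ?R \<Longrightarrow> f r = 0" "f x \<noteq> 0"
    by (rule ex_separating_functional[OF vs subspace_span n(1)]) (rule that)
  obtain g where g: "Vector_Spaces.linear s ((*) :: 'k \<Rightarrow> 'k \<Rightarrow> 'k) g" "\<And>r. r \<in> ?R \<Longrightarrow> g r = 0" "g y \<noteq> 0"
    by (rule ex_separating_functional[OF vs subspace_span n(2)]) (rule that)
  \<comment> \<open>One of \<open>f\<close>, \<open>g\<close> and \<open>f + g\<close> is nonzero at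
    both points: if \<open>f y = 0\<close> and \<open>g x = 0\<close>, the sum takes the values
    \<open>f x\<close> and \<open>g y\<close>.\<close>
  have "\<exists>h. Vector_Spaces.linear s ((*) :: 'k \<Rightarrow> 'k \<Rightarrow> 'k) h \<and> (\<forall>r\<in>?R. h r = 0) \<and> h x \<noteq> 0 \<and> h y \<noteq> 0"
  proof (cases "f y = 0")
    case True
    show ?thesis
    proof (cases "g x = 0")
      case gx: True
      have "Vector_Spaces.linear s ((*) :: 'k \<Rightarrow> 'k \<Rightarrow> 'k) (\<lambda>x. f x + g x)"
        using f(1) g(1) by (simp add: Vector_Spaces.linear_iff algebra_simps)
      then show ?thesis using f g True gx by (intro exI[of _ "\<lambda>x. f x + g x"]) simp
    qed (use g in blast)
  qed (use f in blast)
  then obtain h where h: "Vector_Spaces.linear s ((*) :: 'k \<Rightarrow> 'k \<Rightarrow> 'k) h" "\<And>r. r \<in> ?R \<Longrightarrow> h r = 0" "h x \<noteq> 0" "h y \<noteq> 0"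
    by blast
  interpret k: vector_space "(*) :: 'k \<Rightarrow> 'k \<Rightarrow> 'k" by unfold_locales (simp_all add: algebra_simps)
  note hl = linear_simps[OF h(1)]
  \<comment> \<open>\<open>H\<close> is \<open>h\<close> viewed on one-element lists, the
    representatives of the first homology; \<open>P\<close> below is the symmetric form
    \<open>h \<otimes> h\<close>.\<close>
  define H where "H = lift ((*) :: 'k \<Rightarrow> 'k \<Rightarrow> 'k) (\<lambda>xs :: 'l list. h (xs ! 0))"
  have Hl: "Vector_Spaces.linear pscale (*) H" unfolding H_def by (rule linear_lift[OF k.vector_space_axioms])
  note Hs = linear_simps[OF Hl]
  have Hp: "H (pure xs) = h (xs ! 0)" for xs unfolding H_def by (rule lift_pure[OF k.vector_space_axioms])
  define P where "P = lift ((*) :: 'k \<Rightarrow> 'k \<Rightarrow> 'k) (\<lambda>ps. H (ps ! 0) * H (ps ! 1))"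
  have Pl: "Vector_Spaces.linear pscale (*) P" unfolding P_def by (rule linear_lift[OF k.vector_space_axioms])
  have Pp: "P (pure ps) = H (ps ! 0) * H (ps ! 1)" for ps unfolding P_def by (rule lift_pure[OF k.vector_space_axioms])
  have e1: "H r = 0" if "r \<in> rel (extpow 1 (whole s))" for r
  proof -
    have "H r \<in> {0}"
    proof (rule extpow_rel_induct[OF Hl k.subspace_single_0 that])
      show "H t \<in> {0}" if "t \<in> rel (tpow 1 (whole s))" for t
        by (rule tpow_rel_induct[OF Hl k.subspace_single_0 that]; unfold split1) (auto simp: Hp hl)
    qed (auto simp: length1)
    then show ?thesis by simp
  qed
  have e2: "H (ce_diff br w) = 0" if "w \<in> carr (extpow (Suc 1) (whole s))" for w
  proof -
    have w: "w \<in> carr (tpow 2 (whole s))" using that by (simp add: numeral_2_eq_2)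
    have "H (ce_diff br w) \<in> {0}"
      by (rule tpow_carr_induct[OF linear_compose[OF linear_ce_diff Hl] k.subspace_single_0 w])
        (use h(2)[OF span_base] in \<open>force simp: length2 Hs Hp\<close>)
    then show ?thesis by simp
  qed
  have Hrel: "H r = 0" if "r \<in> rel ?H" for r
    using that e1 e2 by (auto simp: homology_def Hs)
  have Psym: "P t = 0" if "t \<in> rel (sympow 2 ?H)" for t
  proof -
    have scl: "scl ?H = pscale" by (simp add: homology_def)
    have "P t \<in> {0}"
    proof (rule sympow2_rel_induct[OF Pl k.subspace_single_0 that])
      fix x y z :: "'l list \<Rightarrow>\<^sub>0 'k" and c :: 'k
      have P2: "P (pure [p, q]) = H p * H q" for p q by (simp add: Pp)
      show "P (pure [x + y, z]) - P (pure [x, z]) - P (pure [y, z]) \<in> {0}"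
        "P (pure [z, x + y]) - P (pure [z, x]) - P (pure [z, y]) \<in> {0}"
        unfolding P2 Hs by (simp_all add: ring_distribs)
      show "P (pure [scl ?H c x, z]) - c * P (pure [x, z]) \<in> {0}"
        "P (pure [z, scl ?H c x]) - c * P (pure [z, x]) \<in> {0}"
        "P (pure [x, y]) - P (pure [y, x]) \<in> {0}"
        unfolding P2 scl Hs by simp_all
      show "P (pure [x, z]) \<in> {0}" "P (pure [z, x]) \<in> {0}" if "x \<in> rel ?H"
        unfolding P2 Hrel[OF that] by simp_all
    qed
    then show ?thesis by simp
  qed
  let ?S = "S2_H1 s br G \<beta>"
  let ?K = "\<lambda>\<gamma>. carr (hcomp ?H (hpow G 1 \<gamma>))"
  have z0: "0 \<in> rel ?H"
  proof -
    have "0 = ce_diff br (0 :: 'l list \<Rightarrow>\<^sub>0 'k) + 0" by simp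
    moreover have "(0 :: 'l list \<Rightarrow>\<^sub>0 'k) \<in> carr (extpow (Suc 1) (whole s))" "(0 :: 'l list \<Rightarrow>\<^sub>0 'k) \<in> rel (extpow 1 (whole s))"
      using carr_facts(1)[OF wf_ext] rel_facts(1)[OF wf_ext] by blast+
    ultimately show ?thesis unfolding homology_def by force
  qed
  have hx: "pure [x] \<in> carr ?H" "pure [x] \<in> ?K \<gamma>" if "x \<in> G \<gamma>" for x \<gamma>
  proof -
    have "ce_diff br (pure [x]) = (0 :: 'l list \<Rightarrow>\<^sub>0 'k)"
      by (auto simp: ce_diff_def intro!: sum.neutral)
    then show 1: "pure [x] \<in> carr ?H"
      using rel_facts(1)[OF wf_ext] by (simp add: homology_def)
    have "pure [x] \<in> hpow G 1 \<gamma>" unfolding hpow_def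
      using that by (intro pv.span_base) (auto intro!: exI[of _ "[\<gamma>]"])
    then have "pure [x] = pure [x] + 0 \<and> pure [x] \<in> hpow G 1 \<gamma> \<inter> carr ?H \<and> 0 \<in> rel ?H" using 1 z0 by simp
    then show "pure [x] \<in> ?K \<gamma>" unfolding hcomp_simps by blast
  qed
  let ?p = "pure [pure [x], pure [y]] :: ('l list \<Rightarrow>\<^sub>0 'k) list \<Rightarrow>\<^sub>0 'k"
  have c1: "?p \<in> hpow ?K 2 \<beta>"
  proof -
    have "list_all2 (\<lambda>x \<gamma>. x \<in> ?K \<gamma>) [pure [x], pure [y]] [\<gamma>, \<delta>] \<and> sum_list [\<gamma>, \<delta>] = \<beta>"
      using hx(2)[OF x] hx(2)[OF y] b by (simp only: list_all2_Cons list_all2_Nil sum_list.Cons sum_list.Nil add_0_right simp_thms)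
    then show ?thesis unfolding hpow_def[of ?K]
      by (intro pv.span_base CollectI exI[of _ "[pure [x], pure [y]]"] exI[of _ "[\<gamma>, \<delta>]"]) (simp only: list.size add_0 simp_thms numeral_2_eq_2 One_nat_def add_Suc_right add_0_right)
  qed
  have c2: "?p \<in> carr (sympow 2 ?H)"
    unfolding pow_carr using hx(1)[OF x] hx(1)[OF y] by (intro tpow_carr_pure) auto
  have c0: "0 \<in> rel (sympow 2 ?H)" unfolding sympow_rel by (rule pv.span_zero)
  then have "?p \<in> carr ?S" unfolding S2_H1_def hcomp_simps using c1 c2
    by (intro CollectI exI[of _ ?p] exI[of _ 0]) simp
  then have "cls ?S ?p \<in> {rel ?S}" using Z unfolding is_zero_space_def elts_def by blast
  moreover have "?p \<in> cls ?S ?p" using c0 by (simp add: cls_def S2_H1_def)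
  ultimately have "?p \<in> rel ?S" by simp
  then have "P ?p = 0" using Psym by (simp add: S2_H1_def)
  then show False using h(3,4) by (simp add: Pp Hp)
qed

text \<open>The form in which the hypothesis on \<open>S\<^sup>2(H\<^sub>1)\<close> is used: a
  bilinear condition on a homogeneous pair of total degree \<beta> needs checking only when one
  entry is a bracket.\<close>

lemma degree_induct:
  assumes Z: "is_zero_space (S2_H1 s br G \<beta>)" and x: "x \<in> G \<gamma>" and y: "y \<in> G \<delta>" and b: "\<gamma> + \<delta> = \<beta>"
    and br: "\<And>u v y. P (br u v) y" "\<And>u v x. P x (br u v)"
    and zero: "\<And>x. P 0 x" "\<And>x. P x 0"
    and add: "\<And>x x' y. P x y \<Longrightarrow> P x' y \<Longrightarrow> P (x + x') y" "\<And>x x' y. P y x \<Longrightarrow> P y x' \<Longrightarrow> P y (x + x')"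
    and scale: "\<And>c x y. P x y \<Longrightarrow> P (s c x) y" "\<And>c x y. P y x \<Longrightarrow> P y (s c x)"
  shows "P x y"
  using S2_H1_zero[OF assms(1-4)]
proof
  assume "x \<in> span {br u v |u v. True}"
  then show ?thesis
    by (induction rule: span_induct_alt) (use br zero add scale in auto)
next
  assume "y \<in> span {br u v |u v. True}"
  then show ?thesis
    by (induction rule: span_induct_alt) (use br zero add scale in auto)
qed

end

subsection \<open>Multilinear extension\<close>

definition lift2 :: "('a \<Rightarrow> 'x \<Rightarrow> 'b \<Rightarrow> 'y \<Rightarrow> ('z \<Rightarrow>\<^sub>0 'k)) \<Rightarrow> ('a \<times> 'x \<Rightarrow>\<^sub>0 'k::field) \<Rightarrow> ('b \<times> 'y \<Rightarrow>\<^sub>0 'k) \<Rightarrow> ('z \<Rightarrow>\<^sub>0 'k)" where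
  "lift2 f p q = lift pscale (\<lambda>u. lift pscale (\<lambda>v. f (fst u) (snd u) (fst v) (snd v)) q) p"

lemma lift2_simps [simp]:
  "lift2 f (p + p') q = lift2 f p q + lift2 f p' q" "lift2 f p (q + q') = lift2 f p q + lift2 f p q'"
  "lift2 f (p - p') q = lift2 f p q - lift2 f p' q" "lift2 f p (q - q') = lift2 f p q - lift2 f p q'"
  "lift2 f (- p) q = - lift2 f p q" "lift2 f p (- q) = - lift2 f p q"
  "lift2 f (pscale c p) q = pscale c (lift2 f p q)" "lift2 f p (pscale c q) = pscale c (lift2 f p q)"
  "lift2 f (pure (a, x)) (pure (b, y)) = f a x b y"
  by (simp_all add: lift2_def plift_fun_add plift_fun_diff plift_fun_neg plift_fun_scale)

lemma lift2_case: "lift pscale (\<lambda>(a, x). lift pscale (\<lambda>(b, y). f a x b y) q) p = lift2 f p q"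
  by (simp add: lift2_def case_prod_unfold)

definition blift :: "('x \<Rightarrow> 'y \<Rightarrow> ('z \<Rightarrow>\<^sub>0 'k)) \<Rightarrow> ('x \<Rightarrow>\<^sub>0 'k::field) \<Rightarrow> ('y \<Rightarrow>\<^sub>0 'k) \<Rightarrow> ('z \<Rightarrow>\<^sub>0 'k)" where
  "blift f p q = lift pscale (\<lambda>u. lift pscale (\<lambda>v. f u v) q) p"

lemma blift_simps [simp]:
  "blift f (p + p') q = blift f p q + blift f p' q" "blift f p (q + q') = blift f p q + blift f p q'"
  "blift f (p - p') q = blift f p q - blift f p' q" "blift f p (q - q') = blift f p q - blift f p q'"
  "blift f (- p) q = - blift f p q" "blift f p (- q) = - blift f p q"
  "blift f (pscale c p) q = pscale c (blift f p q)" "blift f p (pscale c q) = pscale c (blift f p q)"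
  "blift f (pure x) (pure y) = f x y"
  by (simp_all add: blift_def plift_fun_add plift_fun_diff plift_fun_neg plift_fun_scale)

lemma pure_induct:
  assumes "Vector_Spaces.linear pscale s F" "module.subspace s R" "\<And>x. F (pure x) \<in> R"
  shows "F p \<in> R"
  by (rule linear_span_in[OF assms(1,2), of "range pure"]) (use assms(3) span_pure_UNIV in auto)

lemma homology2_rel: "rel (homology 2 V b) = {ce_diff b w + r |w r. w \<in> carr (tpow 3 V) \<and> r \<in> rel (extpow 2 V)}"
proof -
  have "Suc 2 = (3::nat)" by simp
  then show ?thesis by (simp only: homology_def subquot.simps pow_carr)
qed

text \<open>\<open>unwedge\<close> and \<open>unproj\<close> are sections of \<open>wedge_sym\<close> and \<open>proj_rep\<close> modulo relations.\<close>

definition wedge_sym :: "(('a \<times> 'l \<Rightarrow>\<^sub>0 'k::field) list \<Rightarrow>\<^sub>0 'k) \<Rightarrow> (('a list \<Rightarrow>\<^sub>0 'k) \<times> ('l list \<Rightarrow>\<^sub>0 'k) \<Rightarrow>\<^sub>0 'k)" where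
  "wedge_sym = lift pscale (\<lambda>ps. lift2 (\<lambda>a x b y. pure (pure [a, b], pure [x, y])) (ps ! 0) (ps ! 1))"

definition unwedge :: "(('a list \<Rightarrow>\<^sub>0 'k) \<times> ('l list \<Rightarrow>\<^sub>0 'k) \<Rightarrow>\<^sub>0 'k) \<Rightarrow> (('a \<times> 'l \<Rightarrow>\<^sub>0 'k::field) list \<Rightarrow>\<^sub>0 'k)" where
  "unwedge = lift pscale (\<lambda>t. blift (\<lambda>as xs. pscale (inverse 2)
     (pure [pure (as ! 0, xs ! 0), pure (as ! 1, xs ! 1)] + pure [pure (as ! 0, xs ! 1), pure (as ! 1, xs ! 0)]))
     (fst t) (snd t))"

definition unproj :: "('a::one \<times> ('l list \<Rightarrow>\<^sub>0 'k) \<Rightarrow>\<^sub>0 'k) \<Rightarrow> (('a \<times> 'l \<Rightarrow>\<^sub>0 'k::field) list \<Rightarrow>\<^sub>0 'k)" where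
  "unproj = lift pscale (\<lambda>t. lift pscale (\<lambda>xs. pscale (inverse 2)
     (pure [pure (fst t, xs ! 0), pure (1, xs ! 1)] - pure [pure (fst t, xs ! 1), pure (1, xs ! 0)])) (snd t))"

lemma linear_maps:
  "Vector_Spaces.linear pscale pscale wedge_sym" "Vector_Spaces.linear pscale pscale unwedge"
  "Vector_Spaces.linear pscale pscale unproj" "Vector_Spaces.linear pscale pscale proj_rep"
  by (simp_all add: wedge_sym_def unwedge_def unproj_def proj_rep_def linear_plift)

lemmas wedge_sym_simps [simp] = linear_simps[OF linear_maps(1)]
lemmas unwedge_simps [simp] = linear_simps[OF linear_maps(2)]
lemmas unproj_simps [simp] = linear_simps[OF linear_maps(3)]
lemmas proj_rep_simps [simp] = linear_simps[OF linear_maps(4)]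

lemma wedge_sym_pure [simp]: "wedge_sym (pure [p, q]) = lift2 (\<lambda>a x b y. pure (pure [a, b], pure [x, y])) p q"
  by (simp add: wedge_sym_def)

lemma proj_rep_pure [simp]: "proj_rep (pure [p, q]) = lift2 (\<lambda>a x b y. pure (a * b, pure [x, y])) p q"
  by (simp add: proj_rep_def lift2_case)

lemma cur_br_eq: "cur_br br p q = lift2 (\<lambda>a x b y. pure (a * b, br x y)) p q"
  by (simp add: cur_br_def lift2_case)

lemma unwedge_pure: "unwedge (pure (\<alpha>, \<xi>)) = blift (\<lambda>as xs. pscale (inverse 2)
     (pure [pure (as ! 0, xs ! 0), pure (as ! 1, xs ! 1)] + pure [pure (as ! 0, xs ! 1), pure (as ! 1, xs ! 0)])) \<alpha> \<xi>"
  by (simp add: unwedge_def)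

lemma unproj_pure: "unproj (pure (a, \<xi>)) = lift pscale (\<lambda>xs. pscale (inverse 2)
     (pure [pure (a, xs ! 0), pure (1, xs ! 1)] - pure [pure (a, xs ! 1), pure (1, xs ! 0)])) \<xi>"
  by (simp add: unproj_def)

section \<open>The current algebra, its boundaries, and the Hochschild and cyclic homology of the
  coefficients\<close>

locale current = A: comm_unital_algebra sA + L: graded_lie_algebra sL br G
  for sA :: "'k::field \<Rightarrow> 'a::{comm_ring, comm_monoid_mult} \<Rightarrow> 'a"
    and sL :: "'k \<Rightarrow> 'l::ab_group_add \<Rightarrow> 'l"
    and br :: "'l \<Rightarrow> 'l \<Rightarrow> 'l" and G :: "'b::ab_group_add \<Rightarrow> 'l set" +
  fixes \<beta> :: 'b
  assumes two: "(2::'k) \<noteq> 0" and S2_zero: "is_zero_space (S2_H1 sL br G \<beta>)"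
begin

abbreviation "\<AA> \<equiv> whole sA"
abbreviation "\<LL> \<equiv> whole sL"
abbreviation "\<CC> \<equiv> cur sA sL"
abbreviation "cbr \<equiv> cur_br br"
abbreviation "\<BB> \<equiv> rel (homology 2 \<CC> cbr)"
abbreviation D2 :: "('l list \<Rightarrow>\<^sub>0 'k) set" where "D2 \<equiv> hpow G 2 \<beta>"
abbreviation "Kb \<equiv> hcomp (kill sL br) D2"

lemma wf_A: "wf_subquot \<AA>"
  by (rule wf_whole) unfold_locales

lemma wf_C: "wf_subquot \<CC>"
  unfolding cur_def by (intro wf_tensor wf_A L.wf_L)

lemma carr_C [simp]: "carr \<CC> = UNIV"
proof -
  have "range pure \<subseteq> {pure (x, y) |x y. x \<in> carr (whole sA) \<and> y \<in> carr (whole sL)}" by auto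
  from pv.span_mono[OF this] show ?thesis by (auto simp: cur_def tensor_def span_pure_UNIV)
qed

lemma scl_C [simp]: "scl \<CC> = pscale"
  by (simp add: cur_def)

lemma pure_C [simp]: "length ps = n \<Longrightarrow> pure ps \<in> carr (tpow n \<CC>)"
  by (rule tpow_carr_pure) auto

lemma rel_C: "pure (a + a', x) - pure (a, x) - pure (a', x) \<in> rel \<CC>"
  "pure (a, x + x') - pure (a, x) - pure (a, x') \<in> rel \<CC>"
  "pure (sA c a, x) - pscale c (pure (a, x)) \<in> rel \<CC>"
  "pure (a, sL c x) - pscale c (pure (a, x)) \<in> rel \<CC>"
  unfolding cur_def using tensor_relI(1-4)[where V = \<AA> and W = \<LL>] by simp_all

lemma B_sub: "pv.subspace \<BB>"
  unfolding homology2_rel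
  using wf_tpow[OF wf_C, of 3] wf_extpow[OF wf_C, of 2]
  by (intro subspace_image_sum[OF linear_ce_diff]) (simp_all add: wf_subquot_def)

lemma B_ext: "r \<in> rel (extpow 2 \<CC>) \<Longrightarrow> r \<in> \<BB>"
  unfolding homology2_rel using carr_facts(1)[OF wf_tpow[OF wf_C, of 3]]
  by (intro CollectI exI[of _ 0] exI[of _ r]) simp

lemma B_diff: "w \<in> carr (tpow 3 \<CC>) \<Longrightarrow> ce_diff cbr w \<in> \<BB>"
  unfolding homology2_rel using rel_facts(1)[OF wf_extpow[OF wf_C, of 2]]
  by (intro CollectI exI[of _ w] exI[of _ 0]) simp

definition T0_map :: "('a list \<Rightarrow>\<^sub>0 'k) \<Rightarrow> ('a list \<Rightarrow>\<^sub>0 'k)" where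
  "T0_map = lift pscale (\<lambda>as. let a = as ! 0; b = as ! 1; c = as ! 2 in
        pure [a * b, c] + pure [b * c, a] + pure [c * a, b] - pure [a * b * c, 1])"

definition T_map :: "('a list \<Rightarrow>\<^sub>0 'k) \<Rightarrow> ('a list \<Rightarrow>\<^sub>0 'k)" where
  "T_map = lift pscale (\<lambda>as. let a = as ! 0; b = as ! 1; c = as ! 2 in
        pure [a * b, c] + pure [b * c, a] + pure [c * a, b])"

lemma linear_T: "Vector_Spaces.linear pscale pscale T0_map" "Vector_Spaces.linear pscale pscale T_map"
  by (simp_all add: T0_map_def T_map_def linear_plift)

lemma T0_pure [simp]: "T0_map (pure [a, b, c]) = pure [a * b, c] + pure [b * c, a] + pure [c * a, b] - pure [a * b * c, 1]"
  by (simp add: T0_map_def)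

lemma T_pure [simp]: "T_map (pure [a, b, c]) = pure [a * b, c] + pure [b * c, a] + pure [c * a, b]"
  by (simp add: T_map_def)

lemma HH1_eq: "HH1 sA = coker T0_map (tpow 3 \<AA>) (extpow 2 \<AA>)"
  by (simp add: HH1_def T0_map_def)

lemma HC1_eq: "HC1 sA = coker T_map (tpow 3 \<AA>) (extpow 2 \<AA>)"
  by (simp add: HC1_def T_map_def)

lemma pure_A [simp]: "length xs = n \<Longrightarrow> pure xs \<in> carr (tpow n \<AA>)"
  by (rule tpow_carr_pure) auto

lemma subspace_tpow_A: "pv.subspace (carr (tpow n \<AA>))"
  using wf_tpow[OF wf_A, of n] by (simp add: wf_subquot_def)

lemma T_carr: "x \<in> carr (tpow 3 \<AA>) \<Longrightarrow> T0_map x \<in> carr (tpow 2 \<AA>)"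
  "x \<in> carr (tpow 3 \<AA>) \<Longrightarrow> T_map x \<in> carr (tpow 2 \<AA>)"
  by (erule tpow_carr_induct[OF linear_T(1) subspace_tpow_A]
        tpow_carr_induct[OF linear_T(2) subspace_tpow_A];
      auto simp: length3 intro!: pv.subspace_add[OF subspace_tpow_A] pv.subspace_diff[OF subspace_tpow_A])+

lemma wf_HH1: "wf_subquot (HH1 sA)" and wf_HC1: "wf_subquot (HC1 sA)"
  unfolding HH1_eq HC1_eq using T_carr
  by (auto intro!: wf_coker wf_extpow wf_A linear_T subspace_tpow_A)

lemma HH1_simps [simp]: "scl (HH1 sA) = pscale" "carr (HH1 sA) = carr (tpow 2 \<AA>)"
  "scl (HC1 sA) = pscale" "carr (HC1 sA) = carr (tpow 2 \<AA>)"
  by (simp_all add: HH1_eq HC1_eq)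

lemma wf_Kb: "wf_subquot Kb"
  using L.wf_kill L.hpow_sub by (intro wf_hcomp) (auto simp: wf_subquot_def)

lemma cur_grading_induct:
  assumes "Vector_Spaces.linear pscale s F" "module.subspace s R" "p \<in> cur_grading sA sL G \<gamma>"
    "\<And>a x. x \<in> G \<gamma> \<Longrightarrow> F (pure (a, x)) \<in> R"
  shows "F p \<in> R"
  by (rule tensor_carr_induct[OF assms(1,2) assms(3)[unfolded cur_grading_def]]) (use assms(4) in auto)

subsection \<open>Relations modulo boundaries of the current algebra\<close>

context
  fixes \<pi> :: "(('a \<times> 'l \<Rightarrow>\<^sub>0 'k) list \<Rightarrow>\<^sub>0 'k) \<Rightarrow> (('a \<times> 'l \<Rightarrow>\<^sub>0 'k) list \<Rightarrow>\<^sub>0 'k)"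
  assumes \<pi>: "Vector_Spaces.linear pscale pscale \<pi>" and ker: "\<And>r. r \<in> \<BB> \<Longrightarrow> \<pi> r = 0"
  notes \<pi>_simps [simp] = linear_simps[OF \<pi>]
begin

lemma V_bilinear:
  "\<pi> (pure [p + p', q]) = \<pi> (pure [p, q]) + \<pi> (pure [p', q])"
  "\<pi> (pure [q, p + p']) = \<pi> (pure [q, p]) + \<pi> (pure [q, p'])"
  "\<pi> (pure [pscale c p, q]) = pscale c (\<pi> (pure [p, q]))"
  "\<pi> (pure [q, pscale c p]) = pscale c (\<pi> (pure [q, p]))"
  "r \<in> rel \<CC> \<Longrightarrow> \<pi> (pure [r, q]) = 0" "r \<in> rel \<CC> \<Longrightarrow> \<pi> (pure [q, r]) = 0"
  "\<pi> (pure [q, q]) = 0"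
proof -
  note tp = tpow2I[where V = \<CC>, simplified, THEN extpow_relI(1), THEN B_ext, THEN ker]
  show "\<pi> (pure [p + p', q]) = \<pi> (pure [p, q]) + \<pi> (pure [p', q])"
    using tp(1)[of p p' q] by (simp add: algebra_simps)
  show "\<pi> (pure [q, p + p']) = \<pi> (pure [q, p]) + \<pi> (pure [q, p'])"
    using tp(2)[of q p p'] by (simp add: algebra_simps)
  show "\<pi> (pure [pscale c p, q]) = pscale c (\<pi> (pure [p, q]))" using tp(3)[of c p q] by simp
  show "\<pi> (pure [q, pscale c p]) = pscale c (\<pi> (pure [q, p]))" using tp(4)[of q c p] by simp
  show "\<pi> (pure [r, q]) = 0" "\<pi> (pure [q, r]) = 0" if "r \<in> rel \<CC>" using tp(5,6)[OF that] by simp_all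
  show "\<pi> (pure [q, q]) = 0" by (rule ker[OF B_ext[OF extpow_relI(2)]]) auto
qed

lemma V_diff:
  "\<pi> (pure [p - p', q]) = \<pi> (pure [p, q]) - \<pi> (pure [p', q])"
  "\<pi> (pure [q, p - p']) = \<pi> (pure [q, p]) - \<pi> (pure [q, p'])"
  using V_bilinear(1)[of "p - p'" p' q] V_bilinear(2)[of q "p - p'" p'] by simp_all

lemma V_skew: "\<pi> (pure [p, q]) = - \<pi> (pure [q, p])"
proof -
  have "\<pi> (pure [p + q, p + q]) = \<pi> (pure [p, p]) + \<pi> (pure [q, p]) + (\<pi> (pure [p, q]) + \<pi> (pure [q, q]))"
    by (simp only: V_bilinear(1,2))
  then have "\<pi> (pure [p, q]) + \<pi> (pure [q, p]) = 0" by (simp add: V_bilinear(7) add.commute)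
  then show ?thesis by (simp only: eq_neg_iff_add_eq_0)
qed

definition W :: "'a \<Rightarrow> 'l \<Rightarrow> 'a \<Rightarrow> 'l \<Rightarrow> (('a \<times> 'l \<Rightarrow>\<^sub>0 'k) list \<Rightarrow>\<^sub>0 'k)" where
  "W a x b y = \<pi> (pure [pure (a, x), pure (b, y)])"

lemma W_linear:
  "W (a + a') x b y = W a x b y + W a' x b y" "W a x (b + b') y = W a x b y + W a x b' y"
  "W a (x + x') b y = W a x b y + W a x' b y" "W a x b (y + y') = W a x b y + W a x b y'"
  "W (sA c a) x b y = pscale c (W a x b y)" "W a x (sA c b) y = pscale c (W a x b y)"
  "W a (sL c x) b y = pscale c (W a x b y)" "W a x b (sL c y) = pscale c (W a x b y)"
  unfolding W_def
  using V_bilinear(5)[OF rel_C(1)[of a a' x], of "pure (b, y)"] V_bilinear(6)[OF rel_C(1)[of b b' y], of "pure (a, x)"]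
    V_bilinear(5)[OF rel_C(2)[of a x x'], of "pure (b, y)"] V_bilinear(6)[OF rel_C(2)[of b y y'], of "pure (a, x)"]
    V_bilinear(5)[OF rel_C(3)[of c a x], of "pure (b, y)"] V_bilinear(6)[OF rel_C(3)[of c b y], of "pure (a, x)"]
    V_bilinear(5)[OF rel_C(4)[of a c x], of "pure (b, y)"] V_bilinear(6)[OF rel_C(4)[of b c y], of "pure (a, x)"]
  by (simp_all add: V_diff V_bilinear(3,4) diff_eq_eq add.commute)

lemma W_zero: "W 0 x b y = 0" "W a 0 b y = 0" "W a x 0 y = 0" "W a x b 0 = 0"
  using W_linear(5)[of 0 0 x b y] W_linear(6)[of a x 0 0 y] W_linear(7)[of a 0 0 b y] W_linear(8)[of a x b 0 0]
  by simp_all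

lemma W_minus: "W a (- x) b y = - W a x b y" "W a x b (- y) = - W a x b y"
  using W_linear(3)[of a "- x" x b y] W_linear(4)[of a x b "- y" y] by (simp_all add: W_zero eq_neg_iff_add_eq_0)

text \<open>Killing the boundary of \<open>(a \<otimes> x) \<and> (b \<otimes> y) \<and> (c
  \<otimes> z)\<close> is the cocycle identity, after writing \<open>[x, z]\<close> as
  \<open>- [z, x]\<close>.\<close>

lemma W_cocycle: "current_cocycle W br"
proof
  show "W b y a x = - W a x b y" for a b x y unfolding W_def by (rule V_skew)
  show "W (a * b) (br x y) c z + W (b * c) (br y z) a x + W (c * a) (br z x) b y = 0" for a b c x y z
  proof -
    have "\<pi> (ce_diff cbr (pure [pure (a, x), pure (b, y), pure (c, z)])) = 0"
      by (intro ker B_diff) simp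
    then have "- W (a * b) (br x y) c z + W (a * c) (br x z) b y - W (b * c) (br y z) a x = 0"
      by (simp add: cur_br_eq W_def)
    then have "W (a * b) (br x y) c z + W (b * c) (br y z) a x - W (c * a) (- br z x) b y = 0"
      using L.br_skew[of x z] by (simp add: mult.commute algebra_simps)
    then show ?thesis by (simp add: W_minus)
  qed
  show "w + w = 0 \<Longrightarrow> w = 0" for w :: "('a \<times> 'l \<Rightarrow>\<^sub>0 'k) list \<Rightarrow>\<^sub>0 'k" by (rule double_eq_0[OF two])
qed

interpretation W: current_cocycle W br by (rule W_cocycle)

lemma \<pi>_unwedge: "\<pi> (unwedge (pure (pure [a, b], pure [x, y]))) = pscale (inverse 2) (W.Sy a b x y)"
  by (simp add: unwedge_pure W.Sy_def W_def)

lemma \<pi>_unproj: "\<pi> (unproj (pure (a, pure [x, y]))) = pscale (inverse 2) (W.Sk a 1 x y)"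
  by (simp add: unproj_pure W.Sk_def W_def)

lemma unwedge_linear1: "Vector_Spaces.linear pscale pscale (\<lambda>\<alpha>. \<pi> (unwedge (pure (\<alpha>, \<xi>))))"
  by (simp add: plin_iff unwedge_pure)

lemma unwedge_linear2: "Vector_Spaces.linear pscale pscale (\<lambda>\<xi>. \<pi> (unwedge (pure (\<alpha>, \<xi>))))"
  by (simp add: plin_iff unwedge_pure)

lemma unproj_linear2: "Vector_Spaces.linear pscale pscale (\<lambda>\<xi>. \<pi> (unproj (pure (a, \<xi>))))"
  by (simp add: plin_iff unproj_pure)

text \<open>\<open>unwedge\<close> yields half of \<open>Sy\<close>, and the Killing relations are
  \<open>Sy_cyclic\<close> together with \<open>Sy_swap\<close>.\<close>

lemma unwedge_kill_rel:
  assumes \<alpha>: "\<alpha> \<in> carr (tpow 2 \<AA>)" and r: "r \<in> rel (kill sL br)"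
  shows "\<pi> (unwedge (pure (\<alpha>, r))) \<in> {0}"
proof (rule tpow_carr_induct[OF unwedge_linear1 pv.subspace_single_0 \<alpha>])
  fix as :: "'a list" assume "length as = 2"
  then obtain a b where as: "as = [a, b]" by (auto simp: \<pi>_unwedge \<pi>_unproj length2)
  note l = unwedge_linear2[of "pure [a, b]"]
  note ls = linear_simps[OF l]
  show "\<pi> (unwedge (pure (pure as, r))) \<in> {0}"
    unfolding as
  proof (rule coker_rel_induct[OF r[unfolded L.kill_eq] _ pv.subspace_single_0])
    fix v :: "'l list \<Rightarrow>\<^sub>0 'k" assume v: "v \<in> carr (tpow 3 \<LL>)"
    show "\<pi> (unwedge (pure (pure [a, b], L.kill_map v))) \<in> {0}"
    proof (rule tpow_carr_induct[OF linear_compose[OF L.linear_kill_map l] pv.subspace_single_0 v])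
      fix xs :: "'l list" assume "length xs = 3"
      then obtain x y z where xs: "xs = [x, y, z]" by (auto simp: length3)
      show "\<pi> (unwedge (pure (pure [a, b], L.kill_map (pure xs)))) \<in> {0}"
        unfolding xs L.kill_map3 ls \<pi>_unwedge
        using W.Sy_cyclic[of a b x y z] W.Sy_cyclic[of a b z x y] W.Sy_swap[of a b x "br y z"] by simp
    qed
  next
    fix t :: "'l list \<Rightarrow>\<^sub>0 'k" assume t: "t \<in> rel (sympow 2 \<LL>)"
    show "\<pi> (unwedge (pure (pure [a, b], t))) \<in> {0}"
      by (rule sympow2_rel_induct[OF l pv.subspace_single_0 t], unfold \<pi>_unwedge)
        (simp_all add: W.Sy_def W_linear W_zero pv.scale_right_distrib mult.commute add.commute)
  qed (simp add: l)
qed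

text \<open>The Hochschild relation for \<open>Sy\<close> is available only when an argument is a
  bracket. For fixed \<open>\<alpha>\<close> the expression is bilinear in \<open>x\<close> and
  \<open>y\<close>, so \<open>degree_induct\<close> extends the vanishing to all of degree
  \<beta>.\<close>

lemma unwedge_HH1_rel:
  assumes \<alpha>: "\<alpha> \<in> rel (HH1 sA)" and d: "d \<in> D2"
  shows "\<pi> (unwedge (pure (\<alpha>, d))) \<in> {0}"
proof (rule L.hpow2_induct[OF unwedge_linear2 pv.subspace_single_0 d])
  fix x y \<gamma> \<delta> assume h: "x \<in> G \<gamma>" "y \<in> G \<delta>" "\<gamma> + \<delta> = \<beta>"
  \<comment> \<open>Thanks to the symmetrisation in \<open>unwedge\<close>, linearity and the
    bracket case need proof for the first slot only.\<close>
  have sym: "unwedge (pure (\<alpha>, pure [x, y])) = unwedge (pure (\<alpha>, pure [y, x]))" for x y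
    by (rule linear_eq_pure[where s = pscale and F = "\<lambda>\<alpha>. unwedge (pure (\<alpha>, pure [x, y]))" and H = "\<lambda>\<alpha>. unwedge (pure (\<alpha>, pure [y, x]))"]) (simp_all add: plin_iff unwedge_pure add.commute)
  have bl: "\<pi> (unwedge (pure (\<alpha>, pure [x + x', y]))) = \<pi> (unwedge (pure (\<alpha>, pure [x, y]))) + \<pi> (unwedge (pure (\<alpha>, pure [x', y])))"
    "\<pi> (unwedge (pure (\<alpha>, pure [sL c x, y]))) = pscale c (\<pi> (unwedge (pure (\<alpha>, pure [x, y]))))" for x x' y c
  proof -
    have a: "\<alpha> \<in> carr (tpow 2 \<AA>)" using wf_sub[OF wf_HH1 \<alpha>] by simp
    have "\<pi> (unwedge (pure (\<alpha>, pure [x + x', y]))) - \<pi> (unwedge (pure (\<alpha>, pure [x, y]))) - \<pi> (unwedge (pure (\<alpha>, pure [x', y]))) \<in> {0}"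
      by (rule tpow_carr_induct[OF _ pv.subspace_single_0 a,
          where F = "\<lambda>\<alpha>. \<pi> (unwedge (pure (\<alpha>, pure [x + x', y]))) - \<pi> (unwedge (pure (\<alpha>, pure [x, y]))) - \<pi> (unwedge (pure (\<alpha>, pure [x', y])))"])
        (auto simp: \<pi>_unwedge \<pi>_unproj length2 linear_simps[OF unwedge_linear1] plin_iff pv.scale_right_diff_distrib W.Sy_def W_linear pv.scale_right_distrib)
    then show "\<pi> (unwedge (pure (\<alpha>, pure [x + x', y]))) = \<pi> (unwedge (pure (\<alpha>, pure [x, y]))) + \<pi> (unwedge (pure (\<alpha>, pure [x', y])))"
      by (simp add: algebra_simps)
    have "\<pi> (unwedge (pure (\<alpha>, pure [sL c x, y]))) - pscale c (\<pi> (unwedge (pure (\<alpha>, pure [x, y])))) \<in> {0}"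
      by (rule tpow_carr_induct[OF _ pv.subspace_single_0 a,
          where F = "\<lambda>\<alpha>. \<pi> (unwedge (pure (\<alpha>, pure [sL c x, y]))) - pscale c (\<pi> (unwedge (pure (\<alpha>, pure [x, y]))))"])
        (auto simp: \<pi>_unwedge \<pi>_unproj length2 linear_simps[OF unwedge_linear1] plin_iff pv.scale_right_diff_distrib W.Sy_def W_linear pv.scale_right_distrib mult.commute)
    then show "\<pi> (unwedge (pure (\<alpha>, pure [sL c x, y]))) = pscale c (\<pi> (unwedge (pure (\<alpha>, pure [x, y]))))" by simp
  qed
  have base: "\<pi> (unwedge (pure (\<alpha>, pure [br u v, y]))) = 0" for u v y
  proof -
    note l = unwedge_linear1[of "pure [br u v, y]"]
    note ls = linear_simps[OF l]
    have "\<pi> (unwedge (pure (\<alpha>, pure [br u v, y]))) \<in> {0}"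
    proof (rule coker_rel_induct[OF \<alpha>[unfolded HH1_eq] _ pv.subspace_single_0])
      fix w :: "'a list \<Rightarrow>\<^sub>0 'k" assume w: "w \<in> carr (tpow 3 \<AA>)"
      show "\<pi> (unwedge (pure (T0_map w, pure [br u v, y]))) \<in> {0}"
      proof (rule tpow_carr_induct[OF linear_compose[OF linear_T(1) l] pv.subspace_single_0 w])
        fix as :: "'a list" assume "length as = 3"
        then obtain a b c where as: "as = [a, b, c]" by (auto simp: length3)
        show "\<pi> (unwedge (pure (T0_map (pure as), pure [br u v, y]))) \<in> {0}"
          unfolding as T0_pure ls \<pi>_unwedge
          by (simp only: pv.scale_right_distrib[symmetric] pv.scale_right_diff_distrib[symmetric] W.Sy_hochschild) simp
      qed
    next
      fix t :: "'a list \<Rightarrow>\<^sub>0 'k" assume t: "t \<in> rel (extpow 2 \<AA>)"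
      have "W.Sy a a (br u v) y = 0" for a
        using W.Sy_skew[of a a "br u v" y] double_eq_0[OF two] by (simp only: eq_neg_iff_add_eq_0)
      then show "\<pi> (unwedge (pure (t, pure [br u v, y]))) \<in> {0}"
        by - (rule extpow2_rel_induct[OF l pv.subspace_single_0 t], unfold \<pi>_unwedge,
          simp_all add: W.Sy_def W_linear W_zero pv.scale_right_distrib mult.commute)
    qed (simp add: l)
    then show ?thesis by simp
  qed
  have z: "\<pi> (unwedge (pure (\<alpha>, pure [0, y]))) = 0" for y using bl(2)[of 0 0 y] by simp
  have "\<pi> (unwedge (pure (\<alpha>, pure [x, y]))) = 0"
  proof (rule L.degree_induct[OF S2_zero h])
    show "\<pi> (unwedge (pure (\<alpha>, pure [x, br u v]))) = 0" for u v x unfolding sym[of x] by (rule base)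
    show "\<pi> (unwedge (pure (\<alpha>, pure [x, 0]))) = 0" for x unfolding sym[of x] by (rule z)
    show "\<pi> (unwedge (pure (\<alpha>, pure [y, x + x']))) = 0"
      if "\<pi> (unwedge (pure (\<alpha>, pure [y, x]))) = 0" "\<pi> (unwedge (pure (\<alpha>, pure [y, x']))) = 0" for x x' y
      using that unfolding sym[of y] bl by simp
    show "\<pi> (unwedge (pure (\<alpha>, pure [y, sL c x]))) = 0" if "\<pi> (unwedge (pure (\<alpha>, pure [y, x]))) = 0" for c x y
      using that unfolding sym[of y] bl by simp
  qed (simp_all add: base z bl)
  then show "\<pi> (unwedge (pure (\<alpha>, pure [x, y]))) \<in> {0}" by simp
qed

lemma unwedge_rel: "t \<in> rel (tensor (HH1 sA) Kb) \<Longrightarrow> \<pi> (unwedge t) \<in> {0}"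
proof (rule tensor_rel_induct[OF linear_compose[OF linear_maps(2) \<pi>] pv.subspace_single_0])
  fix \<alpha> \<xi> assume a: "\<alpha> \<in> rel (HH1 sA)" and "\<xi> \<in> carr Kb"
  then obtain d r where "\<xi> = d + r" "d \<in> D2" "r \<in> rel (kill sL br)" by auto
  moreover have "\<alpha> \<in> carr (tpow 2 \<AA>)" using wf_sub[OF wf_HH1 a] by simp
  ultimately show "\<pi> (unwedge (pure (\<alpha>, \<xi>))) \<in> {0}"
    using unwedge_HH1_rel[OF a] unwedge_kill_rel by (simp add: linear_simps[OF unwedge_linear2])
next
  fix \<alpha> \<xi> assume "\<alpha> \<in> carr (HH1 sA)" "\<xi> \<in> rel Kb"
  then show "\<pi> (unwedge (pure (\<alpha>, \<xi>))) \<in> {0}" using unwedge_kill_rel by simp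
qed (simp_all add: linear_simps[OF unwedge_linear2] linear_simps[OF unwedge_linear1])

text \<open>In contrast to \<open>unwedge\<close>, no degree restriction occurs: bilinearity of
  \<open>W\<close> and the skewness of \<open>Sk\<close> in \<open>x\<close> and \<open>y\<close>
  suffice.\<close>

lemma unproj_rel: "t \<in> rel (tensor \<AA> (extpow 2 \<LL>)) \<Longrightarrow> \<pi> (unproj t) \<in> {0}"
proof (rule tensor_rel_induct[OF linear_compose[OF linear_maps(3) \<pi>] pv.subspace_single_0])
  fix a a' \<xi> and c :: 'k assume \<xi>: "\<xi> \<in> carr (extpow 2 \<LL>)"
  then have \<xi>: "\<xi> \<in> carr (tpow 2 \<LL>)" by simp
  note ls = linear_simps[OF unproj_linear2]
  show "\<pi> (unproj (pure (a + a', \<xi>))) - \<pi> (unproj (pure (a, \<xi>))) - \<pi> (unproj (pure (a', \<xi>))) \<in> {0}"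
    by (rule tpow_carr_induct[OF _ pv.subspace_single_0 \<xi>, where F = "\<lambda>\<xi>. \<pi> (unproj (pure (a + a', \<xi>))) - \<pi> (unproj (pure (a, \<xi>))) - \<pi> (unproj (pure (a', \<xi>)))"])
      (auto simp: \<pi>_unwedge \<pi>_unproj length2 ls plin_iff pv.scale_right_diff_distrib W.Sk_def W_linear pv.scale_right_distrib)
  show "\<pi> (unproj (pure (scl \<AA> c a, \<xi>))) - pscale c (\<pi> (unproj (pure (a, \<xi>)))) \<in> {0}"
    by (rule tpow_carr_induct[OF _ pv.subspace_single_0 \<xi>, where F = "\<lambda>\<xi>. \<pi> (unproj (pure (scl \<AA> c a, \<xi>))) - pscale c (\<pi> (unproj (pure (a, \<xi>))))"])
      (auto simp: \<pi>_unwedge \<pi>_unproj length2 ls plin_iff pv.scale_right_diff_distrib pv.scale_right_distrib W.Sk_def W_linear mult.commute)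
next
  fix a \<xi> assume "a \<in> rel \<AA>" and \<xi>: "\<xi> \<in> carr (extpow 2 \<LL>)"
  then have a: "a = 0" and \<xi>: "\<xi> \<in> carr (tpow 2 \<LL>)" by simp_all
  show "\<pi> (unproj (pure (a, \<xi>))) \<in> {0}"
    by (rule tpow_carr_induct[OF unproj_linear2 pv.subspace_single_0 \<xi>]) (auto simp: \<pi>_unwedge \<pi>_unproj a length2 W.Sk_def W_zero)
next
  fix a \<xi> assume \<xi>: "\<xi> \<in> rel (extpow 2 \<LL>)"
  show "\<pi> (unproj (pure (a, \<xi>))) \<in> {0}"
    by (rule extpow2_rel_induct[OF unproj_linear2 pv.subspace_single_0 \<xi>], unfold \<pi>_unproj)
      (simp_all add: W.Sk_def W_linear W_zero pv.scale_right_distrib pv.scale_right_diff_distrib mult.commute)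
qed (simp_all add: linear_simps[OF unproj_linear2])

text \<open>Half of \<open>Sy_one\<close>, with the three skew terms collected into the differential
  of \<open>x \<and> y \<and> z\<close>.\<close>

lemma unwedge_koszul:
  assumes w: "w \<in> carr (tpow 3 \<LL>)"
  shows "\<pi> (unwedge (pure (pure [a, 1], koszul br w))) - \<pi> (unproj (pure (a, ce_diff br w))) \<in> {0}"
proof (rule tpow_carr_induct[OF _ pv.subspace_single_0 w])
  show "Vector_Spaces.linear pscale pscale (\<lambda>w. \<pi> (unwedge (pure (pure [a, 1], koszul br w))) - \<pi> (unproj (pure (a, ce_diff br w))))"
    by (simp add: plin_iff linear_simps[OF unwedge_linear2] linear_simps[OF unproj_linear2] pv.scale_right_diff_distrib)
  fix xs :: "'l list" assume "length xs = 3"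
  then obtain x y z where xs: "xs = [x, y, z]" by (auto simp: length3)
  have m: "W.Sk a 1 (br x z) y = - W.Sk a 1 (br z x) y"
    by (simp add: W.Sk_def L.br_skew[of x z] W_minus)
  have "W.Sy a 1 x (br y z) + (W.Sk a 1 (br x y) z + W.Sk a 1 (br y z) x - W.Sk a 1 (br x z) y) = 0"
    using W.Sy_one[of a y z x] unfolding m W.Sy_swap[of a 1 x] by (simp add: algebra_simps)
  then have "pscale (inverse 2) (W.Sy a 1 x (br y z) + (W.Sk a 1 (br x y) z + W.Sk a 1 (br y z) x - W.Sk a 1 (br x z) y)) = 0"
    by simp
  then show "\<pi> (unwedge (pure (pure [a, 1], koszul br (pure xs)))) - \<pi> (unproj (pure (a, ce_diff br (pure xs)))) \<in> {0}"
    unfolding xs koszul3 ce_diff3 linear_simps[OF unproj_linear2] \<pi>_unwedge \<pi>_unproj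
    by (simp add: pv.scale_right_distrib pv.scale_right_diff_distrib algebra_simps)
qed

text \<open>Half of \<open>W.decompose\<close>: the symmetric part passes through
  \<open>HH1\<close>, the skew part depends on the product of the scalars only and so passes through
  \<open>proj_rep\<close>.\<close>

lemma decompose_homogeneous:
  assumes z: "z \<in> hpow (cur_grading sA sL G) 2 \<beta>"
  shows "\<pi> z - \<pi> (unwedge (wedge_sym z)) - \<pi> (unproj (proj_rep z)) \<in> {0}"
proof -
  let ?F = "\<lambda>z. \<pi> z - \<pi> (unwedge (wedge_sym z)) - \<pi> (unproj (proj_rep z))"
  have l: "Vector_Spaces.linear pscale pscale ?F" by (simp add: plin_iff pv.scale_right_diff_distrib)
  show ?thesis
  proof (rule linear_span_in[OF l pv.subspace_single_0 _ z[unfolded hpow_def]])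
    fix t :: "('a \<times> 'l \<Rightarrow>\<^sub>0 'k) list \<Rightarrow>\<^sub>0 'k"
    assume "t \<in> {pure xs |xs \<gamma>s. length xs = 2 \<and> list_all2 (\<lambda>x \<gamma>. x \<in> cur_grading sA sL G \<gamma>) xs \<gamma>s \<and> sum_list \<gamma>s = \<beta>}"
    then obtain p q \<gamma> \<delta> where t: "t = pure [p, q]" and p: "p \<in> cur_grading sA sL G \<gamma>" and q: "q \<in> cur_grading sA sL G \<delta>"
      and b: "\<gamma> + \<delta> = \<beta>"
      by (auto simp: \<pi>_unwedge \<pi>_unproj length2 list_all2_Cons1)
    have l1: "Vector_Spaces.linear pscale pscale (\<lambda>p. ?F (pure [p, q]))" for q
      by (simp add: plin_iff V_bilinear(1,3) pv.scale_right_diff_distrib)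
    have l2: "Vector_Spaces.linear pscale pscale (\<lambda>q. ?F (pure [p, q]))" for p
      by (simp add: plin_iff V_bilinear(2,4) pv.scale_right_diff_distrib)
    have "?F (pure [p, q]) \<in> {0}"
    proof (rule cur_grading_induct[OF l1 pv.subspace_single_0 p], rule cur_grading_induct[OF l2 pv.subspace_single_0 q])
      fix a x c y assume h: "x \<in> G \<gamma>" "y \<in> G \<delta>"
      have "W a x c y + W a x c y = W.Sy a c x y + W.Sk (a * c) 1 x y"
      proof -
        \<comment> \<open>The defect of the decomposition is bilinear and vanishes on brackets, as
          \<open>degree_induct\<close> requires.\<close>
        define Q where "Q x y = W a x c y + W a x c y - (W.Sy a c x y + W.Sk (a * c) 1 x y)" for x y
        have l: "Q (x + x') y = Q x y + Q x' y" "Q y (x + x') = Q y x + Q y x'" for x x' y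
          by (simp_all add: Q_def W.Sy_def W.Sk_def W_linear)
        have m: "Q (sL k x) y = pscale k (Q x y)" "Q y (sL k x) = pscale k (Q y x)" for k x y
          by (simp_all add: Q_def W.Sy_def W.Sk_def W_linear pv.scale_right_distrib pv.scale_right_diff_distrib)
        have base: "Q (br u v) y = 0" "Q x (br u v) = 0" for u v x y
          using W.decompose[where x = "br u v" and y = y and u = u and v = v and a = a and b = c]
            W.decompose[where x = x and y = "br u v" and u = u and v = v and a = a and b = c] by (simp_all add: Q_def)
        have "Q 0 y = 0" "Q y 0 = 0" for y using m(1)[of 0 0 y] m(2)[of y 0 0] by simp_all
        then have "Q x y = 0"
          by (intro L.degree_induct[OF S2_zero h b, where P = "\<lambda>x y. Q x y = 0"]) (simp_all add: l m base)
        then show ?thesis by (simp add: Q_def)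
      qed
      then have e1: "pscale (inverse 2) (W a x c y + W a x c y) = pscale (inverse 2) (W.Sy a c x y + W.Sk (a * c) 1 x y)" by simp
      have e2: "pscale (inverse 2) (W a x c y + W a x c y) = W a x c y"
      proof -
        have "pscale (inverse 2) (W a x c y + W a x c y) = pscale (inverse 2 + inverse 2) (W a x c y)"
          by (simp only: pv.scale_right_distrib pv.scale_left_distrib)
        also have "inverse 2 + inverse 2 = (1::'k)" using two by (simp add: field_simps)
        finally show ?thesis by simp
      qed
      have "W a x c y = pscale (inverse 2) (W.Sy a c x y) + pscale (inverse 2) (W.Sk (a * c) 1 x y)"
        using e1 unfolding e2 unfolding pv.scale_right_distrib .
      then have "W a x c y - pscale (inverse 2) (W.Sy a c x y) - pscale (inverse 2) (W.Sk (a * c) 1 x y) = 0"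
        by (simp only: add_diff_cancel_left' diff_self)
      then show "?F (pure [pure (a, x), pure (c, y)]) \<in> {0}" by (simp add: W_def \<pi>_unwedge \<pi>_unproj)
    qed
    then show "?F t \<in> {0}" by (simp add: t)
  qed
qed

end

lemma B_quotient:
  obtains \<pi> :: "(('a \<times> 'l \<Rightarrow>\<^sub>0 'k) list \<Rightarrow>\<^sub>0 'k) \<Rightarrow> (('a \<times> 'l \<Rightarrow>\<^sub>0 'k) list \<Rightarrow>\<^sub>0 'k)"
  where "Vector_Spaces.linear pscale pscale \<pi>" "\<And>r. r \<in> \<BB> \<Longrightarrow> \<pi> r = 0" "\<And>x. \<pi> x = 0 \<Longrightarrow> x \<in> \<BB>"
  using quotient_map_pscale[OF B_sub] by blast

lemma unwedge_rel_B: "t \<in> rel (tensor (HH1 sA) Kb) \<Longrightarrow> unwedge t \<in> \<BB>"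
  by (rule B_quotient) (use unwedge_rel in blast)

lemma unproj_rel_B: "t \<in> rel (tensor \<AA> (extpow 2 \<LL>)) \<Longrightarrow> unproj t \<in> \<BB>"
  by (rule B_quotient) (use unproj_rel in blast)

lemma unwedge_koszul_B:
  assumes "w \<in> carr (tpow 3 \<LL>)"
  shows "unwedge (pure (pure [a, 1], koszul br w)) - unproj (pure (a, ce_diff br w)) \<in> \<BB>"
proof (rule B_quotient)
  fix \<pi> :: "(('a \<times> 'l \<Rightarrow>\<^sub>0 'k) list \<Rightarrow>\<^sub>0 'k) \<Rightarrow> (('a \<times> 'l \<Rightarrow>\<^sub>0 'k) list \<Rightarrow>\<^sub>0 'k)"
  assume p: "Vector_Spaces.linear pscale pscale \<pi>" "\<And>r. r \<in> \<BB> \<Longrightarrow> \<pi> r = 0" "\<And>x. \<pi> x = 0 \<Longrightarrow> x \<in> \<BB>"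
  show ?thesis by (rule p(3)) (use unwedge_koszul[OF p(1,2) assms] in \<open>simp add: linear_simps[OF p(1)]\<close>)
qed

lemma decompose_homogeneous_B:
  assumes "z \<in> hpow (cur_grading sA sL G) 2 \<beta>"
  shows "z - (unwedge (wedge_sym z) + unproj (proj_rep z)) \<in> \<BB>"
proof (rule B_quotient)
  fix \<pi> :: "(('a \<times> 'l \<Rightarrow>\<^sub>0 'k) list \<Rightarrow>\<^sub>0 'k) \<Rightarrow> (('a \<times> 'l \<Rightarrow>\<^sub>0 'k) list \<Rightarrow>\<^sub>0 'k)"
  assume p: "Vector_Spaces.linear pscale pscale \<pi>" "\<And>r. r \<in> \<BB> \<Longrightarrow> \<pi> r = 0" "\<And>x. \<pi> x = 0 \<Longrightarrow> x \<in> \<BB>"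
  show ?thesis by (rule p(3)) (use decompose_homogeneous[OF p(1,2) assms] in \<open>simp add: linear_simps[OF p(1)] algebra_simps\<close>)
qed

end

section \<open>Bilinear forms on tensor products, and the chain maps in degrees 1 and 3\<close>

text \<open>\<open>tensor_carr_induct\<close> leaves arbitrary elements in both factors. If
  \<open>F\<close> is bilinear modulo \<open>R\<close>, these can be reduced further to generators
  of each factor.\<close>

lemma tensor_span_induct:
  assumes V: "wf_subquot V" "carr V = module.span (scl V) S" and W: "wf_subquot W" "carr W = module.span (scl W) T"
    and F: "Vector_Spaces.linear pscale s F" "module.subspace s R"
    and add: "\<And>x x' y. x \<in> carr V \<Longrightarrow> x' \<in> carr V \<Longrightarrow> y \<in> carr W \<Longrightarrow> F (pure (x + x', y)) - F (pure (x, y)) - F (pure (x', y)) \<in> R"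
    "\<And>x y y'. x \<in> carr V \<Longrightarrow> y \<in> carr W \<Longrightarrow> y' \<in> carr W \<Longrightarrow> F (pure (x, y + y')) - F (pure (x, y)) - F (pure (x, y')) \<in> R"
    and scale: "\<And>c x y. x \<in> carr V \<Longrightarrow> y \<in> carr W \<Longrightarrow> F (pure (scl V c x, y)) - s c (F (pure (x, y))) \<in> R"
    "\<And>c x y. x \<in> carr V \<Longrightarrow> y \<in> carr W \<Longrightarrow> F (pure (x, scl W c y)) - s c (F (pure (x, y))) \<in> R"
    and gen: "\<And>x y. x \<in> S \<Longrightarrow> y \<in> T \<Longrightarrow> F (pure (x, y)) \<in> R"
    and t: "t \<in> carr (tensor V W)"
  shows "F t \<in> R"
proof -
  have vs: "vector_space s" using F(1) by (simp add: Vector_Spaces.linear_iff)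
  interpret V: vector_space "scl V" by (rule wf_vs[OF V(1)])
  interpret W: vector_space "scl W" by (rule wf_vs[OF W(1)])
  interpret U: vector_space s by (rule vs)
  have add': "p \<in> R" if "p - q - r \<in> R" "q \<in> R" "r \<in> R" for p q r
    using U.subspace_add[OF F(2) U.subspace_add[OF F(2) that(1,2)] that(3)] by simp
  have scale': "p \<in> R" if "p - s c q \<in> R" "q \<in> R" for p c q
    using U.subspace_add[OF F(2) that(1) U.subspace_scale[OF F(2) that(2)], of c] by simp
  have 1: "F (pure (x, y)) \<in> R" if y: "y \<in> T" and x: "x \<in> carr V" for x y
  proof -
    have yc: "y \<in> carr W" unfolding W(2) by (rule W.span_base[OF y])
    have "V.subspace {x \<in> carr V. F (pure (x, y)) \<in> R}"
    proof (rule V.subspaceI)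
      show "0 \<in> {x \<in> carr V. F (pure (x, y)) \<in> R}"
        using scale(1)[OF carr_facts(1)[OF V(1)] yc, of 0] carr_facts(1)[OF V(1)] by simp
      show "x + x' \<in> {x \<in> carr V. F (pure (x, y)) \<in> R}"
        if "x \<in> {x \<in> carr V. F (pure (x, y)) \<in> R}" "x' \<in> {x \<in> carr V. F (pure (x, y)) \<in> R}" for x x'
        using that add'[OF add(1)[of x x' y]] yc carr_facts(2)[OF V(1)] by simp
      show "scl V c x \<in> {x \<in> carr V. F (pure (x, y)) \<in> R}" if "x \<in> {x \<in> carr V. F (pure (x, y)) \<in> R}" for c x
        using that scale'[OF scale(1)[of x y c]] yc carr_facts(3)[OF V(1)] by simp
    qed
    then have "V.span S \<subseteq> {x \<in> carr V. F (pure (x, y)) \<in> R}"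
      using gen[OF _ y] V.span_base V(2) by (intro V.span_minimal) auto
    then show ?thesis using x V(2) by auto
  qed
  have 2: "F (pure (x, y)) \<in> R" if x: "x \<in> carr V" and y: "y \<in> carr W" for x y
  proof -
    have "W.subspace {y \<in> carr W. F (pure (x, y)) \<in> R}"
    proof (rule W.subspaceI)
      show "0 \<in> {y \<in> carr W. F (pure (x, y)) \<in> R}"
        using scale(2)[OF x carr_facts(1)[OF W(1)], of 0] carr_facts(1)[OF W(1)] by simp
      show "y + y' \<in> {y \<in> carr W. F (pure (x, y)) \<in> R}"
        if "y \<in> {y \<in> carr W. F (pure (x, y)) \<in> R}" "y' \<in> {y \<in> carr W. F (pure (x, y)) \<in> R}" for y y'
        using that add'[OF add(2)[of x y y']] x carr_facts(2)[OF W(1)] by simp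
      show "scl W c y \<in> {y \<in> carr W. F (pure (x, y)) \<in> R}" if "y \<in> {y \<in> carr W. F (pure (x, y)) \<in> R}" for c y
        using that scale'[OF scale(2)[of x y c]] x carr_facts(3)[OF W(1)] by simp
    qed
    then have "W.span T \<subseteq> {y \<in> carr W. F (pure (x, y)) \<in> R}"
      using 1[OF _ x] W.span_base W(2) by (intro W.span_minimal) auto
    then show ?thesis using y W(2) by auto
  qed
  show ?thesis by (rule tensor_carr_induct[OF F t]) (rule 2)
qed

lemma tpow_carr: "carr (tpow n V) = pspan {pure xs |xs. length xs = n \<and> set xs \<subseteq> carr V}"
  by (simp add: tpow_def)

context
  fixes V :: "('k::field, 'v::ab_group_add) subquot" and W :: "('k, 'w::ab_group_add) subquot"
    and \<pi> :: "('v \<times> 'w \<Rightarrow>\<^sub>0 'k) \<Rightarrow> 'z::ab_group_add" and s :: "'k \<Rightarrow> 'z \<Rightarrow> 'z"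
  assumes V: "wf_subquot V" and W: "wf_subquot W" and \<pi>: "Vector_Spaces.linear pscale s \<pi>"
    and ker: "\<And>r. r \<in> rel (tensor V W) \<Longrightarrow> \<pi> r = 0"
begin

lemma tensor_form:
  "x \<in> carr V \<Longrightarrow> x' \<in> carr V \<Longrightarrow> y \<in> carr W \<Longrightarrow> \<pi> (pure (x + x', y)) = \<pi> (pure (x, y)) + \<pi> (pure (x', y))"
  "x \<in> carr V \<Longrightarrow> y \<in> carr W \<Longrightarrow> y' \<in> carr W \<Longrightarrow> \<pi> (pure (x, y + y')) = \<pi> (pure (x, y)) + \<pi> (pure (x, y'))"
  "x \<in> carr V \<Longrightarrow> y \<in> carr W \<Longrightarrow> \<pi> (pure (scl V c x, y)) = s c (\<pi> (pure (x, y)))"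
  "x \<in> carr V \<Longrightarrow> y \<in> carr W \<Longrightarrow> \<pi> (pure (x, scl W c y)) = s c (\<pi> (pure (x, y)))"
  "x \<in> rel V \<Longrightarrow> y \<in> carr W \<Longrightarrow> \<pi> (pure (x, y)) = 0"
  "x \<in> carr V \<Longrightarrow> y \<in> rel W \<Longrightarrow> \<pi> (pure (x, y)) = 0"
  using tensor_relI[where V = V and W = W, THEN ker, unfolded linear_simps[OF \<pi>]]
  by (simp_all add: algebra_simps)

lemma tensor_form_diff:
  "x \<in> carr V \<Longrightarrow> x' \<in> carr V \<Longrightarrow> y \<in> carr W \<Longrightarrow> \<pi> (pure (x - x', y)) = \<pi> (pure (x, y)) - \<pi> (pure (x', y))"
  "x \<in> carr V \<Longrightarrow> y \<in> carr W \<Longrightarrow> y' \<in> carr W \<Longrightarrow> \<pi> (pure (x, y - y')) = \<pi> (pure (x, y)) - \<pi> (pure (x, y'))"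
  using tensor_form(1)[of "x - x'" x' y] tensor_form(2)[of x "y - y'" y'] carr_facts(4)[OF V] carr_facts(4)[OF W]
  by simp_all

lemma tensor_form_rel:
  assumes "x \<in> carr V" "y \<in> carr W"
  shows "x' \<in> carr V \<Longrightarrow> x - x' \<in> rel V \<Longrightarrow> \<pi> (pure (x, y)) = \<pi> (pure (x', y))"
    "x' \<in> carr V \<Longrightarrow> x'' \<in> carr V \<Longrightarrow> x - x' - x'' \<in> rel V \<Longrightarrow> \<pi> (pure (x, y)) = \<pi> (pure (x', y)) + \<pi> (pure (x'', y))"
    "y' \<in> carr W \<Longrightarrow> y - y' \<in> rel W \<Longrightarrow> \<pi> (pure (x, y)) = \<pi> (pure (x, y'))"
    "y' \<in> carr W \<Longrightarrow> y'' \<in> carr W \<Longrightarrow> y - y' - y'' \<in> rel W \<Longrightarrow> \<pi> (pure (x, y)) = \<pi> (pure (x, y')) + \<pi> (pure (x, y''))"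
proof -
  have d: "\<pi> (pure (x, y)) = \<pi> (pure (u, y))" if "u \<in> carr V" "x - u \<in> rel V" for u
    using tensor_form(5)[OF that(2) assms(2)] tensor_form_diff(1)[OF assms(1) that(1) assms(2)] by simp
  have e: "\<pi> (pure (x, y)) = \<pi> (pure (x, u))" if "u \<in> carr W" "y - u \<in> rel W" for u
    using tensor_form(6)[OF assms(1) that(2)] tensor_form_diff(2)[OF assms that(1)] by simp
  show "x' \<in> carr V \<Longrightarrow> x - x' \<in> rel V \<Longrightarrow> \<pi> (pure (x, y)) = \<pi> (pure (x', y))"
    "y' \<in> carr W \<Longrightarrow> y - y' \<in> rel W \<Longrightarrow> \<pi> (pure (x, y)) = \<pi> (pure (x, y'))" by (rule d e; assumption)+
  show "x' \<in> carr V \<Longrightarrow> x'' \<in> carr V \<Longrightarrow> x - x' - x'' \<in> rel V \<Longrightarrow> \<pi> (pure (x, y)) = \<pi> (pure (x', y)) + \<pi> (pure (x'', y))"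
    using d[of "x' + x''"] tensor_form(1)[of x' x'' y] carr_facts(2)[OF V, of x' x''] assms(2) by (simp add: diff_diff_eq)
  show "y' \<in> carr W \<Longrightarrow> y'' \<in> carr W \<Longrightarrow> y - y' - y'' \<in> rel W \<Longrightarrow> \<pi> (pure (x, y)) = \<pi> (pure (x, y')) + \<pi> (pure (x, y''))"
    using e[of "y' + y''"] tensor_form(2)[of x y' y''] carr_facts(2)[OF W, of y' y''] assms(1) by (simp add: diff_diff_eq)
qed

end

definition lift3 :: "('a \<Rightarrow> 'x \<Rightarrow> 'b \<Rightarrow> 'y \<Rightarrow> 'c \<Rightarrow> 'w \<Rightarrow> ('z \<Rightarrow>\<^sub>0 'k)) \<Rightarrow> ('a \<times> 'x \<Rightarrow>\<^sub>0 'k::field) \<Rightarrow>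
    ('b \<times> 'y \<Rightarrow>\<^sub>0 'k) \<Rightarrow> ('c \<times> 'w \<Rightarrow>\<^sub>0 'k) \<Rightarrow> ('z \<Rightarrow>\<^sub>0 'k)" where
  "lift3 f p q r = lift pscale (\<lambda>u. lift2 (f (fst u) (snd u)) q r) p"

lemma lift3_simps [simp]:
  "lift3 f (p + p') q r = lift3 f p q r + lift3 f p' q r" "lift3 f p (q + q') r = lift3 f p q r + lift3 f p q' r"
  "lift3 f p q (r + r') = lift3 f p q r + lift3 f p q r'"
  "lift3 f (pscale k p) q r = pscale k (lift3 f p q r)" "lift3 f p (pscale k q) r = pscale k (lift3 f p q r)"
  "lift3 f p q (pscale k r) = pscale k (lift3 f p q r)"
  "lift3 f (pure (a, x)) (pure (b, y)) (pure (c, z)) = f a x b y c z"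
  by (simp_all add: lift3_def plift_fun_add plift_fun_scale)

text \<open>Degree 3 of the family that has \<open>proj_rep\<close> in degree 2 and
  \<open>proj1\<close> in degree 1: multiply the scalars and keep the elements of \<open>l\<close>.
  The family commutes with the differentials modulo relations.\<close>

definition proj3 :: "(('a::times \<times> 'l \<Rightarrow>\<^sub>0 'k::field) list \<Rightarrow>\<^sub>0 'k) \<Rightarrow> ('a \<times> ('l list \<Rightarrow>\<^sub>0 'k) \<Rightarrow>\<^sub>0 'k)" where
  "proj3 = lift pscale (\<lambda>ps. lift3 (\<lambda>a x b y c z. pure (a * b * c, pure [x, y, z])) (ps ! 0) (ps ! 1) (ps ! 2))"

definition proj1 :: "(('a \<times> 'l \<Rightarrow>\<^sub>0 'k::field) list \<Rightarrow>\<^sub>0 'k) \<Rightarrow> ('a \<times> ('l list \<Rightarrow>\<^sub>0 'k) \<Rightarrow>\<^sub>0 'k)" where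
  "proj1 = lift pscale (\<lambda>ps. lift pscale (\<lambda>u. pure (fst u, pure [snd u])) (ps ! 0))"

definition incl1 :: "'a \<Rightarrow> ('l list \<Rightarrow>\<^sub>0 'k::field) \<Rightarrow> (('a \<times> 'l \<Rightarrow>\<^sub>0 'k) list \<Rightarrow>\<^sub>0 'k)" where
  "incl1 a = lift pscale (\<lambda>xs. pure [pure (a, xs ! 0)])"

lemma linear_maps':
  "Vector_Spaces.linear pscale pscale proj3" "Vector_Spaces.linear pscale pscale proj1"
  "Vector_Spaces.linear pscale pscale (incl1 a)"
  by (simp_all add: proj3_def proj1_def incl1_def linear_plift)

lemmas proj3_simps [simp] = linear_simps[OF linear_maps'(1)]
lemmas proj1_simps [simp] = linear_simps[OF linear_maps'(2)]
lemmas incl1_simps [simp] = linear_simps[OF linear_maps'(3)]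

lemma proj3_pure [simp]: "proj3 (pure [p, q, r]) = lift3 (\<lambda>a x b y c z. pure (a * b * c, pure [x, y, z])) p q r"
  by (simp add: proj3_def)

lemma proj1_pure [simp]: "proj1 (pure [p]) = lift pscale (\<lambda>u. pure (fst u, pure [snd u])) p"
  by (simp add: proj1_def)

lemma incl1_pure [simp]: "incl1 a (pure [x]) = pure [pure (a, x)]"
  by (simp add: incl1_def)

context current
begin

abbreviation "TK \<equiv> tensor (HH1 sA) (kill sL br)"
abbreviation "TE n \<equiv> tensor \<AA> (extpow n \<LL>)"

lemma wf_TK: "wf_subquot TK" and wf_TE: "wf_subquot (TE n)"
  by (simp_all add: wf_tensor wf_HH1 L.wf_kill wf_A L.wf_ext)

lemma C_tpow3_induct:
  assumes F: "Vector_Spaces.linear pscale s F" "module.subspace s R" and w: "w \<in> carr (tpow 3 \<CC>)"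
    and l: "\<And>q r. Vector_Spaces.linear pscale s (\<lambda>p. F (pure [p, q, r]))"
      "\<And>p r. Vector_Spaces.linear pscale s (\<lambda>q. F (pure [p, q, r]))"
      "\<And>p q. Vector_Spaces.linear pscale s (\<lambda>r. F (pure [p, q, r]))"
    and gen: "\<And>a x b y c z. F (pure [pure (a, x), pure (b, y), pure (c, z)]) \<in> R"
  shows "F w \<in> R"
proof (rule tpow_carr_induct[OF F w])
  fix ps :: "('a \<times> 'l \<Rightarrow>\<^sub>0 'k) list" assume "length ps = 3"
  then obtain p q r where ps: "ps = [p, q, r]" by (auto simp: length3)
  show "F (pure ps) \<in> R" unfolding ps
  proof (rule pure_induct[OF l(1) F(2)], rule pure_induct[OF l(2) F(2)], rule pure_induct[OF l(3) F(2)])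
    fix u v w :: "'a \<times> 'l"
    show "F (pure [pure u, pure v, pure w]) \<in> R"
      using gen[of "fst u" "snd u" "fst v" "snd v" "fst w" "snd w"] by simp
  qed
qed

lemma C_tpow2_induct:
  assumes F: "Vector_Spaces.linear pscale s F" "module.subspace s R" and w: "w \<in> carr (tpow 2 \<CC>)"
    and l: "\<And>q. Vector_Spaces.linear pscale s (\<lambda>p. F (pure [p, q]))"
      "\<And>p. Vector_Spaces.linear pscale s (\<lambda>q. F (pure [p, q]))"
    and gen: "\<And>a x b y. F (pure [pure (a, x), pure (b, y)]) \<in> R"
  shows "F w \<in> R"
proof (rule tpow_carr_induct[OF F w])
  fix ps :: "('a \<times> 'l \<Rightarrow>\<^sub>0 'k) list" assume "length ps = 2"
  then obtain p q where ps: "ps = [p, q]" by (auto simp: length2)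
  show "F (pure ps) \<in> R" unfolding ps
  proof (rule pure_induct[OF l(1) F(2)], rule pure_induct[OF l(2) F(2)])
    fix u v :: "'a \<times> 'l"
    show "F (pure [pure u, pure v]) \<in> R"
      using gen[of "fst u" "snd u" "fst v" "snd v"] by simp
  qed
qed

text \<open>Skewness transfers linearity from the first tensor to the second, and gives twice the
  value at \<open>[x, x]\<close> equal to 0; it is first extended from generators to all
  representatives.\<close>

lemma ext2_C_rel:
  fixes F :: "(('a \<times> 'l \<Rightarrow>\<^sub>0 'k) list \<Rightarrow>\<^sub>0 'k) \<Rightarrow> ('z \<Rightarrow>\<^sub>0 'k)"
  assumes F: "Vector_Spaces.linear pscale pscale F" and r: "r \<in> rel (extpow 2 \<CC>)"
    and l: "\<And>q. Vector_Spaces.linear pscale pscale (\<lambda>p. F (pure [p, q]))"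
      "\<And>p. Vector_Spaces.linear pscale pscale (\<lambda>q. F (pure [p, q]))"
    and f: "\<And>a x b y. F (pure [pure (a, x), pure (b, y)]) = f a x b y"
    and lin: "\<And>a a' x b y. f (a + a') x b y = f a x b y + f a' x b y" "\<And>a x x' b y. f a (x + x') b y = f a x b y + f a x' b y"
      "\<And>c a x b y. f (sA c a) x b y = pscale c (f a x b y)" "\<And>c a x b y. f a (sL c x) b y = pscale c (f a x b y)"
    and skew: "\<And>a x b y. f a x b y = - f b y a x"
  shows "F r = 0"
proof -
  note ls = linear_simps[OF l(1)] linear_simps[OF l(2)]
  have sk: "F (pure [p, q]) = - F (pure [q, p])" for p q
  proof -
    have 1: "Vector_Spaces.linear pscale pscale (\<lambda>p. F (pure [p, q]) + F (pure [q, p]))" for q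
      by (simp add: plin_iff ls pv.scale_right_distrib)
    have 2: "Vector_Spaces.linear pscale pscale (\<lambda>q. F (pure [p, q]) + F (pure [q, p]))" for p
      by (simp add: plin_iff ls pv.scale_right_distrib)
    have "F (pure [p, q]) + F (pure [q, p]) \<in> {0}"
    proof (rule pure_induct[OF 1 pv.subspace_single_0], rule pure_induct[OF 2 pv.subspace_single_0])
      fix u v :: "'a \<times> 'l"
      show "F (pure [pure u, pure v]) + F (pure [pure v, pure u]) \<in> {0}"
        using f[of "fst u" "snd u" "fst v" "snd v"] f[of "fst v" "snd v" "fst u" "snd u"]
          skew[of "fst u" "snd u" "fst v" "snd v"] by simp
    qed
    then show ?thesis by (simp add: eq_neg_iff_add_eq_0)
  qed
  have z: "f 0 x b y = 0" "f a 0 b y = 0" for a x b y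
    using lin(3)[of 0 0 x b y] lin(4)[of a 0 0 b y] by simp_all
  have rc: "F (pure [r, q]) \<in> {0}" if r: "r \<in> rel \<CC>" for r q
  proof (rule pure_induct[OF l(2) pv.subspace_single_0])
    fix v :: "'a \<times> 'l"
    have f': "F (pure [pure (a, x), pure v]) = f a x (fst v) (snd v)" for a x
      using f[of a x "fst v" "snd v"] by simp
    show "F (pure [r, pure v]) \<in> {0}"
      by (rule tensor_rel_induct[OF l(1) pv.subspace_single_0 r[unfolded cur_def]]; unfold f')
        (simp_all add: lin z)
  qed
  have "F r \<in> {0}"
  proof (rule extpow2_rel_induct[OF F pv.subspace_single_0 r])
    show "F (pure [x, x]) \<in> {0}" for x
    proof -
      have "F (pure [x, x]) + F (pure [x, x]) = 0" using sk[of x x] by (simp only: eq_neg_iff_add_eq_0)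
      then show ?thesis using double_eq_0[OF two] by simp
    qed
    show "F (pure [z, x]) \<in> {0}" if "x \<in> rel \<CC>" for x z
      using rc[OF that, of z] sk[of z x] by simp
  qed (use rc in \<open>simp_all add: ls\<close>)
  then show ?thesis by simp
qed

lemma ext_kill_zero: "0 \<in> carr (tpow n \<AA>)" "0 \<in> carr (tpow n \<LL>)"
  using subspace_tpow_A L.subspace_tpow pv.subspace_0 by blast+

lemma ext_HH1: "r \<in> rel (extpow 2 \<AA>) \<Longrightarrow> r \<in> rel (HH1 sA)"
  unfolding HH1_eq coker_simps
  by (intro CollectI exI[of _ 0] exI[of _ r]) (simp add: ext_kill_zero linear_simps[OF linear_T(1)])

lemma T0_HH1: "v \<in> carr (tpow 3 \<AA>) \<Longrightarrow> T0_map v \<in> rel (HH1 sA)"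
  unfolding HH1_eq coker_simps using rel_facts(1)[OF wf_extpow[OF wf_A]]
  by (intro CollectI exI[of _ v] exI[of _ 0]) simp

lemma ext2_swap: "pure [a, b] - - pure [b, a] \<in> rel (extpow 2 \<AA>)"
proof -
  note sub = rel_facts[OF wf_extpow[OF wf_A, of 2], simplified]
  have d: "pure [a, a] \<in> rel (extpow 2 \<AA>)" for a by (rule extpow_relI(2)) auto
  have t: "pure [a + b, c] - pure [a, c] - pure [b, c] \<in> rel (extpow 2 \<AA>)"
    "pure [c, a + b] - pure [c, a] - pure [c, b] \<in> rel (extpow 2 \<AA>)" for a b c
    by (intro extpow_relI(1) tpow2I; simp)+
  have "pure [a + b, a + b] - (pure [a + b, a + b] - pure [a, a + b] - pure [b, a + b]) - (pure [a, a + b] - pure [a, a] - pure [a, b])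
    - (pure [b, a + b] - pure [b, a] - pure [b, b]) - pure [a, a] - pure [b, b] \<in> rel (extpow 2 \<AA>)"
    by (intro sub(4) d t)
  then show ?thesis by (simp add: algebra_simps)
qed

subsection \<open>The component in \<open>HH\<^sub>1(A) \<otimes> Kill(l)\<close>\<close>

context
  fixes \<pi> :: "(('a list \<Rightarrow>\<^sub>0 'k) \<times> ('l list \<Rightarrow>\<^sub>0 'k) \<Rightarrow>\<^sub>0 'k) \<Rightarrow> (('a list \<Rightarrow>\<^sub>0 'k) \<times> ('l list \<Rightarrow>\<^sub>0 'k) \<Rightarrow>\<^sub>0 'k)"
  assumes \<pi>: "Vector_Spaces.linear pscale pscale \<pi>" and ker: "\<And>r. r \<in> rel TK \<Longrightarrow> \<pi> r = 0"
  notes \<pi>K_simps [simp] = linear_simps[OF \<pi>]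
begin

lemmas K_form = tensor_form[OF wf_HH1 L.wf_kill \<pi> ker, simplified]
lemmas K_form_diff = tensor_form_diff[OF wf_HH1 L.wf_kill \<pi> ker, simplified]
lemmas K_form_rel = tensor_form_rel[OF wf_HH1 L.wf_kill \<pi> ker, simplified]

definition \<tau> :: "'a \<Rightarrow> 'l \<Rightarrow> 'a \<Rightarrow> 'l \<Rightarrow> (('a list \<Rightarrow>\<^sub>0 'k) \<times> ('l list \<Rightarrow>\<^sub>0 'k) \<Rightarrow>\<^sub>0 'k)" where
  "\<tau> a x b y = \<pi> (pure (pure [a, b], pure [x, y]))"

lemma K_form_neg:
  "\<alpha> \<in> carr (tpow 2 \<AA>) \<Longrightarrow> \<xi> \<in> carr (tpow 2 \<LL>) \<Longrightarrow> \<pi> (pure (- \<alpha>, \<xi>)) = - \<pi> (pure (\<alpha>, \<xi>))"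
  "\<alpha> \<in> carr (tpow 2 \<AA>) \<Longrightarrow> \<xi> \<in> carr (tpow 2 \<LL>) \<Longrightarrow> \<pi> (pure (\<alpha>, - \<xi>)) = - \<pi> (pure (\<alpha>, \<xi>))"
  using K_form(3)[of \<alpha> \<xi> "-1"] K_form(4)[of \<alpha> \<xi> "-1"] by simp_all

lemma \<tau>_linear:
  "\<tau> (a + a') x b y = \<tau> a x b y + \<tau> a' x b y" "\<tau> a (x + x') b y = \<tau> a x b y + \<tau> a x' b y"
  "\<tau> (sA c a) x b y = pscale c (\<tau> a x b y)" "\<tau> a (sL c x) b y = pscale c (\<tau> a x b y)"
proof -
  have e: "r \<in> rel (tpow 2 \<AA>) \<Longrightarrow> r \<in> rel (HH1 sA)" "r' \<in> rel (tpow 2 \<LL>) \<Longrightarrow> r' \<in> rel (kill sL br)" for r r'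
    by (auto intro: ext_HH1 extpow_relI L.sympow_kill sympow_relI)
  show "\<tau> (a + a') x b y = \<tau> a x b y + \<tau> a' x b y"
    unfolding \<tau>_def by (rule K_form_rel(2)) (auto intro!: e tpow2I)
  show "\<tau> a (x + x') b y = \<tau> a x b y + \<tau> a x' b y"
    unfolding \<tau>_def by (rule K_form_rel(4)) (auto intro!: e tpow2I)
  have s: "pure [sA c a, b] - pscale c (pure [a, b]) \<in> rel (HH1 sA)" "pure [sL c x, y] - pscale c (pure [x, y]) \<in> rel (kill sL br)"
    using e tpow2I(3)[of b \<AA> a c] tpow2I(3)[of y \<LL> x c] by simp_all
  have sc: "pscale c (pure [a, b]) \<in> carr (tpow 2 \<AA>)" "pscale c (pure [x, y]) \<in> carr (tpow 2 \<LL>)"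
    by (simp_all add: pv.subspace_scale[OF subspace_tpow_A] pv.subspace_scale[OF L.subspace_tpow])
  show "\<tau> (sA c a) x b y = pscale c (\<tau> a x b y)" "\<tau> a (sL c x) b y = pscale c (\<tau> a x b y)"
    unfolding \<tau>_def using K_form_rel(1)[OF _ _ sc(1) s(1), of "pure [x, y]"] K_form_rel(3)[OF _ _ sc(2) s(2), of "pure [a, b]"]
    by (simp_all add: K_form)
qed

lemma \<tau>_swap: "\<tau> a x b y = - \<tau> b x a y" "\<tau> a x b y = \<tau> a y b x"
proof -
  have "\<pi> (pure (pure [a, b], pure [x, y])) = \<pi> (pure (- pure [b, a], pure [x, y]))"
    by (rule K_form_rel(1)) (use ext_HH1[OF ext2_swap] in \<open>auto intro!: pv.subspace_neg[OF subspace_tpow_A]\<close>)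
  then show "\<tau> a x b y = - \<tau> b x a y" by (simp add: \<tau>_def K_form_neg)
  show "\<tau> a x b y = \<tau> a y b x"
    unfolding \<tau>_def by (rule K_form_rel(3)) (auto intro!: L.kill_swap)
qed

lemma \<tau>_invariant: "\<tau> a (br x y) b z = \<tau> a x b (br y z)"
  unfolding \<tau>_def by (rule K_form_rel(3)) (auto intro!: L.kill_relI)

lemma \<tau>_hochschild: "\<tau> (a * b) x c y + \<tau> (b * c) x a y + \<tau> (c * a) x b y = \<tau> (a * b * c) x 1 y"
proof -
  have "\<pi> (pure (T0_map (pure [a, b, c]), pure [x, y])) = 0"
    by (rule K_form(5)[OF T0_HH1]) auto
  then show ?thesis
    unfolding T0_pure
    by (simp add: K_form K_form_diff pv.subspace_add[OF subspace_tpow_A] \<tau>_def)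
qed

lemma wedge_sym_ext: "r \<in> rel (extpow 2 \<CC>) \<Longrightarrow> \<pi> (wedge_sym r) = 0"
  by (erule ext2_C_rel[where f = \<tau>, rotated])
    (auto simp: plin_iff \<tau>_linear \<tau>_def[symmetric] intro: trans[OF \<tau>_swap(1)], metis \<tau>_swap)

text \<open>Invariance turns the second factor of all three boundary terms into \<open>x\<close>
  times \<open>[y, z]\<close>. The scalars then form the Hochschild sum, which collapses to
  \<open>a * b * c \<and> 1\<close>.\<close>

lemma wedge_sym_boundary:
  assumes w: "w \<in> carr (tpow 3 \<CC>)"
  shows "\<pi> (wedge_sym (ce_diff cbr w)) + \<pi> (tmap (\<lambda>a. pure [a, 1]) (koszul br) (proj3 w)) \<in> {0}"
proof (rule C_tpow3_induct[OF _ pv.subspace_single_0 w])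
  fix a x b y c z
  have "\<tau> (b * c) (br y z) a x = \<tau> (b * c) x a (br y z)" by (rule \<tau>_swap(2))
  moreover have "\<tau> (a * b) (br x y) c z = \<tau> (a * b) x c (br y z)" by (rule \<tau>_invariant)
  moreover have "\<tau> (a * c) (br x z) b y = - \<tau> (a * c) x b (br y z)"
  proof -
    have "\<tau> (a * c) (br x z) b y = \<tau> (a * c) x b (br z y)" by (rule \<tau>_invariant)
    also have "br z y = sL (- 1) (br y z)" by (simp add: L.br_skew[of z y])
    finally show ?thesis using \<tau>_swap(2) \<tau>_linear(4)[of "a * c" "- 1" "br y z" b x] by simp
  qed
  ultimately have "- \<tau> (a * b) (br x y) c z + \<tau> (a * c) (br x z) b y - \<tau> (b * c) (br y z) a x
      + \<tau> (a * b * c) x 1 (br y z) = 0"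
    using \<tau>_hochschild[of a b x c "br y z"] by (simp add: mult.commute[of c a] algebra_simps)
  then show "\<pi> (wedge_sym (ce_diff cbr (pure [pure (a, x), pure (b, y), pure (c, z)])))
     + \<pi> (tmap (\<lambda>a. pure [a, 1]) (koszul br) (proj3 (pure [pure (a, x), pure (b, y), pure (c, z)]))) \<in> {0}"
    by (simp add: cur_br_eq \<tau>_def)
qed (simp_all add: plin_iff cur_br_eq pv.scale_right_distrib pv.scale_right_diff_distrib)

text \<open>The two halves produced by \<open>unwedge\<close> coincide because \<open>\<tau>\<close>
  is symmetric in the elements of \<open>l\<close>. Reduction to generators of both factors is
  needed, since \<open>pure (\<alpha>, \<xi>)\<close> is bilinear only after
  \<open>\<pi>\<close>.\<close>

lemma wedge_sym_unwedge:
  assumes t: "t \<in> carr TK"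
  shows "\<pi> (wedge_sym (unwedge t)) - \<pi> t \<in> {0}"
proof (rule tensor_span_induct[OF wf_HH1 _ L.wf_kill _ _ pv.subspace_single_0 _ _ _ _ _ t])
  show "carr (HH1 sA) = module.span (scl (HH1 sA)) {pure xs |xs. length xs = 2 \<and> set xs \<subseteq> carr \<AA>}"
    "carr (kill sL br) = module.span (scl (kill sL br)) {pure xs |xs. length xs = 2 \<and> set xs \<subseteq> carr \<LL>}"
    by (simp_all add: tpow_carr)
  fix \<alpha> :: "'a list \<Rightarrow>\<^sub>0 'k" and \<xi> :: "'l list \<Rightarrow>\<^sub>0 'k"
  assume "\<alpha> \<in> {pure xs |xs. length xs = 2 \<and> set xs \<subseteq> carr \<AA>}" "\<xi> \<in> {pure xs |xs. length xs = 2 \<and> set xs \<subseteq> carr \<LL>}"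
  then obtain a b x y where e: "\<alpha> = pure [a, b]" "\<xi> = pure [x, y]" by (auto simp: length2)
  have "pscale (inverse 2) (\<tau> a x b y) + pscale (inverse 2) (\<tau> a y b x) = \<tau> a x b y"
  proof -
    have "pscale (inverse 2) (\<tau> a x b y) + pscale (inverse 2) (\<tau> a y b x) = pscale (inverse 2 + inverse 2) (\<tau> a x b y)"
      unfolding \<tau>_swap(2)[of a y b x] by (simp only: pv.scale_left_distrib)
    also have "inverse 2 + inverse 2 = (1::'k)" using two by (simp add: field_simps)
    finally show ?thesis by simp
  qed
  then show "\<pi> (wedge_sym (unwedge (pure (\<alpha>, \<xi>)))) - \<pi> (pure (\<alpha>, \<xi>)) \<in> {0}"
    by (simp add: e unwedge_pure \<tau>_def pv.scale_right_distrib)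
qed (simp_all add: plin_iff pv.scale_right_diff_distrib unwedge_pure K_form)

end

lemma TK_quotient:
  obtains \<pi> :: "(('a list \<Rightarrow>\<^sub>0 'k) \<times> ('l list \<Rightarrow>\<^sub>0 'k) \<Rightarrow>\<^sub>0 'k) \<Rightarrow> (('a list \<Rightarrow>\<^sub>0 'k) \<times> ('l list \<Rightarrow>\<^sub>0 'k) \<Rightarrow>\<^sub>0 'k)"
  where "Vector_Spaces.linear pscale pscale \<pi>" "\<And>r. r \<in> rel TK \<Longrightarrow> \<pi> r = 0" "\<And>x. \<pi> x = 0 \<Longrightarrow> x \<in> rel TK"
  using quotient_map_pscale wf_rel[OF wf_TK] by fastforce

lemma wedge_sym_TK:
  "r \<in> rel (extpow 2 \<CC>) \<Longrightarrow> wedge_sym r \<in> rel TK"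
  "w \<in> carr (tpow 3 \<CC>) \<Longrightarrow> wedge_sym (ce_diff cbr w) - - tmap (\<lambda>a. pure [a, 1]) (koszul br) (proj3 w) \<in> rel TK"
  "t \<in> carr TK \<Longrightarrow> wedge_sym (unwedge t) - t \<in> rel TK"
proof -
  obtain \<pi> :: "(('a list \<Rightarrow>\<^sub>0 'k) \<times> ('l list \<Rightarrow>\<^sub>0 'k) \<Rightarrow>\<^sub>0 'k) \<Rightarrow> (('a list \<Rightarrow>\<^sub>0 'k) \<times> ('l list \<Rightarrow>\<^sub>0 'k) \<Rightarrow>\<^sub>0 'k)"
    where p: "Vector_Spaces.linear pscale pscale \<pi>" "\<And>r. r \<in> rel TK \<Longrightarrow> \<pi> r = 0" "\<And>x. \<pi> x = 0 \<Longrightarrow> x \<in> rel TK"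
    using TK_quotient by blast
  show "r \<in> rel (extpow 2 \<CC>) \<Longrightarrow> wedge_sym r \<in> rel TK"
    by (rule p(3)[OF wedge_sym_ext[OF p(1,2)]])
  show "w \<in> carr (tpow 3 \<CC>) \<Longrightarrow> wedge_sym (ce_diff cbr w) - - tmap (\<lambda>a. pure [a, 1]) (koszul br) (proj3 w) \<in> rel TK"
    using wedge_sym_boundary[OF p(1,2)] by (intro p(3)) (simp add: linear_simps[OF p(1)])
  show "t \<in> carr TK \<Longrightarrow> wedge_sym (unwedge t) - t \<in> rel TK"
    using wedge_sym_unwedge[OF p(1,2)] by (intro p(3)) (simp add: linear_simps[OF p(1)])
qed

subsection \<open>The component in \<open>A \<otimes> \<Lambda>\<^sup>2 l\<close>\<close>

context
  fixes \<pi> :: "('a \<times> ('l list \<Rightarrow>\<^sub>0 'k) \<Rightarrow>\<^sub>0 'k) \<Rightarrow> ('a \<times> ('l list \<Rightarrow>\<^sub>0 'k) \<Rightarrow>\<^sub>0 'k)"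
  assumes \<pi>: "Vector_Spaces.linear pscale pscale \<pi>" and ker: "\<And>r. r \<in> rel (TE 2) \<Longrightarrow> \<pi> r = 0"
  notes \<pi>E_simps [simp] = linear_simps[OF \<pi>]
begin

lemmas E_form = tensor_form[OF wf_A L.wf_ext[of 2] \<pi> ker, simplified]
lemmas E_form_diff = tensor_form_diff[OF wf_A L.wf_ext[of 2] \<pi> ker, simplified]
lemmas E_form_rel = tensor_form_rel[OF wf_A L.wf_ext[of 2] \<pi> ker, simplified]

definition \<theta> :: "'a \<Rightarrow> 'l \<Rightarrow> 'l \<Rightarrow> ('a \<times> ('l list \<Rightarrow>\<^sub>0 'k) \<Rightarrow>\<^sub>0 'k)" where
  "\<theta> a x y = \<pi> (pure (a, pure [x, y]))"

lemma E_form_neg: "\<xi> \<in> carr (tpow 2 \<LL>) \<Longrightarrow> \<pi> (pure (a, - \<xi>)) = - \<pi> (pure (a, \<xi>))"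
  using E_form(4)[of \<xi> a "-1"] by simp

lemma \<theta>_linear:
  "\<theta> (a + a') x y = \<theta> a x y + \<theta> a' x y" "\<theta> a (x + x') y = \<theta> a x y + \<theta> a x' y"
  "\<theta> a y (x + x') = \<theta> a y x + \<theta> a y x'"
  "\<theta> (sA c a) x y = pscale c (\<theta> a x y)" "\<theta> a (sL c x) y = pscale c (\<theta> a x y)"
proof -
  show "\<theta> (a + a') x y = \<theta> a x y + \<theta> a' x y" unfolding \<theta>_def by (rule E_form(1)) auto
  show "\<theta> a (x + x') y = \<theta> a x y + \<theta> a x' y"
    unfolding \<theta>_def by (rule E_form_rel(4)) (auto intro!: extpow_relI(1) tpow2I)
  show "\<theta> a y (x + x') = \<theta> a y x + \<theta> a y x'"
    unfolding \<theta>_def by (rule E_form_rel(4)) (auto intro!: extpow_relI(1) tpow2I)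
  show "\<theta> (sA c a) x y = pscale c (\<theta> a x y)" unfolding \<theta>_def by (rule E_form(3)) auto
  have s: "pure [sL c x, y] - pscale c (pure [x, y]) \<in> rel (extpow 2 \<LL>)"
    using extpow_relI(1)[OF tpow2I(3)[of y \<LL> x c]] by simp
  have sc: "pscale c (pure [x, y]) \<in> carr (tpow 2 \<LL>)" by (simp add: pv.subspace_scale[OF L.subspace_tpow])
  show "\<theta> a (sL c x) y = pscale c (\<theta> a x y)"
    unfolding \<theta>_def using E_form_rel(3)[OF _ sc s, of a] by (simp add: E_form)
qed

lemma \<theta>_skew: "\<theta> a x y = - \<theta> a y x"
proof -
  have d: "\<theta> a x x = 0" for x unfolding \<theta>_def by (rule E_form(6)[OF extpow_relI(2)]) auto
  have "\<theta> a (x + y) (x + y) = \<theta> a x x + \<theta> a y x + (\<theta> a x y + \<theta> a y y)" by (simp only: \<theta>_linear)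
  then have "\<theta> a x y + \<theta> a y x = 0" by (simp add: d add.commute)
  then show ?thesis by (simp only: eq_neg_iff_add_eq_0)
qed

lemma proj_rep_ext: "r \<in> rel (extpow 2 \<CC>) \<Longrightarrow> \<pi> (proj_rep r) = 0"
  by (erule ext2_C_rel[where f = "\<lambda>a x b y. \<theta> (a * b) x y", rotated])
    (auto simp: plin_iff \<theta>_linear \<theta>_def[symmetric] distrib_right A.scale_mult[symmetric], metis \<theta>_skew mult.commute)

text \<open>All three boundary terms carry the same scalar \<open>a * b * c\<close> by
  commutativity, so they assemble to the differential of \<open>x \<and> y \<and> z\<close>.\<close>

lemma proj_rep_boundary:
  assumes w: "w \<in> carr (tpow 3 \<CC>)"
  shows "\<pi> (proj_rep (ce_diff cbr w)) - \<pi> (tmap (\<lambda>a. a) (ce_diff br) (proj3 w)) \<in> {0}"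
proof (rule C_tpow3_induct[OF _ pv.subspace_single_0 w])
  fix a b c :: 'a and x y z :: 'l
  have m: "a * c * b = a * b * c" "b * c * a = a * b * c" by (simp_all only: ac_simps)
  have "\<pi> (pure (a * b * c, - pure [br x y, z] + pure [br x z, y] - pure [br y z, x])) = - \<theta> (a * b * c) (br x y) z + \<theta> (a * b * c) (br x z) y - \<theta> (a * b * c) (br y z) x"
    by (simp add: E_form E_form_diff E_form_neg \<theta>_def pv.subspace_add[OF L.subspace_tpow] pv.subspace_neg[OF L.subspace_tpow]
        del: add_uminus_conv_diff uminus_add_conv_diff)
  then show "\<pi> (proj_rep (ce_diff cbr (pure [pure (a, x), pure (b, y), pure (c, z)])))
     - \<pi> (tmap (\<lambda>a. a) (ce_diff br) (proj3 (pure [pure (a, x), pure (b, y), pure (c, z)]))) \<in> {0}"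
    by (simp add: cur_br_eq \<theta>_def m)
qed (simp_all add: plin_iff cur_br_eq pv.scale_right_distrib pv.scale_right_diff_distrib)

text \<open>\<open>unwedge\<close> is symmetric in \<open>x\<close> and \<open>y\<close> while both
  halves carry the scalar \<open>a * b\<close>, so they cancel in the exterior square.\<close>

lemma proj_rep_unwedge:
  assumes t: "t \<in> carr TK"
  shows "\<pi> (proj_rep (unwedge t)) \<in> {0}"
proof (rule tensor_carr_induct[OF _ pv.subspace_single_0 t])
  fix \<alpha> \<xi> assume "\<alpha> \<in> carr (HH1 sA)" "\<xi> \<in> carr (kill sL br)"
  then have \<alpha>: "\<alpha> \<in> carr (tpow 2 \<AA>)" and \<xi>: "\<xi> \<in> carr (tpow 2 \<LL>)" by simp_all
  have 1: "Vector_Spaces.linear pscale pscale (\<lambda>\<alpha>. \<pi> (proj_rep (unwedge (pure (\<alpha>, \<xi>)))))" for \<xi>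
    by (simp add: plin_iff unwedge_pure)
  have 2: "Vector_Spaces.linear pscale pscale (\<lambda>\<xi>. \<pi> (proj_rep (unwedge (pure (\<alpha>, \<xi>)))))" for \<alpha>
    by (simp add: plin_iff unwedge_pure)
  show "\<pi> (proj_rep (unwedge (pure (\<alpha>, \<xi>)))) \<in> {0}"
  proof (rule tpow_carr_induct[OF 1 pv.subspace_single_0 \<alpha>], rule tpow_carr_induct[OF 2 pv.subspace_single_0 \<xi>])
    fix as :: "'a list" and xs :: "'l list" assume "length as = 2" "length xs = 2"
    then obtain a b x y where e: "as = [a, b]" "xs = [x, y]" by (auto simp: length2)
    show "\<pi> (proj_rep (unwedge (pure (pure as, pure xs)))) \<in> {0}"
      using \<theta>_skew[of "a * b" x y] by (simp add: e unwedge_pure \<theta>_def pv.scale_right_distrib)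
  qed
qed (simp add: plin_iff)

text \<open>Both halves carry the scalar \<open>a * 1 = a\<close>, and skewness makes them add up
  instead of cancelling.\<close>

lemma proj_rep_unproj:
  assumes t: "t \<in> carr (TE 2)"
  shows "\<pi> (proj_rep (unproj t)) - \<pi> t \<in> {0}"
proof (rule tensor_carr_induct[OF _ pv.subspace_single_0 t])
  fix a \<xi> assume "a \<in> carr \<AA>" "\<xi> \<in> carr (extpow 2 \<LL>)"
  then have \<xi>: "\<xi> \<in> carr (tpow 2 \<LL>)" by simp
  define F where "F \<xi> = \<pi> (proj_rep (unproj (pure (a, \<xi>)))) - \<pi> (pure (a, \<xi>))" for \<xi>
  have "\<xi> \<in> {\<xi> \<in> carr (tpow 2 \<LL>). F \<xi> = 0}"
  proof (rule linear_span_in[OF pv.linear_ident _ _ \<xi>[unfolded tpow_carr]])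
    have "F 0 = 0" using E_form(4)[OF ext_kill_zero(2), of a 0] by (simp add: F_def unproj_pure)
    then show "pv.subspace {\<xi> \<in> carr (tpow 2 \<LL>). F \<xi> = 0}"
      by (intro pv.subspaceI)
        (auto simp: ext_kill_zero pv.subspace_add[OF L.subspace_tpow] pv.subspace_scale[OF L.subspace_tpow] F_def unproj_pure E_form)
    fix t :: "'l list \<Rightarrow>\<^sub>0 'k" assume "t \<in> {pure xs |xs. length xs = 2 \<and> set xs \<subseteq> carr \<LL>}"
    then obtain x y where e: "t = pure [x, y]" by (auto simp: length2)
    have "pscale (inverse 2) (\<theta> a x y) - pscale (inverse 2) (\<theta> a y x) = \<theta> a x y"
    proof -
      have "pscale (inverse 2) (\<theta> a x y) - pscale (inverse 2) (\<theta> a y x) = pscale (inverse 2 + inverse 2) (\<theta> a x y)"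
        unfolding \<theta>_skew[of a y x] pv.scale_left_distrib pv.scale_minus_right diff_minus_eq_add ..
      also have "inverse 2 + inverse 2 = (1::'k)" using two by (simp add: field_simps)
      finally show ?thesis by simp
    qed
    then show "t \<in> {\<xi> \<in> carr (tpow 2 \<LL>). F \<xi> = 0}"
      by (simp add: e F_def unproj_pure \<theta>_def pv.scale_right_diff_distrib)
  qed
  then show "\<pi> (proj_rep (unproj (pure (a, \<xi>)))) - \<pi> (pure (a, \<xi>)) \<in> {0}" by (simp add: F_def)
qed (simp add: plin_iff pv.scale_right_diff_distrib)

end

lemma proj_rep_TE:
  "r \<in> rel (extpow 2 \<CC>) \<Longrightarrow> proj_rep r \<in> rel (TE 2)"
  "w \<in> carr (tpow 3 \<CC>) \<Longrightarrow> proj_rep (ce_diff cbr w) - tmap (\<lambda>a. a) (ce_diff br) (proj3 w) \<in> rel (TE 2)"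
  "t \<in> carr TK \<Longrightarrow> proj_rep (unwedge t) \<in> rel (TE 2)"
  "t' \<in> carr (TE 2) \<Longrightarrow> proj_rep (unproj t') - t' \<in> rel (TE 2)"
proof -
  have "pv.subspace (rel (TE 2))" using wf_rel[OF wf_TE] by simp
  then obtain \<pi> :: "('a \<times> ('l list \<Rightarrow>\<^sub>0 'k) \<Rightarrow>\<^sub>0 'k) \<Rightarrow> ('a \<times> ('l list \<Rightarrow>\<^sub>0 'k) \<Rightarrow>\<^sub>0 'k)"
    where p: "Vector_Spaces.linear pscale pscale \<pi>" "\<And>r. r \<in> rel (TE 2) \<Longrightarrow> \<pi> r = 0" "\<And>x. \<pi> x = 0 \<Longrightarrow> x \<in> rel (TE 2)"
    using quotient_map_pscale by blast
  show "r \<in> rel (extpow 2 \<CC>) \<Longrightarrow> proj_rep r \<in> rel (TE 2)"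
    by (rule p(3)[OF proj_rep_ext[OF p(1,2)]])
  show "w \<in> carr (tpow 3 \<CC>) \<Longrightarrow> proj_rep (ce_diff cbr w) - tmap (\<lambda>a. a) (ce_diff br) (proj3 w) \<in> rel (TE 2)"
    using proj_rep_boundary[OF p(1,2)] by (intro p(3)) (simp add: linear_simps[OF p(1)])
  show "t \<in> carr TK \<Longrightarrow> proj_rep (unwedge t) \<in> rel (TE 2)"
    using proj_rep_unwedge[OF p(1,2)] by (intro p(3)) simp
  show "t' \<in> carr (TE 2) \<Longrightarrow> proj_rep (unproj t') - t' \<in> rel (TE 2)"
    using proj_rep_unproj[OF p(1,2)] by (intro p(3)) (simp add: linear_simps[OF p(1)])
qed

lemma proj3_carr:
  assumes w: "w \<in> carr (tpow 3 \<CC>)"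
  shows "proj3 w \<in> carr (TE 3)"
proof (rule C_tpow3_induct[OF linear_maps'(1) _ w])
  show "pv.subspace (carr (TE 3))" using wf_carr[OF wf_TE] by simp
qed (auto simp: plin_iff intro!: tensor_carr_pure)

subsection \<open>Cycles\<close>

lemma ext1I: "pure [x + y] - pure [x] - pure [y] \<in> rel (extpow 1 \<LL>)"
    "pure [sL c x] - pscale c (pure [x]) \<in> rel (extpow 1 \<LL>)" "pure [0] \<in> rel (extpow 1 \<LL>)"
    "pure [p + q] - pure [p] - pure [q] \<in> rel (extpow 1 \<CC>)"
    "pure [pscale c p] - pscale c (pure [p]) \<in> rel (extpow 1 \<CC>)" "r \<in> rel \<CC> \<Longrightarrow> pure [r] \<in> rel (extpow 1 \<CC>)"
  using tpow_relI[where V = \<LL> and n = 1 and us = "[]" and vs = "[]", THEN extpow_relI(1)]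
    tpow_relI[where V = \<CC> and n = 1 and us = "[]" and vs = "[]", THEN extpow_relI(1)] by simp_all

lemma proj1_ext:
  assumes r: "r \<in> rel (extpow 1 \<CC>)"
  shows "proj1 r \<in> rel (TE 1)"
proof -
  have sub: "pv.subspace (rel (TE 1))" using wf_rel[OF wf_TE] by simp
  have rc: "proj1 (pure [r]) \<in> rel (TE 1)" if r: "r \<in> rel \<CC>" for r
  proof -
    have "lift pscale (\<lambda>u. pure (fst u, pure [snd u])) r \<in> rel (TE 1)"
    proof (rule tensor_rel_induct[OF linear_plift sub r[unfolded cur_def]], simp_all)
      fix a a' x c
      have px: "pure [x] \<in> carr (tpow (Suc 0) \<LL>)" for x by simp
      note tr = tensor_relI[where V = \<AA> and W = "extpow (Suc 0) \<LL>", simplified]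
      show "pure (a + a', pure [x]) - pure (a, pure [x]) - pure (a', pure [x]) \<in> rel (TE (Suc 0))"
        by (rule tr(1)[OF px])
      show "pure (sA c a, pure [x]) - pscale c (pure (a, pure [x])) \<in> rel (TE (Suc 0))"
        by (rule tr(3)[OF px])
      show "pure (0, pure [x]) \<in> rel (TE (Suc 0))" by (rule tr(5)[OF refl px])
      show "pure (a, pure [0]) \<in> rel (TE (Suc 0))" by (rule tr(6)) (use ext1I(3) in simp)
      have sub: "pv.subspace (carr (tpow (Suc 0) \<LL>))" by (rule L.subspace_tpow)
      fix y
      \<comment> \<open>\<open>pure [x + y]\<close> is a basis vector. It is rewritten as an
        exterior relation plus \<open>pure [x] + pure [y]\<close>, so that the tensor relations
        apply.\<close>
      have "pure (a, pure [x + y]) - pure (a, pure [x]) - pure (a, pure [y])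
         = pure (a, (pure [x + y] - pure [x] - pure [y]) + (pure [x] + pure [y])) - pure (a, pure [x + y] - pure [x] - pure [y]) - pure (a, pure [x] + pure [y])
         + (pure (a, pure [x + y] - pure [x] - pure [y]) + (pure (a, pure [x] + pure [y]) - pure (a, pure [x]) - pure (a, pure [y])))"
        by simp
      also have "\<dots> \<in> rel (TE (Suc 0))"
        using ext1I(1)[of x y]
        by (intro pv.subspace_add[OF wf_rel[OF wf_TE, simplified]] tr(2) tr(6) pv.subspace_add[OF sub] pv.subspace_diff[OF sub] px) simp
      finally show "pure (a, pure [x + y]) - pure (a, pure [x]) - pure (a, pure [y]) \<in> rel (TE (Suc 0))" .
      have "pure (a, pure [sL c x]) - pscale c (pure (a, pure [x]))
         = pure (a, (pure [sL c x] - pscale c (pure [x])) + pscale c (pure [x])) - pure (a, pure [sL c x] - pscale c (pure [x])) - pure (a, pscale c (pure [x]))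
         + (pure (a, pure [sL c x] - pscale c (pure [x])) + (pure (a, pscale c (pure [x])) - pscale c (pure (a, pure [x]))))"
        by simp
      also have "\<dots> \<in> rel (TE (Suc 0))"
        using ext1I(2)[of c x]
        by (intro pv.subspace_add[OF wf_rel[OF wf_TE, simplified]] tr(2) tr(4) tr(6) pv.subspace_scale[OF sub] pv.subspace_diff[OF sub] px) simp
      finally show "pure (a, pure [sL c x]) - pscale c (pure (a, pure [x])) \<in> rel (TE (Suc 0))" .
    qed
    then show ?thesis by simp
  qed
  show ?thesis
  proof (rule extpow_rel_induct[OF linear_maps'(2) sub r])
    fix t assume t: "t \<in> rel (tpow 1 \<CC>)"
    show "proj1 t \<in> rel (TE 1)"
      by (rule tpow_rel_induct[OF linear_maps'(2) sub t]; unfold split1)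
        (use rc in \<open>auto simp: rel_facts(1)[OF wf_TE, of 1, simplified]\<close>)
  qed (auto simp: length1)
qed

text \<open>\<open>proj1\<close> after the differential agrees with \<open>1 \<otimes> d\<close>
  after \<open>proj_rep\<close> modulo relations, so a cycle of the current algebra lands in the
  kernel of \<open>1 \<otimes> d\<close>.\<close>

lemma cycle_proj:
  assumes z: "z \<in> carr (tpow 2 \<CC>)" "ce_diff cbr z \<in> rel (extpow 1 \<CC>)"
  shows "tmap (\<lambda>a. a) (ce_diff br) (proj_rep z) \<in> rel (TE 1)"
proof -
  have sub: "pv.subspace (rel (TE 1))" using wf_rel[OF wf_TE] by simp
  have "proj1 (ce_diff cbr z) - tmap (\<lambda>a. a) (ce_diff br) (proj_rep z) \<in> rel (TE 1)"
  proof (rule C_tpow2_induct[OF _ sub z(1)])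
    fix a x b y
    have p: "pure [br x y] \<in> carr (extpow 1 \<LL>)" by simp
    \<comment> \<open>Moves the sign of the differential out of the second factor:
      \<open>pure (c, - \<xi>)\<close> and \<open>- pure (c, \<xi>)\<close> are different vectors,
      congruent by a scaling relation.\<close>
    have "pure (a * b, scl (extpow 1 \<LL>) (- 1) (pure [br x y])) - pscale (- 1) (pure (a * b, pure [br x y])) \<in> rel (TE 1)"
      by (rule tensor_relI(4)[OF _ p]) simp
    then have "pure (a * b, - pure [br x y]) + pure (a * b, pure [br x y]) \<in> rel (TE 1)" by simp
    then have "- pure (a * b, pure [br x y]) - pure (a * b, - pure [br x y]) \<in> rel (TE 1)"
      using pv.subspace_neg[OF sub, of "pure (a * b, - pure [br x y]) + pure (a * b, pure [br x y])"]
      by (simp only: minus_add_distrib add_uminus_conv_diff minus_diff_commute add.commute[of "- pure (a * b, - pure [br x y])"])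
    then show "proj1 (ce_diff cbr (pure [pure (a, x), pure (b, y)])) - tmap (\<lambda>a. a) (ce_diff br) (proj_rep (pure [pure (a, x), pure (b, y)])) \<in> rel (TE 1)"
      by (simp add: cur_br_eq)
  qed (simp_all add: plin_iff cur_br_eq pv.scale_right_diff_distrib)
  moreover have "proj1 (ce_diff cbr z) \<in> rel (TE 1)" by (rule proj1_ext[OF z(2)])
  ultimately show ?thesis using rel_mem'[OF wf_TE] by blast
qed

lemma ext1_L_neg: "pure [- x] + pure [x] \<in> rel (extpow 1 \<LL>)"
  using ext1I(2)[of "- 1" x] by simp

lemma ext_C_sub: "pv.subspace (rel (extpow n \<CC>))"
  using wf_rel[OF wf_extpow[OF wf_C]] by simp

lemma incl1_ext:
  assumes r: "r \<in> rel (extpow 1 \<LL>)"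
  shows "incl1 a r \<in> rel (extpow 1 \<CC>)"
proof -
  note sub = ext_C_sub[of 1]
  have p: "pure [p] - pure [q] - pure [q'] \<in> rel (extpow 1 \<CC>)" if "p - q - q' \<in> rel \<CC>" for p q q'
  proof -
    have "(pure [(p - q - q') + (q + q')] - pure [p - q - q'] - pure [q + q']) + (pure [p - q - q'] + (pure [q + q'] - pure [q] - pure [q'])) \<in> rel (extpow 1 \<CC>)"
      by (intro pv.subspace_add[OF sub] ext1I that)
    moreover have "(pure [(p - q - q') + (q + q')] - pure [p - q - q'] - pure [q + q']) + (pure [p - q - q'] + (pure [q + q'] - pure [q] - pure [q']))
      = pure [p] - pure [q] - (pure [q'] :: ('a \<times> 'l \<Rightarrow>\<^sub>0 'k) list \<Rightarrow>\<^sub>0 'k)" by (simp add: algebra_simps)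
    ultimately show ?thesis by (simp only:)
  qed
  have p': "pure [p] - pscale c (pure [q]) \<in> rel (extpow 1 \<CC>)" if "p - pscale c q \<in> rel \<CC>" for p q c
  proof -
    have "(pure [(p - pscale c q) + pscale c q] - pure [p - pscale c q] - pure [pscale c q]) + (pure [p - pscale c q] + (pure [pscale c q] - pscale c (pure [q]))) \<in> rel (extpow 1 \<CC>)"
      by (intro pv.subspace_add[OF sub] ext1I that)
    then show ?thesis by simp
  qed
  have z: "pure (a, 0) \<in> rel \<CC>"
    unfolding cur_def by (rule tensor_relI(6)) simp_all
  show ?thesis
  proof (rule extpow_rel_induct[OF linear_maps'(3) sub r])
    fix t assume t: "t \<in> rel (tpow 1 \<LL>)"
    show "incl1 a t \<in> rel (extpow 1 \<CC>)"
      by (rule tpow_rel_induct[OF linear_maps'(3) sub t]; unfold split1)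
        (use p[OF rel_C(2)] p'[OF rel_C(4)] ext1I(6)[OF z] in auto)
  qed (auto simp: length1)
qed

text \<open>The differential of \<open>unproj\<close> at \<open>a \<otimes> \<xi>\<close> is
  \<open>a \<otimes> d \<xi>\<close> modulo relations: its two halves
  \<open>a \<otimes> [x, y]\<close> and \<open>- a \<otimes> [y, x]\<close> agree up to the common
  sign.\<close>

lemma unproj_cycle:
  assumes \<xi>: "\<xi> \<in> carr (tpow 2 \<LL>)" "ce_diff br \<xi> \<in> rel (extpow 1 \<LL>)"
  shows "ce_diff cbr (unproj (pure (a, \<xi>))) \<in> rel (extpow 1 \<CC>)"
proof -
  note sub = ext_C_sub[of 1]
  have "ce_diff cbr (unproj (pure (a, \<xi>))) - incl1 a (ce_diff br \<xi>) \<in> rel (extpow 1 \<CC>)"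
  proof (rule tpow_carr_induct[OF _ sub \<xi>(1)])
    fix xs :: "'l list" assume "length xs = 2"
    then obtain x y where e: "xs = [x, y]" by (auto simp: length2)
    have "incl1 a (pure [- br x y] + pure [br x y]) \<in> rel (extpow 1 \<CC>)"
      by (rule incl1_ext[OF ext1_L_neg])
    then have "pscale (inverse (2::'k)) (pure [pure (a, br y x)] + pure [pure (a, br x y)]) \<in> rel (extpow 1 \<CC>)"
      by (intro pv.subspace_scale[OF sub]) (simp add: L.br_skew[of y x])
    moreover have "ce_diff cbr (unproj (pure (a, pure xs))) - incl1 a (ce_diff br (pure xs))
        = pscale (inverse (2::'k)) (pure [pure (a, br y x)] + pure [pure (a, br x y)])"
    proof -
      have "pscale (inverse (2::'k)) (pure [pure (a, br x y)]) + pscale (inverse 2) (pure [pure (a, br x y)]) = pscale (inverse 2 + inverse 2) (pure [pure (a, br x y)] :: ('a \<times> 'l \<Rightarrow>\<^sub>0 'k) list \<Rightarrow>\<^sub>0 'k)"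
        by (simp only: pv.scale_left_distrib)
      also have "inverse 2 + inverse 2 = (1::'k)" using two by (simp add: field_simps)
      finally have h: "pure [pure (a, br x y)] = pscale (inverse 2) (pure [pure (a, br x y)]) + pscale (inverse 2) (pure [pure (a, br x y)] :: ('a \<times> 'l \<Rightarrow>\<^sub>0 'k) list \<Rightarrow>\<^sub>0 'k)"
        by simp
      have "ce_diff cbr (unproj (pure (a, pure xs))) - incl1 a (ce_diff br (pure xs))
        = pscale (inverse (2::'k)) (pure [pure (a, br y x)] - pure [pure (a, br x y)]) + pure [pure (a, br x y)]"
        by (simp add: e unproj_pure cur_br_eq)
      also have "\<dots> = pscale (inverse (2::'k)) (pure [pure (a, br y x)] + pure [pure (a, br x y)])"
        by (subst (2) h) (simp add: pv.scale_right_distrib pv.scale_right_diff_distrib)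
      finally show ?thesis .
    qed
    ultimately show "ce_diff cbr (unproj (pure (a, pure xs))) - incl1 a (ce_diff br (pure xs)) \<in> rel (extpow 1 \<CC>)" by simp
  qed (simp add: plin_iff unproj_pure pv.scale_right_diff_distrib)
  then show ?thesis using incl1_ext[OF \<xi>(2)] rel_mem[OF wf_extpow[OF wf_C]] by blast
qed

text \<open>The two halves have boundaries proportional to \<open>a b \<otimes> [x, y]\<close> and
  \<open>a b \<otimes> [y, x]\<close>, which cancel. Hence symmetric tensors give cycles without any
  condition.\<close>

lemma unwedge_cycle:
  assumes \<alpha>: "\<alpha> \<in> carr (tpow 2 \<AA>)" and \<xi>: "\<xi> \<in> carr (tpow 2 \<LL>)"
  shows "ce_diff cbr (unwedge (pure (\<alpha>, \<xi>))) \<in> rel (extpow 1 \<CC>)"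
proof -
  note sub = ext_C_sub[of 1]
  have 1: "Vector_Spaces.linear pscale pscale (\<lambda>\<alpha>. ce_diff cbr (unwedge (pure (\<alpha>, \<xi>))))" for \<xi>
    by (simp add: plin_iff unwedge_pure)
  have 2: "Vector_Spaces.linear pscale pscale (\<lambda>\<xi>. ce_diff cbr (unwedge (pure (\<alpha>, \<xi>))))" for \<alpha>
    by (simp add: plin_iff unwedge_pure)
  show ?thesis
  proof (rule tpow_carr_induct[OF 1 sub \<alpha>], rule tpow_carr_induct[OF 2 sub \<xi>])
    fix as :: "'a list" and xs :: "'l list" assume "length as = 2" "length xs = 2"
    then obtain a b x y where e: "as = [a, b]" "xs = [x, y]" by (auto simp: length2)
    have "incl1 (a * b) (pure [- br x y] + pure [br x y]) \<in> rel (extpow 1 \<CC>)"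
      by (rule incl1_ext[OF ext1_L_neg])
    then have "pscale (inverse (2::'k)) (- (pure [pure (a * b, br y x)] + pure [pure (a * b, br x y)])) \<in> rel (extpow 1 \<CC>)"
      by (intro pv.subspace_scale[OF sub] pv.subspace_neg[OF sub]) (simp add: L.br_skew[of y x])
    moreover have "ce_diff cbr (unwedge (pure (pure as, pure xs))) = pscale (inverse (2::'k)) (- (pure [pure (a * b, br y x)] + pure [pure (a * b, br x y)]))"
      by (simp add: e unwedge_pure cur_br_eq)
    ultimately show "ce_diff cbr (unwedge (pure (pure as, pure xs))) \<in> rel (extpow 1 \<CC>)" by simp
  qed
qed

end

section \<open>Comparison of tensor products with different carriers and relations\<close>

lemma tmap_id: "tmap (\<lambda>x. x) (\<lambda>y. y) t = t"
  by (rule linear_eq_pure[where s = pscale and F = "tmap (\<lambda>x. x) (\<lambda>y. y)" and H = "\<lambda>t. t"]) (auto simp: plin_iff)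

lemma tensor_mono:
  assumes "wf_subquot V" "wf_subquot W" "wf_subquot V'" "wf_subquot W'" "scl V' = scl V" "scl W' = scl W"
    "carr V \<subseteq> carr V'" "rel V \<subseteq> rel V'" "carr W \<subseteq> carr W'" "rel W \<subseteq> rel W'"
  shows "t \<in> carr (tensor V W) \<Longrightarrow> t \<in> carr (tensor V' W')" "t \<in> rel (tensor V W) \<Longrightarrow> t \<in> rel (tensor V' W')"
proof -
  have "rep_map (tensor V W) (tensor V' W') (tmap (\<lambda>x. x) (\<lambda>y. y))"
    using assms by (intro rep_map_tmap wf_tensor) (auto simp: rep_map_def rel_facts)
  then show "t \<in> carr (tensor V W) \<Longrightarrow> t \<in> carr (tensor V' W')" "t \<in> rel (tensor V W) \<Longrightarrow> t \<in> rel (tensor V' W')"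
    by (auto simp: rep_map_def tmap_id)
qed

lemma tensor_cong:
  fixes V :: "('k::field, 'v::ab_group_add) subquot" and W :: "('k, 'w::ab_group_add) subquot"
  assumes V: "wf_subquot V" and W: "wf_subquot W" and x: "x \<in> carr V" "x' \<in> carr V" "x - x' \<in> rel V"
    and y: "y \<in> carr W" "y' \<in> carr W" "y - y' \<in> rel W"
  shows "pure (x, y) - pure (x', y') \<in> rel (tensor V W)"
proof -
  have "pv.subspace (rel (tensor V W))" using wf_rel[OF wf_tensor[OF V W]] by simp
  from quotient_map_pscale[OF this]
  obtain \<pi> :: "('v \<times> 'w \<Rightarrow>\<^sub>0 'k) \<Rightarrow> ('v \<times> 'w \<Rightarrow>\<^sub>0 'k)" where \<pi>: "Vector_Spaces.linear pscale pscale \<pi>" "\<And>t. \<pi> t = 0 \<longleftrightarrow> t \<in> rel (tensor V W)"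
    by blast
  have ker: "\<pi> t = 0" if "t \<in> rel (tensor V W)" for t using \<pi>(2) that by blast
  note f = tensor_form_rel[OF V W \<pi>(1) ker]
  have "\<pi> (pure (x, y)) = \<pi> (pure (x', y'))"
    using f(1)[OF _ x(1) y(1) x(2,3)] f(3)[OF _ x(2) y(1) y(2,3)] by simp
  then have "\<pi> (pure (x, y) - pure (x', y')) = 0" by (simp add: linear_simps[OF \<pi>(1)])
  then show ?thesis using \<pi>(2) by blast
qed

lemma tensor_slice:
  assumes V: "wf_subquot V" and W: "wf_subquot W" and R: "pv.subspace R" "rel (tensor V W) \<subseteq> R" and y: "y \<in> carr W"
  shows "module.subspace (scl V) {x \<in> carr V. pure (x, y) \<in> R}"
proof (rule vector_space_subspaceI[OF wf_vs[OF V]])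
  have add: "p \<in> R" if "p - q \<in> rel (tensor V W)" "q \<in> R" for p q
    using pv.subspace_add[OF R(1) _ that(2), of "p - q"] that(1) R(2) by auto
  show "0 \<in> {x \<in> carr V. pure (x, y) \<in> R}"
    using carr_facts(1)[OF V] tensor_relI(5)[OF rel_facts(1)[OF V] y] R(2) by auto
  fix x assume x: "x \<in> {x \<in> carr V. pure (x, y) \<in> R}"
  show "x + x' \<in> {x \<in> carr V. pure (x, y) \<in> R}" if "x' \<in> {x \<in> carr V. pure (x, y) \<in> R}" for x'
  proof -
    have "pure (x + x', y) - (pure (x, y) + pure (x', y)) \<in> rel (tensor V W)"
      using tensor_relI(1)[of x V x' y W] x that y by (simp add: diff_diff_eq)
    then show ?thesis using add pv.subspace_add[OF R(1)] x that carr_facts(2)[OF V] by blast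
  qed
  show "scl V c x \<in> {x \<in> carr V. pure (x, y) \<in> R}" for c
  proof -
    have "pure (scl V c x, y) - pscale c (pure (x, y)) \<in> rel (tensor V W)"
      using tensor_relI(3)[of x V y W] x y by simp
    then show ?thesis using add pv.subspace_scale[OF R(1)] x carr_facts(3)[OF V] by blast
  qed
qed

lemma lin_cong:
  assumes "wf_subquot V" "lin V W F" "\<And>x. x \<in> carr V \<Longrightarrow> F' (cls V x) = F (cls V x)"
  shows "lin V W F'"
proof -
  have 1: "F' X = F X" if "X \<in> elts V" for X using that assms(3) by (auto simp: elts_def)
  have 2: "qadd X Y \<in> elts V" if "X \<in> elts V" "Y \<in> elts V" for X Y
    using that carr_facts(2)[OF assms(1)] by (auto simp: elts_def qadd_cls[OF assms(1)])
  have 3: "qscl V c X \<in> elts V" if "X \<in> elts V" for c X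
    using that carr_facts(3)[OF assms(1)] by (auto simp: elts_def qscl_cls[OF assms(1)])
  show ?thesis using assms(2) unfolding lin_def by (simp add: 1 2 3)
qed

lemma homology_simps: "scl (homology n V b) = pscale"
  "carr (homology n V b) = {z \<in> carr (tpow n V). ce_diff b z \<in> rel (extpow (n - 1) V)}"
  by (simp_all add: homology_def)

lemma homology_carr_subspace:
  assumes "wf_subquot V"
  shows "pv.subspace (carr (homology n V b))"
proof -
  have 1: "pv.subspace (carr (tpow n V))" using wf_carr[OF wf_tpow[OF assms]] by simp
  define m where "m = n - 1"
  have 2: "pv.subspace (rel (extpow m V))" using wf_rel[OF wf_extpow[OF assms]] by simp
  show ?thesis unfolding homology_simps m_def[symmetric]
    using pv.subspace_0[OF 1] pv.subspace_0[OF 2]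
    by (intro pv.subspaceI) (auto simp: pv.subspace_add[OF 1] pv.subspace_add[OF 2] pv.subspace_scale[OF 1] pv.subspace_scale[OF 2])
qed

context current
begin

abbreviation "H2 \<equiv> H2_cur sA sL br G \<beta>"
abbreviation "HL \<equiv> hcomp (homology 2 \<LL> br) D2"
abbreviation "AH \<equiv> A_tensor_H2 sA sL br G \<beta>"
abbreviation "CK \<equiv> coker (ce_diff br) (extpow 3 \<LL>) (extpow 2 \<LL>)"
abbreviation "N \<equiv> rel (tensor \<AA> CK)"
abbreviation Dg :: "(('a \<times> 'l \<Rightarrow>\<^sub>0 'k) list \<Rightarrow>\<^sub>0 'k) set" where "Dg \<equiv> hpow (cur_grading sA sL G) 2 \<beta>"
abbreviation "Eb \<equiv> hcomp (extpow 2 \<LL>) D2"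
abbreviation "np \<equiv> nat_proj sA sL br G \<beta>"

subsection \<open>The natural projection\<close>

lemma H2_simps [simp]: "scl H2 = pscale" "rel H2 = \<BB>"
  "carr H2 = {d + r |d r. d \<in> Dg \<inter> carr (homology 2 \<CC> cbr) \<and> r \<in> \<BB>}"
  by (simp_all add: H2_cur_def homology_simps(1))

lemma AH_eq: "AH = tensor \<AA> HL"
  by (simp add: A_tensor_H2_def)

lemma Dg_sub: "pv.subspace Dg"
  by (simp add: hpow_def)

lemma wf_H2: "wf_subquot H2"
  unfolding H2_cur_def
  by (intro wf_hcomp) (simp_all add: homology_simps(1) homology_carr_subspace[OF wf_C] B_sub Dg_sub pv.vector_space_axioms)

lemma rel_HL: "rel (homology 2 \<LL> br) = rel CK"
  by (simp add: homology2_rel)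

lemma ce_diff_carr: "w \<in> carr (tpow 3 \<LL>) \<Longrightarrow> ce_diff br w \<in> carr (tpow 2 \<LL>)"
  "z \<in> carr (tpow 2 \<LL>) \<Longrightarrow> ce_diff br z \<in> carr (tpow 1 \<LL>)"
proof -
  show "ce_diff br w \<in> carr (tpow 2 \<LL>)" if "w \<in> carr (tpow 3 \<LL>)"
    by (rule tpow_carr_induct[OF linear_ce_diff L.subspace_tpow that])
      (auto simp: length3 simp del: add_uminus_conv_diff uminus_add_conv_diff
        intro!: pv.subspace_add[OF L.subspace_tpow] pv.subspace_diff[OF L.subspace_tpow] pv.subspace_neg[OF L.subspace_tpow])
  show "ce_diff br z \<in> carr (tpow 1 \<LL>)" if "z \<in> carr (tpow 2 \<LL>)"
    by (rule tpow_carr_induct[OF linear_ce_diff L.subspace_tpow that])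
      (auto simp: length2 intro!: pv.subspace_neg[OF L.subspace_tpow])
qed

lemma wf_CK: "wf_subquot CK"
  by (intro wf_coker) (simp_all add: linear_ce_diff L.subspace_tpow L.wf_ext ce_diff_carr)

lemma wf_HL: "wf_subquot HL"
  using wf_rel[OF wf_CK]
  by (intro wf_hcomp)
    (simp_all add: homology_simps(1) homology_carr_subspace[OF L.wf_L] L.hpow_sub pv.vector_space_axioms rel_HL del: coker_simps(3))

lemma wf_AH: "wf_subquot AH"
  unfolding AH_eq by (rule wf_tensor[OF wf_A wf_HL])

lemma wf_Eb: "wf_subquot Eb"
  using L.wf_ext[of 2] L.hpow_sub by (intro wf_hcomp) (auto simp: wf_subquot_def)

lemma ext2_CK: "r \<in> rel (extpow 2 \<LL>) \<Longrightarrow> r \<in> rel CK"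
  unfolding coker_simps by (intro CollectI exI[of _ 0] exI[of _ r]) (simp add: ext_kill_zero)

lemma ce_diff_CK: "w \<in> carr (tpow 3 \<LL>) \<Longrightarrow> ce_diff br w \<in> rel CK"
  unfolding coker_simps using rel_facts(1)[OF L.wf_ext]
  by (intro CollectI exI[of _ w] exI[of _ 0]) simp

lemma wf_TCK: "wf_subquot (tensor \<AA> CK)"
  by (rule wf_tensor[OF wf_A wf_CK])

lemmas N_facts = rel_facts[OF wf_TCK, simplified tensor_scl]
lemmas N_mem = rel_mem[OF wf_TCK] and N_mem' = rel_mem'[OF wf_TCK] and N_trans = rel_trans[OF wf_TCK] and N_sym = rel_sym[OF wf_TCK]

lemma TE_N: "t \<in> rel (TE 2) \<Longrightarrow> t \<in> N"
  by (erule tensor_mono(2)[OF wf_A L.wf_ext wf_A wf_CK, rotated -1]) (use ext2_CK in \<open>simp_all add: subset_iff del: coker_simps(3)\<close>)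

lemma Eb_N: "t \<in> rel (tensor \<AA> Eb) \<Longrightarrow> t \<in> N"
  by (erule tensor_mono(2)[OF wf_A wf_Eb wf_A wf_CK, rotated -1])
    (use ext2_CK wf_sub[OF wf_Eb] carr_facts(2)[OF L.wf_ext[of 2]] wf_sub[OF L.wf_ext[of 2]] in \<open>auto simp: subset_iff simp del: coker_simps(3)\<close>)

lemma HL_CK: "carr HL \<subseteq> carr CK"
  using wf_sub[OF wf_CK] carr_facts(2)[OF wf_CK] by (auto simp: homology_simps rel_HL simp del: coker_simps(3))

text \<open>\<open>H\<^sub>2\<close> and \<open>\<Lambda>\<^sup>2/B\<^sub>2\<close> have the same
  relations and differ in their carriers. Tensoring over a field keeps the inclusion injective, so
  equality in \<open>A \<otimes> H\<^sub>2\<close> may be tested modulo \<open>N\<close>.\<close>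

lemma AH_N: "t \<in> rel AH \<Longrightarrow> t \<in> N" "t \<in> carr AH \<Longrightarrow> t \<in> N \<Longrightarrow> t \<in> rel AH"
proof -
  show "t \<in> N" if "t \<in> rel AH"
    using HL_CK by (intro tensor_mono(2)[OF wf_A wf_HL wf_A wf_CK _ _ _ _ _ _ that[unfolded AH_eq]])
      (simp_all add: rel_HL homology_simps(1) del: coker_simps(3) hcomp_simps(3))
  show "t \<in> rel AH" if "t \<in> carr AH" "t \<in> N"
    unfolding AH_eq using HL_CK that
    by (intro tensor_subspace_rel[OF wf_A wf_A _ _ _ wf_CK wf_HL _ _ _ _ that(2)])
      (simp_all add: rel_HL homology_simps(1) AH_eq del: coker_simps(3) hcomp_simps(3))
qed

text \<open>The chain map property sends a boundary into the image of
  \<open>A \<otimes> d(\<Lambda>\<^sup>3)\<close>, which is divided out in \<open>N\<close>.\<close>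

lemma proj_rep_B: "b \<in> \<BB> \<Longrightarrow> proj_rep b \<in> N"
proof -
  assume "b \<in> \<BB>"
  then obtain w r where b: "b = ce_diff cbr w + r" "w \<in> carr (tpow 3 \<CC>)" "r \<in> rel (extpow 2 \<CC>)"
    unfolding homology2_rel by blast
  have "pv.subspace N" using wf_rel[OF wf_TCK] by simp
  from tensor_carr_induct[OF linear_tmap this proj3_carr[OF b(2)], of "\<lambda>a. a" "ce_diff br"]
  have "tmap (\<lambda>a. a) (ce_diff br) (proj3 w) \<in> N"
    by (simp add: tensor_relI(6) ce_diff_CK del: coker_simps(3))
  then have "proj_rep (ce_diff cbr w) \<in> N" using N_mem TE_N[OF proj_rep_TE(2)[OF b(2)]] by blast
  then show ?thesis using N_facts(2) TE_N[OF proj_rep_TE(1)[OF b(3)]] by (simp add: b(1) del: coker_simps(3))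
qed

lemma Dg_induct:
  assumes F: "Vector_Spaces.linear pscale s F" "module.subspace s R" and z: "z \<in> Dg"
    and l: "\<And>q. Vector_Spaces.linear pscale s (\<lambda>p. F (pure [p, q]))"
      "\<And>p. Vector_Spaces.linear pscale s (\<lambda>q. F (pure [p, q]))"
    and gen: "\<And>a x b y \<gamma> \<delta>. x \<in> G \<gamma> \<Longrightarrow> y \<in> G \<delta> \<Longrightarrow> \<gamma> + \<delta> = \<beta> \<Longrightarrow> F (pure [pure (a, x), pure (b, y)]) \<in> R"
  shows "F z \<in> R"
proof (rule linear_span_in[OF F _ z[unfolded hpow_def]])
  fix t :: "('a \<times> 'l \<Rightarrow>\<^sub>0 'k) list \<Rightarrow>\<^sub>0 'k"
  assume "t \<in> {pure xs |xs \<gamma>s. length xs = 2 \<and> list_all2 (\<lambda>x \<gamma>. x \<in> cur_grading sA sL G \<gamma>) xs \<gamma>s \<and> sum_list \<gamma>s = \<beta>}"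
  then obtain p q \<gamma> \<delta> where t: "t = pure [p, q]" and p: "p \<in> cur_grading sA sL G \<gamma>" and q: "q \<in> cur_grading sA sL G \<delta>"
    and b: "\<gamma> + \<delta> = \<beta>"
    by (auto simp: length2 list_all2_Cons1)
  show "F t \<in> R" unfolding t
    by (rule cur_grading_induct[OF l(1) F(2) p], rule cur_grading_induct[OF l(2) F(2) q]) (rule gen[OF _ _ b])
qed

lemma DgI:
  assumes "x \<in> G \<gamma>" "y \<in> G \<delta>" "\<gamma> + \<delta> = \<beta>"
  shows "pure [pure (a, x), pure (b, y)] \<in> Dg"
proof -
  have "pure (a, x) \<in> cur_grading sA sL G \<gamma>" if "x \<in> G \<gamma>" for a x \<gamma>
    unfolding cur_grading_def using that by (intro tensor_carr_pure) auto
  then show ?thesis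
    unfolding hpow_def using assms
    by (intro pv.span_base CollectI exI[of _ "[pure (a, x), pure (b, y)]"] exI[of _ "[\<gamma>, \<delta>]"]) auto
qed

lemma Dg_carr: "z \<in> Dg \<Longrightarrow> z \<in> carr (tpow 2 \<CC>)"
  unfolding hpow_def tpow_carr by (erule set_mp[OF pv.span_mono, rotated]) auto

lemma proj_rep_Dg: "z \<in> Dg \<Longrightarrow> proj_rep z \<in> carr (tensor \<AA> Eb)"
proof (erule Dg_induct[OF linear_maps(4), rotated])
  show "pv.subspace (carr (tensor \<AA> Eb))" using wf_carr[OF wf_tensor[OF wf_A wf_Eb]] by simp
  fix a x b y \<gamma> \<delta> assume h: "x \<in> G \<gamma>" "y \<in> G \<delta>" "\<gamma> + \<delta> = \<beta>"
  have "pure [x, y] = pure [x, y] + 0 \<and> pure [x, y] \<in> D2 \<inter> carr (extpow 2 \<LL>) \<and> 0 \<in> rel (extpow 2 \<LL>)"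
    using L.hpowI(1)[OF h] rel_facts(1)[OF L.wf_ext] by simp
  then have "pure [x, y] \<in> carr Eb" unfolding hcomp_simps by blast
  then show "proj_rep (pure [pure (a, x), pure (b, y)]) \<in> carr (tensor \<AA> Eb)" by (simp add: tensor_carr_pure)
qed (simp_all add: plin_iff)

text \<open>The image of a cycle lies in the kernel of \<open>1 \<otimes> d\<close>, and
  \<open>tensor_kernel\<close> rewrites it with cycles in the second factor. Applying it to
  \<open>Eb\<close> rather than to the full exterior square keeps these cycles in degree
  \<beta>.\<close>

lemma np_ex:
  assumes "z \<in> carr H2"
  obtains t where "t \<in> carr AH" "proj_rep z - t \<in> N"
proof -
  obtain d r where z: "z = d + r" "d \<in> Dg" "d \<in> carr (homology 2 \<CC> cbr)" "r \<in> \<BB>" using assms by auto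
  have cy: "d \<in> carr (tpow 2 \<CC>)" "ce_diff cbr d \<in> rel (extpow 1 \<CC>)" using z(3) by (simp_all add: homology_simps)
  have "rep_map Eb (extpow 1 \<LL>) (ce_diff br)"
  proof (rule linear_rep_map)
    fix x assume "x \<in> carr Eb"
    then have "x \<in> carr (tpow 2 \<LL>)"
      using carr_facts(2)[OF L.wf_ext[of 2]] wf_sub[OF L.wf_ext[of 2]] by auto
    then show "ce_diff br x \<in> carr (extpow 1 \<LL>)" using ce_diff_carr(2) by simp
  next
    fix x assume "x \<in> rel Eb"
    then show "ce_diff br x \<in> rel (extpow 1 \<LL>)" by (intro L.ce_diff_ext2) simp
  qed (simp_all add: linear_ce_diff L.wf_ext)
  from tensor_kernel[OF wf_A wf_Eb L.wf_ext[of 1] _ this proj_rep_Dg[OF z(2)] cycle_proj[OF cy]]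
  obtain t where t: "t \<in> carr (tensor \<AA> (Eb\<lparr>carr := {x \<in> carr Eb. ce_diff br x \<in> rel (extpow 1 \<LL>)}\<rparr>))"
    "proj_rep d - t \<in> rel (tensor \<AA> Eb)"
    by (auto simp: linear_ce_diff)
  have "x \<in> carr HL" if x: "x \<in> carr Eb" "ce_diff br x \<in> rel (extpow 1 \<LL>)" for x
  proof -
    obtain d r where e: "x = d + r" "d \<in> D2" "r \<in> rel (extpow 2 \<LL>)" using x(1) by auto
    have "ce_diff br d = ce_diff br x - ce_diff br r" by (simp add: e)
    then have "ce_diff br d \<in> rel (extpow 1 \<LL>)" using rel_facts(4)[OF L.wf_ext x(2) L.ce_diff_ext2[OF e(3)]] by simp
    then have "d \<in> D2 \<inter> carr (homology 2 \<LL> br)" using e(2) L.hpow_carr[OF e(2)] by (simp add: homology_simps)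
    moreover have "r \<in> rel (homology 2 \<LL> br)" unfolding rel_HL by (rule ext2_CK[OF e(3)])
    ultimately show ?thesis unfolding hcomp_simps e(1) by blast
  qed
  moreover have "pv.subspace (carr AH)" using wf_carr[OF wf_AH] by (simp add: AH_eq)
  ultimately have tA: "t \<in> carr AH"
    by (intro tensor_carr_induct[OF pv.linear_ident _ t(1)]) (auto simp: AH_eq simp del: hcomp_simps(3) intro: tensor_carr_pure)
  moreover have "proj_rep d - t \<in> N" by (rule Eb_N[OF t(2)])
  then have "proj_rep d - t + proj_rep r \<in> N" by (rule N_facts(2)[OF _ proj_rep_B[OF z(4)]])
  moreover have "proj_rep d - t + proj_rep r = proj_rep z - t" by (simp add: z(1))
  ultimately have "proj_rep z - t \<in> N" by (simp only:)
  with tA show ?thesis by (rule that)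
qed

text \<open>The choice is unique modulo \<open>rel AH\<close> by \<open>AH_N\<close>, so linearity
  on cosets follows from linearity of \<open>proj_rep\<close>.\<close>

definition np_rep :: "(('a \<times> 'l \<Rightarrow>\<^sub>0 'k) list \<Rightarrow>\<^sub>0 'k) \<Rightarrow> ('a \<times> ('l list \<Rightarrow>\<^sub>0 'k) \<Rightarrow>\<^sub>0 'k)" where
  "np_rep z = (SOME t. t \<in> carr AH \<and> proj_rep z - t \<in> N)"

lemma np_rep: "z \<in> carr H2 \<Longrightarrow> np_rep z \<in> carr AH" "z \<in> carr H2 \<Longrightarrow> proj_rep z - np_rep z \<in> N"
proof -
  assume "z \<in> carr H2"
  then have "\<exists>t. t \<in> carr AH \<and> proj_rep z - t \<in> N" using np_ex[of z] by metis
  then have "np_rep z \<in> carr AH \<and> proj_rep z - np_rep z \<in> N" unfolding np_rep_def by (rule someI_ex)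
  then show "np_rep z \<in> carr AH" "proj_rep z - np_rep z \<in> N" by auto
qed

lemma AH_scl: "scl AH = pscale"
  by (simp add: AH_eq)

lemma rep_map_np: "rep_map H2 AH np_rep"
  unfolding rep_map_def
proof (intro conjI ballI allI)
  note c = carr_facts[OF wf_AH, unfolded AH_scl] and h = carr_facts[OF wf_H2, unfolded H2_simps(1)]
  show "np_rep x \<in> carr AH" if "x \<in> carr H2" for x by (rule np_rep(1)[OF that])
  show "np_rep x \<in> rel AH" if "x \<in> rel H2" for x
  proof (rule AH_N(2))
    have x: "x \<in> carr H2" by (rule wf_sub[OF wf_H2 that])
    show "np_rep x \<in> carr AH" by (rule np_rep(1)[OF x])
    have "proj_rep x \<in> N" using that by (intro proj_rep_B) simp
    then show "np_rep x \<in> N" by (rule N_mem'[OF np_rep(2)[OF x]])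
  qed
  show "np_rep (x + y) - (np_rep x + np_rep y) \<in> rel AH" if x: "x \<in> carr H2" and y: "y \<in> carr H2" for x y
  proof (rule AH_N(2))
    show "np_rep (x + y) - (np_rep x + np_rep y) \<in> carr AH" by (intro c h np_rep x y)
    have "(proj_rep x - np_rep x) + (proj_rep y - np_rep y) - (proj_rep (x + y) - np_rep (x + y)) \<in> N"
      by (intro N_facts(2,4) np_rep(2) x y h)
    then show "np_rep (x + y) - (np_rep x + np_rep y) \<in> N" by (simp add: algebra_simps del: coker_simps(3))
  qed
  show "np_rep (scl H2 k x) - scl AH k (np_rep x) \<in> rel AH" if x: "x \<in> carr H2" for k x
  proof (rule AH_N(2), unfold H2_simps(1) AH_scl)
    show "np_rep (pscale k x) - pscale k (np_rep x) \<in> carr AH" by (intro c h np_rep x)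
    have "pscale k (proj_rep x - np_rep x) - (proj_rep (pscale k x) - np_rep (pscale k x)) \<in> N"
      by (intro N_facts(3,4) np_rep(2) x h)
    then show "np_rep (pscale k x) - pscale k (np_rep x) \<in> N"
      by (simp add: pv.scale_right_diff_distrib del: coker_simps(3))
  qed
qed

lemma np_cls: "z \<in> carr H2 \<Longrightarrow> np (cls H2 z) = cls AH (np_rep z)"
proof (intro equalityI subsetI)
  assume z: "z \<in> carr H2"
  show "t \<in> cls AH (np_rep z)" if "t \<in> np (cls H2 z)" for t
  proof -
    obtain z' where t: "t \<in> carr AH" "z' - z \<in> \<BB>" "proj_rep z' - t \<in> N" using \<open>t \<in> np (cls H2 z)\<close>
      unfolding nat_proj_def cls_def by (auto simp del: coker_simps(3))
    have "proj_rep z' - proj_rep z \<in> N" using proj_rep_B[OF t(2)] by (simp del: coker_simps(3))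
    then have "t - np_rep z \<in> N" using t(3) np_rep(2)[OF z] N_sym N_trans by blast
    then show ?thesis unfolding cls_def using AH_N(2) carr_facts(4)[OF wf_AH t(1) np_rep(1)[OF z]] by simp
  qed
  show "t \<in> np (cls H2 z)" if "t \<in> cls AH (np_rep z)" for t
  proof -
    have t: "t - np_rep z \<in> rel AH" using that by (simp add: cls_def)
    have "(t - np_rep z) + np_rep z \<in> carr AH"
      by (rule carr_facts(2)[OF wf_AH wf_sub[OF wf_AH t] np_rep(1)[OF z]])
    then have 1: "t \<in> carr AH" by simp
    have 2: "proj_rep z - t \<in> N" using np_rep(2)[OF z] AH_N(1)[OF t] N_sym N_trans by blast
    have "z \<in> cls H2 z" using rel_facts(1)[OF wf_H2] by (simp add: cls_def)
    then show ?thesis unfolding nat_proj_def using 1 2 by blast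
  qed
qed

lemma np_induced: "z \<in> carr H2 \<Longrightarrow> np (cls H2 z) = induced AH np_rep (cls H2 z)"
  by (simp only: np_cls induced_cls[OF wf_H2 wf_AH rep_map_np])

lemma np_rep_iff: "z \<in> carr H2 \<Longrightarrow> np_rep z \<in> rel AH \<longleftrightarrow> proj_rep z \<in> N"
  using np_rep[of z] AH_N N_mem N_mem' by blast

lemma unproj_Dg: "d \<in> D2 \<Longrightarrow> unproj (pure (a, d)) \<in> Dg"
proof (erule L.hpow2_induct[OF _ Dg_sub, rotated])
  fix x y \<gamma> \<delta> assume h: "x \<in> G \<gamma>" "y \<in> G \<delta>" "\<gamma> + \<delta> = \<beta>"
  then have "\<delta> + \<gamma> = \<beta>" by (simp add: add.commute)
  then show "unproj (pure (a, pure [x, y])) \<in> Dg"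
    using DgI[OF h, of a 1] DgI[OF h(2,1), of a 1] by (simp add: unproj_pure pv.subspace_scale[OF Dg_sub] pv.subspace_diff[OF Dg_sub])
qed (simp add: plin_iff unproj_pure)

text \<open>A preimage of \<open>a \<otimes> \<xi>\<close> with \<open>\<xi>\<close> a cycle is
  \<open>unproj (pure (a, \<xi>))\<close>, again a cycle by \<open>unproj_cycle\<close>.\<close>

lemma rep_surj_np: "rep_surj H2 AH np_rep"
  unfolding rep_surj_def
proof
  fix t assume t: "t \<in> carr AH"
  \<comment> \<open>The elements with a preimage modulo \<open>N\<close> form a subspace, so pure
    tensors suffice.\<close>
  have sub: "pv.subspace {proj_rep z + n |z n. z \<in> carr H2 \<and> n \<in> N}"
    using wf_carr[OF wf_H2] wf_rel[OF wf_TCK] by (intro subspace_image_sum[OF linear_maps(4)]) (simp_all del: H2_simps(3) coker_simps(3))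
  have "t \<in> {proj_rep z + n |z n. z \<in> carr H2 \<and> n \<in> N}"
  proof (rule tensor_carr_induct[OF pv.linear_ident sub t[unfolded AH_eq]])
    fix a :: 'a and y :: "'l list \<Rightarrow>\<^sub>0 'k" assume "y \<in> carr HL"
    then obtain d r where y: "y = d + r" "d \<in> D2" "d \<in> carr (homology 2 \<LL> br)" "r \<in> rel CK"
      by (auto simp: rel_HL simp del: coker_simps(3))
    have d: "d \<in> carr (tpow 2 \<LL>)" "ce_diff br d \<in> rel (extpow 1 \<LL>)" using y(3) by (simp_all add: homology_simps)
    let ?z = "unproj (pure (a, d))"
    have "?z \<in> Dg" by (rule unproj_Dg[OF y(2)])
    moreover then have "?z \<in> carr (homology 2 \<CC> cbr)" using unproj_cycle[OF d] Dg_carr by (simp add: homology_simps)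
    ultimately have "?z + 0 \<in> carr H2" unfolding H2_simps using rel_facts(1)[OF wf_H2] by (intro CollectI exI[of _ ?z] exI[of _ 0]) simp
    then have 1: "?z \<in> carr H2" by (simp del: H2_simps(3))
    have 2: "proj_rep ?z - pure (a, d) \<in> N"
      by (rule TE_N[OF proj_rep_TE(4)]) (simp add: tensor_carr_pure d)
    have yd: "y - d \<in> rel CK" "d \<in> carr CK" using y(4) d(1) by (simp_all add: y(1) del: coker_simps(3))
    have "y \<in> carr CK" using carr_facts(2)[OF wf_CK yd(2) wf_sub[OF wf_CK y(4)]] by (simp add: y(1) del: coker_simps(3))
    then have "pure (a, y) - pure (a, d) \<in> N"
      using yd rel_facts(1)[OF wf_A] by (intro tensor_cong wf_A wf_CK) (simp_all del: coker_simps(3))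
    then have "pure (a, y) - proj_rep ?z \<in> N" using 2 N_sym N_trans by blast
    then have "pure (a, y) = proj_rep ?z + (pure (a, y) - proj_rep ?z) \<and> ?z \<in> carr H2 \<and> pure (a, y) - proj_rep ?z \<in> N"
      using 1 by simp
    then show "pure (a, y) \<in> {proj_rep z + n |z n. z \<in> carr H2 \<and> n \<in> N}" by blast
  qed
  then obtain z n where z: "t = proj_rep z + n" "z \<in> carr H2" "n \<in> N" by blast
  have "t - proj_rep z \<in> N" using z(1,3) by (simp del: coker_simps(3))
  then have "t - np_rep z \<in> N" using np_rep(2)[OF z(2)] N_trans by blast
  then have "t - np_rep z \<in> rel AH" using AH_N(2) carr_facts(4)[OF wf_AH t np_rep(1)[OF z(2)]] by blast
  then show "\<exists>x\<in>carr H2. t - np_rep x \<in> rel AH" using z(2) by blast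
qed

lemma lin_np: "lin H2 AH np"
  by (rule lin_cong[OF wf_H2 lin_induced[OF wf_H2 wf_AH rep_map_np] np_induced])

lemma surj_np: "np ` elts H2 = elts AH"
proof -
  have "np ` elts H2 = induced AH np_rep ` elts H2"
    by (rule image_cong[OF refl]) (auto simp: elts_def np_induced simp del: H2_simps(3))
  then show ?thesis using image_induced_surj[OF wf_H2 wf_AH rep_map_np rep_surj_np] by simp
qed

abbreviation "KK \<equiv> K_space sA sL br G \<beta>"

lemma KK_eq: "KK = H2\<lparr>carr := {z \<in> carr H2. np_rep z \<in> rel AH}\<rparr>"
proof -
  have "{x \<in> carr H2. np (cls H2 x) = rel AH} = {z \<in> carr H2. np_rep z \<in> rel AH}"
  proof (rule Collect_cong, rule conj_cong[OF refl])
    fix z assume "z \<in> carr H2"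
    then show "np (cls H2 z) = rel AH \<longleftrightarrow> np_rep z \<in> rel AH" by (simp only: np_cls cls_rel_iff[OF wf_AH])
  qed
  then show ?thesis by (simp only: K_space_def ker_space_def)
qed

lemma KK_simps: "scl KK = pscale" "rel KK = \<BB>" "carr KK = {z \<in> carr H2. proj_rep z \<in> N}"
  using np_rep_iff by (auto simp: KK_eq simp del: H2_simps(3) coker_simps(3))

lemma wf_KK: "wf_subquot KK"
  unfolding KK_eq by (rule wf_carr_kernel[OF wf_H2 wf_AH rep_map_np])

declare hcomp_simps(3) [simp del] coker_simps(3) [simp del] imag_simps(3) [simp del] H2_simps(3) [simp del]

subsection \<open>The kernel of the natural projection\<close>

text \<open>The same set is the carrier of the image of the reduced Koszul map and the relations of
  its cokernel.\<close>

abbreviation IM :: "('l list \<Rightarrow>\<^sub>0 'k) set" where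
  "IM \<equiv> rel (coker_koszul sL br)"
abbreviation "Imb \<equiv> hcomp (im_koszul sL br) D2"
abbreviation "Cb \<equiv> hcomp (coker_koszul sL br) D2"
abbreviation \<iota> :: "'a \<Rightarrow> ('a list \<Rightarrow>\<^sub>0 'k)" where "\<iota> \<equiv> \<lambda>a. pure [a, 1]"
abbreviation "p2 \<equiv> L.proj2 \<beta>"
abbreviation "TQ \<equiv> tensor (HH1 sA) Kb"

lemma Z3: "carr (homology 3 \<LL> br) = {z \<in> carr (tpow 3 \<LL>). ce_diff br z \<in> rel (extpow 2 \<LL>)}"
  by (simp add: homology_simps numeral_3_eq_3 numeral_2_eq_2)

lemma kos_simps [simp]: "scl (im_koszul sL br) = pscale" "scl (coker_koszul sL br) = pscale"
  "carr (im_koszul sL br) = IM" "rel (im_koszul sL br) = rel (kill sL br)"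
  "carr (coker_koszul sL br) = carr (tpow 2 \<LL>)"
  by (simp_all add: im_koszul_def coker_koszul_def imag_simps(3) coker_simps(3))

lemma IM_iff: "y \<in> IM \<longleftrightarrow> (\<exists>v r. y = koszul br v + r \<and> v \<in> carr (tpow 3 \<LL>) \<and> ce_diff br v \<in> rel (extpow 2 \<LL>) \<and> r \<in> rel (kill sL br))"
  unfolding coker_koszul_def coker_simps(3) Z3 by blast

lemma koszul_carr: "v \<in> carr (tpow 3 \<LL>) \<Longrightarrow> koszul br v \<in> carr (tpow 2 \<LL>)"
  by (erule tpow_carr_induct[OF linear_koszul L.subspace_tpow]) (auto simp: length3)

lemma wf_im: "wf_subquot (im_koszul sL br)" and wf_ck: "wf_subquot (coker_koszul sL br)"
proof -
  have s: "pv.subspace (carr (homology 3 \<LL> br))" by (rule homology_carr_subspace[OF L.wf_L])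
  show "wf_subquot (im_koszul sL br)" unfolding im_koszul_def
    by (rule wf_imag) (simp_all add: homology_simps(1) linear_koszul s L.wf_kill)
  show "wf_subquot (coker_koszul sL br)" unfolding coker_koszul_def
    by (rule wf_coker) (auto simp: homology_simps(1) linear_koszul s[unfolded Z3] L.wf_kill Z3 koszul_carr)
qed

lemma wf_Imb: "wf_subquot Imb" and wf_Cb: "wf_subquot Cb"
  using wf_vs[OF wf_im] wf_carr[OF wf_im] wf_rel[OF wf_im] wf_vs[OF wf_ck] wf_carr[OF wf_ck]
    wf_rel[OF wf_ck] L.hpow_sub[of 2 \<beta>] by (auto intro!: wf_hcomp)

lemma kill_IM: "r \<in> rel (kill sL br) \<Longrightarrow> r \<in> IM"
  using wf_sub[OF wf_im] by simp

lemma koszul_IM: "v \<in> carr (tpow 3 \<LL>) \<Longrightarrow> ce_diff br v \<in> rel (extpow 2 \<LL>) \<Longrightarrow> koszul br v \<in> IM"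
  unfolding IM_iff using rel_facts(1)[OF L.wf_kill] by (intro exI[of _ v] exI[of _ 0]) simp

lemma D2_carr: "d \<in> D2 \<Longrightarrow> d \<in> carr (tpow 2 \<LL>)"
  by (rule L.hpow_carr)

lemma carr_Kb: "y \<in> carr Kb \<longleftrightarrow> (\<exists>d r. y = d + r \<and> d \<in> D2 \<and> r \<in> rel (kill sL br))"
  using D2_carr by (auto simp: hcomp_simps(3))

lemma carr_Cb: "y \<in> carr Cb \<longleftrightarrow> (\<exists>d r. y = d + r \<and> d \<in> D2 \<and> r \<in> IM)"
  using D2_carr by (auto simp: hcomp_simps(3))

lemma carr_Imb: "y \<in> carr Imb \<longleftrightarrow> (\<exists>d r. y = d + r \<and> d \<in> D2 \<and> d \<in> IM \<and> r \<in> rel (kill sL br))"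
  by (auto simp: hcomp_simps(3))

lemma D2_Kb: "d \<in> D2 \<Longrightarrow> d \<in> carr Kb"
  unfolding carr_Kb using rel_facts(1)[OF L.wf_kill] by (intro exI[of _ d] exI[of _ 0]) simp

lemma D2_Imb: "d \<in> D2 \<Longrightarrow> d \<in> IM \<Longrightarrow> d \<in> carr Imb"
  unfolding carr_Imb using rel_facts(1)[OF L.wf_kill] by (intro exI[of _ d] exI[of _ 0]) simp

lemma Imb_Kb: "y \<in> carr Imb \<Longrightarrow> y \<in> carr Kb" and Kb_Cb: "y \<in> carr Kb \<Longrightarrow> y \<in> carr Cb"
  and Imb_IM: "y \<in> carr Imb \<Longrightarrow> y \<in> IM"
  unfolding carr_Kb carr_Cb carr_Imb using kill_IM rel_facts(2)[OF wf_ck] by auto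

lemma carr_K2: "y \<in> carr Kb \<Longrightarrow> y \<in> carr (tpow 2 \<LL>)" "y \<in> carr Cb \<Longrightarrow> y \<in> carr (tpow 2 \<LL>)"
  unfolding carr_Kb carr_Cb
  using D2_carr wf_sub[OF L.wf_kill] wf_sub[OF wf_ck] by (auto intro!: pv.subspace_add[OF L.subspace_tpow])

lemma koszul_D2: "w \<in> hpow G 3 \<beta> \<Longrightarrow> koszul br w \<in> D2"
  by (rule L.hpow3_induct[OF linear_koszul L.hpow_sub]) (auto intro: L.hpowI L.G_bracket)

lemma tpow_kill: "r \<in> rel (tpow 2 \<LL>) \<Longrightarrow> r \<in> rel (kill sL br)"
  by (rule L.sympow_kill[OF sympow_relI(1)])

lemma p2_Kb: "y \<in> carr Kb \<Longrightarrow> p2 y - y \<in> rel (kill sL br)"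
proof -
  assume "y \<in> carr Kb"
  then obtain d r where y: "y = d + r" "d \<in> D2" "r \<in> rel (kill sL br)" by (auto simp: carr_Kb)
  have "(p2 d - d) + (p2 r - r) \<in> rel (kill sL br)"
    by (intro rel_facts(2,4)[OF L.wf_kill] tpow_kill L.proj2_id y L.proj2_kill[OF two])
  then show ?thesis by (simp add: y(1) algebra_simps)
qed

text \<open>The image of the reduced Koszul map is a graded subspace: the degree \<beta> part of a
  cycle, supplied by \<open>homogeneous_part\<close>, is again a cycle, and its Koszul image is the
  projection of the given one.\<close>

lemma p2_IM: "y \<in> IM \<Longrightarrow> p2 y \<in> carr Imb"
proof -
  assume "y \<in> IM"
  then obtain v r where y: "y = koszul br v + r" "v \<in> carr (tpow 3 \<LL>)" "ce_diff br v \<in> rel (extpow 2 \<LL>)" "r \<in> rel (kill sL br)"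
    unfolding IM_iff by blast
  from L.homogeneous_part[OF two y(2), of \<beta>]
  obtain v' where v': "v' \<in> hpow G 3 \<beta>" "ce_diff br v' - p2 (ce_diff br v) \<in> rel (extpow 2 \<LL>)"
    "koszul br v' - p2 (koszul br v) \<in> rel (kill sL br)" by blast
  have "ce_diff br v' \<in> rel (extpow 2 \<LL>)"
    using rel_mem[OF L.wf_ext v'(2) L.proj2_ext[OF two y(3)]] .
  then have k: "koszul br v' \<in> IM" "koszul br v' \<in> D2" using v'(1) by (auto intro: koszul_IM L.hpow_carr koszul_D2)
  have "p2 y = koszul br v' + (p2 r - (koszul br v' - p2 (koszul br v)))" by (simp add: y(1))
  moreover have "p2 r - (koszul br v' - p2 (koszul br v)) \<in> rel (kill sL br)"
    by (intro rel_facts(4)[OF L.wf_kill] L.proj2_kill[OF two y(4)] v'(3))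
  ultimately show ?thesis unfolding carr_Imb using k by blast
qed

text \<open>A representative in degree \<beta> of the cokernel may contain elements of
  \<open>IM\<close> of any degree. Projection strips these down to degree \<beta> and changes the
  representative only by \<open>IM\<close>.\<close>

lemma p2_Cb: "y \<in> carr Cb \<Longrightarrow> p2 y \<in> carr Kb" "y \<in> carr Cb \<Longrightarrow> y - p2 y \<in> IM"
proof -
  assume y: "y \<in> carr Cb"
  show "p2 y \<in> carr Kb" by (rule D2_Kb[OF L.proj2_in[OF carr_K2(2)[OF y]]])
  obtain d r where e: "y = d + r" "d \<in> D2" "r \<in> IM" using y by (auto simp: carr_Cb)
  have "(r - p2 r) - (p2 d - d) \<in> IM"
    by (intro rel_facts(4)[OF wf_ck] e(3) Imb_IM[OF p2_IM[OF e(3)]] kill_IM tpow_kill L.proj2_id[OF e(2)])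
  then show "y - p2 y \<in> IM" by (simp add: e(1) algebra_simps)
qed

lemma wf_TQ: "wf_subquot TQ"
  by (rule wf_tensor[OF wf_HH1 wf_Kb])

lemma TQ_TK: "t \<in> carr TQ \<Longrightarrow> t \<in> carr TK" "t \<in> rel TQ \<Longrightarrow> t \<in> rel TK"
proof -
  have k: "carr Kb \<subseteq> carr (kill sL br)" using carr_K2 by auto
  show "t \<in> carr TQ \<Longrightarrow> t \<in> carr TK" "t \<in> rel TQ \<Longrightarrow> t \<in> rel TK"
    using k by (intro tensor_mono[OF wf_HH1 wf_Kb wf_HH1 L.wf_kill]; simp)+
qed

lemma TK_TQ: "t \<in> carr TQ \<Longrightarrow> t \<in> rel TK \<Longrightarrow> t \<in> rel TQ"
  by (rule tensor_subspace_rel[OF wf_HH1 wf_HH1 _ _ _ L.wf_kill wf_Kb]) (use carr_K2 in auto)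

definition QL :: "(('a list \<Rightarrow>\<^sub>0 'k) \<times> ('l list \<Rightarrow>\<^sub>0 'k) \<Rightarrow>\<^sub>0 'k) set" where
  "QL = {pure (\<iota> a, y) |a y. y \<in> carr Imb}"

text \<open>\<open>QQ\<close> is \<open>(HH\<^sub>1(A) \<otimes> Kill\<^sub>\<beta>) / ((A \<and> 1) \<otimes> Im(\<eta>)\<^sub>\<beta>)\<close>, a model of the kernel.\<close>

definition "QQ = TQ\<lparr>rel := pspan (rel TQ \<union> QL)\<rparr>"

lemma QQ_simps [simp]: "scl QQ = pscale" "carr QQ = carr TQ"
  by (simp_all add: QQ_def)

lemma rel_QQ: "rel QQ = pspan (rel TQ \<union> QL)"
  by (simp add: QQ_def)

lemma QL_carr: "t \<in> QL \<Longrightarrow> t \<in> carr TQ"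
  using Imb_Kb by (auto simp: QL_def intro!: tensor_carr_pure)

lemma TQ_sub: "pv.subspace (carr TQ)" "pv.subspace (rel TQ)"
  using wf_TQ by (simp_all add: wf_subquot_def)

lemma wf_QQ: "wf_subquot QQ"
proof -
  have "pspan (rel TQ \<union> QL) \<subseteq> carr TQ"
    using QL_carr wf_sub[OF wf_TQ] by (intro pv.span_minimal TQ_sub) auto
  then show ?thesis using TQ_sub by (simp add: wf_subquot_def rel_QQ pv.vector_space_axioms)
qed

lemma QQ_sub: "pv.subspace (rel QQ)"
  by (simp add: rel_QQ)

lemma QQ_relI: "t \<in> rel TQ \<Longrightarrow> t \<in> rel QQ" "y \<in> carr Imb \<Longrightarrow> pure (\<iota> a, y) \<in> rel QQ"
  unfolding rel_QQ QL_def by (auto intro: pv.span_base)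

lemma QQ_rel_induct:
  assumes "Vector_Spaces.linear pscale s F" "module.subspace s R" "t \<in> rel QQ"
    "\<And>t. t \<in> rel TQ \<Longrightarrow> F t \<in> R" "\<And>a y. y \<in> carr Imb \<Longrightarrow> F (pure (\<iota> a, y)) \<in> R"
  shows "F t \<in> R"
  by (rule linear_span_in[OF assms(1,2) _ assms(3)[unfolded rel_QQ]]) (use assms(4,5) in \<open>auto simp: QL_def\<close>)

lemma rep_map_iota: "rep_map \<AA> (HH1 sA) \<iota>"
proof -
  have "pure [0, 1] \<in> rel (HH1 sA)"
    by (intro ext_HH1 extpow_relI(1) tpow2I(5)) simp_all
  moreover have "pure [a + a', 1] - (pure [a, 1] + pure [a', 1]) \<in> rel (HH1 sA)" for a a'
    using ext_HH1[OF extpow_relI(1)[OF tpow2I(1)[of 1 \<AA> a a']]] by (simp add: diff_diff_eq)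
  moreover have "pure [sA c a, 1] - pscale c (pure [a, 1]) \<in> rel (HH1 sA)" for c a
    using ext_HH1[OF extpow_relI(1)[OF tpow2I(3)[of 1 \<AA> a c]]] by simp
  ultimately show ?thesis by (simp add: rep_map_def)
qed

lemma BB_KK: "b \<in> \<BB> \<Longrightarrow> b \<in> carr KK"
  using wf_sub[OF wf_KK] by (simp add: KK_simps(2))

lemma KK_sub: "pv.subspace (carr KK)"
  using wf_carr[OF wf_KK] by (simp add: KK_simps(1))

lemma Dg_H2: "d \<in> Dg \<Longrightarrow> ce_diff cbr d \<in> rel (extpow 1 \<CC>) \<Longrightarrow> d \<in> carr H2"
  unfolding H2_simps using rel_facts(1)[OF wf_H2] Dg_carr
  by (intro CollectI exI[of _ d] exI[of _ 0]) (simp add: homology_simps)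

lemma unwedge_Dg: "\<alpha> \<in> carr (tpow 2 \<AA>) \<Longrightarrow> d \<in> D2 \<Longrightarrow> unwedge (pure (\<alpha>, d)) \<in> Dg"
proof -
  assume \<alpha>: "\<alpha> \<in> carr (tpow 2 \<AA>)" and d: "d \<in> D2"
  have 1: "Vector_Spaces.linear pscale pscale (\<lambda>\<alpha>. unwedge (pure (\<alpha>, \<xi>)))" for \<xi>
    by (simp add: plin_iff unwedge_pure)
  have 2: "Vector_Spaces.linear pscale pscale (\<lambda>\<xi>. unwedge (pure (\<alpha>, \<xi>)))" for \<alpha>
    by (simp add: plin_iff unwedge_pure)
  show ?thesis
  proof (rule tpow_carr_induct[OF 1 Dg_sub \<alpha>], rule L.hpow2_induct[OF 2 Dg_sub d])
    fix as :: "'a list" and x y \<gamma> \<delta> assume "length as = 2" and h: "x \<in> G \<gamma>" "y \<in> G \<delta>" "\<gamma> + \<delta> = \<beta>"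
    then obtain a b where e: "as = [a, b]" by (auto simp: length2)
    have "\<delta> + \<gamma> = \<beta>" using h by (simp add: add.commute)
    then show "unwedge (pure (pure as, pure [x, y])) \<in> Dg"
      using DgI[OF h, of a b] DgI[OF h(2,1), of a b]
      by (simp add: e unwedge_pure pv.subspace_scale[OF Dg_sub] pv.subspace_add[OF Dg_sub])
  qed
qed

lemma unwedge_KK: "t \<in> carr TQ \<Longrightarrow> unwedge t \<in> carr KK"
proof (erule tensor_carr_induct[OF linear_maps(2) KK_sub])
  fix \<alpha> \<xi> assume a: "\<alpha> \<in> carr (HH1 sA)" and "\<xi> \<in> carr Kb"
  then obtain d r where e: "\<xi> = d + r" "d \<in> D2" "r \<in> rel (kill sL br)" by (auto simp: carr_Kb)
  have \<alpha>: "\<alpha> \<in> carr (tpow 2 \<AA>)" using a by simp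
  have "unwedge (pure (\<alpha>, r)) \<in> \<BB>"
    by (rule unwedge_rel_B[OF tensor_relI(6)[OF a]]) (simp add: e(3))
  moreover have "unwedge (pure (\<alpha>, d)) \<in> carr KK"
  proof -
    have "unwedge (pure (\<alpha>, d)) \<in> carr H2"
      by (rule Dg_H2[OF unwedge_Dg[OF \<alpha> e(2)] unwedge_cycle[OF \<alpha> D2_carr[OF e(2)]]])
    moreover have "proj_rep (unwedge (pure (\<alpha>, d))) \<in> N"
      using TE_N[OF proj_rep_TE(3)[OF tensor_carr_pure]] a D2_carr[OF e(2)] by simp
    ultimately show ?thesis by (simp add: KK_simps)
  qed
  moreover have "unwedge (pure (\<alpha>, \<xi>)) = unwedge (pure (\<alpha>, d)) + unwedge (pure (\<alpha>, r))"
    by (simp add: e(1) unwedge_pure)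
  ultimately show "unwedge (pure (\<alpha>, \<xi>)) \<in> carr KK"
    using pv.subspace_add[OF KK_sub] BB_KK by simp
qed

text \<open>For a cycle \<open>v\<close> the term \<open>unproj (pure (a, ce_diff br v))\<close> is
  a boundary, so \<open>unwedge_koszul_B\<close> makes \<open>unwedge\<close> at
  \<open>\<iota> a \<otimes> \<eta>(v)\<close> a boundary too. This is why exactly \<open>QL\<close>
  is divided out.\<close>

lemma rep_map_unwedge: "rep_map QQ KK unwedge"
proof (rule linear_rep_map[OF _ wf_KK])
  show "Vector_Spaces.linear (scl QQ) (scl KK) unwedge" by (simp add: KK_simps linear_maps)
  show "unwedge t \<in> carr KK" if "t \<in> carr QQ" for t using that unwedge_KK by simp
  show "unwedge t \<in> rel KK" if t: "t \<in> rel QQ" for t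
    unfolding KK_simps
  proof (rule QQ_rel_induct[OF linear_maps(2) B_sub t])
    fix a y assume "y \<in> carr Imb"
    then obtain v r where y: "y = koszul br v + r" "v \<in> carr (tpow 3 \<LL>)" "ce_diff br v \<in> rel (extpow 2 \<LL>)" "r \<in> rel (kill sL br)"
      using Imb_IM IM_iff by blast
    have "unproj (pure (a, ce_diff br v)) \<in> \<BB>"
      by (rule unproj_rel_B[OF tensor_relI(6)[OF _ y(3)]]) simp
    then have "unwedge (pure (\<iota> a, koszul br v)) \<in> \<BB>"
      using pv.subspace_add[OF B_sub unwedge_koszul_B[OF y(2), of a]] by fastforce
    moreover have "unwedge (pure (\<iota> a, r)) \<in> \<BB>"
      by (rule unwedge_rel_B[OF tensor_relI(6)]) (simp_all add: y(4))
    moreover have "unwedge (pure (\<iota> a, y)) = unwedge (pure (\<iota> a, koszul br v)) + unwedge (pure (\<iota> a, r))"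
      by (simp add: y(1) unwedge_pure)
    ultimately show "unwedge (pure (\<iota> a, y)) \<in> \<BB>" using pv.subspace_add[OF B_sub] by simp
  qed (rule unwedge_rel_B)
qed

lemma rep_map_p2_kill: "rep_map (kill sL br) (kill sL br) p2"
  by (rule linear_rep_map) (auto simp: L.linear_proj2 L.wf_kill L.proj2_kill[OF two] intro: D2_carr L.proj2_in)

lemma rep_map_p2_ext: "rep_map (extpow 2 \<LL>) (extpow 2 \<LL>) p2"
  by (rule linear_rep_map) (auto simp: L.linear_proj2 L.wf_ext L.proj2_ext[OF two] intro: D2_carr L.proj2_in)

lemma rep_map_id: "wf_subquot V \<Longrightarrow> rep_map V V (\<lambda>x. x)"
  by (simp add: rep_map_def rel_facts)

lemma p2_TQ: "t \<in> carr TQ \<Longrightarrow> tmap (\<lambda>x. x) p2 t - t \<in> rel TQ"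
proof (erule tensor_carr_induct[OF _ TQ_sub(2), rotated])
  fix \<alpha> \<xi> assume a: "\<alpha> \<in> carr (HH1 sA)" and x: "\<xi> \<in> carr Kb"
  have "p2 \<xi> \<in> carr Kb" by (rule p2_Cb(1)[OF Kb_Cb[OF x]])
  then show "tmap (\<lambda>x. x) p2 (pure (\<alpha>, \<xi>)) - pure (\<alpha>, \<xi>) \<in> rel TQ"
    using a x p2_Kb[OF x] rel_facts(1)[OF wf_HH1] by (simp add: tensor_cong wf_HH1 wf_Kb)
qed (simp add: plin_iff pv.scale_right_diff_distrib)

text \<open>
  If \<open>unwedge t\<close> is the boundary of \<open>w\<close>, both components of this boundary are computed from \<open>v = proj3 w\<close>:
  \<open>t = - (\<iota> \<otimes> \<eta>) v\<close> and \<open>0 = (1 \<otimes> d) v\<close>.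
\<close>

lemma rep_inj_unwedge: "rep_inj QQ KK unwedge"
  unfolding rep_inj_def
proof (intro ballI impI)
  fix t assume "t \<in> carr QQ" and "unwedge t \<in> rel KK"
  then have t: "t \<in> carr TQ" and "unwedge t \<in> \<BB>" by (simp_all add: KK_simps)
  then obtain w r where w: "unwedge t = ce_diff cbr w + r" "w \<in> carr (tpow 3 \<CC>)" "r \<in> rel (extpow 2 \<CC>)"
    unfolding homology2_rel by blast
  define v where "v = proj3 w"
  have v: "v \<in> carr (TE 3)" unfolding v_def by (rule proj3_carr[OF w(2)])
  note K = rel_facts[OF wf_TK, simplified tensor_scl] and E = rel_facts[OF wf_TE[of 2], simplified tensor_scl]
  have "(wedge_sym (ce_diff cbr w) - - tmap \<iota> (koszul br) v) + wedge_sym r - (wedge_sym (unwedge t) - t) \<in> rel TK"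
    unfolding v_def by (intro K(2,4) wedge_sym_TK TQ_TK w t)
  then have 1: "t + tmap \<iota> (koszul br) v \<in> rel TK" by (simp add: w(1) algebra_simps)
  have "proj_rep (unwedge t) - proj_rep r - (proj_rep (ce_diff cbr w) - tmap (\<lambda>a. a) (ce_diff br) v) \<in> rel (TE 2)"
    unfolding v_def by (intro E(4) proj_rep_TE TQ_TK w t)
  then have 2: "tmap (\<lambda>a. a) (ce_diff br) v \<in> rel (TE 2)" by (simp add: w(1))
  \<comment> \<open>The chain \<open>w\<close>, hence \<open>v\<close>, may have components of all
    degrees. Projecting the second factor restricts both equations to degree \<beta> and leaves
    \<open>t\<close> unchanged modulo relations.\<close>
  have "rep_map TK TK (tmap (\<lambda>x. x) p2)"
    by (intro rep_map_tmap rep_map_p2_kill rep_map_id wf_HH1 L.wf_kill wf_TK)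
  then have "tmap (\<lambda>x. x) p2 (t + tmap \<iota> (koszul br) v) \<in> rel TK" using 1 unfolding rep_map_def by blast
  then have "tmap (\<lambda>x. x) p2 t + tmap \<iota> (\<lambda>x. p2 (koszul br x)) v \<in> rel TK" by (simp add: tmap_comp)
  from K(4)[OF this TQ_TK(2)[OF p2_TQ[OF t]]]
  have 3: "t + tmap \<iota> (\<lambda>x. p2 (koszul br x)) v \<in> rel TK" by (simp add: algebra_simps)
  have "rep_map (TE 2) (TE 2) (tmap (\<lambda>x. x) p2)"
    by (intro rep_map_tmap rep_map_p2_ext rep_map_id wf_A L.wf_ext wf_TE)
  then have "tmap (\<lambda>a. a) p2 (tmap (\<lambda>a. a) (ce_diff br) v) \<in> rel (TE 2)" using 2 unfolding rep_map_def by blast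
  then have 4: "tmap (\<lambda>a. a) (\<lambda>x. p2 (ce_diff br x)) v \<in> rel (TE 2)" by (simp add: tmap_comp)
  let ?d = "\<lambda>x. p2 (ce_diff br x)"
  have dl: "Vector_Spaces.linear (scl (extpow 3 \<LL>)) (scl (extpow 2 \<LL>)) ?d"
    by (simp add: linear_compose[OF linear_ce_diff L.linear_proj2])
  have dm: "rep_map (extpow 3 \<LL>) (extpow 2 \<LL>) ?d"
    by (rule linear_rep_map[OF dl L.wf_ext]) (auto intro: D2_carr L.proj2_in ce_diff_carr L.proj2_ext[OF two] L.ce_diff_ext3)
  \<comment> \<open>Flatness: \<open>v\<close> is replaced by a combination of tensors whose second
    factors have boundary trivial in degree \<beta>.\<close>
  from tensor_kernel[OF wf_A L.wf_ext L.wf_ext dl dm v 4]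
  obtain v' where v': "v' \<in> carr (tensor \<AA> (extpow 3 \<LL>\<lparr>carr := {x \<in> carr (extpow 3 \<LL>). ?d x \<in> rel (extpow 2 \<LL>)}\<rparr>))"
    "v - v' \<in> rel (TE 3)" by blast
  let ?e = "\<lambda>x. p2 (koszul br x)"
  have "rep_map (extpow 3 \<LL>) (kill sL br) ?e"
    by (rule linear_rep_map) (auto simp: linear_compose[OF linear_koszul L.linear_proj2] L.wf_kill
        intro: D2_carr L.proj2_in koszul_carr L.proj2_kill[OF two] L.koszul_ext3)
  then have "rep_map (TE 3) TK (tmap \<iota> ?e)"
    by (intro rep_map_tmap rep_map_iota wf_HH1 L.wf_kill wf_TE)
  then have "tmap \<iota> ?e (v - v') \<in> rel TK" using v'(2) unfolding rep_map_def by blast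
  from K(4)[OF 3 this] have 5: "t + tmap \<iota> ?e v' \<in> rel TK" by simp
  have Rs: "pv.subspace {x + y |x y. x \<in> pspan QL \<and> y \<in> rel TK}"
    using wf_rel[OF wf_TK] by (intro pv.subspace_sums) simp_all
  have "tmap \<iota> ?e v' \<in> {x + y |x y. x \<in> pspan QL \<and> y \<in> rel TK}"
  proof (rule tensor_carr_induct[OF linear_tmap Rs v'(1)])
    fix a x assume "x \<in> carr (extpow 3 \<LL>\<lparr>carr := {x \<in> carr (extpow 3 \<LL>). ?d x \<in> rel (extpow 2 \<LL>)}\<rparr>)"
    then have x: "x \<in> carr (tpow 3 \<LL>)" "?d x \<in> rel (extpow 2 \<LL>)" by simp_all
    \<comment> \<open>Such a factor \<open>x\<close> need not be a cycle in other degrees; its part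
      \<open>x'\<close> of degree \<beta> is one, with the same projected Koszul image.\<close>
    from L.homogeneous_part[OF two x(1), of \<beta>]
    obtain x' where x': "x' \<in> hpow G 3 \<beta>" "ce_diff br x' - ?d x \<in> rel (extpow 2 \<LL>)" "koszul br x' - ?e x \<in> rel (kill sL br)"
      by blast
    have "ce_diff br x' \<in> rel (extpow 2 \<LL>)" by (rule rel_mem[OF L.wf_ext x'(2) x(2)])
    then have k: "koszul br x' \<in> carr Imb" using x'(1) by (intro D2_Imb koszul_D2 koszul_IM L.hpow_carr)
    have e: "?e x - koszul br x' \<in> rel (kill sL br)" by (rule rel_sym[OF L.wf_kill x'(3)])
    have "pure (\<iota> a, ?e x) - pure (\<iota> a, koszul br x') \<in> rel TK"
      using rel_facts(1)[OF wf_HH1] e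
      by (intro tensor_cong wf_HH1 L.wf_kill) (auto intro: D2_carr L.proj2_in koszul_carr x L.hpow_carr x')
    moreover have "pure (\<iota> a, koszul br x') \<in> pspan QL" using k by (intro pv.span_base) (auto simp: QL_def)
    moreover have "tmap \<iota> ?e (pure (a, x)) = pure (\<iota> a, koszul br x') + (pure (\<iota> a, ?e x) - pure (\<iota> a, koszul br x'))" by simp
    ultimately show "tmap \<iota> ?e (pure (a, x)) \<in> {x + y |x y. x \<in> pspan QL \<and> y \<in> rel TK}" by blast
  qed
  then obtain l y where l: "tmap \<iota> ?e v' = l + y" "l \<in> pspan QL" "y \<in> rel TK" by blast
  have lc: "l \<in> carr TQ" using pv.span_minimal[OF _ TQ_sub(1), of QL] QL_carr l(2) by auto
  have "t + l \<in> rel TK" using K(4)[OF 5 l(3)] by (simp add: l(1))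
  \<comment> \<open>Back from all of the Killing module to its degree \<beta> part, by injectivity
    of tensoring with a subspace.\<close>
  then have "t + l \<in> rel TQ" using TK_TQ pv.subspace_add[OF TQ_sub(1) t lc] by blast
  then have "t + l \<in> rel QQ" by (rule QQ_relI(1))
  moreover have "l \<in> rel QQ" unfolding rel_QQ using l(2) pv.span_mono[of QL "rel TQ \<union> QL"] by auto
  ultimately show "t \<in> rel QQ" using pv.subspace_diff[OF QQ_sub] by fastforce
qed

lemma wedge_sym_Dg: "z \<in> Dg \<Longrightarrow> wedge_sym z \<in> carr TQ"
proof (erule Dg_induct[OF linear_maps(1) TQ_sub(1)])
  fix a x b y \<gamma> \<delta> assume h: "x \<in> G \<gamma>" "y \<in> G \<delta>" "\<gamma> + \<delta> = \<beta>"
  then show "wedge_sym (pure [pure (a, x), pure (b, y)]) \<in> carr TQ"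
    using D2_Kb[OF L.hpowI(1)[OF h]] by (simp add: tensor_carr_pure)
qed (simp_all add: plin_iff)

text \<open>An element of \<open>A \<otimes> d(\<Lambda>\<^sup>3)\<close> can be traded for one of
  \<open>HH1 \<otimes> Kill\<close>: \<open>unwedge_koszul_B\<close> exchanges
  \<open>a \<otimes> d w\<close> for \<open>\<iota> a \<otimes> \<eta>(w)\<close>. The projection
  \<open>p2\<close>, through \<open>homogeneous_part\<close>, allows a homogeneous \<open>w'\<close>
  in place of \<open>w\<close>.\<close>

lemma unproj_N:
  assumes e: "e \<in> N"
  shows "unproj (tmap (\<lambda>a. a) p2 e) \<in> {unwedge t + b |t b. t \<in> carr TQ \<and> b \<in> \<BB>}"
proof -
  let ?R = "{unwedge t + b |t b. t \<in> carr TQ \<and> b \<in> \<BB>}"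
  let ?F = "\<lambda>e. unproj (tmap (\<lambda>a. a) p2 e)"
  have Rs: "pv.subspace ?R" by (rule subspace_image_sum[OF linear_maps(2) TQ_sub(1) B_sub])
  have BR: "b \<in> ?R" if "b \<in> \<BB>" for b
    using that pv.subspace_0[OF TQ_sub(1)] by (intro CollectI exI[of _ 0] exI[of _ b]) simp
  have RI: "x \<in> ?R" if "x - unwedge t \<in> \<BB>" "t \<in> carr TQ" for x t
    using that by (intro CollectI exI[of _ t] exI[of _ "x - unwedge t"]) simp
  have l: "Vector_Spaces.linear pscale pscale ?F" by (simp add: plin_iff)
  note ls = linear_simps[OF l]
  have "rep_map (TE 2) (TE 2) (tmap (\<lambda>x. x) p2)"
    by (intro rep_map_tmap rep_map_p2_ext rep_map_id wf_A L.wf_ext wf_TE)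
  then have TR: "?F x \<in> ?R" if "x \<in> rel (TE 2)" for x
    using that by (intro BR unproj_rel_B) (simp add: rep_map_def)
  show ?thesis
  proof (rule tensor_rel_induct[OF l Rs e])
    fix a a' y assume h: "a \<in> carr \<AA>" "a' \<in> carr \<AA>" "y \<in> carr CK"
    show "?F (pure (a + a', y)) - ?F (pure (a, y)) - ?F (pure (a', y)) \<in> ?R"
      unfolding ls[symmetric] using h by (intro TR tensor_relI) simp_all
  next
    fix a y y' assume h: "a \<in> carr \<AA>" "y \<in> carr CK" "y' \<in> carr CK"
    show "?F (pure (a, y + y')) - ?F (pure (a, y)) - ?F (pure (a, y')) \<in> ?R"
      unfolding ls[symmetric] using h by (intro TR tensor_relI) simp_all
  next
    fix c a y assume h: "a \<in> carr \<AA>" "y \<in> carr CK"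
    show "?F (pure (scl \<AA> c a, y)) - pscale c (?F (pure (a, y))) \<in> ?R"
      unfolding ls[symmetric] using h by (intro TR tensor_relI) simp_all
    show "?F (pure (a, scl CK c y)) - pscale c (?F (pure (a, y))) \<in> ?R"
      unfolding ls[symmetric] using h tensor_relI(4)[of a \<AA> y "extpow 2 \<LL>" c] by (intro TR) simp
  next
    fix a y assume h: "a \<in> rel \<AA>" "y \<in> carr CK"
    show "?F (pure (a, y)) \<in> ?R" using h by (intro TR tensor_relI) simp_all
  next
    fix a y assume "y \<in> rel CK"
    then obtain w r where y: "y = ce_diff br w + r" "w \<in> carr (tpow 3 \<LL>)" "r \<in> rel (extpow 2 \<LL>)"
      by (auto simp: coker_simps(3))
    from L.homogeneous_part[OF two y(2), of \<beta>]
    obtain w' where w': "w' \<in> hpow G 3 \<beta>" "ce_diff br w' - p2 (ce_diff br w) \<in> rel (extpow 2 \<LL>)" by blast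
    have z: "unproj (pure (a, x)) \<in> \<BB>" if "x \<in> rel (extpow 2 \<LL>)" for x
      using that by (intro unproj_rel_B tensor_relI) simp_all
    have "unproj (pure (a, p2 r)) - unproj (pure (a, ce_diff br w' - p2 (ce_diff br w)))
        - (unwedge (pure (\<iota> a, koszul br w')) - unproj (pure (a, ce_diff br w'))) \<in> \<BB>"
      by (rule pv.subspace_diff[OF B_sub pv.subspace_diff[OF B_sub z[OF L.proj2_ext[OF two y(3)]] z[OF w'(2)]]
            unwedge_koszul_B[OF L.hpow_carr[OF w'(1)]]])
    moreover have "unproj (pure (a, p2 r)) - unproj (pure (a, ce_diff br w' - p2 (ce_diff br w)))
        - (unwedge (pure (\<iota> a, koszul br w')) - unproj (pure (a, ce_diff br w')))
      = ?F (pure (a, y)) - unwedge (pure (\<iota> a, koszul br w'))"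
      by (simp add: y(1) unproj_pure)
    moreover have "pure (\<iota> a, koszul br w') \<in> carr TQ"
      using D2_Kb[OF koszul_D2[OF w'(1)]] by (intro tensor_carr_pure) simp_all
    ultimately show "?F (pure (a, y)) \<in> ?R" by (intro RI[of _ "pure (\<iota> a, koszul br w')"]) simp_all
  qed
qed

text \<open>By \<open>decompose_homogeneous_B\<close> a class is an \<open>unwedge\<close> part plus
  an \<open>unproj\<close> part. In the kernel the second has its argument in \<open>N\<close>, so
  \<open>unproj_N\<close> rewrites it as an \<open>unwedge\<close> part as well.\<close>

lemma rep_surj_unwedge: "rep_surj QQ KK unwedge"
  unfolding rep_surj_def
proof
  fix z assume "z \<in> carr KK"
  then have "z \<in> carr H2" and zN: "proj_rep z \<in> N" by (simp_all add: KK_simps)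
  then obtain d r where z: "z = d + r" "d \<in> Dg" "r \<in> \<BB>" unfolding H2_simps by blast
  have "proj_rep z - proj_rep r \<in> N" by (intro N_facts(4) zN proj_rep_B z)
  then have dN: "proj_rep d \<in> N" by (simp add: z(1))
  let ?e = "proj_rep d"
  have ps: "pv.subspace (rel (TE 2))" using wf_rel[OF wf_TE] by simp
  have "tmap (\<lambda>a. a) p2 ?e - ?e \<in> rel (TE 2)"
  proof (rule tensor_carr_induct[OF _ ps proj_rep_Dg[OF z(2)]])
    fix a y assume "y \<in> carr Eb"
    then obtain d' r' where y: "y = d' + r'" "d' \<in> D2" "r' \<in> rel (extpow 2 \<LL>)" by (auto simp: hcomp_simps(3))
    have "(p2 d' - d') + (p2 r' - r') \<in> rel (extpow 2 \<LL>)"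
      by (intro rel_facts(2,4)[OF L.wf_ext] extpow_relI(1) L.proj2_id y L.proj2_ext[OF two])
    then have "p2 y - y \<in> rel (extpow 2 \<LL>)" by (simp add: y(1) algebra_simps)
    moreover have "y \<in> carr (tpow 2 \<LL>)"
      unfolding y(1) using wf_sub[OF L.wf_ext y(3)] by (intro pv.subspace_add[OF L.subspace_tpow] D2_carr[OF y(2)]) simp
    ultimately show "tmap (\<lambda>a. a) p2 (pure (a, y)) - pure (a, y) \<in> rel (TE 2)"
      by (simp, intro tensor_cong wf_A L.wf_ext) (auto intro: D2_carr L.proj2_in)
  qed (simp add: plin_iff pv.scale_right_diff_distrib)
  then have up: "unproj (tmap (\<lambda>a. a) p2 ?e - ?e) \<in> \<BB>" by (rule unproj_rel_B)
  obtain t b where t: "unproj (tmap (\<lambda>a. a) p2 ?e) = unwedge t + b" "t \<in> carr TQ" "b \<in> \<BB>"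
    using unproj_N[OF dN] by blast
  \<comment> \<open>Four boundaries whose sum telescopes to
    \<open>z - unwedge (wedge_sym d + t)\<close>: the decomposition error, the effect of
    \<open>p2\<close>, the error \<open>b\<close>, and the boundary \<open>r\<close> in
    \<open>z\<close>.\<close>
  have mem: "(d - (unwedge (wedge_sym d) + unproj ?e)) - unproj (tmap (\<lambda>a. a) p2 ?e - ?e) + b + r \<in> \<BB>"
    by (rule pv.subspace_add[OF B_sub pv.subspace_add[OF B_sub pv.subspace_diff[OF B_sub decompose_homogeneous_B[OF z(2)] up] t(3)] z(3)])
  have eq: "(d - (unwedge (wedge_sym d) + unproj ?e)) - unproj (tmap (\<lambda>a. a) p2 ?e - ?e) + b + r
      = z - unwedge (wedge_sym d + t)"
    using t(1) by (simp add: z(1))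
  have "wedge_sym d + t \<in> carr QQ"
    using pv.subspace_add[OF TQ_sub(1) wedge_sym_Dg[OF z(2)] t(2)] by simp
  then show "\<exists>x\<in>carr QQ. z - unwedge x \<in> rel KK" using mem unfolding eq KK_simps(2)[symmetric] by blast
qed

subsection \<open>The two exact sequences\<close>

abbreviation "TI \<equiv> tensor (HC1 sA) Imb"
abbreviation "TC \<equiv> tensor (HH1 sA) Cb"
abbreviation "TH \<equiv> tensor (HC1 sA) Kb"
abbreviation "A0 \<equiv> A_mod_A0 sA"
abbreviation "TA \<equiv> tensor A0 Cb"

lemma wf_TI: "wf_subquot TI" and wf_TC: "wf_subquot TC" and wf_TH: "wf_subquot TH"
  by (simp_all add: wf_tensor wf_HH1 wf_HC1 wf_Imb wf_Cb wf_Kb)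

text \<open>\<open>T\<close> at \<open>(a, 1, 1)\<close> is
  \<open>a \<and> 1 + 1 \<and> a + a \<and> 1\<close>, that is \<open>a \<and> 1\<close>.\<close>

lemma iota_HC1: "\<iota> a \<in> rel (HC1 sA)"
proof -
  have "pure [1, a] - - pure [a, 1] \<in> rel (extpow 2 \<AA>)" by (rule ext2_swap)
  from rel_facts(5)[OF wf_extpow[OF wf_A] this]
  have r: "- pure [1, a] - pure [a, 1] \<in> rel (extpow 2 \<AA>)" by (simp add: algebra_simps)
  have "\<iota> a = T_map (pure [a, 1, 1]) + (- pure [1, a] - pure [a, 1])" by simp
  then show ?thesis unfolding HC1_eq coker_simps(3) using r pure_A[of "[a,1,1]" 3] by fastforce
qed

lemma HC1_sub: "pv.subspace (rel (HC1 sA))"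
  using wf_rel[OF wf_HC1] by simp

lemma ext_HC1: "r \<in> rel (extpow 2 \<AA>) \<Longrightarrow> r \<in> rel (HC1 sA)"
  unfolding HC1_eq coker_simps(3)
  by (intro CollectI exI[of _ 0] exI[of _ r]) (simp add: ext_kill_zero linear_simps[OF linear_T(2)])

lemma T_HC1: "v \<in> carr (tpow 3 \<AA>) \<Longrightarrow> T_map v \<in> rel (HC1 sA)"
  unfolding HC1_eq coker_simps(3) using rel_facts(1)[OF wf_extpow[OF wf_A]]
  by (intro CollectI exI[of _ v] exI[of _ 0]) simp

lemma T_diff:
  assumes "module.subspace pscale R" "\<And>a. \<iota> a \<in> R" "v \<in> carr (tpow 3 \<AA>)"
  shows "T_map v - T0_map v \<in> R"
  by (rule tpow_carr_induct[OF _ assms(1,3)])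
    (auto simp: plin_iff linear_simps[OF linear_T(1)] linear_simps[OF linear_T(2)] pv.scale_right_diff_distrib length3 assms(2))

lemma HH1_HC1: "r \<in> rel (HH1 sA) \<Longrightarrow> r \<in> rel (HC1 sA)"
proof -
  assume "r \<in> rel (HH1 sA)"
  then obtain v s where r: "r = T0_map v + s" "v \<in> carr (tpow 3 \<AA>)" "s \<in> rel (extpow 2 \<AA>)"
    unfolding HH1_eq coker_simps(3) by blast
  have "T_map v - (T_map v - T0_map v) + s \<in> rel (HC1 sA)"
    by (intro pv.subspace_add[OF HC1_sub] pv.subspace_diff[OF HC1_sub, of "T_map v"] T_HC1 T_diff HC1_sub iota_HC1 ext_HC1 r)
  then show ?thesis by (simp add: r(1))
qed

text \<open>\<open>T\<close> and \<open>T\<^sub>0\<close> differ at \<open>(a, b, c)\<close> by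
  \<open>\<iota> (a * b * c)\<close>, so the relations of \<open>HC1\<close> are those of
  \<open>HH1\<close> together with the image of \<open>\<iota>\<close>.\<close>

lemma HC1_rel_induct:
  assumes R: "pv.subspace R" "\<And>r. r \<in> rel (HH1 sA) \<Longrightarrow> r \<in> R" "\<And>a. \<iota> a \<in> R" and r: "r \<in> rel (HC1 sA)"
  shows "r \<in> R"
proof -
  obtain v s where e: "r = T_map v + s" "v \<in> carr (tpow 3 \<AA>)" "s \<in> rel (extpow 2 \<AA>)"
    using r unfolding HC1_eq coker_simps(3) by blast
  have "(T_map v - T0_map v) + T0_map v + s \<in> R"
    by (intro pv.subspace_add[OF R(1)] T_diff R e T0_HH1 ext_HH1)
  then show ?thesis by (simp add: e(1))
qed

lemma HC1_slice:
  assumes R: "pv.subspace R" "rel TQ \<subseteq> R" and y: "y \<in> carr Kb" and i: "\<And>a. pure (\<iota> a, y) \<in> R" and x: "x \<in> rel (HC1 sA)"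
  shows "pure (x, y) \<in> R"
proof -
  have "pv.subspace {x \<in> carr (HH1 sA). pure (x, y) \<in> R}"
    using tensor_slice[OF wf_HH1 wf_Kb R y] by simp
  then have "x \<in> {x \<in> carr (HH1 sA). pure (x, y) \<in> R}"
    using i R(2) tensor_relI(5)[OF _ y] wf_sub[OF wf_HH1] by (intro HC1_rel_induct[OF _ _ _ x]) auto
  then show ?thesis by simp
qed

lemma QQ_TC: "t \<in> rel QQ \<Longrightarrow> t \<in> rel TC"
proof (erule QQ_rel_induct[OF pv.linear_ident, rotated])
  show "pv.subspace (rel TC)" using wf_rel[OF wf_TC] by simp
  show "t \<in> rel TC" if "t \<in> rel TQ" for t
    using Kb_Cb kill_IM by (intro tensor_mono(2)[OF wf_HH1 wf_Kb wf_HH1 wf_Cb _ _ _ _ _ _ that]) auto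
  show "pure (\<iota> a, y) \<in> rel TC" if "y \<in> carr Imb" for a y
    using Imb_IM[OF that] by (intro tensor_relI(6)) simp_all
qed

lemma QQ_TH: "t \<in> rel QQ \<Longrightarrow> t \<in> rel TH"
proof (erule QQ_rel_induct[OF pv.linear_ident, rotated])
  show "pv.subspace (rel TH)" using wf_rel[OF wf_TH] by simp
  show "t \<in> rel TH" if "t \<in> rel TQ" for t
    using HH1_HC1 by (intro tensor_mono(2)[OF wf_HH1 wf_Kb wf_HC1 wf_Kb _ _ _ _ _ _ that]) auto
  show "pure (\<iota> a, y) \<in> rel TH" if "y \<in> carr Imb" for a y
    by (rule tensor_relI(5)[OF iota_HC1 Imb_Kb[OF that]])
qed

lemma TI_carr: "t \<in> carr TI \<Longrightarrow> t \<in> carr TQ"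
  by (erule tensor_carr_induct[OF pv.linear_ident TQ_sub(1)]) (auto intro: tensor_carr_pure Imb_Kb)

text \<open>The relations that \<open>HC1\<close> has beyond \<open>HH1\<close> are the
  \<open>\<iota> a\<close>, and their tensors with the Koszul image were put into \<open>QQ\<close>
  by \<open>QL\<close>.\<close>

lemma TI_QQ: "t \<in> rel TI \<Longrightarrow> t \<in> rel QQ"
proof (erule tensor_rel_induct[OF pv.linear_ident QQ_sub])
  show "pure (x, y) \<in> rel QQ" if "x \<in> rel (HC1 sA)" "y \<in> carr Imb" for x y
    using QQ_relI that Imb_Kb by (intro HC1_slice[OF QQ_sub _ _ _ that(1)]) auto
qed (auto intro!: QQ_relI(1) tensor_relI Imb_Kb simp flip: kos_simps(1) intro: tensor_relI(4)[where W = Kb, simplified] tensor_relI(3)[where V = "HH1 sA", simplified])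

text \<open>Both maps are the identity on representatives. The kernel of
  \<open>HH1 \<otimes> Kill \<rightarrow> HH1 \<otimes> coker\<close> is
  \<open>HH1 \<otimes> Im\<close>, and dividing by \<open>\<iota>(A) \<otimes> Im\<close> leaves
  \<open>HC1 \<otimes> Im\<close>.\<close>

lemma exact_2: "rep_exact TI QQ TC (\<lambda>t. t) (\<lambda>t. t)"
  unfolding rep_exact_def
proof (intro conjI ballI)
  show "rep_map TI QQ (\<lambda>t. t)"
    by (rule linear_rep_map) (simp_all add: pv.linear_ident wf_QQ TI_carr TI_QQ)
  have TQ_TC: "t \<in> carr TC" if "t \<in> carr TQ" for t
    using Kb_Cb kill_IM by (intro tensor_mono(1)[OF wf_HH1 wf_Kb wf_HH1 wf_Cb _ _ _ _ _ _ that]) auto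
  show "rep_map QQ TC (\<lambda>t. t)"
    by (rule linear_rep_map) (simp_all add: pv.linear_ident wf_TC QQ_TC TQ_TC)
  show "rep_inj TI QQ (\<lambda>t. t)"
    unfolding rep_inj_def
  proof (intro ballI impI)
    fix t assume t: "t \<in> carr TI" "t \<in> rel QQ"
    \<comment> \<open>Injectivity is tested after enlarging the second factor: relations of
      \<open>QQ\<close> hold in \<open>HC1 \<otimes> Kill\<close>, where
      \<open>HC1 \<otimes> Im\<close> embeds by flatness.\<close>
    have "t \<in> rel (tensor (HC1 sA) (kill sL br))"
      using carr_K2 by (intro tensor_mono(2)[OF wf_HC1 wf_Kb wf_HC1 L.wf_kill _ _ _ _ _ _ QQ_TH[OF t(2)]]) auto
    then show "t \<in> rel TI"
      using carr_K2 Imb_Kb t(1) by (intro tensor_subspace_rel[OF wf_HC1 wf_HC1 _ _ _ L.wf_kill wf_Imb]) auto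
  qed
  have TCs: "pv.subspace (rel TC)" using wf_rel[OF wf_TC] by simp
  show "rep_surj QQ TC (\<lambda>t. t)"
    unfolding rep_surj_def
  proof
    fix t assume t: "t \<in> carr TC"
    have 1: "tmap (\<lambda>x. x) p2 t \<in> carr TQ"
      by (rule tensor_carr_induct[OF linear_tmap TQ_sub(1) t]) (auto intro: tensor_carr_pure p2_Cb)
    have "t - tmap (\<lambda>x. x) p2 t \<in> rel TC"
    proof (rule tensor_carr_induct[OF _ TCs t])
      fix x y assume h: "x \<in> carr (HH1 sA)" "y \<in> carr Cb"
      then show "pure (x, y) - tmap (\<lambda>x. x) p2 (pure (x, y)) \<in> rel TC"
        using p2_Cb[OF h(2)] Kb_Cb rel_facts(1)[OF wf_HH1] by (simp add: tensor_cong[OF wf_HH1 wf_Cb])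
    qed (simp add: plin_iff pv.scale_right_diff_distrib)
    with 1 show "\<exists>x\<in>carr QQ. t - x \<in> rel TC" by auto
  qed
  fix t assume "t \<in> carr QQ"
  then have t: "t \<in> carr TQ" by simp
  show "t \<in> rel TC \<longleftrightarrow> (\<exists>u\<in>carr TI. t - u \<in> rel QQ)"
  proof
    assume "\<exists>u\<in>carr TI. t - u \<in> rel QQ"
    then obtain u where u: "u \<in> carr TI" "t - u \<in> rel QQ" by blast
    have "u \<in> rel TC"
      by (rule tensor_carr_induct[OF pv.linear_ident TCs u(1)]) (auto intro!: tensor_relI(6) Imb_IM)
    then show "t \<in> rel TC" using rel_mem[OF wf_TC QQ_TC[OF u(2)]] by blast
  next
    assume tr: "t \<in> rel TC"
    \<comment> \<open>After projecting the second factor, each relation of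
      \<open>HH1 \<otimes> coker\<close> is either a relation of \<open>QQ\<close> or a tensor over
      the Koszul image; \<open>?R\<close> collects the sums of both.\<close>
    let ?R = "{x + y |x y. x \<in> carr TI \<and> y \<in> rel QQ}"
    have Rs: "pv.subspace ?R" using wf_carr[OF wf_TI] QQ_sub by (intro pv.subspace_sums) simp_all
    have QR: "y \<in> ?R" if "y \<in> rel QQ" for y
      using that carr_facts(1)[OF wf_TI] by (intro CollectI exI[of _ 0] exI[of _ y]) simp
    have IR: "y \<in> ?R" if "y \<in> carr TI" for y
      using that pv.subspace_0[OF QQ_sub] by (intro CollectI exI[of _ y] exI[of _ 0]) simp
    have "rep_map (tensor (HH1 sA) (kill sL br)) TQ (tmap (\<lambda>x. x) p2)"
    proof (intro rep_map_tmap wf_HH1 wf_Kb rep_map_id wf_TK linear_rep_map)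
      show "p2 x \<in> carr Kb" if "x \<in> carr (kill sL br)" for x
        using that by (intro D2_Kb L.proj2_in) simp
    qed (simp_all add: L.linear_proj2 L.proj2_kill[OF two])
    then have K: "tmap (\<lambda>x. x) p2 t \<in> ?R" if "t \<in> rel TK" for t
      using that by (intro QR QQ_relI(1)) (simp add: rep_map_def)
    note ls = linear_simps[OF linear_tmap[of "\<lambda>x. x" p2]]
    have "tmap (\<lambda>x. x) p2 t \<in> ?R"
    proof (rule tensor_rel_induct[OF linear_tmap Rs tr])
      fix x y assume h: "x \<in> carr (HH1 sA)" "y \<in> rel Cb"
      then show "tmap (\<lambda>x. x) p2 (pure (x, y)) \<in> ?R"
        unfolding tmap_pure by (intro IR tensor_carr_pure) (auto intro: p2_IM)
    next
      fix c x y assume h: "x \<in> carr (HH1 sA)" "y \<in> carr Cb"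
      have y: "y \<in> carr (kill sL br)" using carr_K2(2)[OF h(2)] by simp
      show "tmap (\<lambda>x. x) p2 (pure (scl (HH1 sA) c x, y)) - pscale c (tmap (\<lambda>x. x) p2 (pure (x, y))) \<in> ?R"
        unfolding ls[symmetric] by (rule K[OF tensor_relI(3)[OF h(1) y]])
      show "tmap (\<lambda>x. x) p2 (pure (x, scl Cb c y)) - pscale c (tmap (\<lambda>x. x) p2 (pure (x, y))) \<in> ?R"
        unfolding ls[symmetric] using K[OF tensor_relI(4)[OF h(1) y, of c]] by simp
    next
      fix x x' y assume h: "x \<in> carr (HH1 sA)" "x' \<in> carr (HH1 sA)" "y \<in> carr Cb"
      then show "tmap (\<lambda>x. x) p2 (pure (x + x', y)) - tmap (\<lambda>x. x) p2 (pure (x, y)) - tmap (\<lambda>x. x) p2 (pure (x', y)) \<in> ?R"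
        unfolding ls[symmetric] using carr_K2(2)[OF h(3)] by (intro K tensor_relI) simp_all
    next
      fix x y y' assume h: "x \<in> carr (HH1 sA)" "y \<in> carr Cb" "y' \<in> carr Cb"
      then show "tmap (\<lambda>x. x) p2 (pure (x, y + y')) - tmap (\<lambda>x. x) p2 (pure (x, y)) - tmap (\<lambda>x. x) p2 (pure (x, y')) \<in> ?R"
        unfolding ls[symmetric] using carr_K2(2)[OF h(2)] carr_K2(2)[OF h(3)] by (intro K tensor_relI) simp_all
    next
      fix x y assume h: "x \<in> rel (HH1 sA)" "y \<in> carr Cb"
      then show "tmap (\<lambda>x. x) p2 (pure (x, y)) \<in> ?R"
        using carr_K2(2)[OF h(2)] by (intro K tensor_relI) simp_all
    qed
    then obtain u y where u: "tmap (\<lambda>x. x) p2 t = u + y" "u \<in> carr TI" "y \<in> rel QQ" by blast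
    have "y - (tmap (\<lambda>x. x) p2 t - t) \<in> rel QQ"
      by (rule pv.subspace_diff[OF QQ_sub u(3) QQ_relI(1)[OF p2_TQ[OF t]]])
    then show "\<exists>u\<in>carr TI. t - u \<in> rel QQ" using u(2) by (auto simp: u(1) algebra_simps intro!: bexI[of _ u])
  qed
qed

lemma A0_simps [simp]: "scl A0 = sA" "carr A0 = UNIV" "rel A0 = {a. \<iota> a \<in> rel (HH1 sA)}"
  by (simp_all add: A_mod_A0_def cls_rel_iff[OF wf_HH1])

lemma wf_A0: "wf_subquot A0"
  using kernel_good[OF wf_A wf_HH1 rep_map_iota] wf_vs[OF wf_A] wf_carr[OF wf_A]
  by (simp add: wf_subquot_def)

lemma wf_TA: "wf_subquot TA"
  by (rule wf_tensor[OF wf_A0 wf_Cb])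

text \<open>The map \<open>A / A\<^sub>0 \<rightarrow> HH\<^sub>1(A)\<close> induced by
  \<open>\<iota>\<close> is injective by definition of \<open>A\<^sub>0\<close>, and over a field it
  has a linear left inverse. A left inverse stays one after tensoring.\<close>

lemma retraction:
  obtains \<rho> :: "('a list \<Rightarrow>\<^sub>0 'k) \<Rightarrow> 'a" where "Vector_Spaces.linear pscale sA \<rho>"
    "\<And>x. x \<in> rel (HH1 sA) \<Longrightarrow> \<rho> x = 0" "\<And>a. \<rho> (\<iota> a) - a \<in> rel A0"
proof -
  have "pv.subspace (rel (HH1 sA))" using wf_rel[OF wf_HH1] by simp
  from quotient_map_pscale[OF this]
  obtain \<pi> :: "('a list \<Rightarrow>\<^sub>0 'k) \<Rightarrow> ('a list \<Rightarrow>\<^sub>0 'k)" where \<pi>: "Vector_Spaces.linear pscale pscale \<pi>" "\<And>x. \<pi> x = 0 \<longleftrightarrow> x \<in> rel (HH1 sA)"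
    by blast
  note pl = linear_simps[OF \<pi>(1)]
  interpret VP: vector_space_pair sA "pscale :: 'k \<Rightarrow> ('a list \<Rightarrow>\<^sub>0 'k) \<Rightarrow> _" by unfold_locales
  define j where "j a = \<pi> (\<iota> a)" for a
  have jl: "Vector_Spaces.linear sA pscale j"
    unfolding Vector_Spaces.linear_iff
  proof (intro conjI allI)
    show "vector_space sA" by unfold_locales
    show "vector_space (pscale :: 'k \<Rightarrow> ('a list \<Rightarrow>\<^sub>0 'k) \<Rightarrow> _)" by (rule pv.vector_space_axioms)
    show "j (a + b) = j a + j b" for a b
    proof -
      have "\<pi> (\<iota> (a + b) - (\<iota> a + \<iota> b)) = 0" unfolding \<pi>(2) using rep_map_iota by (simp add: rep_map_def)
      then show ?thesis by (simp add: j_def pl)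
    qed
    show "j (sA c a) = pscale c (j a)" for c a
    proof -
      have "\<pi> (\<iota> (sA c a) - pscale c (\<iota> a)) = 0" unfolding \<pi>(2) using rep_map_iota by (simp add: rep_map_def)
      then show ?thesis by (simp add: j_def pl)
    qed
  qed
  from VP.linear_exists_right_inverse_on[OF this A.subspace_UNIV]
  \<comment> \<open>From \<open>j (h (j a)) = j a\<close> it follows that \<open>h (j a) - a\<close>
    lies in the kernel of \<open>j\<close>, which is \<open>A\<^sub>0\<close>.\<close>
  obtain h where h: "Vector_Spaces.linear pscale sA h" "\<And>a. j (h (j a)) = j a" by auto
  show ?thesis
  proof (rule that[of "\<lambda>x. h (\<pi> x)"])
    show "Vector_Spaces.linear pscale sA (\<lambda>x. h (\<pi> x))" by (rule linear_compose[OF \<pi>(1) h(1)])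
    show "h (\<pi> x) = 0" if "x \<in> rel (HH1 sA)" for x
    proof -
      have "\<pi> x = 0" using that \<pi>(2) by blast
      then show ?thesis by (simp add: linear_simps[OF h(1)])
    qed
    show "h (\<pi> (\<iota> a)) - a \<in> rel A0" for a
    proof -
      have "j (h (j a) - a) = 0" using h(2) by (simp add: linear_simps[OF jl])
      then show ?thesis by (simp add: j_def \<pi>(2))
    qed
  qed
qed

text \<open>The first map is \<open>\<iota> \<otimes> p2\<close>: the projection turns
  representatives of the cokernel into elements of the Killing module of degree \<beta>, and the
  ambiguity by the Koszul image is absorbed by \<open>QL\<close>. Dividing out the image leaves
  \<open>HC1\<close>, which is \<open>HH1\<close> modulo \<open>\<iota>(A)\<close>.\<close>

lemma exact_1: "rep_exact TA QQ TH (tmap \<iota> p2) (\<lambda>t. t)"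
  unfolding rep_exact_def
proof (intro conjI ballI)
  have f_carr: "tmap \<iota> p2 t \<in> carr TQ" if "t \<in> carr TA" for t
    by (rule tensor_carr_induct[OF linear_tmap TQ_sub(1) that]) (auto intro!: tensor_carr_pure p2_Cb)
  have "rep_map (tensor \<AA> (kill sL br)) TQ (tmap \<iota> p2)"
  proof (intro rep_map_tmap wf_HH1 wf_Kb rep_map_iota wf_tensor wf_A L.wf_kill linear_rep_map)
    show "p2 x \<in> carr Kb" if "x \<in> carr (kill sL br)" for x
      using that by (intro D2_Kb L.proj2_in) simp
  qed (simp_all add: L.linear_proj2 L.proj2_kill[OF two])
  then have K: "tmap \<iota> p2 t \<in> rel QQ" if "t \<in> rel (tensor \<AA> (kill sL br))" for t
    using that by (intro QQ_relI(1)) (simp add: rep_map_def)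
  note ls = linear_simps[OF linear_tmap[of \<iota> p2]]
  show "rep_map TA QQ (tmap \<iota> p2)"
  proof (rule linear_rep_map[OF _ wf_QQ])
    show "tmap \<iota> p2 t \<in> rel QQ" if t: "t \<in> rel TA" for t
    proof (rule tensor_rel_induct[OF linear_tmap QQ_sub t])
      fix a y assume h: "a \<in> carr A0" "y \<in> rel Cb"
      then show "tmap \<iota> p2 (pure (a, y)) \<in> rel QQ"
        unfolding tmap_pure by (intro QQ_relI(2)) (auto intro: p2_IM)
    next
      fix a y assume h: "a \<in> rel A0" "y \<in> carr Cb"
      then show "tmap \<iota> p2 (pure (a, y)) \<in> rel QQ"
        unfolding tmap_pure by (intro QQ_relI(1) tensor_relI(5) p2_Cb) simp_all
    next
      fix c a y assume h: "a \<in> carr A0" "y \<in> carr Cb"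
      have y: "y \<in> carr (kill sL br)" using carr_K2(2)[OF h(2)] by simp
      show "tmap \<iota> p2 (pure (scl A0 c a, y)) - pscale c (tmap \<iota> p2 (pure (a, y))) \<in> rel QQ"
        unfolding ls[symmetric] using K[OF tensor_relI(3)[OF _ y, of a \<AA> c]] by simp
      show "tmap \<iota> p2 (pure (a, scl Cb c y)) - pscale c (tmap \<iota> p2 (pure (a, y))) \<in> rel QQ"
        unfolding ls[symmetric] using K[OF tensor_relI(4)[OF _ y, of a \<AA> c]] by simp
    next
      fix a a' y assume h: "a \<in> carr A0" "a' \<in> carr A0" "y \<in> carr Cb"
      then show "tmap \<iota> p2 (pure (a + a', y)) - tmap \<iota> p2 (pure (a, y)) - tmap \<iota> p2 (pure (a', y)) \<in> rel QQ"
        unfolding ls[symmetric] using carr_K2(2)[OF h(3)] by (intro K tensor_relI) simp_all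
    next
      fix a y y' assume h: "a \<in> carr A0" "y \<in> carr Cb" "y' \<in> carr Cb"
      then show "tmap \<iota> p2 (pure (a, y + y')) - tmap \<iota> p2 (pure (a, y)) - tmap \<iota> p2 (pure (a, y')) \<in> rel QQ"
        unfolding ls[symmetric] using carr_K2(2)[OF h(2)] carr_K2(2)[OF h(3)] by (intro K tensor_relI) simp_all
    qed
  qed (simp_all add: linear_tmap f_carr)
  show "rep_map QQ TH (\<lambda>t. t)"
  proof (rule linear_rep_map)
    show "t \<in> carr TH" if "t \<in> carr QQ" for t
      using that HH1_HC1 by (intro tensor_mono(1)[OF wf_HH1 wf_Kb wf_HC1 wf_Kb]) auto
  qed (simp_all add: pv.linear_ident wf_TH QQ_TH)
  have TAs: "pv.subspace (rel TA)" using wf_rel[OF wf_TA] by simp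
  show "rep_inj TA QQ (tmap \<iota> p2)"
    unfolding rep_inj_def
  proof (intro ballI impI)
    fix t assume t: "t \<in> carr TA" "tmap \<iota> p2 t \<in> rel QQ"
    obtain \<rho> :: "('a list \<Rightarrow>\<^sub>0 'k) \<Rightarrow> 'a" where \<rho>: "Vector_Spaces.linear pscale sA \<rho>"
      "\<And>x. x \<in> rel (HH1 sA) \<Longrightarrow> \<rho> x = 0" "\<And>a. \<rho> (\<iota> a) - a \<in> rel A0"
      using retraction by blast
    \<comment> \<open>The retraction is applied to the first factor. It also kills \<open>QL\<close>
      modulo relations, since the Koszul image is zero in the cokernel, so it descends to
      \<open>QQ\<close>.\<close>
    have "rep_map TQ TA (tmap \<rho> (\<lambda>y. y))"
    proof (intro rep_map_tmap wf_A0 wf_Cb wf_TQ linear_rep_map)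
      show "\<rho> x \<in> rel A0" if "x \<in> rel (HH1 sA)" for x using \<rho>(2)[OF that] rel_facts(1)[OF wf_A0] by simp
    qed (simp_all add: pv.linear_ident \<rho>(1) Kb_Cb kill_IM)
    then have 1: "tmap \<rho> (\<lambda>y. y) r \<in> rel TA" if "r \<in> rel TQ" for r using that unfolding rep_map_def by blast
    have "tmap \<rho> (\<lambda>y. y) (tmap \<iota> p2 t) \<in> rel TA"
    proof (rule QQ_rel_induct[OF linear_tmap TAs t(2) 1])
      show "tmap \<rho> (\<lambda>y. y) (pure (\<iota> a, y)) \<in> rel TA" if "y \<in> carr Imb" for a y
        unfolding tmap_pure by (rule tensor_relI(6)) (use Imb_IM[OF that] in simp_all)
    qed
    then have 2: "tmap (\<lambda>a. \<rho> (\<iota> a)) p2 t \<in> rel TA" by (simp add: tmap_comp)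
    have "tmap (\<lambda>a. \<rho> (\<iota> a)) p2 t - t \<in> rel TA"
    proof (rule tensor_carr_induct[OF _ TAs t(1)])
      fix a y assume y: "y \<in> carr Cb"
      have "p2 y - y \<in> rel Cb" using rel_facts(5)[OF wf_ck p2_Cb(2)[OF y]] by simp
      then show "tmap (\<lambda>a. \<rho> (\<iota> a)) p2 (pure (a, y)) - pure (a, y) \<in> rel TA"
        unfolding tmap_pure using \<rho>(3)[of a] by (intro tensor_cong wf_A0 wf_Cb y Kb_Cb p2_Cb(1)[OF y]) simp_all
    qed (simp add: plin_iff pv.scale_right_diff_distrib)
    then show "t \<in> rel TA" using 2 rel_mem'[OF wf_TA] by blast
  qed
  have TH_TQ: "t \<in> carr TQ" if "t \<in> carr TH" for t
    by (rule tensor_carr_induct[OF pv.linear_ident TQ_sub(1) that]) (auto intro: tensor_carr_pure)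
  show "rep_surj QQ TH (\<lambda>t. t)"
    unfolding rep_surj_def using TH_TQ rel_facts(1)[OF wf_TH] by (intro ballI) (auto intro!: bexI)
  fix t assume "t \<in> carr QQ"
  show "t \<in> rel TH \<longleftrightarrow> (\<exists>u\<in>carr TA. t - tmap \<iota> p2 u \<in> rel QQ)"
  proof
    assume "\<exists>u\<in>carr TA. t - tmap \<iota> p2 u \<in> rel QQ"
    then obtain u where u: "u \<in> carr TA" "t - tmap \<iota> p2 u \<in> rel QQ" by blast
    have THs: "pv.subspace (rel TH)" using wf_rel[OF wf_TH] by simp
    have "tmap \<iota> p2 u \<in> rel TH"
      by (rule tensor_carr_induct[OF linear_tmap THs u(1)]) (auto intro!: tensor_relI(5) iota_HC1 p2_Cb)
    then show "t \<in> rel TH" using rel_mem[OF wf_TH QQ_TH[OF u(2)]] by blast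
  next
    assume tr: "t \<in> rel TH"
    let ?R = "{tmap \<iota> p2 u + y |u y. u \<in> carr TA \<and> y \<in> rel QQ}"
    have Rs: "pv.subspace ?R" using wf_carr[OF wf_TA] QQ_sub by (intro subspace_image_sum[OF linear_tmap]) simp_all
    have QR: "y \<in> ?R" if "y \<in> rel QQ" for y
      using that carr_facts(1)[OF wf_TA] by (intro CollectI exI[of _ 0] exI[of _ y]) simp
    have TR: "rel TQ \<subseteq> ?R" using QR QQ_relI(1) by blast
    \<comment> \<open>These are the only relations of \<open>HC1 \<otimes> Kill\<close> not already
      in \<open>TQ\<close>, and each is the image of \<open>a \<otimes> y\<close> up to replacing
      \<open>y\<close> by \<open>p2 y\<close>.\<close>
    have IR: "pure (\<iota> a, y) \<in> ?R" if y: "y \<in> carr Kb" for a y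
    proof -
      have "y - p2 y \<in> rel Kb" using rel_sym[OF L.wf_kill p2_Kb[OF y]] by simp
      then have "pure (\<iota> a, y) - pure (\<iota> a, p2 y) \<in> rel TQ"
        using rel_facts(1)[OF wf_HH1] by (intro tensor_cong wf_HH1 wf_Kb y p2_Cb(1)[OF Kb_Cb[OF y]]) simp_all
      moreover have "pure (a, y) \<in> carr TA" using Kb_Cb[OF y] by (intro tensor_carr_pure) simp_all
      ultimately show ?thesis
        by (intro CollectI exI[of _ "pure (a, y)"] exI[of _ "pure (\<iota> a, y) - pure (\<iota> a, p2 y)"]) (simp add: QQ_relI(1))
    qed
    have "t \<in> ?R"
    proof (rule tensor_rel_induct[OF pv.linear_ident Rs tr])
      fix x y assume "x \<in> rel (HC1 sA)" "y \<in> carr Kb"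
      then show "pure (x, y) \<in> ?R" by (intro HC1_slice[OF Rs TR _ IR])
    next
      fix c x y assume h: "x \<in> carr (HC1 sA)" "y \<in> carr Kb"
      then have x: "x \<in> carr (HH1 sA)" by simp
      show "pure (scl (HC1 sA) c x, y) - pscale c (pure (x, y)) \<in> ?R"
        using TR tensor_relI(3)[OF x h(2), of c] by auto
      show "pure (x, scl Kb c y) - pscale c (pure (x, y)) \<in> ?R"
        using TR tensor_relI(4)[OF x h(2), of c] by auto
    next
      fix x x' y assume "x \<in> carr (HC1 sA)" "x' \<in> carr (HC1 sA)" "y \<in> carr Kb"
      then show "pure (x + x', y) - pure (x, y) - pure (x', y) \<in> ?R"
        by (intro set_mp[OF TR] tensor_relI(1)) simp_all
    next
      fix x y y' assume "x \<in> carr (HC1 sA)" "y \<in> carr Kb" "y' \<in> carr Kb"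
      then show "pure (x, y + y') - pure (x, y) - pure (x, y') \<in> ?R"
        by (intro set_mp[OF TR] tensor_relI(2)) simp_all
    next
      fix x y assume "x \<in> carr (HC1 sA)" "y \<in> rel Kb"
      then show "pure (x, y) \<in> ?R" by (intro set_mp[OF TR] tensor_relI(6)) simp_all
    qed
    then obtain u y where "t = tmap \<iota> p2 u + y" "u \<in> carr TA" "y \<in> rel QQ" by blast
    then show "\<exists>u\<in>carr TA. t - tmap \<iota> p2 u \<in> rel QQ" by (intro bexI[of _ u]) simp_all
  qed
qed

text \<open>\<open>unwedge\<close> identifies \<open>QQ\<close> with the kernel, and the first
  sequence also refines the filtration \<open>0 \<subseteq> KK \<subseteq> H2\<close>, giving the
  three layers.\<close>

lemma main_statement:
  "iterated_extension H2 [isomorphic TH, isomorphic TA, isomorphic AH] \<and> lin H2 AH np \<and> np ` elts H2 = elts AH \<and>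
   short_exact TA KK TH \<and> short_exact TI KK TC"
proof -
  obtain f g where fg: "rep_exact TA KK TH f g"
    using rep_exact_transport[OF wf_TA wf_QQ wf_KK wf_TH exact_1 rep_map_unwedge rep_inj_unwedge rep_surj_unwedge] by blast
  obtain f' g' where fg': "rep_exact TI KK TC f' g'"
    using rep_exact_transport[OF wf_TI wf_QQ wf_KK wf_TC exact_2 rep_map_unwedge rep_inj_unwedge rep_surj_unwedge] by blast
  have "iterated_extension H2 [isomorphic TH, isomorphic TA, isomorphic AH]"
    by (rule iterated_extension3[OF wf_TA wf_H2 wf_TH wf_AH rep_map_np rep_surj_np fg[unfolded KK_eq]])
  then show ?thesis
    using lin_np surj_np rep_exact_short_exact[OF wf_TA wf_KK wf_TH fg]
      rep_exact_short_exact[OF wf_TI wf_KK wf_TC fg'] by blast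
qed

end

theorem corollaryB6:
  fixes sA :: "'k::field \<Rightarrow> 'a::{comm_ring, comm_monoid_mult} \<Rightarrow> 'a"
    and sL :: "'k \<Rightarrow> 'l::ab_group_add \<Rightarrow> 'l"
    and br :: "'l \<Rightarrow> 'l \<Rightarrow> 'l"
    and G :: "'b::ab_group_add \<Rightarrow> 'l set"
    and \<beta> :: 'b
  assumes "(2::'k) \<noteq> 0"
    and "comm_unital_algebra sA"
    and "graded_lie_algebra sL br G"
    and "is_zero_space (S2_H1 sL br G \<beta>)"
  shows "iterated_extension (H2_cur sA sL br G \<beta>)
      [isomorphic (tensor (HC1 sA) (hcomp (kill sL br) (hpow G 2 \<beta>))),
       isomorphic (tensor (A_mod_A0 sA) (hcomp (coker_koszul sL br) (hpow G 2 \<beta>))),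
       isomorphic (tensor (whole sA) (hcomp (homology 2 (whole sL) br) (hpow G 2 \<beta>)))]
    \<and> lin (H2_cur sA sL br G \<beta>) (A_tensor_H2 sA sL br G \<beta>) (nat_proj sA sL br G \<beta>)
    \<and> nat_proj sA sL br G \<beta> ` elts (H2_cur sA sL br G \<beta>) = elts (A_tensor_H2 sA sL br G \<beta>)
    \<and> short_exact
      (tensor (A_mod_A0 sA) (hcomp (coker_koszul sL br) (hpow G 2 \<beta>)))
      (K_space sA sL br G \<beta>)
      (tensor (HC1 sA) (hcomp (kill sL br) (hpow G 2 \<beta>)))
    \<and> short_exact
      (tensor (HC1 sA) (hcomp (im_koszul sL br) (hpow G 2 \<beta>)))
      (K_space sA sL br G \<beta>)
      (tensor (HH1 sA) (hcomp (coker_koszul sL br) (hpow G 2 \<beta>)))"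
proof -
  interpret current sA sL br G \<beta>
    using assms by (intro current.intro current_axioms.intro)
  show ?thesis using main_statement unfolding AH_eq .
qed

end
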